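(* Let $\mathcal T$ be a rigidly-compactly generated tensor-triangulated category. Let $X$ be a spectral space equipped with a notion of support $\sigma(t)\subseteq X$ for the objects $t\in\mathcal T$ satisfying: (i) $\sigma(0)=\varnothing$ and $\sigma(\mathbb 1)=X$; (ii) $\sigma(\Sigma t)=\sigma(t)$ for all $t$; (iii) $\sigma(c)\subseteq\sigma(a)\cup\sigma(b)$ for any exact triangle $a\to b\to c\to\Sigma a$; (iv) $\sigma(\coprod_{i\in I}t_i)=\bigcup_{i\in I}\sigma(t_i)$ for any set of objects $t_i$; (v) $\sigma(t_1\otimes t_2)\subseteq\sigma(t_1)\cap\sigma(t_2)$. Suppose that $\sigma$ stratifies $\mathcal T$ in the sense that the map $$\{\text{localizing }\otimes\text{-ideals of }\mathcal T\}\to\{\text{subsets of }X\},\qquad\mathcal L\mapsto\sigma(\mathcal L):=\bigcup_{t\in\mathcal L}\sigma(t)$$ is a bijection. Then the following are equivalent: (a) The subset $\sigma(x)\subseteq X$ is Thomason closed for each compact object $x\in\mathcal T^c$, and every Thomason closed subset of $X$ arises in this way. (b) Under the bijection, the compactly generated localizing $\otimes$-ideals of $\mathcal T$ correspond to the Thomason subsets of $X$. (c) There is a unique homeomorphism $f\colon X\xrightarrow{\sim}\mathrm{Spc}(\mathcal T^c)$ such that $\sigma(x)=f^{-1}(\mathrm{supp}(x))$ for every compact $x\in\mathcal T^c$. If these conditions hold and the spectral space $X$ is weakly noetherian, then under the homeomorphism $f\colon X\xrightarrow{\sim}\mathrm{Spc}(\mathcal T^c)$ the notion of support $\sigma$ coincides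 with the Balmer--Favi notion of support $\mathrm{Supp}$, i.e. $\sigma(t)=f^{-1}(\mathrm{Supp}(t))$ for all $t\in\mathcal T$.
   Context: A tensor-triangulated category is a triangulated category with a compatible closed symmetric monoidal structure $(\otimes,\mathbb 1)$; it is rigidly-compactly generated if it is compactly generated (in particular has all small coproducts) and its compact objects coincide with its dualizable objects. $\mathcal T^c$ is the full subcategory of compact objects. A localizing $\otimes$-ideal is a triangulated subcategory closed under coproducts and under tensoring with arbitrary objects; $\mathrm{Loc}_\otimes\langle\mathcal E\rangle$ is the smallest one containing $\mathcal E$; it is compactly generated if it equals $\mathrm{Loc}_\otimes\langle\mathcal E\rangle$ for some $\mathcal E\subseteq\mathcal T^c$. $\mathrm{Spc}(\mathcal T^c)$ is the Balmer spectrum: the set of prime thick $\otimes$-ideals of $\mathcal T^c$, with the sets $\mathrm{supp}(x)=\{\mathcal P : x\notin\mathcal P\}$, $x\in\mathcal T^c$, as a basis of closed sets; it is a spectral space. A subset of a spectral space is Thomason if it is a union of closed subsets each with quasi-compact complement; the Thomason closed subsets are precisely the closed subsets with quasi-compact complement. A spectral space is weakly noetherian if for every point $\mathcal P$ there are Thomason subsets $Y_1,Y_2$ with $\{\mathcal P\}=Y_1\cap Y_2^c$. For $Y\subseteq\mathrm{Spc}(\mathcal T^c)$ Thomason put $\mathcal T^c_Y=\{x\in\mathcal T^c:\mathrm{supp}(x)\subseteq Y\}$; there is an (essentially unique) exact triangle $e_Y\to\mathbb 1\to f_Y\to\Sigma e_Y$ with $e_Y\otimes f_Y=0$ and $\mathrm{Ker}(f_Y\otimes-)=e_Y\otimes\mathcal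 T=\mathrm{Loc}\langle\mathcal T^c_Y\rangle$. If $\{\mathcal P\}=Y_1\cap Y_2^c$ in $\mathrm{Spc}(\mathcal T^c)$, put $g(\mathcal P)=e_{Y_1}\otimes f_{Y_2}$ (independent of choices). When $\mathrm{Spc}(\mathcal T^c)$ is weakly noetherian, the Balmer--Favi support is $\mathrm{Supp}(t)=\{\mathcal P: g(\mathcal P)\otimes t\ne0\}$. *)

theory Defs
  imports "HOL-Analysis.Abstract_Topology" "HOL-Algebra.Product_Groups" "HOL-Algebra.FiniteProduct"
begin

unbundle cardinal_syntax

section \<open>Smallness\<close>

text \<open>
  ``Small'' means ``of cardinality below a fixed strongly inaccessible cardinal \<open>\<kappa>\<close>'', that is, an
  element of a Grothendieck universe up to bijection. Index sets of small coproducts are subsets of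
  the type on which \<open>\<kappa>\<close> lives; every set of cardinality below \<open>\<kappa>\<close> is in bijection with such a subset.
\<close>

definition inaccessible :: "'u rel \<Rightarrow> bool" where
  "inaccessible \<kappa> \<longleftrightarrow>
     Card_order \<kappa> \<and> natLeq <o \<kappa> \<and> regularCard \<kappa> \<and>
     (\<forall>A :: 'u set. |A| <o \<kappa> \<longrightarrow> |Pow A| <o \<kappa>)"

definition small :: "'u rel \<Rightarrow> 'a set \<Rightarrow> bool" where
  "small \<kappa> A \<longleftrightarrow> |A| <o \<kappa>"


section \<open>Categories\<close>

record ('o, 'm) cat =
  Obj :: "'o set"
  Arr :: "'m set"
  Dom :: "'m \<Rightarrow> 'o"
  Cod :: "'m \<Rightarrow> 'o"
  Id :: "'o \<Rightarrow> 'm"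
  Comp :: "'m \<Rightarrow> 'm \<Rightarrow> 'm"  (infixr "\<cdot>\<index>" 70)

definition homset :: "('o, 'm, 'z) cat_scheme \<Rightarrow> 'o \<Rightarrow> 'o \<Rightarrow> 'm set" where
  "homset C x y = {f \<in> Arr C. Dom C f = x \<and> Cod C f = y}"

locale category =
  fixes C (structure)
  assumes Dom_in: "f \<in> Arr C \<Longrightarrow> Dom C f \<in> Obj C"
    and Cod_in: "f \<in> Arr C \<Longrightarrow> Cod C f \<in> Obj C"
    and Id_in: "x \<in> Obj C \<Longrightarrow> Id C x \<in> homset C x x"
    and Comp_in: "\<lbrakk>f \<in> homset C x y; g \<in> homset C y z\<rbrakk> \<Longrightarrow> g \<cdot> f \<in> homset C x z"
    and Id_right: "f \<in> homset C x y \<Longrightarrow> f \<cdot> Id C x = f"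
    and Id_left: "f \<in> homset C x y \<Longrightarrow> Id C y \<cdot> f = f"
    and Comp_assoc: "\<lbrakk>f \<in> homset C w x; g \<in> homset C x y; h \<in> homset C y z\<rbrakk>
          \<Longrightarrow> (h \<cdot> g) \<cdot> f = h \<cdot> (g \<cdot> f)"

definition inverse_arrows :: "('o, 'm, 'z) cat_scheme \<Rightarrow> 'm \<Rightarrow> 'm \<Rightarrow> bool" where
  "inverse_arrows C f g \<longleftrightarrow>
     f \<in> Arr C \<and> g \<in> homset C (Cod C f) (Dom C f) \<and>
     g \<cdot>\<^bsub>C\<^esub> f = Id C (Dom C f) \<and> f \<cdot>\<^bsub>C\<^esub> g = Id C (Cod C f)"

definition is_iso_arr :: "('o, 'm, 'z) cat_scheme \<Rightarrow> 'm \<Rightarrow> bool" where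
  "is_iso_arr C f \<longleftrightarrow> (\<exists>g. inverse_arrows C f g)"

definition inverse_arr :: "('o, 'm, 'z) cat_scheme \<Rightarrow> 'm \<Rightarrow> 'm" where
  "inverse_arr C f = (THE g. inverse_arrows C f g)"

definition isomorphic :: "('o, 'm, 'z) cat_scheme \<Rightarrow> 'o \<Rightarrow> 'o \<Rightarrow> bool" where
  "isomorphic C x y \<longleftrightarrow> (\<exists>f \<in> homset C x y. is_iso_arr C f)"

definition is_zero_obj :: "('o, 'm, 'z) cat_scheme \<Rightarrow> 'o \<Rightarrow> bool" where
  "is_zero_obj C z \<longleftrightarrow>
     z \<in> Obj C \<and> (\<forall>x \<in> Obj C. (\<exists>!f. f \<in> homset C z x) \<and> (\<exists>!f. f \<in> homset C x z))"

definition is_coproduct ::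
  "('o, 'm, 'z) cat_scheme \<Rightarrow> 'i set \<Rightarrow> ('i \<Rightarrow> 'o) \<Rightarrow> 'o \<Rightarrow> ('i \<Rightarrow> 'm) \<Rightarrow> bool" where
  "is_coproduct C I t c \<iota> \<longleftrightarrow>
     c \<in> Obj C \<and> (\<forall>i \<in> I. t i \<in> Obj C \<and> \<iota> i \<in> homset C (t i) c) \<and>
     (\<forall>y \<in> Obj C. \<forall>g. (\<forall>i \<in> I. g i \<in> homset C (t i) y) \<longrightarrow>
        (\<exists>!h. h \<in> homset C c y \<and> (\<forall>i \<in> I. h \<cdot>\<^bsub>C\<^esub> \<iota> i = g i)))"

definition has_small_coproducts :: "'u rel \<Rightarrow> ('o, 'm, 'z) cat_scheme \<Rightarrow> bool" where
  "has_small_coproducts \<kappa> C \<longleftrightarrow>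
     (\<forall>(I :: 'u set) t. small \<kappa> I \<longrightarrow> (\<forall>i \<in> I. t i \<in> Obj C) \<longrightarrow>
        (\<exists>c \<iota>. is_coproduct C I t c \<iota>))"

definition locally_small :: "'u rel \<Rightarrow> ('o, 'm, 'z) cat_scheme \<Rightarrow> bool" where
  "locally_small \<kappa> C \<longleftrightarrow> (\<forall>x \<in> Obj C. \<forall>y \<in> Obj C. small \<kappa> (homset C x y))"


section \<open>Additive categories\<close>

record ('o, 'm) add_cat = "('o, 'm) cat" +
  Plus :: "'m \<Rightarrow> 'm \<Rightarrow> 'm"  (infixl "\<boxplus>\<index>" 65)
  Zero :: "'o \<Rightarrow> 'o \<Rightarrow> 'm"

text \<open>HOL-Algebra writes groups multiplicatively; the product below is the addition of arrows.\<close>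

definition hom_group :: "('o, 'm, 'z) add_cat_scheme \<Rightarrow> 'o \<Rightarrow> 'o \<Rightarrow> 'm monoid" where
  "hom_group C x y = \<lparr>carrier = homset C x y, monoid.mult = Plus C, one = Zero C x y\<rparr>"

definition neg_arr :: "('o, 'm, 'z) add_cat_scheme \<Rightarrow> 'm \<Rightarrow> 'm" where
  "neg_arr C f = m_inv (hom_group C (Dom C f) (Cod C f)) f"

definition is_biproduct :: "('o, 'm, 'z) add_cat_scheme \<Rightarrow> 'o \<Rightarrow> 'o \<Rightarrow> 'o \<Rightarrow> bool" where
  "is_biproduct C x y s \<longleftrightarrow>
     (\<exists>i \<in> homset C x s. \<exists>j \<in> homset C y s. \<exists>p \<in> homset C s x. \<exists>q \<in> homset C s y.
        p \<cdot>\<^bsub>C\<^esub> i = Id C x \<and> q \<cdot>\<^bsub>C\<^esub> j = Id C y \<and>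
        q \<cdot>\<^bsub>C\<^esub> i = Zero C x y \<and> p \<cdot>\<^bsub>C\<^esub> j = Zero C y x \<and>
        (i \<cdot>\<^bsub>C\<^esub> p) \<boxplus>\<^bsub>C\<^esub> (j \<cdot>\<^bsub>C\<^esub> q) = Id C s)"

locale additive_category = category C for C (structure) +
  assumes hom_comm_group: "\<lbrakk>x \<in> Obj C; y \<in> Obj C\<rbrakk> \<Longrightarrow> comm_group (hom_group C x y)"
    and Comp_Plus_right: "\<lbrakk>f \<in> homset C x y; f' \<in> homset C x y; g \<in> homset C y z\<rbrakk>
          \<Longrightarrow> g \<cdot> (f \<boxplus> f') = (g \<cdot> f) \<boxplus> (g \<cdot> f')"
    and Comp_Plus_left: "\<lbrakk>f \<in> homset C x y; g \<in> homset C y z; g' \<in> homset C y z\<rbrakk>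
          \<Longrightarrow> (g \<boxplus> g') \<cdot> f = (g \<cdot> f) \<boxplus> (g' \<cdot> f)"
    and zero_obj_exists: "\<exists>z. is_zero_obj C z"
    and biproduct_exists: "\<lbrakk>x \<in> Obj C; y \<in> Obj C\<rbrakk> \<Longrightarrow> \<exists>s \<in> Obj C. is_biproduct C x y s"


section \<open>Triangulated categories\<close>

record ('o, 'm) tri_cat = "('o, 'm) add_cat" +
  ShO :: "'o \<Rightarrow> 'o"  ("\<Sigma>\<^sub>o\<index>")
  ShA :: "'m \<Rightarrow> 'm"  ("\<Sigma>\<^sub>a\<index>")
  Tri :: "('m \<times> 'm \<times> 'm) set"

text \<open>The suspension is an additive self-equivalence, not necessarily an automorphism.\<close>

locale triangulated_category = additive_category T for T (structure) +
  assumes ShO_in: "x \<in> Obj T \<Longrightarrow> \<Sigma>\<^sub>o x \<in> Obj T"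
    and ShA_in: "f \<in> homset T x y \<Longrightarrow> \<Sigma>\<^sub>a f \<in> homset T (\<Sigma>\<^sub>o x) (\<Sigma>\<^sub>o y)"
    and ShA_Id: "x \<in> Obj T \<Longrightarrow> \<Sigma>\<^sub>a (Id T x) = Id T (\<Sigma>\<^sub>o x)"
    and ShA_Comp: "\<lbrakk>f \<in> homset T x y; g \<in> homset T y z\<rbrakk> \<Longrightarrow> \<Sigma>\<^sub>a (g \<cdot> f) = \<Sigma>\<^sub>a g \<cdot> \<Sigma>\<^sub>a f"
    and ShA_Plus: "\<lbrakk>f \<in> homset T x y; f' \<in> homset T x y\<rbrakk> \<Longrightarrow> \<Sigma>\<^sub>a (f \<boxplus> f') = \<Sigma>\<^sub>a f \<boxplus> \<Sigma>\<^sub>a f'"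
    and Sh_fully_faithful: "\<lbrakk>x \<in> Obj T; y \<in> Obj T\<rbrakk>
          \<Longrightarrow> bij_betw (\<Sigma>\<^sub>a) (homset T x y) (homset T (\<Sigma>\<^sub>o x) (\<Sigma>\<^sub>o y))"
    and Sh_ess_surj: "y \<in> Obj T \<Longrightarrow> \<exists>x \<in> Obj T. isomorphic T (\<Sigma>\<^sub>o x) y"
    and Tri_typed: "(f, g, h) \<in> Tri T \<Longrightarrow>
          \<exists>x y z. f \<in> homset T x y \<and> g \<in> homset T y z \<and> h \<in> homset T z (\<Sigma>\<^sub>o x)"
    and Tri_iso: "\<lbrakk>(f, g, h) \<in> Tri T;
          f \<in> homset T x y; g \<in> homset T y z; h \<in> homset T z (\<Sigma>\<^sub>o x);
          f' \<in> homset T x' y'; g' \<in> homset T y' z'; h' \<in> homset T z' (\<Sigma>\<^sub>o x');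
          a \<in> homset T x x'; b \<in> homset T y y'; c \<in> homset T z z';
          is_iso_arr T a; is_iso_arr T b; is_iso_arr T c;
          b \<cdot> f = f' \<cdot> a; c \<cdot> g = g' \<cdot> b; \<Sigma>\<^sub>a a \<cdot> h = h' \<cdot> c\<rbrakk> \<Longrightarrow> (f', g', h') \<in> Tri T"
    and Tri_Id: "\<lbrakk>x \<in> Obj T; is_zero_obj T z\<rbrakk>
          \<Longrightarrow> (Id T x, Zero T x z, Zero T z (\<Sigma>\<^sub>o x)) \<in> Tri T"
    and Tri_complete: "f \<in> Arr T \<Longrightarrow> \<exists>g h. (f, g, h) \<in> Tri T"
    and Tri_rotate: "\<lbrakk>f \<in> homset T x y; g \<in> homset T y z; h \<in> homset T z (\<Sigma>\<^sub>o x)\<rbrakk>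
          \<Longrightarrow> (f, g, h) \<in> Tri T \<longleftrightarrow> (g, h, neg_arr T (\<Sigma>\<^sub>a f)) \<in> Tri T"
    and Tri_fill: "\<lbrakk>(f, g, h) \<in> Tri T; (f', g', h') \<in> Tri T;
          a \<in> homset T (Dom T f) (Dom T f'); b \<in> homset T (Cod T f) (Cod T f'); b \<cdot> f = f' \<cdot> a\<rbrakk>
          \<Longrightarrow> \<exists>c \<in> homset T (Cod T g) (Cod T g'). c \<cdot> g = g' \<cdot> b \<and> \<Sigma>\<^sub>a a \<cdot> h = h' \<cdot> c"
    and Tri_octahedral: "\<lbrakk>f \<in> homset T x y; g \<in> homset T y z;
          (f, i, i') \<in> Tri T; (g, j, j') \<in> Tri T; (g \<cdot> f, k, k') \<in> Tri T\<rbrakk>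
          \<Longrightarrow> \<exists>u v. (u, v, \<Sigma>\<^sub>a i \<cdot> j') \<in> Tri T \<and>
                u \<in> homset T (Cod T i) (Cod T k) \<and> v \<in> homset T (Cod T k) (Cod T j) \<and>
                u \<cdot> i = k \<cdot> g \<and> k' \<cdot> u = i' \<and> v \<cdot> k = j \<and> j' \<cdot> v = \<Sigma>\<^sub>a f \<cdot> k'"

definition triangulated_subcategory :: "('o, 'm, 'z) tri_cat_scheme \<Rightarrow> 'o set \<Rightarrow> bool" where
  "triangulated_subcategory T S \<longleftrightarrow>
     S \<subseteq> Obj T \<and>
     (\<forall>z. is_zero_obj T z \<longrightarrow> z \<in> S) \<and>
     (\<forall>x \<in> S. \<forall>y \<in> Obj T. isomorphic T x y \<longrightarrow> y \<in> S) \<and>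
     (\<forall>x \<in> Obj T. \<Sigma>\<^sub>o\<^bsub>T\<^esub> x \<in> S \<longleftrightarrow> x \<in> S) \<and>
     (\<forall>f g h. (f, g, h) \<in> Tri T \<longrightarrow> Dom T f \<in> S \<longrightarrow> Cod T f \<in> S \<longrightarrow> Cod T g \<in> S)"

definition thick_subcategory :: "('o, 'm, 'z) tri_cat_scheme \<Rightarrow> 'o set \<Rightarrow> bool" where
  "thick_subcategory T S \<longleftrightarrow>
     triangulated_subcategory T S \<and>
     (\<forall>x \<in> Obj T. \<forall>y \<in> Obj T. \<forall>s \<in> S. is_biproduct T x y s \<longrightarrow> x \<in> S)"

definition localizing_subcategory :: "'u rel \<Rightarrow> ('o, 'm, 'z) tri_cat_scheme \<Rightarrow> 'o set \<Rightarrow> bool" where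
  "localizing_subcategory \<kappa> T L \<longleftrightarrow>
     triangulated_subcategory T L \<and>
     (\<forall>(I :: 'u set) t c \<iota>. small \<kappa> I \<longrightarrow> is_coproduct T I t c \<iota> \<longrightarrow> (\<forall>i \<in> I. t i \<in> L) \<longrightarrow> c \<in> L)"

definition Loc :: "'u rel \<Rightarrow> ('o, 'm, 'z) tri_cat_scheme \<Rightarrow> 'o set \<Rightarrow> 'o set" where
  "Loc \<kappa> T E = \<Inter>{L. localizing_subcategory \<kappa> T L \<and> E \<subseteq> L}"

text \<open>
  An object \<open>x\<close> is compact if, for every small coproduct, the canonical homomorphism
  \<open>\<Oplus>\<^sub>i Hom(x, t\<^sub>i) \<rightarrow> Hom(x, \<Coprod>\<^sub>i t\<^sub>i)\<close>, \<open>(a\<^sub>i) \<mapsto> \<Sum>\<^sub>i \<iota>\<^sub>i a\<^sub>i\<close>, is an isomorphism.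
\<close>

definition compact_objects :: "'u rel \<Rightarrow> ('o, 'm, 'z) add_cat_scheme \<Rightarrow> 'o set" where
  "compact_objects \<kappa> T =
     {x \<in> Obj T. \<forall>(I :: 'u set) t c \<iota>. small \<kappa> I \<longrightarrow> is_coproduct T I t c \<iota> \<longrightarrow>
        (\<lambda>a. finprod (hom_group T x c) (\<lambda>i. \<iota> i \<cdot>\<^bsub>T\<^esub> a i) {i \<in> I. a i \<noteq> Zero T x (t i)})
          \<in> iso (sum_group I (\<lambda>i. hom_group T x (t i))) (hom_group T x c)}"

text \<open>
  The objects \<open>\<Sigma>\<^sup>n t\<close> with \<open>n < 0\<close> in the usual generation condition \<open>Hom(g, \<Sigma>\<^sup>n t) = 0\<close> are
  accounted for by \<open>Hom(\<Sigma>\<^sup>m g, t)\<close> with \<open>m = -n\<close>.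
\<close>

definition compactly_generated :: "'u rel \<Rightarrow> ('o, 'm, 'z) tri_cat_scheme \<Rightarrow> bool" where
  "compactly_generated \<kappa> T \<longleftrightarrow>
     locally_small \<kappa> T \<and> has_small_coproducts \<kappa> T \<and>
     (\<exists>G \<subseteq> compact_objects \<kappa> T. small \<kappa> G \<and>
        (\<forall>t \<in> Obj T.
           (\<forall>g \<in> G. \<forall>n :: nat.
              homset T g ((ShO T ^^ n) t) = {Zero T g ((ShO T ^^ n) t)} \<and>
              homset T ((ShO T ^^ n) g) t = {Zero T ((ShO T ^^ n) g) t})
           \<longrightarrow> is_zero_obj T t))"


section \<open>Tensor-triangulated categories\<close>

text \<open>
  \<open>Ev x y\<close> is the evaluation \<open>[x, y] \<boxtimes> x \<rightarrow> y\<close>, and \<open>TSh x y\<close> is the comparison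
  \<open>\<Sigma> x \<boxtimes> y \<rightarrow> \<Sigma> (x \<boxtimes> y)\<close>.
\<close>

record ('o, 'm) tt_cat = "('o, 'm) tri_cat" +
  Unit :: 'o  ("\<one>\<^sub>T\<index>")
  TenO :: "'o \<Rightarrow> 'o \<Rightarrow> 'o"  (infixr "\<boxtimes>\<index>" 75)
  TenA :: "'m \<Rightarrow> 'm \<Rightarrow> 'm"  (infixr "\<boxdot>\<index>" 75)
  Assoc :: "'o \<Rightarrow> 'o \<Rightarrow> 'o \<Rightarrow> 'm"
  LUnit :: "'o \<Rightarrow> 'm"
  RUnit :: "'o \<Rightarrow> 'm"
  Braid :: "'o \<Rightarrow> 'o \<Rightarrow> 'm"
  IHom :: "'o \<Rightarrow> 'o \<Rightarrow> 'o"
  Ev :: "'o \<Rightarrow> 'o \<Rightarrow> 'm"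
  TSh :: "'o \<Rightarrow> 'o \<Rightarrow> 'm"

locale symmetric_monoidal_category = category T for T (structure) +
  assumes Unit_in: "\<one>\<^sub>T \<in> Obj T"
    and TenO_in: "\<lbrakk>x \<in> Obj T; y \<in> Obj T\<rbrakk> \<Longrightarrow> x \<boxtimes> y \<in> Obj T"
    and TenA_in: "\<lbrakk>f \<in> homset T x y; g \<in> homset T v w\<rbrakk> \<Longrightarrow> f \<boxdot> g \<in> homset T (x \<boxtimes> v) (y \<boxtimes> w)"
    and TenA_Id: "\<lbrakk>x \<in> Obj T; y \<in> Obj T\<rbrakk> \<Longrightarrow> Id T x \<boxdot> Id T y = Id T (x \<boxtimes> y)"
    and TenA_Comp: "\<lbrakk>f \<in> homset T x y; f' \<in> homset T y z; g \<in> homset T u v; g' \<in> homset T v w\<rbrakk>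
          \<Longrightarrow> (f' \<cdot> f) \<boxdot> (g' \<cdot> g) = (f' \<boxdot> g') \<cdot> (f \<boxdot> g)"
    and Assoc_in: "\<lbrakk>x \<in> Obj T; y \<in> Obj T; z \<in> Obj T\<rbrakk>
          \<Longrightarrow> Assoc T x y z \<in> homset T ((x \<boxtimes> y) \<boxtimes> z) (x \<boxtimes> (y \<boxtimes> z))"
    and Assoc_iso: "\<lbrakk>x \<in> Obj T; y \<in> Obj T; z \<in> Obj T\<rbrakk> \<Longrightarrow> is_iso_arr T (Assoc T x y z)"
    and Assoc_natural: "\<lbrakk>f \<in> homset T x x'; g \<in> homset T y y'; h \<in> homset T z z'\<rbrakk>
          \<Longrightarrow> Assoc T x' y' z' \<cdot> ((f \<boxdot> g) \<boxdot> h) = (f \<boxdot> (g \<boxdot> h)) \<cdot> Assoc T x y z"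
    and LUnit_in: "x \<in> Obj T \<Longrightarrow> LUnit T x \<in> homset T (\<one>\<^sub>T \<boxtimes> x) x"
    and LUnit_iso: "x \<in> Obj T \<Longrightarrow> is_iso_arr T (LUnit T x)"
    and LUnit_natural: "f \<in> homset T x y \<Longrightarrow> LUnit T y \<cdot> (Id T \<one>\<^sub>T \<boxdot> f) = f \<cdot> LUnit T x"
    and RUnit_in: "x \<in> Obj T \<Longrightarrow> RUnit T x \<in> homset T (x \<boxtimes> \<one>\<^sub>T) x"
    and RUnit_iso: "x \<in> Obj T \<Longrightarrow> is_iso_arr T (RUnit T x)"
    and RUnit_natural: "f \<in> homset T x y \<Longrightarrow> RUnit T y \<cdot> (f \<boxdot> Id T \<one>\<^sub>T) = f \<cdot> RUnit T x"
    and Braid_in: "\<lbrakk>x \<in> Obj T; y \<in> Obj T\<rbrakk> \<Longrightarrow> Braid T x y \<in> homset T (x \<boxtimes> y) (y \<boxtimes> x)"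
    and Braid_natural: "\<lbrakk>f \<in> homset T x x'; g \<in> homset T y y'\<rbrakk>
          \<Longrightarrow> Braid T x' y' \<cdot> (f \<boxdot> g) = (g \<boxdot> f) \<cdot> Braid T x y"
    and Braid_symmetric: "\<lbrakk>x \<in> Obj T; y \<in> Obj T\<rbrakk>
          \<Longrightarrow> Braid T y x \<cdot> Braid T x y = Id T (x \<boxtimes> y)"
    and pentagon: "\<lbrakk>w \<in> Obj T; x \<in> Obj T; y \<in> Obj T; z \<in> Obj T\<rbrakk>
          \<Longrightarrow> Assoc T w x (y \<boxtimes> z) \<cdot> Assoc T (w \<boxtimes> x) y z =
              (Id T w \<boxdot> Assoc T x y z) \<cdot> Assoc T w (x \<boxtimes> y) z \<cdot> (Assoc T w x y \<boxdot> Id T z)"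
    and unit_triangle: "\<lbrakk>x \<in> Obj T; y \<in> Obj T\<rbrakk>
          \<Longrightarrow> (Id T x \<boxdot> LUnit T y) \<cdot> Assoc T x \<one>\<^sub>T y = RUnit T x \<boxdot> Id T y"
    and hexagon: "\<lbrakk>x \<in> Obj T; y \<in> Obj T; z \<in> Obj T\<rbrakk>
          \<Longrightarrow> Assoc T y z x \<cdot> Braid T x (y \<boxtimes> z) \<cdot> Assoc T x y z =
              (Id T y \<boxdot> Braid T x z) \<cdot> Assoc T y x z \<cdot> (Braid T x y \<boxdot> Id T z)"

locale closed_symmetric_monoidal_category = symmetric_monoidal_category T for T (structure) +
  assumes IHom_in: "\<lbrakk>x \<in> Obj T; y \<in> Obj T\<rbrakk> \<Longrightarrow> IHom T x y \<in> Obj T"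
    and Ev_in: "\<lbrakk>x \<in> Obj T; y \<in> Obj T\<rbrakk> \<Longrightarrow> Ev T x y \<in> homset T (IHom T x y \<boxtimes> x) y"
    and Ev_universal: "\<lbrakk>a \<in> Obj T; x \<in> Obj T; y \<in> Obj T; f \<in> homset T (a \<boxtimes> x) y\<rbrakk>
          \<Longrightarrow> \<exists>!g. g \<in> homset T a (IHom T x y) \<and> Ev T x y \<cdot> (g \<boxdot> Id T x) = f"

definition curry_arr :: "('o, 'm, 'z) tt_cat_scheme \<Rightarrow> 'o \<Rightarrow> 'o \<Rightarrow> 'o \<Rightarrow> 'm \<Rightarrow> 'm" where
  "curry_arr T a x y f =
     (THE g. g \<in> homset T a (IHom T x y) \<and> Ev T x y \<cdot>\<^bsub>T\<^esub> (g \<boxdot>\<^bsub>T\<^esub> Id T x) = f)"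

definition ihom_cov :: "('o, 'm, 'z) tt_cat_scheme \<Rightarrow> 'o \<Rightarrow> 'm \<Rightarrow> 'm" where
  "ihom_cov T w f =
     curry_arr T (IHom T w (Dom T f)) w (Cod T f) (f \<cdot>\<^bsub>T\<^esub> Ev T w (Dom T f))"

definition ihom_contra :: "('o, 'm, 'z) tt_cat_scheme \<Rightarrow> 'm \<Rightarrow> 'o \<Rightarrow> 'm" where
  "ihom_contra T f w =
     curry_arr T (IHom T (Cod T f) w) (Dom T f) w
       (Ev T (Cod T f) w \<cdot>\<^bsub>T\<^esub> (Id T (IHom T (Cod T f) w) \<boxdot>\<^bsub>T\<^esub> f))"

text \<open>The comparison \<open>x \<boxtimes> \<Sigma> y \<rightarrow> \<Sigma> (x \<boxtimes> y)\<close> obtained from \<open>TSh\<close> by conjugating with the symmetry.\<close>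

definition TSh' :: "('o, 'm, 'z) tt_cat_scheme \<Rightarrow> 'o \<Rightarrow> 'o \<Rightarrow> 'm" where
  "TSh' T x y =
     \<Sigma>\<^sub>a\<^bsub>T\<^esub> (Braid T y x) \<cdot>\<^bsub>T\<^esub> TSh T y x \<cdot>\<^bsub>T\<^esub> Braid T x (\<Sigma>\<^sub>o\<^bsub>T\<^esub> y)"

text \<open>The canonical map \<open>\<Sigma> [w, x] \<rightarrow> [w, \<Sigma> x]\<close>.\<close>

definition ihom_Sh_cov :: "('o, 'm, 'z) tt_cat_scheme \<Rightarrow> 'o \<Rightarrow> 'o \<Rightarrow> 'm" where
  "ihom_Sh_cov T w x =
     curry_arr T (\<Sigma>\<^sub>o\<^bsub>T\<^esub> (IHom T w x)) w (\<Sigma>\<^sub>o\<^bsub>T\<^esub> x)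
       (\<Sigma>\<^sub>a\<^bsub>T\<^esub> (Ev T w x) \<cdot>\<^bsub>T\<^esub> TSh T (IHom T w x) w)"

text \<open>
  The canonical map \<open>\<Sigma> [\<Sigma> x, w] \<rightarrow> [x, w]\<close>, adjoint to
  \<open>\<Sigma> [\<Sigma> x, w] \<boxtimes> x \<rightarrow> \<Sigma> ([\<Sigma> x, w] \<boxtimes> x) \<rightarrow> [\<Sigma> x, w] \<boxtimes> \<Sigma> x \<rightarrow> w\<close>.
\<close>

definition ihom_Sh_contra :: "('o, 'm, 'z) tt_cat_scheme \<Rightarrow> 'o \<Rightarrow> 'o \<Rightarrow> 'm" where
  "ihom_Sh_contra T x w =
     (let F = IHom T (\<Sigma>\<^sub>o\<^bsub>T\<^esub> x) w in
      curry_arr T (\<Sigma>\<^sub>o\<^bsub>T\<^esub> F) x w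
        (Ev T (\<Sigma>\<^sub>o\<^bsub>T\<^esub> x) w \<cdot>\<^bsub>T\<^esub> inverse_arr T (TSh' T F x) \<cdot>\<^bsub>T\<^esub> TSh T F x))"

text \<open>
  Compatibility of the closed symmetric monoidal structure with the triangulation is understood in
  the sense of Hovey, Palmieri and Strickland, \<^emph>\<open>Axiomatic stable homotopy theory\<close>, Definition
  A.2.1. Their exact triangle
  \<open>\<Sigma>\<inverse>[x, w] \<rightarrow> [z, w] \<rightarrow> [y, w] \<rightarrow> [x, w]\<close>, with first map \<open>-[h, w]\<close>, appears in \<open>IHom_exact_contra\<close>
  rotated once, which turns the sign into \<open>+\<close>. The last axiom says that the
  symmetry of \<open>\<Sigma>\<one> \<boxtimes> \<Sigma>\<one>\<close> is \<open>-1\<close>; this is graded commutativity in degrees \<open>(1, 1)\<close>, from which the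
  sign \<open>(-1)\<^sup>r\<^sup>s\<close> in degrees \<open>(r, s)\<close> follows.
\<close>

locale tt_category =
  triangulated_category T + closed_symmetric_monoidal_category T for T (structure) +
  assumes TenA_Plus_left: "\<lbrakk>f \<in> homset T x y; f' \<in> homset T x y; g \<in> homset T v w\<rbrakk>
          \<Longrightarrow> (f \<boxplus> f') \<boxdot> g = (f \<boxdot> g) \<boxplus> (f' \<boxdot> g)"
    and TenA_Plus_right: "\<lbrakk>f \<in> homset T x y; g \<in> homset T v w; g' \<in> homset T v w\<rbrakk>
          \<Longrightarrow> f \<boxdot> (g \<boxplus> g') = (f \<boxdot> g) \<boxplus> (f \<boxdot> g')"
    and TSh_in: "\<lbrakk>x \<in> Obj T; y \<in> Obj T\<rbrakk> \<Longrightarrow> TSh T x y \<in> homset T (\<Sigma>\<^sub>o x \<boxtimes> y) (\<Sigma>\<^sub>o (x \<boxtimes> y))"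
    and TSh_iso: "\<lbrakk>x \<in> Obj T; y \<in> Obj T\<rbrakk> \<Longrightarrow> is_iso_arr T (TSh T x y)"
    and TSh_natural: "\<lbrakk>f \<in> homset T x x'; g \<in> homset T y y'\<rbrakk>
          \<Longrightarrow> TSh T x' y' \<cdot> (\<Sigma>\<^sub>a f \<boxdot> g) = \<Sigma>\<^sub>a (f \<boxdot> g) \<cdot> TSh T x y"
    and TSh_RUnit: "x \<in> Obj T \<Longrightarrow> \<Sigma>\<^sub>a (RUnit T x) \<cdot> TSh T x \<one>\<^sub>T = RUnit T (\<Sigma>\<^sub>o x)"
    and TSh_Assoc: "\<lbrakk>x \<in> Obj T; y \<in> Obj T; z \<in> Obj T\<rbrakk>
          \<Longrightarrow> \<Sigma>\<^sub>a (Assoc T x y z) \<cdot> TSh T (x \<boxtimes> y) z \<cdot> (TSh T x y \<boxdot> Id T z) =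
              TSh T x (y \<boxtimes> z) \<cdot> Assoc T (\<Sigma>\<^sub>o x) y z"
    and Ten_exact: "\<lbrakk>(f, g, h) \<in> Tri T; w \<in> Obj T\<rbrakk>
          \<Longrightarrow> (f \<boxdot> Id T w, g \<boxdot> Id T w, TSh T (Dom T f) w \<cdot> (h \<boxdot> Id T w)) \<in> Tri T"
    and IHom_exact_cov: "\<lbrakk>(f, g, h) \<in> Tri T; w \<in> Obj T\<rbrakk>
          \<Longrightarrow> (ihom_cov T w f, ihom_cov T w g,
               inverse_arr T (ihom_Sh_cov T w (Dom T f)) \<cdot> ihom_cov T w h) \<in> Tri T"
    and IHom_exact_contra: "\<lbrakk>(f, g, h) \<in> Tri T; w \<in> Obj T\<rbrakk>
          \<Longrightarrow> (ihom_contra T g w, ihom_contra T f w,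
               \<Sigma>\<^sub>a (ihom_contra T h w) \<cdot> inverse_arr T (ihom_Sh_contra T (Dom T f) w)) \<in> Tri T"
    and Braid_Sh_Unit: "Braid T (\<Sigma>\<^sub>o \<one>\<^sub>T) (\<Sigma>\<^sub>o \<one>\<^sub>T) = neg_arr T (Id T (\<Sigma>\<^sub>o \<one>\<^sub>T \<boxtimes> \<Sigma>\<^sub>o \<one>\<^sub>T))"

definition dualizable_objects :: "('o, 'm, 'z) tt_cat_scheme \<Rightarrow> 'o set" where
  "dualizable_objects T =
     {x \<in> Obj T. \<exists>y \<in> Obj T.
        \<exists>\<eta> \<in> homset T \<one>\<^sub>T\<^bsub>T\<^esub> (x \<boxtimes>\<^bsub>T\<^esub> y). \<exists>\<epsilon> \<in> homset T (y \<boxtimes>\<^bsub>T\<^esub> x) \<one>\<^sub>T\<^bsub>T\<^esub>.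
          RUnit T x \<cdot>\<^bsub>T\<^esub> (Id T x \<boxdot>\<^bsub>T\<^esub> \<epsilon>) \<cdot>\<^bsub>T\<^esub> Assoc T x y x \<cdot>\<^bsub>T\<^esub> (\<eta> \<boxdot>\<^bsub>T\<^esub> Id T x) = LUnit T x \<and>
          LUnit T y \<cdot>\<^bsub>T\<^esub> (\<epsilon> \<boxdot>\<^bsub>T\<^esub> Id T y) \<cdot>\<^bsub>T\<^esub> inverse_arr T (Assoc T y x y) \<cdot>\<^bsub>T\<^esub> (Id T y \<boxdot>\<^bsub>T\<^esub> \<eta>)
            = RUnit T y}"

definition rigidly_compactly_generated :: "'u rel \<Rightarrow> ('o, 'm, 'z) tt_cat_scheme \<Rightarrow> bool" where
  "rigidly_compactly_generated \<kappa> T \<longleftrightarrow>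
     tt_category T \<and> compactly_generated \<kappa> T \<and> compact_objects \<kappa> T = dualizable_objects T"

definition localizing_ideal :: "'u rel \<Rightarrow> ('o, 'm, 'z) tt_cat_scheme \<Rightarrow> 'o set \<Rightarrow> bool" where
  "localizing_ideal \<kappa> T L \<longleftrightarrow>
     localizing_subcategory \<kappa> T L \<and> (\<forall>t \<in> L. \<forall>s \<in> Obj T. s \<boxtimes>\<^bsub>T\<^esub> t \<in> L)"

definition Loc_ideal :: "'u rel \<Rightarrow> ('o, 'm, 'z) tt_cat_scheme \<Rightarrow> 'o set \<Rightarrow> 'o set" where
  "Loc_ideal \<kappa> T E = \<Inter>{L. localizing_ideal \<kappa> T L \<and> E \<subseteq> L}"

definition compactly_generated_ideal :: "'u rel \<Rightarrow> ('o, 'm, 'z) tt_cat_scheme \<Rightarrow> 'o set \<Rightarrow> bool" where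
  "compactly_generated_ideal \<kappa> T L \<longleftrightarrow> (\<exists>E \<subseteq> compact_objects \<kappa> T. L = Loc_ideal \<kappa> T E)"


section \<open>Spectral spaces\<close>

definition irreducible_closed :: "'a topology \<Rightarrow> 'a set \<Rightarrow> bool" where
  "irreducible_closed X Z \<longleftrightarrow>
     closedin X Z \<and> Z \<noteq> {} \<and>
     (\<forall>A B. closedin X A \<longrightarrow> closedin X B \<longrightarrow> Z = A \<union> B \<longrightarrow> Z = A \<or> Z = B)"

definition sober_space :: "'a topology \<Rightarrow> bool" where
  "sober_space X \<longleftrightarrow>
     (\<forall>Z. irreducible_closed X Z \<longrightarrow> (\<exists>!p. p \<in> topspace X \<and> X closure_of {p} = Z))"

definition qc_open :: "'a topology \<Rightarrow> 'a set \<Rightarrow> bool" where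
  "qc_open X U \<longleftrightarrow> openin X U \<and> compactin X U"

definition spectral_space :: "'a topology \<Rightarrow> bool" where
  "spectral_space X \<longleftrightarrow>
     compact_space X \<and> sober_space X \<and>
     (\<forall>U V. qc_open X U \<longrightarrow> qc_open X V \<longrightarrow> qc_open X (U \<inter> V)) \<and>
     (\<forall>U. openin X U \<longrightarrow> (\<forall>p \<in> U. \<exists>V. qc_open X V \<and> p \<in> V \<and> V \<subseteq> U))"

definition thomason_closed :: "'a topology \<Rightarrow> 'a set \<Rightarrow> bool" where
  "thomason_closed X Z \<longleftrightarrow> closedin X Z \<and> compactin X (topspace X - Z)"

definition thomason :: "'a topology \<Rightarrow> 'a set \<Rightarrow> bool" where
  "thomason X Y \<longleftrightarrow> (\<exists>\<F>. (\<forall>Z \<in> \<F>. thomason_closed X Z) \<and> Y = \<Union>\<F>)"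

definition weakly_noetherian :: "'a topology \<Rightarrow> bool" where
  "weakly_noetherian X \<longleftrightarrow>
     (\<forall>p \<in> topspace X. \<exists>Y\<^sub>1 Y\<^sub>2. thomason X Y\<^sub>1 \<and> thomason X Y\<^sub>2 \<and> {p} = Y\<^sub>1 \<inter> (topspace X - Y\<^sub>2))"


section \<open>The Balmer spectrum\<close>

definition thick_ideal_compacts :: "'u rel \<Rightarrow> ('o, 'm, 'z) tt_cat_scheme \<Rightarrow> 'o set \<Rightarrow> bool" where
  "thick_ideal_compacts \<kappa> T J \<longleftrightarrow>
     J \<subseteq> compact_objects \<kappa> T \<and> thick_subcategory T J \<and>
     (\<forall>x \<in> J. \<forall>y \<in> compact_objects \<kappa> T. y \<boxtimes>\<^bsub>T\<^esub> x \<in> J)"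

definition prime_ideals :: "'u rel \<Rightarrow> ('o, 'm, 'z) tt_cat_scheme \<Rightarrow> 'o set set" where
  "prime_ideals \<kappa> T =
     {P. thick_ideal_compacts \<kappa> T P \<and> P \<noteq> compact_objects \<kappa> T \<and>
         (\<forall>x \<in> compact_objects \<kappa> T. \<forall>y \<in> compact_objects \<kappa> T. x \<boxtimes>\<^bsub>T\<^esub> y \<in> P \<longrightarrow> x \<in> P \<or> y \<in> P)}"

definition supp :: "'u rel \<Rightarrow> ('o, 'm, 'z) tt_cat_scheme \<Rightarrow> 'o \<Rightarrow> 'o set set" where
  "supp \<kappa> T x = {P \<in> prime_ideals \<kappa> T. x \<notin> P}"

text \<open>
  The generating family is closed under finite intersections, because
  \<open>supp x \<union> supp y = supp (x \<oplus> y)\<close>, so it is a basis of the topology and not merely a subbasis.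
\<close>

definition Spc :: "'u rel \<Rightarrow> ('o, 'm, 'z) tt_cat_scheme \<Rightarrow> 'o set topology" where
  "Spc \<kappa> T = topology_generated_by ((\<lambda>x. prime_ideals \<kappa> T - supp \<kappa> T x) ` compact_objects \<kappa> T)"


section \<open>The Balmer--Favi support\<close>

definition compacts_on :: "'u rel \<Rightarrow> ('o, 'm, 'z) tt_cat_scheme \<Rightarrow> 'o set set \<Rightarrow> 'o set" where
  "compacts_on \<kappa> T Y = {x \<in> compact_objects \<kappa> T. supp \<kappa> T x \<subseteq> Y}"

definition idempotent_triangle ::
  "'u rel \<Rightarrow> ('o, 'm, 'z) tt_cat_scheme \<Rightarrow> 'o set set \<Rightarrow> 'o \<Rightarrow> 'o \<Rightarrow> bool" where
  "idempotent_triangle \<kappa> T Y e f \<longleftrightarrow>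
     (\<exists>i \<in> homset T e \<one>\<^sub>T\<^bsub>T\<^esub>. \<exists>q \<in> homset T \<one>\<^sub>T\<^bsub>T\<^esub> f. \<exists>d \<in> homset T f (\<Sigma>\<^sub>o\<^bsub>T\<^esub> e). (i, q, d) \<in> Tri T) \<and>
     is_zero_obj T (e \<boxtimes>\<^bsub>T\<^esub> f) \<and>
     {t \<in> Obj T. is_zero_obj T (f \<boxtimes>\<^bsub>T\<^esub> t)} =
       {t \<in> Obj T. \<exists>s \<in> Obj T. isomorphic T t (e \<boxtimes>\<^bsub>T\<^esub> s)} \<and>
     {t \<in> Obj T. \<exists>s \<in> Obj T. isomorphic T t (e \<boxtimes>\<^bsub>T\<^esub> s)} = Loc \<kappa> T (compacts_on \<kappa> T Y)"

text \<open>
  For Thomason \<open>Y\<close> such a triangle exists and is unique up to isomorphism, so that \<open>e\<^sub>Y\<close> and \<open>f\<^sub>Y\<close> are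
  fixed by choosing one; likewise \<open>g(P)\<close> does not depend, up to isomorphism, on the chosen
  presentation \<open>{P} = Y\<^sub>1 \<inter> Y\<^sub>2\<^sup>c\<close>.
\<close>

definition idempotent_pair :: "'u rel \<Rightarrow> ('o, 'm, 'z) tt_cat_scheme \<Rightarrow> 'o set set \<Rightarrow> 'o \<times> 'o" where
  "idempotent_pair \<kappa> T Y = (SOME p. idempotent_triangle \<kappa> T Y (fst p) (snd p))"

definition e_idem :: "'u rel \<Rightarrow> ('o, 'm, 'z) tt_cat_scheme \<Rightarrow> 'o set set \<Rightarrow> 'o" where
  "e_idem \<kappa> T Y = fst (idempotent_pair \<kappa> T Y)"

definition f_idem :: "'u rel \<Rightarrow> ('o, 'm, 'z) tt_cat_scheme \<Rightarrow> 'o set set \<Rightarrow> 'o" where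
  "f_idem \<kappa> T Y = snd (idempotent_pair \<kappa> T Y)"

definition g_obj :: "'u rel \<Rightarrow> ('o, 'm, 'z) tt_cat_scheme \<Rightarrow> 'o set \<Rightarrow> 'o" where
  "g_obj \<kappa> T P =
     (SOME g. \<exists>Y\<^sub>1 Y\<^sub>2. thomason (Spc \<kappa> T) Y\<^sub>1 \<and> thomason (Spc \<kappa> T) Y\<^sub>2 \<and>
        {P} = Y\<^sub>1 \<inter> (topspace (Spc \<kappa> T) - Y\<^sub>2) \<and> g = e_idem \<kappa> T Y\<^sub>1 \<boxtimes>\<^bsub>T\<^esub> f_idem \<kappa> T Y\<^sub>2)"

definition BF_Supp :: "'u rel \<Rightarrow> ('o, 'm, 'z) tt_cat_scheme \<Rightarrow> 'o \<Rightarrow> 'o set set" where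
  "BF_Supp \<kappa> T t = {P \<in> prime_ideals \<kappa> T. \<not> is_zero_obj T (g_obj \<kappa> T P \<boxtimes>\<^bsub>T\<^esub> t)}"


section \<open>Comparison with the spectrum\<close>

text \<open>
  Maps out of \<open>X\<close> are taken extensional on \<open>topspace X\<close>, so that equality of HOL functions is equality of
  maps of spaces.
\<close>

definition comparison_homeo ::
  "'u rel \<Rightarrow> ('o, 'm, 'z) tt_cat_scheme \<Rightarrow> 'x topology \<Rightarrow> ('o \<Rightarrow> 'x set) \<Rightarrow> ('x \<Rightarrow> 'o set) \<Rightarrow> bool" where
  "comparison_homeo \<kappa> T X \<sigma> f \<longleftrightarrow>
     f \<in> extensional (topspace X) \<and> homeomorphic_map X (Spc \<kappa> T) f \<and>
     (\<forall>x \<in> compact_objects \<kappa> T. \<sigma> x = {p \<in> topspace X. f p \<in> supp \<kappa> T x})"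

end

theory Submission
  imports Defs
begin

text \<open>
  Write \<open>\<sigma>(E)\<close> for the union of the supports of a class \<open>E\<close> of objects. Because \<open>\<sigma>\<close> stratifies,
  a localizing ideal consists of all objects supported on its support; hence \<open>\<sigma>(s \<otimes> t) = \<sigma>(s) \<inter> \<sigma>(t)\<close>
  and \<open>\<sigma>(t) = \<emptyset>\<close> only for \<open>t = 0\<close>.

  If \<open>J\<close> is a thick ideal of compact objects, the objects \<open>w\<close> such that every map from a compact
  object to \<open>w\<close> factors through \<open>J\<close> form a localizing subcategory (Neeman), which contains the
  localizing ideal generated by \<open>J\<close>; so the compact objects of this ideal are those of \<open>J\<close>. Thick
  ideals of compact objects are therefore determined by their supports. Under (a) these are the
  Thomason subsets, which is (b); conversely, under (b) the set \<open>\<sigma>(x)\<close> is a union of Thomason closed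
  subsets, and finitely many of them suffice because \<open>x\<close> is compact. The homeomorphism sends \<open>p\<close> to
  the prime \<open>{x. p \<notin> \<sigma>(x)}\<close>; that every prime arises is the compactness of the constructible
  topology together with sobriety.

  For the last claim, cellular approximation shows that \<open>e\<^sub>Y\<close> and \<open>f\<^sub>Y\<close> exist and that \<open>\<sigma>\<close> takes them
  to \<open>f\<^sup>-\<^sup>1(Y)\<close> and its complement. Thus \<open>\<sigma>(g(f(p))) = {p}\<close>, and \<open>g(f(p)) \<otimes> t\<close> vanishes exactly when
  \<open>p \<notin> \<sigma>(t)\<close>.
\<close>

section \<open>Categories and additive categories\<close>

text \<open>Two difficulties shape the proof. The set of compact objects is not assumed small,
  whereas the cells of a cellular approximation must be indexed by a small set. So a small set of
  representatives of the compact objects is built, by closing a generating set under suspension,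
  desuspension, cones and splittings, and a thick ideal is approximated through its representatives.
  Moreover, the suspension is an equivalence rather than an automorphism, so each desuspension is an
  isomorphic replacement that has to be carried along.

  The tensor formula rests on objects t supported at one point: \<sigma>(t \<otimes> t) cannot be
  empty, because otherwise the ideal of objects a with \<sigma>(a \<otimes> t) empty would have full
  support and contain the unit. Rigidity enters through adjunctions: a map into j \<otimes> s with j
  compact is governed by a map out of a tensor product with the dual of j. This lets the closure in
  Neeman's argument absorb all tensor multiples of j, and it shows that tensoring with the ideal
  annihilates the cone of an approximation.\<close>

lemma homsetD:
  assumes "f \<in> homset C x y"
  shows "f \<in> Arr C" "Dom C f = x" "Cod C f = y"
  using assms by (auto simp: homset_def)

lemma homset_iff: "f \<in> homset C x y \<longleftrightarrow> f \<in> Arr C \<and> Dom C f = x \<and> Cod C f = y"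
  by (auto simp: homset_def)

context category
begin

lemma Comp_arr [simp]:
  assumes "f \<in> Arr C" "g \<in> Arr C" "Cod C f = Dom C g"
  shows "g \<cdot> f \<in> Arr C" "Dom C (g \<cdot> f) = Dom C f" "Cod C (g \<cdot> f) = Cod C g"
  using Comp_in[of f "Dom C f" "Cod C f" g "Cod C g"] assms by (auto simp: homset_def)

lemma Id_arr [simp]:
  assumes "x \<in> Obj C"
  shows "Id C x \<in> Arr C" "Dom C (Id C x) = x" "Cod C (Id C x) = x"
  using Id_in[OF assms] by (auto simp: homset_def)

lemma arr_obj [simp]:
  assumes "f \<in> Arr C"
  shows "Dom C f \<in> Obj C" "Cod C f \<in> Obj C"
  using assms Dom_in Cod_in by auto

lemma hom_obj:
  assumes "f \<in> homset C x y"
  shows "x \<in> Obj C" "y \<in> Obj C"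
  using assms Dom_in Cod_in by (auto simp: homset_def)

lemma Comp_Id [simp]: "\<lbrakk>f \<in> Arr C; Dom C f = x\<rbrakk> \<Longrightarrow> f \<cdot> Id C x = f"
  using Id_right[of f x "Cod C f"] by (auto simp: homset_def)

lemma Id_Comp [simp]: "\<lbrakk>f \<in> Arr C; Cod C f = y\<rbrakk> \<Longrightarrow> Id C y \<cdot> f = f"
  using Id_left[of f "Dom C f" y] by (auto simp: homset_def)

lemma assoc [simp]:
  "\<lbrakk>f \<in> Arr C; g \<in> Arr C; h \<in> Arr C; Cod C f = Dom C g; Cod C g = Dom C h\<rbrakk>
    \<Longrightarrow> (h \<cdot> g) \<cdot> f = h \<cdot> (g \<cdot> f)"
  using Comp_assoc[of f "Dom C f" "Dom C g" g "Dom C h" h "Cod C h"] by (auto simp: homset_def)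

text \<open>The simplifier brackets composites to the right, which hides a known composite g f
  inside g (f h). This rule and \<open>comp_eq_extend\<close> apply an equation at that
  place.\<close>

lemma comp_eq_assoc:
  assumes "g \<cdot> f = k" "f \<in> Arr C" "g \<in> Arr C" "Cod C f = Dom C g" "h \<in> Arr C" "Cod C h = Dom C f"
  shows "g \<cdot> (f \<cdot> h) = k \<cdot> h"
  using assms assoc[of h f g] by simp

lemma comp_eq_extend:
  assumes "g \<cdot> f = g' \<cdot> f'" "f \<in> Arr C" "g \<in> Arr C" "Cod C f = Dom C g"
    "f' \<in> Arr C" "g' \<in> Arr C" "Cod C f' = Dom C g'" "Dom C f = Dom C f'"
    "h \<in> Arr C" "Cod C h = Dom C f"
  shows "g \<cdot> (f \<cdot> h) = g' \<cdot> (f' \<cdot> h)"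
  using assms assoc[of h f g] assoc[of h f' g'] by simp

section \<open>Isomorphisms and retracts\<close>

lemma inverse_arrowsD:
  assumes "inverse_arrows C f g"
  shows "f \<in> Arr C" "g \<in> Arr C" "Dom C g = Cod C f" "Cod C g = Dom C f"
    "g \<cdot> f = Id C (Dom C f)" "f \<cdot> g = Id C (Cod C f)"
  using assms by (auto simp: inverse_arrows_def homset_def)

lemma inverse_arrowsI:
  assumes "f \<in> homset C x y" "g \<in> homset C y x" "g \<cdot> f = Id C x" "f \<cdot> g = Id C y"
  shows "inverse_arrows C f g"
  using assms by (auto simp: inverse_arrows_def homset_def)

lemma inverse_arrows_sym: "inverse_arrows C f g \<Longrightarrow> inverse_arrows C g f"
  by (auto simp: inverse_arrows_def homset_def)

lemma inverse_arrows_unique: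
  assumes "inverse_arrows C f g" "inverse_arrows C f g'"
  shows "g = g'"
proof -
  note a = inverse_arrowsD[OF assms(1)] and b = inverse_arrowsD[OF assms(2)]
  have "g = g \<cdot> (f \<cdot> g')" using a(1-5) b by simp
  also have "\<dots> = (g \<cdot> f) \<cdot> g'" using a(1-4) b by simp
  also have "\<dots> = g'" using a b by simp
  finally show ?thesis .
qed

lemma iso_arrI: "\<lbrakk>f \<in> homset C x y; g \<in> homset C y x; g \<cdot> f = Id C x; f \<cdot> g = Id C y\<rbrakk> \<Longrightarrow> is_iso_arr C f"
  using inverse_arrowsI unfolding is_iso_arr_def by blast

lemma inverse_arr_inverse: "is_iso_arr C f \<Longrightarrow> inverse_arrows C f (inverse_arr C f)"
  unfolding is_iso_arr_def inverse_arr_def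
  by (rule theI') (use inverse_arrows_unique in blast)

lemma iso_arrE:
  assumes "is_iso_arr C f" "f \<in> homset C x y"
  obtains g where "g \<in> homset C y x" "g \<cdot> f = Id C x" "f \<cdot> g = Id C y" "is_iso_arr C g" "inverse_arr C f = g"
proof -
  note a = inverse_arr_inverse[OF assms(1)]
  show thesis
    using that[of "inverse_arr C f"] inverse_arrowsD[OF a] assms(2) inverse_arrows_sym[OF a]
    by (auto simp: homset_def is_iso_arr_def)
qed

lemma iso_Id: "x \<in> Obj C \<Longrightarrow> is_iso_arr C (Id C x)"
  by (rule iso_arrI[of _ x x "Id C x"]) (auto simp: homset_def)

lemma iso_comp:
  assumes "is_iso_arr C f" "is_iso_arr C g" "f \<in> homset C x y" "g \<in> homset C y z"
  shows "is_iso_arr C (g \<cdot> f)"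
proof -
  obtain f' where f': "f' \<in> homset C y x" "f' \<cdot> f = Id C x" "f \<cdot> f' = Id C y"
    using iso_arrE[OF assms(1,3)] by metis
  obtain g' where g': "g' \<in> homset C z y" "g' \<cdot> g = Id C y" "g \<cdot> g' = Id C z"
    using iso_arrE[OF assms(2,4)] by metis
  note h = homsetD[OF assms(3)] homsetD[OF assms(4)] homsetD[OF f'(1)] homsetD[OF g'(1)]
  have o: "x \<in> Obj C" "y \<in> Obj C" "z \<in> Obj C" using hom_obj assms by auto
  have "g' \<cdot> (g \<cdot> f) = f" using comp_eq_assoc[OF g'(2)] h by simp
  moreover have "f \<cdot> (f' \<cdot> g') = g'" using comp_eq_assoc[OF f'(3)] h by simp
  ultimately show ?thesis
    by (intro iso_arrI[of _ x z "f' \<cdot> g'"]) (use h o f' g' in \<open>auto simp: homset_iff\<close>)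
qed

lemma isomorphicI: "\<lbrakk>f \<in> homset C x y; is_iso_arr C f\<rbrakk> \<Longrightarrow> isomorphic C x y"
  by (auto simp: isomorphic_def)

lemma isomorphicE:
  assumes "isomorphic C x y"
  obtains f g where "f \<in> homset C x y" "g \<in> homset C y x" "g \<cdot> f = Id C x" "f \<cdot> g = Id C y"
    "is_iso_arr C f" "is_iso_arr C g"
  using assms iso_arrE unfolding isomorphic_def by metis

lemma isomorphic_refl: "x \<in> Obj C \<Longrightarrow> isomorphic C x x"
  using iso_Id Id_in by (auto simp: isomorphic_def)

lemma isomorphic_sym: "isomorphic C x y \<Longrightarrow> isomorphic C y x"
  by (erule isomorphicE) (auto simp: isomorphic_def)

lemma isomorphic_trans: "isomorphic C x y \<Longrightarrow> isomorphic C y z \<Longrightarrow> isomorphic C x z"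
  by (meson Comp_in iso_comp isomorphic_def)

lemma isomorphic_obj: "isomorphic C x y \<Longrightarrow> x \<in> Obj C \<and> y \<in> Obj C"
  by (metis hom_obj isomorphicE)

lemma iso_cancel_left:
  assumes "is_iso_arr C g" "g \<in> homset C y z" "f \<in> homset C x y" "f' \<in> homset C x y" "g \<cdot> f = g \<cdot> f'"
  shows "f = f'"
proof -
  obtain g' where g': "g' \<in> homset C z y" "g' \<cdot> g = Id C y" using iso_arrE[OF assms(1,2)] by metis
  note h = homsetD[OF assms(2)] homsetD[OF assms(3)] homsetD[OF assms(4)] homsetD[OF g'(1)]
  have "g' \<cdot> (g \<cdot> f) = f" "g' \<cdot> (g \<cdot> f') = f'" using comp_eq_assoc[OF g'(2)] h by simp_all
  then show ?thesis using assms(5) by metis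
qed

lemma iso_cancel_right:
  assumes "is_iso_arr C g" "g \<in> homset C x y" "f \<in> homset C y z" "f' \<in> homset C y z" "f \<cdot> g = f' \<cdot> g"
  shows "f = f'"
proof -
  obtain g' where g': "g' \<in> homset C y x" "g \<cdot> g' = Id C y" using iso_arrE[OF assms(1,2)] by metis
  note h = homsetD[OF assms(2)] homsetD[OF assms(3)] homsetD[OF assms(4)] homsetD[OF g'(1)]
  have "(f \<cdot> g) \<cdot> g' = f" "(f' \<cdot> g) \<cdot> g' = f'" using h g' by simp_all
  then show ?thesis using assms(5) by metis
qed

text \<open>Thickness is defined through biproducts. A section with a retraction carries no
  complement and composes freely; \<open>retract_biproduct\<close> supplies the complement when it
  is wanted.\<close>

definition retract where
  "retract x s \<longleftrightarrow> (\<exists>i \<in> homset C x s. \<exists>r \<in> homset C s x. r \<cdot> i = Id C x)"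

lemma retractI: "\<lbrakk>i \<in> homset C x s; r \<in> homset C s x; r \<cdot> i = Id C x\<rbrakk> \<Longrightarrow> retract x s"
  by (auto simp: retract_def)

lemma isomorphic_retract: "isomorphic C x y \<Longrightarrow> retract x y"
  by (erule isomorphicE) (auto simp: retract_def)

lemma retract_trans:
  assumes "retract x y" "retract y z"
  shows "retract x z"
proof -
  obtain i r where 1: "i \<in> homset C x y" "r \<in> homset C y x" "r \<cdot> i = Id C x"
    using assms(1) by (auto simp: retract_def)
  obtain j q where 2: "j \<in> homset C y z" "q \<in> homset C z y" "q \<cdot> j = Id C y"
    using assms(2) by (auto simp: retract_def)
  note h = homsetD[OF 1(1)] homsetD[OF 1(2)] homsetD[OF 2(1)] homsetD[OF 2(2)]
  have "q \<cdot> (j \<cdot> i) = i" using comp_eq_assoc[OF 2(3)] h by simp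
  then show ?thesis using h 1
    by (intro retractI[of "j \<cdot> i" _ _ "r \<cdot> q"]) (auto simp: homset_iff)
qed

lemma zero_obj_obj: "is_zero_obj C z \<Longrightarrow> z \<in> Obj C"
  by (simp add: is_zero_obj_def)

lemma zero_obj_iso: assumes "is_zero_obj C z" "is_zero_obj C z'" shows "isomorphic C z z'"
proof -
  obtain f where f: "f \<in> homset C z z'" using assms by (auto simp: is_zero_obj_def)
  obtain g where g: "g \<in> homset C z' z" using assms by (auto simp: is_zero_obj_def)
  have o: "z \<in> Obj C" "z' \<in> Obj C" using assms zero_obj_obj by auto
  have "g \<cdot> f \<in> homset C z z" "Id C z \<in> homset C z z" "f \<cdot> g \<in> homset C z' z'" "Id C z' \<in> homset C z' z'"
    using f g o by (auto simp: homset_iff)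
  then have "g \<cdot> f = Id C z" "f \<cdot> g = Id C z'"
    using assms o by (auto simp: is_zero_obj_def)
  then show ?thesis using isomorphicI iso_arrI f g by metis
qed

section \<open>Coproducts up to reindexing and isomorphism\<close>

lemma coproduct_ex1:
  assumes "is_coproduct C I t c \<iota>" "y \<in> Obj C" "\<And>i. i \<in> I \<Longrightarrow> g i \<in> homset C (t i) y"
  shows "\<exists>!h. h \<in> homset C c y \<and> (\<forall>i \<in> I. h \<cdot> \<iota> i = g i)"
  using assms unfolding is_coproduct_def by blast

lemma coproduct_ex:
  assumes "is_coproduct C I t c \<iota>" "y \<in> Obj C" "\<And>i. i \<in> I \<Longrightarrow> g i \<in> homset C (t i) y"
  shows "\<exists>h \<in> homset C c y. \<forall>i \<in> I. h \<cdot> \<iota> i = g i"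
  using coproduct_ex1[OF assms] by blast

lemma coproduct_eq:
  assumes "is_coproduct C I t c \<iota>" "h \<in> homset C c y" "h' \<in> homset C c y"
    "\<And>i. i \<in> I \<Longrightarrow> h \<cdot> \<iota> i = h' \<cdot> \<iota> i"
  shows "h = h'"
proof -
  have "h \<cdot> \<iota> i \<in> homset C (t i) y" if "i \<in> I" for i
    using assms(1,2) that by (auto simp: is_coproduct_def homset_iff)
  then have "\<exists>!k. k \<in> homset C c y \<and> (\<forall>i \<in> I. k \<cdot> \<iota> i = h \<cdot> \<iota> i)"
    using coproduct_ex1[OF assms(1), of y "\<lambda>i. h \<cdot> \<iota> i"] hom_obj(2)[OF assms(2)] by blast
  then show ?thesis using assms(2-4) by metis
qed

lemma coproductI:
  assumes "c \<in> Obj C" "\<And>i. i \<in> I \<Longrightarrow> \<iota> i \<in> homset C (t i) c"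
    and "\<And>y g. \<lbrakk>y \<in> Obj C; \<And>i. i \<in> I \<Longrightarrow> g i \<in> homset C (t i) y\<rbrakk>
        \<Longrightarrow> \<exists>h. h \<in> homset C c y \<and> (\<forall>i \<in> I. h \<cdot> \<iota> i = g i)"
    and "\<And>y h h'. \<lbrakk>h \<in> homset C c y; h' \<in> homset C c y; \<And>i. i \<in> I \<Longrightarrow> h \<cdot> \<iota> i = h' \<cdot> \<iota> i\<rbrakk> \<Longrightarrow> h = h'"
  shows "is_coproduct C I t c \<iota>"
  unfolding is_coproduct_def
proof (intro conjI ballI allI impI ex_ex1I)
  fix i assume "i \<in> I"
  then show "t i \<in> Obj C" "\<iota> i \<in> homset C (t i) c" using assms(2) hom_obj by auto
next
  show "c \<in> Obj C" by fact
next
  fix y g assume "y \<in> Obj C" "\<forall>i \<in> I. g i \<in> homset C (t i) y"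
  then show "\<exists>h. h \<in> homset C c y \<and> (\<forall>i \<in> I. h \<cdot> \<iota> i = g i)" using assms(3) by blast
next
  fix y g h h'
  assume "h \<in> homset C c y \<and> (\<forall>i \<in> I. h \<cdot> \<iota> i = g i)" "h' \<in> homset C c y \<and> (\<forall>i \<in> I. h' \<cdot> \<iota> i = g i)"
  then show "h = h'" using assms(4)[of h y h'] by simp
qed

lemma coproduct_in:
  assumes "is_coproduct C I t c \<iota>"
  shows "c \<in> Obj C" "i \<in> I \<Longrightarrow> \<iota> i \<in> homset C (t i) c" "i \<in> I \<Longrightarrow> t i \<in> Obj C"
  using assms by (auto simp: is_coproduct_def)

lemma coproduct_reindex:
  assumes \<phi>: "bij_betw \<phi> A I" and c: "is_coproduct C I t c \<iota>"
  shows "is_coproduct C A (\<lambda>a. t (\<phi> a)) c (\<lambda>a. \<iota> (\<phi> a))"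
proof (rule coproductI)
  let ?\<psi> = "inv_into A \<phi>"
  have \<psi>: "?\<psi> i \<in> A" "\<phi> (?\<psi> i) = i" if "i \<in> I" for i
    using \<phi> that by (auto simp: bij_betw_def inv_into_into f_inv_into_f)
  have \<psi>\<phi>: "?\<psi> (\<phi> a) = a" "\<phi> a \<in> I" if "a \<in> A" for a using \<phi> that by (auto simp: bij_betw_def)
  show "c \<in> Obj C" "\<And>a. a \<in> A \<Longrightarrow> \<iota> (\<phi> a) \<in> homset C (t (\<phi> a)) c"
    using c \<psi>\<phi> by (auto simp: is_coproduct_def)
  fix y
  { fix g assume y: "y \<in> Obj C" and g: "\<And>a. a \<in> A \<Longrightarrow> g a \<in> homset C (t (\<phi> a)) y"
    have "g (?\<psi> i) \<in> homset C (t i) y" if "i \<in> I" for i using g \<psi>[OF that] by metis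
    then have "\<exists>h \<in> homset C c y. \<forall>i \<in> I. h \<cdot> \<iota> i = g (?\<psi> i)" by (rule coproduct_ex[OF c y])
    then obtain h where
      h: "h \<in> homset C c y" "\<And>i. i \<in> I \<Longrightarrow> h \<cdot> \<iota> i = g (?\<psi> i)" by auto
    then show "\<exists>h. h \<in> homset C c y \<and> (\<forall>a\<in>A. h \<cdot> \<iota> (\<phi> a) = g a)" using \<psi>\<phi> by auto }
  fix h h' assume "h \<in> homset C c y" "h' \<in> homset C c y" "\<And>a. a \<in> A \<Longrightarrow> h \<cdot> \<iota> (\<phi> a) = h' \<cdot> \<iota> (\<phi> a)"
  then show "h = h'" using coproduct_eq[OF c] \<psi> by metis
qed

lemma coproduct_cong:
  assumes "is_coproduct C I t c \<iota>" "\<And>i. i \<in> I \<Longrightarrow> t i = t' i" "\<And>i. i \<in> I \<Longrightarrow> \<iota> i = \<iota>' i"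
  shows "is_coproduct C I t' c \<iota>'"
  using assms unfolding is_coproduct_def by simp

text \<open>Needed where a coproduct is known only up to isomorphism of the summands and of the
  total object: after desuspending a diagram, and when the symmetry turns a tensor product
  around.\<close>

lemma coproduct_iso:
  assumes c: "is_coproduct C I t c \<iota>"
    and \<theta>: "\<And>i. i \<in> I \<Longrightarrow> \<theta> i \<in> homset C (t' i) (t i)" "\<And>i. i \<in> I \<Longrightarrow> is_iso_arr C (\<theta> i)"
    and \<alpha>: "\<alpha> \<in> homset C c c'" "is_iso_arr C \<alpha>"
  shows "is_coproduct C I t' c' (\<lambda>i. \<alpha> \<cdot> \<iota> i \<cdot> \<theta> i)"
proof (rule coproductI)
  obtain \<beta> where \<beta>: "\<beta> \<in> homset C c' c" "\<beta> \<cdot> \<alpha> = Id C c" "\<alpha> \<cdot> \<beta> = Id C c'" using iso_arrE[OF \<alpha>(2,1)] by metis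
  have "\<forall>i\<in>I. \<exists>\<theta>'. \<theta>' \<in> homset C (t i) (t' i) \<and> \<theta>' \<cdot> \<theta> i = Id C (t' i) \<and> \<theta> i \<cdot> \<theta>' = Id C (t i)"
    using iso_arrE[OF \<theta>(2,1)] by metis
  then obtain \<theta>' where \<theta>': "\<And>i. i \<in> I \<Longrightarrow> \<theta>' i \<in> homset C (t i) (t' i)"
      "\<And>i. i \<in> I \<Longrightarrow> \<theta>' i \<cdot> \<theta> i = Id C (t' i)" "\<And>i. i \<in> I \<Longrightarrow> \<theta> i \<cdot> \<theta>' i = Id C (t i)"
    by metis
  have \<iota>: "\<And>i. i \<in> I \<Longrightarrow> \<iota> i \<in> homset C (t i) c" using coproduct_in[OF c] by auto
  note hi = homsetD[OF \<theta>(1)] homsetD[OF \<theta>'(1)] homsetD[OF \<iota>]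
  note h = homsetD[OF \<alpha>(1)] homsetD[OF \<beta>(1)]
  show "c' \<in> Obj C" using \<alpha> hom_obj by blast
  show "\<And>i. i \<in> I \<Longrightarrow> \<alpha> \<cdot> \<iota> i \<cdot> \<theta> i \<in> homset C (t' i) c'" using h by (simp add: homset_iff hi)
  fix y
  { fix g assume y: "y \<in> Obj C" and g: "\<And>i. i \<in> I \<Longrightarrow> g i \<in> homset C (t' i) y"
    have "g i \<cdot> \<theta>' i \<in> homset C (t i) y" if "i \<in> I" for i
      using hi[OF that] homsetD[OF g[OF that]] by (simp add: homset_iff)
    then have "\<exists>k \<in> homset C c y. \<forall>i \<in> I. k \<cdot> \<iota> i = g i \<cdot> \<theta>' i" by (rule coproduct_ex[OF c y])
    then obtain k where
      k: "k \<in> homset C c y" "\<And>i. i \<in> I \<Longrightarrow> k \<cdot> \<iota> i = g i \<cdot> \<theta>' i" by auto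
    have "(k \<cdot> \<beta>) \<cdot> \<alpha> \<cdot> \<iota> i \<cdot> \<theta> i = g i" if "i \<in> I" for i
    proof -
      have "\<beta> \<cdot> \<alpha> \<cdot> \<iota> i \<cdot> \<theta> i = \<iota> i \<cdot> \<theta> i" using comp_eq_assoc[OF \<beta>(2)] h hi[OF that] by simp
      then have "(k \<cdot> \<beta>) \<cdot> \<alpha> \<cdot> \<iota> i \<cdot> \<theta> i = k \<cdot> \<iota> i \<cdot> \<theta> i"
        using h hi[OF that] homsetD[OF k(1)] by simp
      also have "\<dots> = (g i \<cdot> \<theta>' i) \<cdot> \<theta> i"
        using comp_eq_assoc[OF k(2)[OF that], of "\<theta> i"] hi[OF that] homsetD[OF k(1)] by simp
      also have "\<dots> = g i" using hi[OF that] homsetD[OF g[OF that]] \<theta>'(2)[OF that] by simp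
      finally show ?thesis .
    qed
    then show "\<exists>h. h \<in> homset C c' y \<and> (\<forall>i\<in>I. h \<cdot> \<alpha> \<cdot> \<iota> i \<cdot> \<theta> i = g i)"
      using h homsetD[OF k(1)] by (intro exI[of _ "k \<cdot> \<beta>"]) (auto simp: homset_iff) }
  fix k k' assume k: "k \<in> homset C c' y" "k' \<in> homset C c' y"
    and e: "\<And>i. i \<in> I \<Longrightarrow> k \<cdot> \<alpha> \<cdot> \<iota> i \<cdot> \<theta> i = k' \<cdot> \<alpha> \<cdot> \<iota> i \<cdot> \<theta> i"
  note h' = homsetD[OF k(1)] homsetD[OF k(2)]
  have "k \<cdot> \<alpha> = k' \<cdot> \<alpha>"
  proof (rule coproduct_eq[OF c])
    fix i assume i: "i \<in> I"
    have "(k \<cdot> \<alpha> \<cdot> \<iota> i \<cdot> \<theta> i) \<cdot> \<theta>' i = (k' \<cdot> \<alpha> \<cdot> \<iota> i \<cdot> \<theta> i) \<cdot> \<theta>' i" using e[OF i] by simp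
    then show "(k \<cdot> \<alpha>) \<cdot> \<iota> i = (k' \<cdot> \<alpha>) \<cdot> \<iota> i" using h h' hi[OF i] \<theta>'(3)[OF i] by simp
  qed (use h h' in \<open>auto simp: homset_iff\<close>)
  then show "k = k'" using iso_cancel_right[OF \<alpha>(2,1) k] by simp
qed

end

section \<open>Hom groups, zero arrows and zero objects\<close>

context additive_category
begin

lemma hom_group_simps [simp]:
  "carrier (hom_group C x y) = homset C x y" "monoid.mult (hom_group C x y) = Plus C"
  "one (hom_group C x y) = Zero C x y"
  by (simp_all add: hom_group_def)

lemma Plus_in: "\<lbrakk>f \<in> homset C x y; g \<in> homset C x y\<rbrakk> \<Longrightarrow> f \<boxplus> g \<in> homset C x y"
  using comm_group.axioms(2)[OF hom_comm_group, of x y] hom_obj[of f x y]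
    group.is_monoid monoid.m_closed[of "hom_group C x y" f g] by auto

lemma Zero_in: "\<lbrakk>x \<in> Obj C; y \<in> Obj C\<rbrakk> \<Longrightarrow> Zero C x y \<in> homset C x y"
  using comm_group.axioms(2)[OF hom_comm_group, of x y]
    group.is_monoid monoid.one_closed[of "hom_group C x y"] by auto

lemma neg_in: "f \<in> homset C x y \<Longrightarrow> neg_arr C f \<in> homset C x y"
  using comm_group.axioms(2)[OF hom_comm_group, of x y] hom_obj[of f x y]
    group.inv_closed[of "hom_group C x y" f] by (auto simp: neg_arr_def homset_iff)

lemma Plus_arr [simp]:
  assumes "f \<in> Arr C" "g \<in> Arr C" "Dom C f = Dom C g" "Cod C f = Cod C g"
  shows "f \<boxplus> g \<in> Arr C" "Dom C (f \<boxplus> g) = Dom C g" "Cod C (f \<boxplus> g) = Cod C g"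
  using Plus_in[of f "Dom C f" "Cod C f" g] assms by (auto simp: homset_iff)

lemma Zero_arr [simp]:
  assumes "x \<in> Obj C" "y \<in> Obj C"
  shows "Zero C x y \<in> Arr C" "Dom C (Zero C x y) = x" "Cod C (Zero C x y) = y"
  using Zero_in[OF assms] by (auto simp: homset_iff)

lemma neg_arr_arr [simp]:
  assumes "f \<in> Arr C"
  shows "neg_arr C f \<in> Arr C" "Dom C (neg_arr C f) = Dom C f" "Cod C (neg_arr C f) = Cod C f"
  using neg_in[of f "Dom C f" "Cod C f"] assms by (auto simp: homset_iff)

lemma Plus_assoc:
  "\<lbrakk>f \<in> homset C x y; g \<in> homset C x y; h \<in> homset C x y\<rbrakk> \<Longrightarrow> (f \<boxplus> g) \<boxplus> h = f \<boxplus> (g \<boxplus> h)"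
  using comm_group.axioms(2)[OF hom_comm_group, of x y] hom_obj[of f x y]
    group.is_monoid monoid.m_assoc[of "hom_group C x y" f g h] by auto

lemma Plus_comm: "\<lbrakk>f \<in> homset C x y; g \<in> homset C x y\<rbrakk> \<Longrightarrow> f \<boxplus> g = g \<boxplus> f"
  using comm_group.axioms(1)[OF hom_comm_group, of x y] hom_obj[of f x y]
    comm_monoid.m_comm[of "hom_group C x y" f g] by auto

lemma Plus_Zero [simp]: "\<lbrakk>f \<in> Arr C; Dom C f = x; Cod C f = y\<rbrakk> \<Longrightarrow> f \<boxplus> Zero C x y = f"
  using comm_group.axioms(2)[OF hom_comm_group, of x y] hom_obj[of f x y]
    group.is_monoid monoid.r_one[of "hom_group C x y" f] by (auto simp: homset_iff)

lemma Zero_Plus [simp]: "\<lbrakk>f \<in> Arr C; Dom C f = x; Cod C f = y\<rbrakk> \<Longrightarrow> Zero C x y \<boxplus> f = f"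
  using Plus_comm[of f x y "Zero C x y"] Zero_in[of x y] hom_obj[of f x y] by (auto simp: homset_iff)

lemma Plus_neg [simp]: "f \<in> Arr C \<Longrightarrow> f \<boxplus> neg_arr C f = Zero C (Dom C f) (Cod C f)"
  using comm_group.axioms(2)[OF hom_comm_group, of "Dom C f" "Cod C f"]
    group.r_inv[of "hom_group C (Dom C f) (Cod C f)" f] by (auto simp: homset_iff neg_arr_def)

lemma neg_Plus [simp]: "f \<in> Arr C \<Longrightarrow> neg_arr C f \<boxplus> f = Zero C (Dom C f) (Cod C f)"
  using Plus_comm[of f "Dom C f" "Cod C f" "neg_arr C f"] by (auto simp: homset_iff)

lemma Plus_cancel:
  assumes "f \<in> homset C x y" "g \<in> homset C x y" "h \<in> homset C x y" "f \<boxplus> h = g \<boxplus> h"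
  shows "f = g"
proof -
  note hs = homsetD[OF assms(1)] homsetD[OF assms(2)] homsetD[OF assms(3)]
  have "f = f \<boxplus> (h \<boxplus> neg_arr C h)" using hs by simp
  also have "\<dots> = (f \<boxplus> h) \<boxplus> neg_arr C h" using Plus_assoc neg_in assms by metis
  also have "\<dots> = g \<boxplus> (h \<boxplus> neg_arr C h)" using Plus_assoc neg_in assms by metis
  also have "\<dots> = g" using hs by simp
  finally show ?thesis .
qed

text \<open>Serves to show that additive operations preserve zero arrows: the image of a zero arrow
  is its own double.\<close>

lemma Plus_idem_zero: "\<lbrakk>f \<in> homset C x y; f \<boxplus> f = f\<rbrakk> \<Longrightarrow> f = Zero C x y"
  by (rule Plus_cancel[of _ x y _ f]) (auto simp: homset_iff)

lemma neg_unique: "\<lbrakk>f \<in> homset C x y; g \<in> homset C x y; f \<boxplus> g = Zero C x y\<rbrakk> \<Longrightarrow> f = neg_arr C g"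
  by (rule Plus_cancel[of _ x y _ g]) (auto simp: homset_iff)

lemma neg_neg [simp]: "f \<in> Arr C \<Longrightarrow> neg_arr C (neg_arr C f) = f"
  by (rule neg_unique[of f "Dom C f" "Cod C f" "neg_arr C f", symmetric]) (auto simp: homset_iff)

lemma minus_eq_zero: "\<lbrakk>f \<in> homset C x y; g \<in> homset C x y; f \<boxplus> neg_arr C g = Zero C x y\<rbrakk> \<Longrightarrow> f = g"
  using neg_unique[of f x y "neg_arr C g"] by (simp add: homset_iff)

lemma Comp_Zero [simp]:
  assumes "f \<in> Arr C" "x \<in> Obj C" "Dom C f = y"
  shows "f \<cdot> Zero C x y = Zero C x (Cod C f)"
proof (rule Plus_idem_zero)
  have y: "y \<in> Obj C" using assms by auto
  show "f \<cdot> Zero C x y \<in> homset C x (Cod C f)" using assms y by (simp add: homset_iff)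
  have "f \<cdot> (Zero C x y \<boxplus> Zero C x y) = f \<cdot> Zero C x y \<boxplus> f \<cdot> Zero C x y"
    using assms y by (intro Comp_Plus_right[of _ x y _ _ "Cod C f"]) (auto simp: homset_iff)
  then show "f \<cdot> Zero C x y \<boxplus> f \<cdot> Zero C x y = f \<cdot> Zero C x y" using assms y by simp
qed

lemma Zero_Comp [simp]:
  assumes "f \<in> Arr C" "z \<in> Obj C" "Cod C f = y"
  shows "Zero C y z \<cdot> f = Zero C (Dom C f) z"
proof (rule Plus_idem_zero)
  have y: "y \<in> Obj C" using assms by auto
  show "Zero C y z \<cdot> f \<in> homset C (Dom C f) z" using assms y by (simp add: homset_iff)
  have "(Zero C y z \<boxplus> Zero C y z) \<cdot> f = Zero C y z \<cdot> f \<boxplus> Zero C y z \<cdot> f"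
    using assms y by (intro Comp_Plus_left[of _ "Dom C f" y _ z]) (auto simp: homset_iff)
  then show "Zero C y z \<cdot> f \<boxplus> Zero C y z \<cdot> f = Zero C y z \<cdot> f" using assms y by simp
qed

lemma Comp_Plus [simp]:
  "\<lbrakk>f \<in> Arr C; f' \<in> Arr C; g \<in> Arr C; Dom C f = Dom C f'; Cod C f = Cod C f'; Cod C f' = Dom C g\<rbrakk>
    \<Longrightarrow> g \<cdot> (f \<boxplus> f') = g \<cdot> f \<boxplus> g \<cdot> f'"
  by (rule Comp_Plus_right[of _ "Dom C f" "Dom C g" _ _ "Cod C g"]) (auto simp: homset_iff)

lemma Plus_Comp [simp]:
  "\<lbrakk>g \<in> Arr C; g' \<in> Arr C; f \<in> Arr C; Dom C g = Dom C g'; Cod C g = Cod C g'; Cod C f = Dom C g'\<rbrakk>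
    \<Longrightarrow> (g \<boxplus> g') \<cdot> f = g \<cdot> f \<boxplus> g' \<cdot> f"
  by (rule Comp_Plus_left[of _ "Dom C f" "Dom C g" _ "Cod C g"]) (auto simp: homset_iff)

lemma Comp_neg [simp]:
  assumes "f \<in> Arr C" "g \<in> Arr C" "Cod C f = Dom C g"
  shows "g \<cdot> neg_arr C f = neg_arr C (g \<cdot> f)"
proof (rule neg_unique[of _ "Dom C f" "Cod C g"])
  have "g \<cdot> (neg_arr C f \<boxplus> f) = g \<cdot> neg_arr C f \<boxplus> g \<cdot> f" using assms by (intro Comp_Plus) auto
  then show "g \<cdot> neg_arr C f \<boxplus> g \<cdot> f = Zero C (Dom C f) (Cod C g)" using assms by simp
qed (use assms in \<open>auto simp: homset_iff\<close>)

lemma neg_Comp [simp]: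
  assumes "f \<in> Arr C" "g \<in> Arr C" "Cod C f = Dom C g"
  shows "neg_arr C g \<cdot> f = neg_arr C (g \<cdot> f)"
proof (rule neg_unique[of _ "Dom C f" "Cod C g"])
  have "(neg_arr C g \<boxplus> g) \<cdot> f = neg_arr C g \<cdot> f \<boxplus> g \<cdot> f" using assms by (intro Plus_Comp) auto
  then show "neg_arr C g \<cdot> f \<boxplus> g \<cdot> f = Zero C (Dom C f) (Cod C g)" using assms by simp
qed (use assms in \<open>auto simp: homset_iff\<close>)

lemma neg_Zero [simp]: "\<lbrakk>x \<in> Obj C; y \<in> Obj C\<rbrakk> \<Longrightarrow> neg_arr C (Zero C x y) = Zero C x y"
  by (rule neg_unique[symmetric]) (auto simp: homset_iff)

lemma neg_eq_Zero: "\<lbrakk>f \<in> homset C x y; neg_arr C f = Zero C x y\<rbrakk> \<Longrightarrow> f = Zero C x y"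
  by (metis neg_neg neg_Zero hom_obj homsetD(1))

lemma neg_inj: "\<lbrakk>f \<in> Arr C; g \<in> Arr C; neg_arr C f = neg_arr C g\<rbrakk> \<Longrightarrow> f = g"
  by (metis neg_neg)

lemma minus_Plus_cancel:
  assumes "f \<in> homset C x y" "g \<in> homset C x y"
  shows "(f \<boxplus> neg_arr C g) \<boxplus> g = f"
  using Plus_assoc[OF assms(1) neg_in[OF assms(2)] assms(2)] homsetD[OF assms(1)] homsetD[OF assms(2)] by simp

lemma zero_obj_hom:
  assumes "is_zero_obj C z"
  shows "f \<in> homset C z x \<Longrightarrow> f = Zero C z x" "f \<in> homset C x z \<Longrightarrow> f = Zero C x z"
proof -
  have z: "z \<in> Obj C" "\<And>y. y \<in> Obj C \<Longrightarrow> (\<exists>!f. f \<in> homset C z y) \<and> (\<exists>!f. f \<in> homset C y z)"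
    using assms by (auto simp: is_zero_obj_def)
  show "f = Zero C z x" if "f \<in> homset C z x"
    using z(2)[OF hom_obj(2)[OF that]] that Zero_in[OF hom_obj[OF that]] by metis
  show "f = Zero C x z" if "f \<in> homset C x z"
    using z(2)[OF hom_obj(1)[OF that]] that Zero_in[OF hom_obj[OF that]] by metis
qed

lemma zero_obj_iff: "is_zero_obj C z \<longleftrightarrow> z \<in> Obj C \<and> Id C z = Zero C z z"
proof
  assume "is_zero_obj C z"
  then show "z \<in> Obj C \<and> Id C z = Zero C z z" using zero_obj_hom(1)[of z "Id C z" z] Id_in zero_obj_obj by auto
next
  assume *: "z \<in> Obj C \<and> Id C z = Zero C z z"
  have "f = Zero C z x" if f: "f \<in> homset C z x" for f x
    using Comp_Id[of f z] * homsetD[OF f] Zero_Comp[of f] hom_obj[OF f] by (metis Comp_Zero)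
  moreover have "f = Zero C x z" if f: "f \<in> homset C x z" for f x
    using Id_Comp[of f z] * homsetD[OF f] hom_obj[OF f] by (metis Zero_Comp)
  ultimately have "homset C z x = {Zero C z x} \<and> homset C x z = {Zero C x z}" if "x \<in> Obj C" for x
    using * that Zero_in[of x z] Zero_in[of z x] by blast
  then show "is_zero_obj C z" using * unfolding is_zero_obj_def by simp
qed

lemma zero_obj_retract:
  assumes "is_zero_obj C z" "retract x z" shows "is_zero_obj C x"
proof -
  obtain i r where i: "i \<in> homset C x z" "r \<in> homset C z x" "r \<cdot> i = Id C x"
    using assms by (auto simp: retract_def)
  have "i = Zero C x z" using zero_obj_hom(2)[OF assms(1) i(1)] .
  then have "Id C x = Zero C x x" using i(3) homsetD[OF i(2)] hom_obj[OF i(1)] by simp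
  then show ?thesis using hom_obj[OF i(1)] by (simp add: zero_obj_iff)
qed

lemma zero_obj_isomorphic: "\<lbrakk>is_zero_obj C z; isomorphic C x z\<rbrakk> \<Longrightarrow> is_zero_obj C x"
  by (rule zero_obj_retract[OF _ isomorphic_retract])

end

section \<open>Exactness in triangulated categories\<close>

context triangulated_category
begin

text \<open>Keeps the three objects at hand, since \<open>Tri\<close> records arrows only and every
  application of exactness needs their types.\<close>

definition tri where
  "tri f g h x y z \<longleftrightarrow> (f, g, h) \<in> Tri T \<and> f \<in> homset T x y \<and> g \<in> homset T y z \<and> h \<in> homset T z (\<Sigma>\<^sub>o x)"

lemma triD:
  assumes "tri f g h x y z"
  shows "(f, g, h) \<in> Tri T" "f \<in> homset T x y" "g \<in> homset T y z" "h \<in> homset T z (\<Sigma>\<^sub>o x)"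
    "x \<in> Obj T" "y \<in> Obj T" "z \<in> Obj T"
  using assms hom_obj by (auto simp: tri_def)

lemma tri_arr:
  assumes "tri f g h x y z"
  shows "f \<in> Arr T" "Dom T f = x" "Cod T f = y" "g \<in> Arr T" "Dom T g = y" "Cod T g = z"
    "h \<in> Arr T" "Dom T h = z" "Cod T h = \<Sigma>\<^sub>o x" "x \<in> Obj T" "y \<in> Obj T" "z \<in> Obj T"
  using triD[OF assms] by (auto simp: homset_iff)

lemma Tri_imp_tri:
  assumes "(f, g, h) \<in> Tri T"
  shows "tri f g h (Dom T f) (Cod T f) (Cod T g)"
  using Tri_typed[OF assms] assms by (auto simp: tri_def homset_iff)

lemma Sh_obj [simp]: "x \<in> Obj T \<Longrightarrow> \<Sigma>\<^sub>o x \<in> Obj T"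
  by (rule ShO_in)

lemma Sh_arr [simp]:
  assumes "f \<in> Arr T"
  shows "\<Sigma>\<^sub>a f \<in> Arr T" "Dom T (\<Sigma>\<^sub>a f) = \<Sigma>\<^sub>o (Dom T f)" "Cod T (\<Sigma>\<^sub>a f) = \<Sigma>\<^sub>o (Cod T f)"
  using ShA_in[of f "Dom T f" "Cod T f"] assms by (auto simp: homset_iff)

lemma Sh_Comp: "\<lbrakk>f \<in> Arr T; g \<in> Arr T; Cod T f = Dom T g\<rbrakk> \<Longrightarrow> \<Sigma>\<^sub>a (g \<cdot> f) = \<Sigma>\<^sub>a g \<cdot> \<Sigma>\<^sub>a f"
  by (rule ShA_Comp[of f "Dom T f" "Cod T f" g "Cod T g"]) (auto simp: homset_iff)

lemma Sh_Zero [simp]: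
  assumes "x \<in> Obj T" "y \<in> Obj T"
  shows "\<Sigma>\<^sub>a (Zero T x y) = Zero T (\<Sigma>\<^sub>o x) (\<Sigma>\<^sub>o y)"
  by (rule Plus_idem_zero) (use assms ShA_Plus[of "Zero T x y" x y "Zero T x y"] in \<open>auto simp: homset_iff\<close>)

lemma Sh_faithful:
  assumes "f \<in> homset T x y" "g \<in> homset T x y" "\<Sigma>\<^sub>a f = \<Sigma>\<^sub>a g"
  shows "f = g"
  using inj_onD[OF bij_betw_imp_inj_on[OF Sh_fully_faithful[OF hom_obj[OF assms(1)]]] assms(3,1,2)] .

lemma Sh_full:
  assumes "x \<in> Obj T" "y \<in> Obj T" "k \<in> homset T (\<Sigma>\<^sub>o x) (\<Sigma>\<^sub>o y)"
  obtains f where "f \<in> homset T x y" "\<Sigma>\<^sub>a f = k"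
  using assms(3) that unfolding bij_betw_imp_surj_on[OF Sh_fully_faithful[OF assms(1,2)], symmetric] by auto

lemma Sh_eq_Zero: "\<lbrakk>f \<in> homset T x y; \<Sigma>\<^sub>a f = Zero T (\<Sigma>\<^sub>o x) (\<Sigma>\<^sub>o y)\<rbrakk> \<Longrightarrow> f = Zero T x y"
  using Sh_faithful[of f x y "Zero T x y"] hom_obj[of f x y] Zero_in[of x y] by simp

lemma Sh_iso:
  assumes "is_iso_arr T f" "f \<in> homset T x y"
  shows "is_iso_arr T (\<Sigma>\<^sub>a f)"
proof -
  obtain g where g: "g \<in> homset T y x" "g \<cdot> f = Id T x" "f \<cdot> g = Id T y" using iso_arrE[OF assms] by metis
  have "\<Sigma>\<^sub>a g \<cdot> \<Sigma>\<^sub>a f = Id T (\<Sigma>\<^sub>o x)" "\<Sigma>\<^sub>a f \<cdot> \<Sigma>\<^sub>a g = Id T (\<Sigma>\<^sub>o y)"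
    using ShA_Comp[OF assms(2) g(1)] ShA_Comp[OF g(1) assms(2)] g ShA_Id hom_obj[OF g(1)] by auto
  then show ?thesis using iso_arrI ShA_in assms g(1) by metis
qed

lemma Sh_isomorphic: "isomorphic T x y \<Longrightarrow> isomorphic T (\<Sigma>\<^sub>o x) (\<Sigma>\<^sub>o y)"
  using Sh_iso ShA_in unfolding isomorphic_def by metis

lemma Sh_reflects_isomorphic:
  assumes "isomorphic T (\<Sigma>\<^sub>o x) (\<Sigma>\<^sub>o y)" "x \<in> Obj T" "y \<in> Obj T"
  shows "isomorphic T x y"
proof -
  obtain f g where fg: "f \<in> homset T (\<Sigma>\<^sub>o x) (\<Sigma>\<^sub>o y)" "g \<in> homset T (\<Sigma>\<^sub>o y) (\<Sigma>\<^sub>o x)"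
    "g \<cdot> f = Id T (\<Sigma>\<^sub>o x)" "f \<cdot> g = Id T (\<Sigma>\<^sub>o y)"
    using assms(1) by (rule isomorphicE)
  obtain f' where f': "f' \<in> homset T x y" "\<Sigma>\<^sub>a f' = f" using Sh_full assms fg by metis
  obtain g' where g': "g' \<in> homset T y x" "\<Sigma>\<^sub>a g' = g" using Sh_full assms fg by metis
  have "g' \<cdot> f' = Id T x"
    by (rule Sh_faithful[of _ x x]) (use ShA_Comp[OF f'(1) g'(1)] f' g' fg ShA_Id assms Comp_in Id_in in auto)
  moreover have "f' \<cdot> g' = Id T y"
    by (rule Sh_faithful[of _ y y]) (use ShA_Comp[OF g'(1) f'(1)] f' g' fg ShA_Id assms Comp_in Id_in in auto)
  ultimately show ?thesis using isomorphicI iso_arrI f' g' by metis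
qed

lemma zero_obj_obtain: obtains z where "is_zero_obj T z" "z \<in> Obj T"
  using zero_obj_exists zero_obj_obj by blast

lemma Sh_zero_obj: "is_zero_obj T z \<Longrightarrow> is_zero_obj T (\<Sigma>\<^sub>o z)"
  using ShA_Id[of z] by (auto simp: zero_obj_iff)

lemma Sh_reflects_zero_obj:
  assumes "is_zero_obj T (\<Sigma>\<^sub>o z)" "z \<in> Obj T" shows "is_zero_obj T z"
  using Sh_eq_Zero[of "Id T z" z z] assms ShA_Id[of z] Id_in by (auto simp: zero_obj_iff)

lemma tri_ex:
  assumes "f \<in> homset T x y"
  obtains g h z where "tri f g h x y z"
  using Tri_complete[of f] Tri_imp_tri homsetD[OF assms] by metis

lemma tri_Id: "\<lbrakk>x \<in> Obj T; is_zero_obj T z\<rbrakk> \<Longrightarrow> tri (Id T x) (Zero T x z) (Zero T z (\<Sigma>\<^sub>o x)) x x z"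
  using Tri_Id[of x z] zero_obj_obj[of z] by (simp add: tri_def homset_iff)

lemma tri_rotate: "tri f g h x y z \<Longrightarrow> tri g h (neg_arr T (\<Sigma>\<^sub>a f)) y z (\<Sigma>\<^sub>o x)"
  using Tri_rotate[of f x y g z h] unfolding tri_def by (auto simp: homset_iff)

lemma tri_unrotate:
  "\<lbrakk>tri g h (neg_arr T (\<Sigma>\<^sub>a f)) y z (\<Sigma>\<^sub>o x); f \<in> homset T x y\<rbrakk> \<Longrightarrow> tri f g h x y z"
  using Tri_rotate[of f x y g z h] unfolding tri_def by auto

lemma tri_fill:
  assumes "tri f g h x y z" "tri f' g' h' x' y' z'" "a \<in> homset T x x'" "b \<in> homset T y y'" "b \<cdot> f = f' \<cdot> a"
  obtains c where "c \<in> homset T z z'" "c \<cdot> g = g' \<cdot> b" "\<Sigma>\<^sub>a a \<cdot> h = h' \<cdot> c"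
  using Tri_fill[of f g h f' g' h' a b] assms unfolding tri_def by (auto simp: homset_iff)

text \<open>Filling in a map from the trivial triangle on the identity of x shows that g f factors
  through a zero object.\<close>

lemma tri_comp1:
  assumes "tri f g h x y z" shows "g \<cdot> f = Zero T x z"
proof -
  obtain o' where o: "is_zero_obj T o'" "o' \<in> Obj T" by (rule zero_obj_obtain)
  note t = tri_arr[OF assms]
  obtain c where "c \<in> homset T o' z" "c \<cdot> Zero T x o' = g \<cdot> f"
    using tri_fill[OF tri_Id[OF t(10) o(1)] assms Id_in[OF t(10)] triD(2)[OF assms]] t by auto
  then show ?thesis using t o by (auto simp: homset_iff)
qed

lemma tri_comp3:
  assumes "tri f g h x y z" shows "\<Sigma>\<^sub>a f \<cdot> h = Zero T z (\<Sigma>\<^sub>o y)"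
  using tri_comp1[OF tri_rotate[OF tri_rotate[OF assms]]] neg_eq_Zero[of "\<Sigma>\<^sub>a f \<cdot> h" z "\<Sigma>\<^sub>o y"] tri_arr[OF assms]
  by (simp add: homset_iff)

text \<open>Compare the rotated trivial triangle on t with the rotation of the given one, using u
  and a zero map as the two known components. The fill-in is a map between suspensions, and full
  faithfulness of the suspension turns it into the lift of u.\<close>

lemma tri_exact1:
  assumes tr: "tri f g h x y z" and u: "u \<in> homset T t y" "g \<cdot> u = Zero T t z"
  obtains v where "v \<in> homset T t x" "f \<cdot> v = u"
proof -
  obtain o' where o: "is_zero_obj T o'" "o' \<in> Obj T" by (rule zero_obj_obtain)
  note h = tri_arr[OF tr] homsetD[OF u(1)]
  have t: "t \<in> Obj T" using u hom_obj by blast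
  obtain c where c: "c \<in> homset T (\<Sigma>\<^sub>o t) (\<Sigma>\<^sub>o x)" "\<Sigma>\<^sub>a u \<cdot> neg_arr T (\<Sigma>\<^sub>a (Id T t)) = neg_arr T (\<Sigma>\<^sub>a f) \<cdot> c"
    by (rule tri_fill[OF tri_rotate[OF tri_Id[OF t o(1)]] tri_rotate[OF tr] u(1) Zero_in[OF o(2) h(12)]])
       (use u h o t in auto)
  obtain v where v: "v \<in> homset T t x" "\<Sigma>\<^sub>a v = c" using Sh_full t h c by metis
  note h' = h t o homsetD[OF v(1)] homsetD[OF c(1)]
  have "neg_arr T (\<Sigma>\<^sub>a u) = neg_arr T (\<Sigma>\<^sub>a f \<cdot> c)" using c(2) h' ShA_Id by simp
  then have "\<Sigma>\<^sub>a u = \<Sigma>\<^sub>a f \<cdot> c" using neg_inj h' by simp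
  then have "\<Sigma>\<^sub>a u = \<Sigma>\<^sub>a (f \<cdot> v)" using v Sh_Comp h' by simp
  then have "f \<cdot> v = u" using Sh_faithful[of u t y "f \<cdot> v"] h' by (simp add: homset_iff)
  then show thesis using that v by blast
qed

lemma tri_exact2:
  assumes "tri f g h x y z" "u \<in> homset T t z" "h \<cdot> u = Zero T t (\<Sigma>\<^sub>o x)"
  obtains v where "v \<in> homset T t y" "g \<cdot> v = u"
  using tri_exact1[OF tri_rotate[OF assms(1)] assms(2,3)] by blast

lemma tri_exact3:
  assumes "tri f g h x y z" "u \<in> homset T t (\<Sigma>\<^sub>o x)" "\<Sigma>\<^sub>a f \<cdot> u = Zero T t (\<Sigma>\<^sub>o y)"
  obtains v where "v \<in> homset T t z" "h \<cdot> v = u"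
proof -
  have "neg_arr T (\<Sigma>\<^sub>a f) \<cdot> u = Zero T t (\<Sigma>\<^sub>o y)"
    using assms(3) homsetD[OF assms(2)] hom_obj[OF assms(2)] tri_arr[OF assms(1)] by simp
  then show thesis using tri_exact2[OF tri_rotate[OF assms(1)] assms(2)] that by blast
qed

text \<open>The triangle is mapped to the trivial triangle with vanishing first object and the
  identity of t as second arrow; the fill-in is the extension of u.\<close>

lemma tri_weak1:
  assumes tr: "tri f g h x y z" and u: "u \<in> homset T y t" "u \<cdot> f = Zero T x t"
  obtains v where "v \<in> homset T z t" "v \<cdot> g = u"
proof -
  obtain o' where o: "is_zero_obj T o'" "o' \<in> Obj T" by (rule zero_obj_obtain)
  note h = tri_arr[OF tr] homsetD[OF u(1)]
  have t: "t \<in> Obj T" using u hom_obj by blast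
  have "tri (Zero T o' t) (Id T t) (Zero T t (\<Sigma>\<^sub>o o')) o' t t"
    by (rule tri_unrotate) (use tri_Id[OF t Sh_zero_obj[OF o(1)]] o t in \<open>auto simp: homset_iff\<close>)
  from tri_fill[OF tr this Zero_in[OF h(10) o(2)] u(1)] show thesis
    using that u(2) h t o by auto
qed

lemma tri_weak2:
  assumes "tri f g h x y z" "u \<in> homset T z t" "u \<cdot> g = Zero T y t"
  obtains v where "v \<in> homset T (\<Sigma>\<^sub>o x) t" "v \<cdot> h = u"
  using tri_weak1[OF tri_rotate[OF assms(1)] assms(2,3)] by blast

lemma tri_weak0:
  assumes tr: "tri f g h x y z" and u: "u \<in> homset T x t" "\<Sigma>\<^sub>a u \<cdot> h = Zero T z (\<Sigma>\<^sub>o t)"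
  obtains v where "v \<in> homset T y t" "v \<cdot> f = u"
proof -
  note h = tri_arr[OF tr] homsetD[OF u(1)] hom_obj[OF u(1)]
  obtain v' where v': "v' \<in> homset T (\<Sigma>\<^sub>o y) (\<Sigma>\<^sub>o t)" "v' \<cdot> neg_arr T (\<Sigma>\<^sub>a f) = \<Sigma>\<^sub>a u"
    by (rule tri_weak2[OF tri_rotate[OF tr], of "\<Sigma>\<^sub>a u" "\<Sigma>\<^sub>o t"]) (use u h in \<open>auto simp: homset_iff\<close>)
  have "neg_arr T v' \<in> homset T (\<Sigma>\<^sub>o y) (\<Sigma>\<^sub>o t)" using v' neg_in by blast
  then obtain v where v: "v \<in> homset T y t" "\<Sigma>\<^sub>a v = neg_arr T v'"
    using Sh_full h by metis
  note h' = h homsetD[OF v(1)] homsetD[OF v'(1)]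
  have "\<Sigma>\<^sub>a (v \<cdot> f) = \<Sigma>\<^sub>a u" using Sh_Comp v v'(2) h' by simp
  then have "v \<cdot> f = u" using Sh_faithful[of "v \<cdot> f" x t u] h' by (simp add: homset_iff)
  then show thesis using that v by blast
qed

text \<open>Exactness speaks of maps with zero composite. Writing u as d plus v makes it available
  for two maps with equal composites, and hides the negatives.\<close>

lemma diff_ex:
  assumes "u \<in> homset T t y" "v \<in> homset T t y"
  obtains d where "d \<in> homset T t y" "u = d \<boxplus> v"
    "\<And>k z. \<lbrakk>k \<in> homset T y z; k \<cdot> u = k \<cdot> v\<rbrakk> \<Longrightarrow> k \<cdot> d = Zero T t z"
    "\<And>k z. \<lbrakk>k \<in> homset T z t; u \<cdot> k = v \<cdot> k\<rbrakk> \<Longrightarrow> d \<cdot> k = Zero T z y"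
proof -
  let ?d = "u \<boxplus> neg_arr T v"
  note h = homsetD[OF assms(1)] homsetD[OF assms(2)]
  have d: "?d \<in> homset T t y" using assms Plus_in neg_in by blast
  have "k \<cdot> ?d = Zero T t z" if k: "k \<in> homset T y z" "k \<cdot> u = k \<cdot> v" for k z
    using h homsetD[OF k(1)] k(2) by simp
  moreover have "?d \<cdot> k = Zero T z y" if k: "k \<in> homset T z t" "u \<cdot> k = v \<cdot> k" for k z
    using h homsetD[OF k(1)] k(2) by simp
  ultimately show thesis using that[OF d minus_Plus_cancel[OF assms, symmetric]] by blast
qed

lemma tri_exact1_diff:
  assumes "tri f g h x y z" "u \<in> homset T t y" "v \<in> homset T t y" "g \<cdot> u = g \<cdot> v"
  obtains w where "w \<in> homset T t x" "u = f \<cdot> w \<boxplus> v"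
proof -
  obtain d where d: "d \<in> homset T t y" "u = d \<boxplus> v" "g \<cdot> d = Zero T t z"
    using diff_ex[OF assms(2,3)] triD(3)[OF assms(1)] assms(4) by metis
  then show thesis using tri_exact1[OF assms(1) d(1,3)] that by metis
qed

lemma tri_exact2_diff:
  assumes "tri f g h x y z" "u \<in> homset T t z" "v \<in> homset T t z" "h \<cdot> u = h \<cdot> v"
  obtains w where "w \<in> homset T t y" "u = g \<cdot> w \<boxplus> v"
  using tri_exact1_diff[OF tri_rotate[OF assms(1)] assms(2-4)] by blast

lemma tri_weak1_diff:
  assumes "tri f g h x y z" "u \<in> homset T z t" "v \<in> homset T z t" "u \<cdot> g = v \<cdot> g"
  obtains w where "w \<in> homset T (\<Sigma>\<^sub>o x) t" "u = w \<cdot> h \<boxplus> v"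
proof -
  obtain d where d: "d \<in> homset T z t" "u = d \<boxplus> v" "d \<cdot> g = Zero T y t"
    using diff_ex[OF assms(2,3)] triD(3)[OF assms(1)] assms(4) by metis
  then show thesis using tri_weak2[OF assms(1) d(1,3)] that by metis
qed

lemma mono_diff:
  assumes k: "k \<in> homset T y z" and m: "\<And>d. \<lbrakk>d \<in> homset T t y; k \<cdot> d = Zero T t z\<rbrakk> \<Longrightarrow> d = Zero T t y"
    and "u \<in> homset T t y" "v \<in> homset T t y" "k \<cdot> u = k \<cdot> v"
  shows "u = v"
proof -
  obtain d where d: "d \<in> homset T t y" "u = d \<boxplus> v" "k \<cdot> d = Zero T t z"
    using diff_ex[OF assms(3,4)] k assms(5) by metis
  then show ?thesis using m[OF d(1,3)] homsetD[OF assms(4)] by simp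
qed

text \<open>The five lemma, carried out on maps from arbitrary test objects. A fill-in c kills no
  nonzero map (\<open>mono\<close>), and a lift of the identity of z' gives a right inverse of c;
  cancelling c then shows that this inverse is two-sided.\<close>

lemma tri_iso_of_iso:
  assumes t: "tri f g h x y z" and t': "tri f' g' h' x' y' z'"
    and a: "a \<in> homset T x x'" "is_iso_arr T a" and b: "b \<in> homset T y y'" "is_iso_arr T b"
    and sq: "b \<cdot> f = f' \<cdot> a"
  shows "isomorphic T z z'"
proof -
  obtain c where c: "c \<in> homset T z z'" "c \<cdot> g = g' \<cdot> b" "\<Sigma>\<^sub>a a \<cdot> h = h' \<cdot> c"
    using tri_fill[OF t t' a(1) b(1) sq] by metis
  obtain a' where a': "a' \<in> homset T x' x" "a \<cdot> a' = Id T x'" using iso_arrE[OF a(2,1)] by metis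
  obtain b' where b': "b' \<in> homset T y' y" "b \<cdot> b' = Id T y'" using iso_arrE[OF b(2,1)] by metis
  have Sab: "\<Sigma>\<^sub>a a \<cdot> \<Sigma>\<^sub>a a' = Id T (\<Sigma>\<^sub>o x')" using ShA_Comp[OF a'(1) a(1)] a'(2) ShA_Id triD(5)[OF t'] by simp
  note A = tri_arr[OF t] tri_arr[OF t'] homsetD[OF a(1)] homsetD[OF b(1)] homsetD[OF c(1)]
    homsetD[OF a'(1)] homsetD[OF b'(1)]
  have Ssq: "\<Sigma>\<^sub>a b \<cdot> \<Sigma>\<^sub>a f = \<Sigma>\<^sub>a f' \<cdot> \<Sigma>\<^sub>a a" using sq Sh_Comp A by metis
  have mono: "u = Zero T t0 z" if u: "u \<in> homset T t0 z" "c \<cdot> u = Zero T t0 z'" for u t0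
  proof -
    note U = homsetD[OF u(1)] hom_obj[OF u(1)]
    have "\<Sigma>\<^sub>a a \<cdot> (h \<cdot> u) = h' \<cdot> (c \<cdot> u)" using comp_eq_extend[OF c(3)] A U by simp
    then have "\<Sigma>\<^sub>a a \<cdot> (h \<cdot> u) = \<Sigma>\<^sub>a a \<cdot> Zero T t0 (\<Sigma>\<^sub>o x)" using u(2) A U by simp
    then have "h \<cdot> u = Zero T t0 (\<Sigma>\<^sub>o x)"
      by (rule iso_cancel_left[OF Sh_iso[OF a(2,1)] ShA_in[OF a(1)], rotated 2]) (use A U in \<open>auto simp: homset_iff\<close>)
    then obtain w where w: "w \<in> homset T t0 y" "g \<cdot> w = u" using tri_exact2[OF t u(1)] by blast
    note W = homsetD[OF w(1)]
    have "g' \<cdot> (b \<cdot> w) = c \<cdot> (g \<cdot> w)" using comp_eq_extend[OF c(2)] A W by simp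
    then have "g' \<cdot> (b \<cdot> w) = Zero T t0 z'" using u(2) w(2) by simp
    then obtain w2 where w2: "w2 \<in> homset T t0 x'" "f' \<cdot> w2 = b \<cdot> w"
      using tri_exact1[OF t', of "b \<cdot> w" t0] A W by (auto simp: homset_iff)
    note W2 = homsetD[OF w2(1)]
    have "b \<cdot> (f \<cdot> (a' \<cdot> w2)) = f' \<cdot> (a \<cdot> (a' \<cdot> w2))" using comp_eq_extend[OF sq, of "a' \<cdot> w2"] A W2 by simp
    also have "\<dots> = b \<cdot> w" using comp_eq_assoc[OF a'(2), of w2] A W2 w2(2) by simp
    finally have "f \<cdot> (a' \<cdot> w2) = w"
      by (rule iso_cancel_left[OF b(2,1), rotated 2]) (use A W W2 in \<open>auto simp: homset_iff\<close>)
    then have "u = g \<cdot> (f \<cdot> (a' \<cdot> w2))" using w by simp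
    also have "\<dots> = Zero T t0 z" using comp_eq_assoc[OF tri_comp1[OF t], of "a' \<cdot> w2"] A W2 by simp
    finally show ?thesis .
  qed
  have Idz: "Id T z' \<in> homset T z' z'" using Id_in A by simp
  have "\<Sigma>\<^sub>a b \<cdot> (\<Sigma>\<^sub>a f \<cdot> (\<Sigma>\<^sub>a a' \<cdot> h')) = \<Sigma>\<^sub>a f' \<cdot> (\<Sigma>\<^sub>a a \<cdot> (\<Sigma>\<^sub>a a' \<cdot> h'))"
    using comp_eq_extend[OF Ssq, of "\<Sigma>\<^sub>a a' \<cdot> h'"] A by simp
  also have "\<dots> = \<Sigma>\<^sub>a f' \<cdot> h'" using comp_eq_assoc[OF Sab, of h'] A by simp
  also have "\<dots> = \<Sigma>\<^sub>a b \<cdot> Zero T z' (\<Sigma>\<^sub>o y)" using tri_comp3[OF t'] A by simp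
  finally have "\<Sigma>\<^sub>a f \<cdot> (\<Sigma>\<^sub>a a' \<cdot> h') = Zero T z' (\<Sigma>\<^sub>o y)"
    by (rule iso_cancel_left[OF Sh_iso[OF b(2,1)] ShA_in[OF b(1)], rotated 2]) (use A in \<open>auto simp: homset_iff\<close>)
  then obtain u0 where u0: "u0 \<in> homset T z' z" "h \<cdot> u0 = \<Sigma>\<^sub>a a' \<cdot> h'"
    using tri_exact3[OF t, of "\<Sigma>\<^sub>a a' \<cdot> h'" z'] A by (auto simp: homset_iff)
  note U0 = homsetD[OF u0(1)]
  have "h' \<cdot> (c \<cdot> u0) = \<Sigma>\<^sub>a a \<cdot> (h \<cdot> u0)" using comp_eq_extend[OF c(3)] A U0 by simp
  also have "\<dots> = h' \<cdot> Id T z'" using u0(2) comp_eq_assoc[OF Sab, of h'] A by simp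
  \<comment> \<open>The lift u0 is correct only after applying h'. Exactness at z' writes the error
    as g' w, which is moved back to z along the inverse of b.\<close>
  finally obtain w where w: "w \<in> homset T z' y'" "Id T z' = g' \<cdot> w \<boxplus> c \<cdot> u0"
    using tri_exact2_diff[OF t' Idz, of "c \<cdot> u0"] A U0 by (metis Comp_in c(1) u0(1))
  note W = homsetD[OF w(1)]
  have "c \<cdot> (g \<cdot> (b' \<cdot> w)) = g' \<cdot> (b \<cdot> (b' \<cdot> w))" using comp_eq_extend[OF c(2), of "b' \<cdot> w"] A W by simp
  also have "\<dots> = g' \<cdot> w" using comp_eq_assoc[OF b'(2), of w] A W by simp
  finally have cd: "c \<cdot> (g \<cdot> (b' \<cdot> w) \<boxplus> u0) = Id T z'" using w(2) A W U0 by simp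
  let ?d = "g \<cdot> (b' \<cdot> w) \<boxplus> u0"
  have d: "?d \<in> homset T z' z" using A W U0 by (simp add: homset_iff)
  note D = homsetD[OF d]
  have "?d \<cdot> c = Id T z"
  proof (rule mono_diff[OF c(1)])
    show "e = Zero T z z" if "e \<in> homset T z z" "c \<cdot> e = Zero T z z'" for e by (rule mono[OF that])
    show "?d \<cdot> c \<in> homset T z z" by (rule Comp_in[OF c(1) d])
    show "Id T z \<in> homset T z z" using Id_in A by simp
    show "c \<cdot> (?d \<cdot> c) = c \<cdot> Id T z" using comp_eq_assoc[OF cd, of c] A D by (metis Comp_Id Id_Comp)
  qed
  then show ?thesis using isomorphicI[OF c(1)] iso_arrI[OF c(1) d _ cd] by blast
qed

lemma tri_mono:
  assumes t: "tri f g h x y z" and z: "is_zero_obj T z" and u: "u \<in> homset T t x" "f \<cdot> u = Zero T t y"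
  shows "u = Zero T t x"
proof -
  note A = tri_arr[OF t] homsetD[OF u(1)] hom_obj[OF u(1)]
  have "\<Sigma>\<^sub>a f \<cdot> \<Sigma>\<^sub>a u = Zero T (\<Sigma>\<^sub>o t) (\<Sigma>\<^sub>o y)" using Sh_Comp[of u f] u(2) A by simp
  then obtain v where v: "v \<in> homset T (\<Sigma>\<^sub>o t) z" "h \<cdot> v = \<Sigma>\<^sub>a u"
    using tri_exact3[OF t ShA_in[OF u(1)]] by blast
  have "v = Zero T (\<Sigma>\<^sub>o t) z" by (rule zero_obj_hom(2)[OF z v(1)])
  then have "\<Sigma>\<^sub>a u = Zero T (\<Sigma>\<^sub>o t) (\<Sigma>\<^sub>o x)" using v(2) A by simp
  then show ?thesis using Sh_eq_Zero u by blast
qed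

lemma tri_zero_cone_iso:
  assumes t: "tri f g h x y z" and z: "is_zero_obj T z"
  shows "isomorphic T x y"
proof -
  note A = tri_arr[OF t]
  have "g = Zero T y z" by (rule zero_obj_hom(2)[OF z triD(3)[OF t]])
  then have "g \<cdot> Id T y = Zero T y z" using A by simp
  then obtain v where v: "v \<in> homset T y x" "f \<cdot> v = Id T y" using tri_exact1[OF t Id_in[OF A(11)]] by blast
  note V = homsetD[OF v(1)]
  have "v \<cdot> f = Id T x"
  proof (rule mono_diff[OF triD(2)[OF t]])
    show "e = Zero T x x" if "e \<in> homset T x x" "f \<cdot> e = Zero T x y" for e by (rule tri_mono[OF t z that])
    show "v \<cdot> f \<in> homset T x x" by (rule Comp_in[OF triD(2)[OF t] v(1)])
    show "Id T x \<in> homset T x x" using Id_in A by simp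
    show "f \<cdot> (v \<cdot> f) = f \<cdot> Id T x" using comp_eq_assoc[OF v(2), of f] A V by simp
  qed
  then show ?thesis using isomorphicI[OF triD(2)[OF t]] iso_arrI[OF triD(2)[OF t] v(1) _ v(2)] by blast
qed

lemma tri_split:
  assumes t: "tri f g h x y z" and h0: "h = Zero T z (\<Sigma>\<^sub>o x)"
  shows "is_biproduct T x z y"
proof -
  note A = tri_arr[OF t]
  have "h \<cdot> Id T z = Zero T z (\<Sigma>\<^sub>o x)" using h0 A by simp
  then obtain m where m: "m \<in> homset T z y" "g \<cdot> m = Id T z" using tri_exact2[OF t Id_in[OF A(12)]] by blast
  have "\<Sigma>\<^sub>a (Id T x) \<cdot> h = Zero T z (\<Sigma>\<^sub>o x)" using h0 A ShA_Id by simp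
  then obtain r where r: "r \<in> homset T y x" "r \<cdot> f = Id T x" using tri_weak0[OF t Id_in[OF A(10)]] by blast
  note B = homsetD[OF m(1)] homsetD[OF r(1)]
  \<comment> \<open>The section m and the retraction r were chosen independently. Subtracting f r m
    from m gives a section j with r j = 0.\<close>
  let ?n = "f \<cdot> (r \<cdot> m)"
  obtain j where j: "j \<in> homset T z y" "m = j \<boxplus> ?n" "r \<cdot> j = Zero T z x"
  proof (rule diff_ex[of m z y ?n])
    fix d assume d: "d \<in> homset T z y" "m = d \<boxplus> ?n" "\<And>k z'. \<lbrakk>k \<in> homset T y z'; k \<cdot> m = k \<cdot> ?n\<rbrakk> \<Longrightarrow> k \<cdot> d = Zero T z z'"
    have "r \<cdot> d = Zero T z x" by (rule d(3)[OF r(1)]) (use comp_eq_assoc[OF r(2), of "r \<cdot> m"] A B in simp)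
    then show thesis using that d by blast
  qed (use A B in \<open>auto simp: homset_iff\<close>)
  note J = homsetD[OF j(1)]
  have gf: "g \<cdot> f = Zero T x z" by (rule tri_comp1[OF t])
  have "g \<cdot> m = g \<cdot> j \<boxplus> g \<cdot> ?n" using arg_cong[OF j(2), of "(\<cdot>) g"] A B J by simp
  moreover have "g \<cdot> ?n = Zero T z z" using comp_eq_assoc[OF gf, of "r \<cdot> m"] A B by simp
  ultimately have gj: "g \<cdot> j = Id T z" using m(2) A J by simp
  have "f \<cdot> r \<boxplus> j \<cdot> g = Id T y"
  proof -
    \<comment> \<open>After g this sum agrees with the identity, so the two differ by some f w;
      applying r shows w = 0.\<close>
    let ?e = "f \<cdot> r \<boxplus> j \<cdot> g"
    have e: "?e \<in> homset T y y" using A B J by (simp add: homset_iff)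
    have "g \<cdot> ?e = g \<cdot> Id T y"
      using A B J comp_eq_assoc[OF gf, of r] comp_eq_assoc[OF gj, of g] by simp
    then obtain w where w: "w \<in> homset T y x" "?e = f \<cdot> w \<boxplus> Id T y"
      using tri_exact1_diff[OF t e Id_in[OF A(11)]] by blast
    note W = homsetD[OF w(1)]
    have "r \<cdot> ?e = w \<boxplus> r"
      using arg_cong[OF w(2), of "(\<cdot>) r"] A B J W comp_eq_assoc[OF r(2), of w] by simp
    moreover have "r \<cdot> ?e = Zero T y x \<boxplus> r"
      using A B J comp_eq_assoc[OF r(2), of r] comp_eq_assoc[OF j(3), of g] by simp
    ultimately have "w = Zero T y x"
      using Plus_cancel[OF w(1) _ r(1)] Zero_in A by metis
    then show ?thesis using w(2) A by simp
  qed
  then show ?thesis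
    unfolding is_biproduct_def using triD(2,3)[OF t] r j gj gf by blast
qed

text \<open>The complement is the cone of the section i. Its connecting map h satisfies \<Sigma>i h
  = 0, and \<Sigma>i is a split monomorphism, so h = 0 and the triangle splits.\<close>

lemma retract_biproduct:
  assumes "retract x s"
  obtains z where "z \<in> Obj T" "is_biproduct T x z s"
proof -
  obtain i r where i: "i \<in> homset T x s" "r \<in> homset T s x" "r \<cdot> i = Id T x"
    using assms by (auto simp: retract_def)
  obtain g h z where t: "tri i g h x s z" by (rule tri_ex[OF i(1)])
  note A = tri_arr[OF t] homsetD[OF i(2)]
  have "\<Sigma>\<^sub>a r \<cdot> \<Sigma>\<^sub>a i = Id T (\<Sigma>\<^sub>o x)" using ShA_Comp[OF i(1,2)] i(3) ShA_Id A by simp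
  then have "h = \<Sigma>\<^sub>a r \<cdot> (\<Sigma>\<^sub>a i \<cdot> h)" using comp_eq_assoc[of "\<Sigma>\<^sub>a r" "\<Sigma>\<^sub>a i" "Id T (\<Sigma>\<^sub>o x)" h] A by simp
  then have "h = Zero T z (\<Sigma>\<^sub>o x)" using tri_comp3[OF t] A by simp
  then show thesis using that tri_split[OF t] A by blast
qed

lemma biproduct_retract:
  assumes "is_biproduct T x y s"
  shows "retract x s" "retract y s"
  using assms unfolding is_biproduct_def retract_def by blast+

lemma biproduct_isomorphic:
  assumes "is_biproduct T x y s" "isomorphic T y y'"
  shows "is_biproduct T x y' s"
proof -
  obtain i j p q where b: "i \<in> homset T x s" "j \<in> homset T y s" "p \<in> homset T s x" "q \<in> homset T s y"
    "p \<cdot> i = Id T x" "q \<cdot> j = Id T y" "q \<cdot> i = Zero T x y" "p \<cdot> j = Zero T y x" "i \<cdot> p \<boxplus> j \<cdot> q = Id T s"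
    using assms(1) unfolding is_biproduct_def by blast
  obtain a a' where a: "a \<in> homset T y y'" "a' \<in> homset T y' y" "a' \<cdot> a = Id T y" "a \<cdot> a' = Id T y'"
    using assms(2) by (rule isomorphicE)
  note A = homsetD[OF b(1)] homsetD[OF b(2)] homsetD[OF b(3)] homsetD[OF b(4)] homsetD[OF a(1)] homsetD[OF a(2)]
    hom_obj[OF a(1)] hom_obj[OF b(1)]
  have "(a \<cdot> q) \<cdot> (j \<cdot> a') = Id T y'" using comp_eq_assoc[OF b(6), of a'] a(4) A by simp
  moreover have "(a \<cdot> q) \<cdot> i = Zero T x y'" using b(7) A by simp
  moreover have "p \<cdot> (j \<cdot> a') = Zero T y' x" using comp_eq_assoc[OF b(8), of a'] A by simp
  moreover have "i \<cdot> p \<boxplus> (j \<cdot> a') \<cdot> (a \<cdot> q) = Id T s" using comp_eq_assoc[OF a(3), of q] b(9) A by simp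
  moreover have "j \<cdot> a' \<in> homset T y' s" "a \<cdot> q \<in> homset T s y'" using A by (simp_all add: homset_iff)
  ultimately show ?thesis unfolding is_biproduct_def using b(1,3,5) by blast
qed

text \<open>Exhibits a biproduct as the cone of a zero map out of a desuspension of y, so that
  closure under cones yields closure under biproducts.\<close>

lemma biproduct_tri:
  assumes "x \<in> Obj T" "y \<in> Obj T"
  obtains w y' g h where "y' \<in> Obj T" "isomorphic T (\<Sigma>\<^sub>o y') y" "tri (Zero T y' x) g h y' x w" "is_biproduct T x y w"
proof -
  obtain y' where y': "y' \<in> Obj T" "isomorphic T (\<Sigma>\<^sub>o y') y" using Sh_ess_surj assms by blast
  obtain g h w where t: "tri (Zero T y' x) g h y' x w" using tri_ex[OF Zero_in[OF y'(1) assms(1)]] by metis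
  have "neg_arr T (\<Sigma>\<^sub>a (Zero T y' x)) = Zero T (\<Sigma>\<^sub>o y') (\<Sigma>\<^sub>o x)" using y' assms by simp
  then have "is_biproduct T x (\<Sigma>\<^sub>o y') w" using tri_split[OF tri_rotate[OF t]] by simp
  then show thesis using that y' t biproduct_isomorphic by blast
qed

section \<open>Triangulated and thick subcategories\<close>

lemma triangulated_subcategoryD:
  assumes "triangulated_subcategory T S"
  shows "x \<in> S \<Longrightarrow> x \<in> Obj T" "is_zero_obj T z \<Longrightarrow> z \<in> S"
    "\<lbrakk>x \<in> S; isomorphic T x y\<rbrakk> \<Longrightarrow> y \<in> S"
    "x \<in> Obj T \<Longrightarrow> \<Sigma>\<^sub>o x \<in> S \<longleftrightarrow> x \<in> S"
    "\<lbrakk>tri f g h x y z; x \<in> S; y \<in> S\<rbrakk> \<Longrightarrow> z \<in> S"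
proof -
  note * = assms[unfolded triangulated_subcategory_def]
  have iso: "\<forall>x\<in>S. \<forall>y\<in>Obj T. isomorphic T x y \<longrightarrow> y \<in> S"
    and cone: "\<forall>f g h. (f, g, h) \<in> Tri T \<longrightarrow> Dom T f \<in> S \<longrightarrow> Cod T f \<in> S \<longrightarrow> Cod T g \<in> S"
    using * by auto
  show "z \<in> S" if "tri f g h x y z" "x \<in> S" "y \<in> S"
    using cone[rule_format, OF triD(1)[OF that(1)]] that(2,3) tri_arr[OF that(1)] by simp
  show "y \<in> S" if "x \<in> S" "isomorphic T x y"
    using iso that isomorphic_obj[OF that(2)] by auto
qed (use assms in \<open>auto simp: triangulated_subcategory_def\<close>)

lemma triangulated_subcategoryI:
  assumes "S \<subseteq> Obj T" "\<And>z. is_zero_obj T z \<Longrightarrow> z \<in> S" "\<And>x y. \<lbrakk>x \<in> S; isomorphic T x y\<rbrakk> \<Longrightarrow> y \<in> S"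
    "\<And>x. x \<in> S \<Longrightarrow> \<Sigma>\<^sub>o x \<in> S" "\<And>x. \<lbrakk>x \<in> Obj T; \<Sigma>\<^sub>o x \<in> S\<rbrakk> \<Longrightarrow> x \<in> S"
    "\<And>f g h x y z. \<lbrakk>tri f g h x y z; x \<in> S; y \<in> S\<rbrakk> \<Longrightarrow> z \<in> S"
  shows "triangulated_subcategory T S"
  unfolding triangulated_subcategory_def using assms Tri_imp_tri by blast

lemma thick_subcategory_iff:
  "thick_subcategory T S \<longleftrightarrow> triangulated_subcategory T S \<and> (\<forall>s \<in> S. \<forall>x. retract x s \<longrightarrow> x \<in> S)"
proof
  assume s: "thick_subcategory T S"
  have "x \<in> S" if sS: "s \<in> S" and xs: "retract x s" for s x
  proof -
    obtain z where "z \<in> Obj T" "is_biproduct T x z s" by (rule retract_biproduct[OF xs])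
    moreover have "x \<in> Obj T" using xs hom_obj by (auto simp: retract_def)
    ultimately show ?thesis using s sS unfolding thick_subcategory_def by blast
  qed
  then show "triangulated_subcategory T S \<and> (\<forall>s \<in> S. \<forall>x. retract x s \<longrightarrow> x \<in> S)"
    using s by (auto simp: thick_subcategory_def)
next
  assume "triangulated_subcategory T S \<and> (\<forall>s \<in> S. \<forall>x. retract x s \<longrightarrow> x \<in> S)"
  then show "thick_subcategory T S" using biproduct_retract(1) by (auto simp: thick_subcategory_def)
qed

lemma triangulated_biproduct:
  assumes S: "triangulated_subcategory T S" and "x \<in> S" "y \<in> S"
  obtains w where "w \<in> S" "is_biproduct T x y w"
proof -
  have o: "x \<in> Obj T" "y \<in> Obj T" using triangulated_subcategoryD(1)[OF S] assms by auto
  obtain w y' g h where w: "y' \<in> Obj T" "isomorphic T (\<Sigma>\<^sub>o y') y" "tri (Zero T y' x) g h y' x w" "is_biproduct T x y w"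
    by (rule biproduct_tri[OF o])
  have "y' \<in> S" using triangulated_subcategoryD(3,4)[OF S] w(1,2) assms isomorphic_sym by blast
  then have "w \<in> S" using triangulated_subcategoryD(5)[OF S w(3)] assms by blast
  then show thesis using that w by blast
qed

section \<open>Suspension and desuspension of coproducts\<close>

lemma Sh_coproduct:
  assumes c: "is_coproduct T I t c \<iota>"
  shows "is_coproduct T I (\<lambda>i. \<Sigma>\<^sub>o (t i)) (\<Sigma>\<^sub>o c) (\<lambda>i. \<Sigma>\<^sub>a (\<iota> i))"
proof (rule coproductI)
  note o = coproduct_in[OF c]
  show "\<Sigma>\<^sub>o c \<in> Obj T" "\<And>i. i \<in> I \<Longrightarrow> \<Sigma>\<^sub>a (\<iota> i) \<in> homset T (\<Sigma>\<^sub>o (t i)) (\<Sigma>\<^sub>o c)" using o ShA_in by auto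
  fix y
  { fix g assume y: "y \<in> Obj T" and g: "\<And>i. i \<in> I \<Longrightarrow> g i \<in> homset T (\<Sigma>\<^sub>o (t i)) y"
    \<comment> \<open>Only maps between suspensions can be desuspended, so the test object y is
      first replaced by an isomorphic suspension.\<close>
    obtain y' \<theta> \<theta>' where y': "y' \<in> Obj T" "\<theta> \<in> homset T (\<Sigma>\<^sub>o y') y" "\<theta>' \<in> homset T y (\<Sigma>\<^sub>o y')" "\<theta> \<cdot> \<theta>' = Id T y"
      using Sh_ess_surj[OF y] isomorphicE by metis
    have "\<exists>a. a \<in> homset T (t i) y' \<and> \<Sigma>\<^sub>a a = \<theta>' \<cdot> g i" if "i \<in> I" for i
      using Sh_full[OF o(3)[OF that] y'(1)] Comp_in[OF g[OF that] y'(3)] by metis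
    then obtain a where a: "\<And>i. i \<in> I \<Longrightarrow> a i \<in> homset T (t i) y'" "\<And>i. i \<in> I \<Longrightarrow> \<Sigma>\<^sub>a (a i) = \<theta>' \<cdot> g i" by metis
    from coproduct_ex[OF c y'(1) a(1)] obtain k where k: "k \<in> homset T c y'" "\<And>i. i \<in> I \<Longrightarrow> k \<cdot> \<iota> i = a i" by auto
    have "(\<theta> \<cdot> \<Sigma>\<^sub>a k) \<cdot> \<Sigma>\<^sub>a (\<iota> i) = g i" if i: "i \<in> I" for i
    proof -
      note A = homsetD[OF k(1)] homsetD[OF o(2)[OF i]] homsetD[OF y'(2)] homsetD[OF y'(3)] homsetD[OF g[OF i]]
      have "\<Sigma>\<^sub>a k \<cdot> \<Sigma>\<^sub>a (\<iota> i) = \<theta>' \<cdot> g i" using k(2)[OF i] a(2)[OF i] Sh_Comp A by metis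
      then show ?thesis using A comp_eq_assoc[OF y'(4), of "g i"] by simp
    qed
    then show "\<exists>h. h \<in> homset T (\<Sigma>\<^sub>o c) y \<and> (\<forall>i\<in>I. h \<cdot> \<Sigma>\<^sub>a (\<iota> i) = g i)"
      using Comp_in[OF ShA_in[OF k(1)] y'(2)] by blast }
  fix h h' assume h: "h \<in> homset T (\<Sigma>\<^sub>o c) y" "h' \<in> homset T (\<Sigma>\<^sub>o c) y"
    and e: "\<And>i. i \<in> I \<Longrightarrow> h \<cdot> \<Sigma>\<^sub>a (\<iota> i) = h' \<cdot> \<Sigma>\<^sub>a (\<iota> i)"
  obtain y' \<theta> where y': "y' \<in> Obj T" "\<theta> \<in> homset T y (\<Sigma>\<^sub>o y')" "is_iso_arr T \<theta>"
    using Sh_ess_surj[OF hom_obj(2)[OF h(1)]] isomorphicE by metis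
  obtain k where k: "k \<in> homset T c y'" "\<Sigma>\<^sub>a k = \<theta> \<cdot> h" using Sh_full[OF o(1) y'(1) Comp_in[OF h(1) y'(2)]] by metis
  obtain k' where k': "k' \<in> homset T c y'" "\<Sigma>\<^sub>a k' = \<theta> \<cdot> h'" using Sh_full[OF o(1) y'(1) Comp_in[OF h(2) y'(2)]] by metis
  note A = homsetD[OF k(1)] homsetD[OF k'(1)] homsetD[OF y'(2)] homsetD[OF h(1)] homsetD[OF h(2)]
  have "k = k'"
  proof (rule coproduct_eq[OF c k(1) k'(1)])
    fix i assume i: "i \<in> I"
    note B = homsetD[OF o(2)[OF i]]
    have "\<Sigma>\<^sub>a (k \<cdot> \<iota> i) = \<Sigma>\<^sub>a (k' \<cdot> \<iota> i)" using k(2) k'(2) e[OF i] A B by (simp add: Sh_Comp)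
    then show "k \<cdot> \<iota> i = k' \<cdot> \<iota> i" using Sh_faithful[of _ "t i" y'] A B by (simp add: homset_iff)
  qed
  then have "\<theta> \<cdot> h = \<theta> \<cdot> h'" using k(2) k'(2) by simp
  then show "h = h'" using iso_cancel_left[OF y'(3,2) h] by blast
qed

lemma Sh_reflects_coproduct:
  assumes c: "is_coproduct T I (\<lambda>i. \<Sigma>\<^sub>o (t i)) (\<Sigma>\<^sub>o c) (\<lambda>i. \<Sigma>\<^sub>a (\<iota> i))"
    and o: "c \<in> Obj T" "\<And>i. i \<in> I \<Longrightarrow> \<iota> i \<in> homset T (t i) c"
  shows "is_coproduct T I t c \<iota>"
proof (rule coproductI)
  fix y
  { fix g assume y: "y \<in> Obj T" and g: "\<And>i. i \<in> I \<Longrightarrow> g i \<in> homset T (t i) y"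
    have "\<exists>k \<in> homset T (\<Sigma>\<^sub>o c) (\<Sigma>\<^sub>o y). \<forall>i \<in> I. k \<cdot> \<Sigma>\<^sub>a (\<iota> i) = \<Sigma>\<^sub>a (g i)"
      by (rule coproduct_ex[OF c]) (use y g ShA_in in auto)
    then obtain k where k: "k \<in> homset T (\<Sigma>\<^sub>o c) (\<Sigma>\<^sub>o y)" "\<And>i. i \<in> I \<Longrightarrow> k \<cdot> \<Sigma>\<^sub>a (\<iota> i) = \<Sigma>\<^sub>a (g i)" by auto
    obtain h where h: "h \<in> homset T c y" "\<Sigma>\<^sub>a h = k" by (rule Sh_full[OF o(1) y k(1)])
    have "h \<cdot> \<iota> i = g i" if i: "i \<in> I" for i
      by (rule Sh_faithful[OF Comp_in[OF o(2)[OF i] h(1)] g[OF i]])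
         (use k(2)[OF i] h(2) ShA_Comp[OF o(2)[OF i] h(1)] in simp)
    then show "\<exists>h. h \<in> homset T c y \<and> (\<forall>i\<in>I. h \<cdot> \<iota> i = g i)" using h by blast }
  fix h h' assume h: "h \<in> homset T c y" "h' \<in> homset T c y" and e: "\<And>i. i \<in> I \<Longrightarrow> h \<cdot> \<iota> i = h' \<cdot> \<iota> i"
  have "\<Sigma>\<^sub>a h = \<Sigma>\<^sub>a h'"
    by (rule coproduct_eq[OF c ShA_in[OF h(1)] ShA_in[OF h(2)]])
       (use e o(2) ShA_Comp h in metis)
  then show "h = h'" using Sh_faithful h by blast
qed (use o in auto)

text \<open>Lets the compactness of x act on maps out of \<Sigma>x: up to isomorphism, their target
  is the suspension of a coproduct, so that they come from maps out of x.\<close>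

lemma desuspend_coproduct:
  assumes c: "is_coproduct T I t c \<iota>"
  obtains t' c' \<iota>' \<theta> \<alpha> where "is_coproduct T I t' c' \<iota>'" "\<alpha> \<in> homset T (\<Sigma>\<^sub>o c') c" "is_iso_arr T \<alpha>"
    "\<And>i. i \<in> I \<Longrightarrow> \<theta> i \<in> homset T (\<Sigma>\<^sub>o (t' i)) (t i) \<and> \<alpha> \<cdot> \<Sigma>\<^sub>a (\<iota>' i) = \<iota> i \<cdot> \<theta> i"
proof -
  note o = coproduct_in[OF c]
  obtain c' \<alpha> \<beta> where \<alpha>: "c' \<in> Obj T" "\<alpha> \<in> homset T (\<Sigma>\<^sub>o c') c" "is_iso_arr T \<alpha>"
    "\<beta> \<in> homset T c (\<Sigma>\<^sub>o c')" "\<alpha> \<cdot> \<beta> = Id T c" "is_iso_arr T \<beta>"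
    using Sh_ess_surj[OF o(1)] isomorphicE by metis
  have "\<exists>t' \<theta>. t' \<in> Obj T \<and> \<theta> \<in> homset T (\<Sigma>\<^sub>o t') (t i) \<and> is_iso_arr T \<theta>" if "i \<in> I" for i
    using Sh_ess_surj[OF o(3)[OF that]] isomorphicE by metis
  then obtain t' \<theta> where \<theta>: "\<And>i. i \<in> I \<Longrightarrow> t' i \<in> Obj T" "\<And>i. i \<in> I \<Longrightarrow> \<theta> i \<in> homset T (\<Sigma>\<^sub>o (t' i)) (t i)"
    "\<And>i. i \<in> I \<Longrightarrow> is_iso_arr T (\<theta> i)" by metis
  have ty: "\<beta> \<cdot> \<iota> i \<cdot> \<theta> i \<in> homset T (\<Sigma>\<^sub>o (t' i)) (\<Sigma>\<^sub>o c')" if "i \<in> I" for i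
    using Comp_in[OF Comp_in[OF \<theta>(2) o(2)] \<alpha>(4)] that by simp
  then have "\<exists>k. k \<in> homset T (t' i) c' \<and> \<Sigma>\<^sub>a k = \<beta> \<cdot> \<iota> i \<cdot> \<theta> i" if "i \<in> I" for i
    using Sh_full[OF \<theta>(1)[OF that] \<alpha>(1) ty[OF that]] that by metis
  then obtain \<iota>' where \<iota>': "\<And>i. i \<in> I \<Longrightarrow> \<iota>' i \<in> homset T (t' i) c'" "\<And>i. i \<in> I \<Longrightarrow> \<Sigma>\<^sub>a (\<iota>' i) = \<beta> \<cdot> \<iota> i \<cdot> \<theta> i" by metis
  have "is_coproduct T I (\<lambda>i. \<Sigma>\<^sub>o (t' i)) (\<Sigma>\<^sub>o c') (\<lambda>i. \<beta> \<cdot> \<iota> i \<cdot> \<theta> i)"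
    by (rule coproduct_iso[OF c]) (use \<theta> \<alpha> in auto)
  then have "is_coproduct T I (\<lambda>i. \<Sigma>\<^sub>o (t' i)) (\<Sigma>\<^sub>o c') (\<lambda>i. \<Sigma>\<^sub>a (\<iota>' i))"
    by (rule coproduct_cong) (use \<iota>'(2) in auto)
  then have "is_coproduct T I t' c' \<iota>'" by (rule Sh_reflects_coproduct) (use \<alpha> \<iota>' in auto)
  moreover have "\<alpha> \<cdot> \<Sigma>\<^sub>a (\<iota>' i) = \<iota> i \<cdot> \<theta> i" if "i \<in> I" for i
    using comp_eq_assoc[OF \<alpha>(5), of "\<iota> i \<cdot> \<theta> i"] \<iota>'(2)[OF that] homsetD[OF \<theta>(2)[OF that]]
      homsetD[OF o(2)[OF that]] homsetD[OF \<alpha>(2)] homsetD[OF \<alpha>(4)] by simp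
  ultimately show thesis using that \<alpha> \<theta>(2) by blast
qed

end

section \<open>Small sets\<close>

lemma small_subset: "\<lbrakk>small \<kappa> B; A \<subseteq> B\<rbrakk> \<Longrightarrow> small \<kappa> A"
  using card_of_mono1 ordLeq_ordLess_trans unfolding small_def by blast

lemma small_image: "small \<kappa> A \<Longrightarrow> small \<kappa> (f ` A)"
  using card_of_image ordLeq_ordLess_trans unfolding small_def by blast

text \<open>This is the regularity of \<kappa>, used in the form that a regular infinite cardinal is
  stable.\<close>

lemma small_UN:
  assumes "inaccessible \<kappa>" "small \<kappa> A" "\<And>a. a \<in> A \<Longrightarrow> small \<kappa> (F a)"
  shows "small \<kappa> (\<Union>a \<in> A. F a)"
proof -
  have "stable \<kappa>"
    using assms(1) regularCard_stable infinite_Card_order_limit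
    by (metis inaccessible_def natLeq_ordLeq_cinfinite cinfinite_def ordLess_imp_ordLeq
        Field_natLeq cinfinite_mono natLeq_cinfinite)
  then show ?thesis using assms(2,3) stable_UNION unfolding small_def by blast
qed

lemma small_nat: "inaccessible \<kappa> \<Longrightarrow> small \<kappa> (A :: nat set)"
proof (rule small_subset)
  assume "inaccessible \<kappa>"
  then show "small \<kappa> (UNIV :: nat set)"
    unfolding small_def inaccessible_def using card_of_nat ordIso_ordLess_trans by blast
qed simp

lemma small_finite: 
  assumes "inaccessible \<kappa>" "finite A"
  shows "small \<kappa> A"
proof -
  obtain f :: "nat \<Rightarrow> 'b" and n where "A = f ` {i. i < n}" using assms(2) finite_conv_nat_seg_image[of A] by auto
  then show ?thesis using small_image[OF small_nat[OF assms(1)]] by simp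
qed

lemma small_Un: "\<lbrakk>inaccessible \<kappa>; small \<kappa> A; small \<kappa> B\<rbrakk> \<Longrightarrow> small \<kappa> (A \<union> B)"
  using small_UN[of \<kappa> "{A, B}" "\<lambda>S. S"] small_finite[of \<kappa> "{A, B}"] by auto

text \<open>The definitions of small coproducts and of compactness quantify over index sets in the
  type of \<kappa>. This bridge lets index sets of natural numbers or of arrows be used as
  well.\<close>

lemma small_transport:
  fixes \<kappa> :: "'u rel"
  assumes "small \<kappa> A" "Card_order \<kappa>"
  obtains \<phi> and I :: "'u set" where "bij_betw \<phi> I A" "small \<kappa> I"
proof -
  have "|A| \<le>o |Field \<kappa>|"
    using assms ordLess_imp_ordLeq ordLeq_ordIso_trans ordIso_symmetric[OF card_of_Field_ordIso[OF assms(2)]]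
    unfolding small_def by blast
  then obtain f where f: "inj_on f A" "f ` A \<subseteq> Field \<kappa>" using card_of_ordLeq[of A "Field \<kappa>"] by blast
  have "bij_betw (inv_into A f) (f ` A) A" using f(1) inj_on_imp_bij_betw bij_betw_inv_into by blast
  then show thesis using that small_image[OF assms(1)] by blast
qed

section \<open>Finite sums of arrows\<close>

context additive_category
begin

abbreviation asum where "asum x y \<phi> F \<equiv> finprod (hom_group C x y) \<phi> F"

lemma hom_comm_monoid: "\<lbrakk>x \<in> Obj C; y \<in> Obj C\<rbrakk> \<Longrightarrow> comm_monoid (hom_group C x y)"
  using hom_comm_group comm_group.axioms(1) by blast

lemma asum_empty [simp]: "\<lbrakk>x \<in> Obj C; y \<in> Obj C\<rbrakk> \<Longrightarrow> asum x y \<phi> {} = Zero C x y"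
  using comm_monoid.finprod_empty[OF hom_comm_monoid] by simp

lemma asum_in:
  "\<lbrakk>x \<in> Obj C; y \<in> Obj C; \<And>i. i \<in> F \<Longrightarrow> \<phi> i \<in> homset C x y\<rbrakk> \<Longrightarrow> asum x y \<phi> F \<in> homset C x y"
  using comm_monoid.finprod_closed[OF hom_comm_monoid, of x y \<phi> F] by auto

lemma asum_insert:
  "\<lbrakk>x \<in> Obj C; y \<in> Obj C; finite F; j \<notin> F; \<And>i. i \<in> insert j F \<Longrightarrow> \<phi> i \<in> homset C x y\<rbrakk>
    \<Longrightarrow> asum x y \<phi> (insert j F) = \<phi> j \<boxplus> asum x y \<phi> F"
  using comm_monoid.finprod_insert[OF hom_comm_monoid, of x y F j \<phi>] by auto

lemma asum_cong:
  "\<lbrakk>x \<in> Obj C; y \<in> Obj C; \<And>i. i \<in> F \<Longrightarrow> \<psi> i \<in> homset C x y; \<And>i. i \<in> F \<Longrightarrow> \<phi> i = \<psi> i\<rbrakk>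
    \<Longrightarrow> asum x y \<phi> F = asum x y \<psi> F"
  using comm_monoid.finprod_cong'[OF hom_comm_monoid, of x y F F \<psi> \<phi>] by auto

lemma asum_neutral:
  assumes "x \<in> Obj C" "y \<in> Obj C" "finite B" "A \<subseteq> B" "\<And>i. i \<in> B - A \<Longrightarrow> \<psi> i = Zero C x y"
    "\<And>i. i \<in> A \<Longrightarrow> \<phi> i = \<psi> i" "\<And>i. i \<in> A \<Longrightarrow> \<psi> i \<in> homset C x y"
  shows "asum x y \<phi> A = asum x y \<psi> B"
proof -
  have "\<psi> \<in> B \<rightarrow> carrier (hom_group C x y)" using assms Zero_in by fastforce
  then show ?thesis
    using comm_monoid.finprod_mono_neutral_cong_left[OF hom_comm_monoid, of x y B A \<psi> \<phi>] assms by simp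
qed

lemma asum_Plus:
  assumes "x \<in> Obj C" "y \<in> Obj C" "\<And>i. i \<in> F \<Longrightarrow> \<phi> i \<in> homset C x y" "\<And>i. i \<in> F \<Longrightarrow> \<psi> i \<in> homset C x y"
  shows "asum x y (\<lambda>i. \<phi> i \<boxplus> \<psi> i) F = asum x y \<phi> F \<boxplus> asum x y \<psi> F"
  using comm_monoid.finprod_multf[OF hom_comm_monoid, of x y \<phi> F \<psi>] assms by auto

lemma asum_zero:
  "\<lbrakk>x \<in> Obj C; y \<in> Obj C; \<And>i. i \<in> F \<Longrightarrow> \<phi> i = Zero C x y\<rbrakk> \<Longrightarrow> asum x y \<phi> F = Zero C x y"
  using comm_monoid.finprod_one_eqI[OF hom_comm_monoid, of x y F \<phi>] by simp

lemma Comp_asum: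
  assumes k: "k \<in> homset C y z" and x: "x \<in> Obj C" and "finite F" "\<And>i. i \<in> F \<Longrightarrow> \<phi> i \<in> homset C x y"
  shows "k \<cdot> asum x y \<phi> F = asum x z (\<lambda>i. k \<cdot> \<phi> i) F"
  using assms(3,4)
proof (induction F)
  case empty
  then show ?case using homsetD[OF k] hom_obj[OF k] x by simp
next
  case (insert j F)
  have \<phi>: "\<phi> j \<in> homset C x y" "\<And>i. i \<in> F \<Longrightarrow> \<phi> i \<in> homset C x y" using insert.prems by auto
  have s: "asum x y \<phi> F \<in> homset C x y" by (rule asum_in[OF x hom_obj(1)[OF k] \<phi>(2)])
  have "k \<cdot> asum x y \<phi> (insert j F) = k \<cdot> (\<phi> j \<boxplus> asum x y \<phi> F)"
    using asum_insert[OF x hom_obj(1)[OF k] insert(1,2) insert.prems] by simp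
  also have "\<dots> = k \<cdot> \<phi> j \<boxplus> k \<cdot> asum x y \<phi> F" by (rule Comp_Plus_right[OF \<phi>(1) s k])
  also have "k \<cdot> asum x y \<phi> F = asum x z (\<lambda>i. k \<cdot> \<phi> i) F" by (rule insert.IH[OF \<phi>(2)])
  also have "k \<cdot> \<phi> j \<boxplus> asum x z (\<lambda>i. k \<cdot> \<phi> i) F = asum x z (\<lambda>i. k \<cdot> \<phi> i) (insert j F)"
    by (rule asum_insert[OF x hom_obj(2)[OF k] insert(1,2), symmetric]) (rule Comp_in[OF insert.prems k])
  finally show ?case .
qed

lemma asum_Comp:
  assumes k: "k \<in> homset C w x" and y: "y \<in> Obj C" and "finite F" "\<And>i. i \<in> F \<Longrightarrow> \<phi> i \<in> homset C x y"
  shows "asum x y \<phi> F \<cdot> k = asum w y (\<lambda>i. \<phi> i \<cdot> k) F"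
  using assms(3,4)
proof (induction F)
  case empty
  then show ?case using homsetD[OF k] hom_obj[OF k] y by simp
next
  case (insert j F)
  have \<phi>: "\<phi> j \<in> homset C x y" "\<And>i. i \<in> F \<Longrightarrow> \<phi> i \<in> homset C x y" using insert.prems by auto
  have s: "asum x y \<phi> F \<in> homset C x y" by (rule asum_in[OF hom_obj(2)[OF k] y \<phi>(2)])
  have "asum x y \<phi> (insert j F) \<cdot> k = (\<phi> j \<boxplus> asum x y \<phi> F) \<cdot> k"
    using asum_insert[OF hom_obj(2)[OF k] y insert(1,2) insert.prems] by simp
  also have "\<dots> = \<phi> j \<cdot> k \<boxplus> asum x y \<phi> F \<cdot> k" by (rule Comp_Plus_left[OF k \<phi>(1) s])
  also have "asum x y \<phi> F \<cdot> k = asum w y (\<lambda>i. \<phi> i \<cdot> k) F" by (rule insert.IH[OF \<phi>(2)])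
  also have "\<phi> j \<cdot> k \<boxplus> asum w y (\<lambda>i. \<phi> i \<cdot> k) F = asum w y (\<lambda>i. \<phi> i \<cdot> k) (insert j F)"
    by (rule asum_insert[OF hom_obj(1)[OF k] y insert(1,2), symmetric]) (rule Comp_in[OF k insert.prems])
  finally show ?case .
qed

lemma asum_single:
  assumes "finite F" "j \<in> F" "\<phi> j \<in> homset C x y" "\<And>i. \<lbrakk>i \<in> F; i \<noteq> j\<rbrakk> \<Longrightarrow> \<phi> i = Zero C x y"
  shows "asum x y \<phi> F = \<phi> j"
proof -
  note o = hom_obj[OF assms(3)] homsetD[OF assms(3)]
  have "asum x y \<phi> {j} = asum x y \<phi> F" by (rule asum_neutral) (use assms o in auto)
  moreover have "asum x y \<phi> {j} = \<phi> j" using asum_insert[of x y "{}" j \<phi>] assms(3) o by simp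
  ultimately show ?thesis by simp
qed

section \<open>Projections of a coproduct and finite factorization of maps\<close>

lemma coproduct_projections:
  assumes c: "is_coproduct C I t c \<iota>"
  obtains \<pi> where "\<And>i. i \<in> I \<Longrightarrow> \<pi> i \<in> homset C c (t i)" "\<And>i. i \<in> I \<Longrightarrow> \<pi> i \<cdot> \<iota> i = Id C (t i)"
    "\<And>i j. \<lbrakk>i \<in> I; j \<in> I; j \<noteq> i\<rbrakk> \<Longrightarrow> \<pi> i \<cdot> \<iota> j = Zero C (t j) (t i)"
proof -
  note o = coproduct_in[OF c]
  have "\<exists>p \<in> homset C c (t i). \<forall>j \<in> I. p \<cdot> \<iota> j = (if j = i then Id C (t i) else Zero C (t j) (t i))" if "i \<in> I" for i
    by (rule coproduct_ex[OF c]) (use o that Id_in Zero_in in auto)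
  then have "\<forall>i. \<exists>p. i \<in> I \<longrightarrow> p \<in> homset C c (t i) \<and> (\<forall>j \<in> I. p \<cdot> \<iota> j = (if j = i then Id C (t i) else Zero C (t j) (t i)))"
    by blast
  then obtain \<pi> where "\<forall>i. i \<in> I \<longrightarrow> \<pi> i \<in> homset C c (t i) \<and> (\<forall>j \<in> I. \<pi> i \<cdot> \<iota> j = (if j = i then Id C (t i) else Zero C (t j) (t i)))"
    by (rule choice[THEN exE])
  then show thesis using that[of \<pi>] by auto
qed

text \<open>Reads off the components of a finite sum of maps through the injections. The components
  are therefore determined by the sum, with value zero off F.\<close>

lemma proj_asum:
  assumes c: "is_coproduct C I t c \<iota>" and x: "x \<in> Obj C" and F: "finite F" "F \<subseteq> I"
    and a: "\<And>i. i \<in> F \<Longrightarrow> a i \<in> homset C x (t i)"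
    and \<pi>: "\<And>i. i \<in> I \<Longrightarrow> \<pi> i \<in> homset C c (t i)" "\<And>i. i \<in> I \<Longrightarrow> \<pi> i \<cdot> \<iota> i = Id C (t i)"
    "\<And>i j. \<lbrakk>i \<in> I; j \<in> I; j \<noteq> i\<rbrakk> \<Longrightarrow> \<pi> i \<cdot> \<iota> j = Zero C (t j) (t i)"
    and j: "j \<in> I"
  shows "\<pi> j \<cdot> asum x c (\<lambda>i. \<iota> i \<cdot> a i) F = (if j \<in> F then a j else Zero C x (t j))"
proof -
  note o = coproduct_in[OF c]
  have e: "\<pi> j \<cdot> asum x c (\<lambda>i. \<iota> i \<cdot> a i) F = asum x (t j) (\<lambda>i. \<pi> j \<cdot> (\<iota> i \<cdot> a i)) F"
    by (rule Comp_asum[OF \<pi>(1)[OF j] x F(1)]) (use F a o Comp_in in blast)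
  have z: "\<pi> j \<cdot> (\<iota> i \<cdot> a i) = (if i = j then a i else Zero C x (t j))" if i: "i \<in> F" for i
  proof -
    have iI: "i \<in> I" using F i by blast
    note A = homsetD[OF \<pi>(1)[OF j]] homsetD[OF o(2)[OF iI]] homsetD[OF a[OF i]] o(3)[OF j] o(3)[OF iI]
    show ?thesis
    proof (cases "i = j")
      case True
      then show ?thesis using comp_eq_assoc[OF \<pi>(2)[OF j], of "a i"] A by simp
    next
      case False
      then show ?thesis using comp_eq_assoc[OF \<pi>(3)[OF j iI], of "a i"] A by simp
    qed
  qed
  show ?thesis
  proof (cases "j \<in> F")
    case True
    have "asum x (t j) (\<lambda>i. \<pi> j \<cdot> (\<iota> i \<cdot> a i)) F = \<pi> j \<cdot> (\<iota> j \<cdot> a j)"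
      by (rule asum_single[OF F(1) True]) (use z a True in auto)
    then show ?thesis using True e z by simp
  next
    case False
    have "asum x (t j) (\<lambda>i. \<pi> j \<cdot> (\<iota> i \<cdot> a i)) F = Zero C x (t j)"
      by (rule asum_zero) (use z False x o(3)[OF j] in auto)
    then show ?thesis using False e by simp
  qed
qed

text \<open>Membership of h in the image of the canonical map from the direct sum of hom groups. The
  coefficients outside F are left arbitrary, which spares the bookkeeping of extensional
  functions.\<close>

definition fin_map where
  "fin_map I t \<iota> x c h \<longleftrightarrow> (\<exists>F a. finite F \<and> F \<subseteq> I \<and> (\<forall>i \<in> F. a i \<in> homset C x (t i)) \<and>
     h = asum x c (\<lambda>i. \<iota> i \<cdot> a i) F)"

lemma fin_mapI:
  "\<lbrakk>finite F; F \<subseteq> I; \<And>i. i \<in> F \<Longrightarrow> a i \<in> homset C x (t i); h = asum x c (\<lambda>i. \<iota> i \<cdot> a i) F\<rbrakk> \<Longrightarrow> fin_map I t \<iota> x c h"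
  unfolding fin_map_def by (intro exI[of _ F] exI[of _ a]) auto

lemma fin_mapE:
  assumes "fin_map I t \<iota> x c h"
  obtains F a where "finite F" "F \<subseteq> I" "\<And>i. i \<in> F \<Longrightarrow> a i \<in> homset C x (t i)" "h = asum x c (\<lambda>i. \<iota> i \<cdot> a i) F"
proof -
  obtain F a where "finite F \<and> F \<subseteq> I \<and> (\<forall>i \<in> F. a i \<in> homset C x (t i)) \<and> h = asum x c (\<lambda>i. \<iota> i \<cdot> a i) F"
    using assms unfolding fin_map_def by (elim exE)
  then show thesis by (intro that[of F a]) auto
qed

lemma fin_map_Comp:
  assumes c: "is_coproduct C I t c \<iota>" and h: "fin_map I t \<iota> x c h" and k: "k \<in> homset C w x"
  shows "fin_map I t \<iota> w c (h \<cdot> k)"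
proof -
  note o = coproduct_in[OF c]
  obtain F a where F: "finite F" "F \<subseteq> I" "\<And>i. i \<in> F \<Longrightarrow> a i \<in> homset C x (t i)" "h = asum x c (\<lambda>i. \<iota> i \<cdot> a i) F"
    using h that by (rule fin_mapE)
  have ia: "\<iota> i \<cdot> a i \<in> homset C x c" if "i \<in> F" for i using Comp_in[OF F(3) o(2)] F(2) that by blast
  have ia': "a i \<cdot> k \<in> homset C w (t i)" if "i \<in> F" for i by (rule Comp_in[OF k F(3)[OF that]])
  have "h \<cdot> k = asum w c (\<lambda>i. (\<iota> i \<cdot> a i) \<cdot> k) F"
    unfolding F(4) by (rule asum_Comp[OF k o(1) F(1) ia])
  also have "\<dots> = asum w c (\<lambda>i. \<iota> i \<cdot> (a i \<cdot> k)) F"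
  proof (rule asum_cong)
    fix i assume i: "i \<in> F"
    then have i': "i \<in> I" using F by blast
    show "\<iota> i \<cdot> (a i \<cdot> k) \<in> homset C w c" using Comp_in[OF ia'[OF i] o(2)[OF i']] .
    show "(\<iota> i \<cdot> a i) \<cdot> k = \<iota> i \<cdot> (a i \<cdot> k)" using Comp_assoc[OF k F(3)[OF i] o(2)[OF i']] .
  qed (use hom_obj k o in auto)
  finally have e: "h \<cdot> k = asum w c (\<lambda>i. \<iota> i \<cdot> (a i \<cdot> k)) F" .
  show ?thesis by (rule fin_mapI[OF F(1,2) _ e]) (rule ia')
qed

lemma fin_map_Plus:
  assumes c: "is_coproduct C I t c \<iota>" and x: "x \<in> Obj C" and h: "fin_map I t \<iota> x c h" and h': "fin_map I t \<iota> x c h'"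
  shows "fin_map I t \<iota> x c (h \<boxplus> h')"
proof -
  note o = coproduct_in[OF c]
  obtain F a where F: "finite F" "F \<subseteq> I" "\<And>i. i \<in> F \<Longrightarrow> a i \<in> homset C x (t i)" "h = asum x c (\<lambda>i. \<iota> i \<cdot> a i) F"
    using h that by (rule fin_mapE)
  obtain G b where G: "finite G" "G \<subseteq> I" "\<And>i. i \<in> G \<Longrightarrow> b i \<in> homset C x (t i)" "h' = asum x c (\<lambda>i. \<iota> i \<cdot> b i) G"
    using h' that by (rule fin_mapE)
  define a' b' where "a' = (\<lambda>i. if i \<in> F then a i else Zero C x (t i))" and "b' = (\<lambda>i. if i \<in> G then b i else Zero C x (t i))"
  have I: "i \<in> I" if "i \<in> F \<union> G" for i using F G that by blast
  have a': "a' i \<in> homset C x (t i)" "b' i \<in> homset C x (t i)" if "i \<in> F \<union> G" for i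
    using F(3) G(3) o(3)[OF I[OF that]] Zero_in x by (auto simp: a'_def b'_def)
  have ab: "\<iota> i \<cdot> a' i \<in> homset C x c" "\<iota> i \<cdot> b' i \<in> homset C x c" if "i \<in> F \<union> G" for i
    using Comp_in[OF a'(1)[OF that] o(2)[OF I[OF that]]] Comp_in[OF a'(2)[OF that] o(2)[OF I[OF that]]] by auto
  have zero: "\<iota> i \<cdot> Zero C x (t i) = Zero C x c" if "i \<in> F \<union> G" for i
    using homsetD[OF o(2)[OF I[OF that]]] x by simp
  have hF: "h = asum x c (\<lambda>i. \<iota> i \<cdot> a' i) (F \<union> G)" unfolding F(4)
  proof (rule asum_neutral[OF x o(1)])
    show "\<iota> i \<cdot> a' i = Zero C x c" if "i \<in> F \<union> G - F" for i using zero[of i] that by (auto simp: a'_def)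
    show "\<iota> i \<cdot> a i = \<iota> i \<cdot> a' i" if "i \<in> F" for i using that by (simp add: a'_def)
    show "\<iota> i \<cdot> a' i \<in> homset C x c" if "i \<in> F" for i using ab(1) that by blast
  qed (use F G in auto)
  have hG: "h' = asum x c (\<lambda>i. \<iota> i \<cdot> b' i) (F \<union> G)" unfolding G(4)
  proof (rule asum_neutral[OF x o(1)])
    show "\<iota> i \<cdot> b' i = Zero C x c" if "i \<in> F \<union> G - G" for i using zero[of i] that by (auto simp: b'_def)
    show "\<iota> i \<cdot> b i = \<iota> i \<cdot> b' i" if "i \<in> G" for i using that by (simp add: b'_def)
    show "\<iota> i \<cdot> b' i \<in> homset C x c" if "i \<in> G" for i using ab(2) that by blast
  qed (use F G in auto)
  have "h \<boxplus> h' = asum x c (\<lambda>i. \<iota> i \<cdot> a' i \<boxplus> \<iota> i \<cdot> b' i) (F \<union> G)"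
    unfolding hF hG by (rule asum_Plus[OF x o(1) ab, symmetric])
  also have "\<dots> = asum x c (\<lambda>i. \<iota> i \<cdot> (a' i \<boxplus> b' i)) (F \<union> G)"
  proof (rule asum_cong[OF x o(1)])
    fix i assume i: "i \<in> F \<union> G"
    have e: "\<iota> i \<cdot> (a' i \<boxplus> b' i) = \<iota> i \<cdot> a' i \<boxplus> \<iota> i \<cdot> b' i" by (rule Comp_Plus_right[OF a'[OF i] o(2)[OF I[OF i]]])
    then show "\<iota> i \<cdot> a' i \<boxplus> \<iota> i \<cdot> b' i = \<iota> i \<cdot> (a' i \<boxplus> b' i)" by simp
    show "\<iota> i \<cdot> (a' i \<boxplus> b' i) \<in> homset C x c" unfolding e using Plus_in ab[OF i] by blast
  qed
  finally have e: "h \<boxplus> h' = asum x c (\<lambda>i. \<iota> i \<cdot> (a' i \<boxplus> b' i)) (F \<union> G)" .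
  show ?thesis
  proof (rule fin_mapI[OF _ _ _ e])
    show "a' i \<boxplus> b' i \<in> homset C x (t i)" if "i \<in> F \<union> G" for i by (rule Plus_in[OF a'[OF that]])
  qed (use F(1,2) G(1,2) in auto)
qed

text \<open>The canonical map is always additive, and the projections make it injective. Its being
  an isomorphism thus amounts to surjectivity, which is the condition
  \<open>fin_map\<close>.\<close>

lemma compact_hom_iso_iff:
  assumes c: "is_coproduct C I t c \<iota>" and x: "x \<in> Obj C"
  shows "(\<lambda>a. asum x c (\<lambda>i. \<iota> i \<cdot> a i) {i \<in> I. a i \<noteq> Zero C x (t i)})
          \<in> iso (sum_group I (\<lambda>i. hom_group C x (t i))) (hom_group C x c)
    \<longleftrightarrow> (\<forall>h \<in> homset C x c. fin_map I t \<iota> x c h)"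
    (is "?\<Theta> \<in> iso ?G ?H \<longleftrightarrow> ?R")
proof -
  note o = coproduct_in[OF c]
  have gr: "group (hom_group C x (t i))" if "i \<in> I" for i
    using hom_comm_group[OF x o(3)[OF that]] comm_group.axioms(2) by blast
  have car: "carrier ?G = {a \<in> \<Pi>\<^sub>E i\<in>I. homset C x (t i). finite {i \<in> I. a i \<noteq> Zero C x (t i)}}"
    using carrier_sum_group[OF gr] by simp
  obtain \<pi> where \<pi>: "\<And>i. i \<in> I \<Longrightarrow> \<pi> i \<in> homset C c (t i)" "\<And>i. i \<in> I \<Longrightarrow> \<pi> i \<cdot> \<iota> i = Id C (t i)"
    "\<And>i j. \<lbrakk>i \<in> I; j \<in> I; j \<noteq> i\<rbrakk> \<Longrightarrow> \<pi> i \<cdot> \<iota> j = Zero C (t j) (t i)"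
    using that by (rule coproduct_projections[OF c])
  let ?s = "\<lambda>a. {i \<in> I. a i \<noteq> Zero C x (t i)}"
  have ty0: "\<iota> i \<cdot> a i \<in> homset C x c" if "a \<in> carrier ?G" "i \<in> I" for a i
    using that car o(2) Comp_in by (auto simp: PiE_iff)
  have zero: "\<iota> i \<cdot> Zero C x (t i) = Zero C x c" if "i \<in> I" for i
    using homsetD[OF o(2)[OF that]] x by simp
  have ext: "?\<Theta> a = asum x c (\<lambda>i. \<iota> i \<cdot> a i) F" if a: "a \<in> carrier ?G" and "finite F" "?s a \<subseteq> F" "F \<subseteq> I" for a F
    by (rule asum_neutral[OF x o(1)]) (use that ty0 zero in auto)
  have coord: "\<pi> i \<cdot> ?\<Theta> a = a i" if a: "a \<in> carrier ?G" and i: "i \<in> I" for a i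
    using proj_asum[OF c x _ _ _ \<pi> i, of "?s a" a] a i car by (auto simp: PiE_iff)
  show ?thesis
  proof
    assume "?\<Theta> \<in> iso ?G ?H"
    then have sur: "?\<Theta> ` carrier ?G = homset C x c" by (auto simp: iso_def bij_betw_def)
    show ?R
    proof
      fix h assume "h \<in> homset C x c"
      then obtain a where "a \<in> carrier ?G" "h = ?\<Theta> a" using sur by blast
      then show "fin_map I t \<iota> x c h" by (intro fin_mapI[of "?s a" I a]) (auto simp: car PiE_iff)
    qed
  next
    assume R: ?R
    have "?\<Theta> \<in> hom ?G ?H"
    proof (rule homI)
      show "?\<Theta> a \<in> carrier ?H" if "a \<in> carrier ?G" for a
        using asum_in[OF x o(1), of "?s a"] ty0[OF that] by auto
      fix a b assume a: "a \<in> carrier ?G" and b: "b \<in> carrier ?G"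
      have "group ?G" by (rule sum_group) (rule gr)
      then have ab: "a \<otimes>\<^bsub>?G\<^esub> b \<in> carrier ?G" using a b group.is_monoid monoid.m_closed by metis
      \<comment> \<open>Cancellation may shrink the support of the sum, so all three sums are taken
        over the union of the supports of a and b.\<close>
      let ?F = "?s a \<union> ?s b"
      have F: "finite ?F" "?F \<subseteq> I" using a b car by auto
      have sub: "?s (a \<otimes>\<^bsub>?G\<^esub> b) \<subseteq> ?F"
        using x o(3) by auto
      have "?\<Theta> (a \<otimes>\<^bsub>?G\<^esub> b) = asum x c (\<lambda>i. \<iota> i \<cdot> (a \<otimes>\<^bsub>?G\<^esub> b) i) ?F" by (rule ext[OF ab F(1) sub F(2)])
      also have "\<dots> = asum x c (\<lambda>i. \<iota> i \<cdot> a i \<boxplus> \<iota> i \<cdot> b i) ?F"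
      proof (rule asum_cong[OF x o(1)])
        fix i assume i: "i \<in> ?F"
        then have iI: "i \<in> I" by blast
        show "\<iota> i \<cdot> a i \<boxplus> \<iota> i \<cdot> b i \<in> homset C x c" using ty0[OF a iI] ty0[OF b iI] Plus_in by blast
        have "(a \<otimes>\<^bsub>?G\<^esub> b) i = a i \<boxplus> b i" using iI by simp
        then show "\<iota> i \<cdot> (a \<otimes>\<^bsub>?G\<^esub> b) i = \<iota> i \<cdot> a i \<boxplus> \<iota> i \<cdot> b i"
          using Comp_Plus_right[OF _ _ o(2)[OF iI], of "a i" x "b i"] a b iI car by (auto simp: PiE_iff)
      qed
      also have "\<dots> = asum x c (\<lambda>i. \<iota> i \<cdot> a i) ?F \<boxplus> asum x c (\<lambda>i. \<iota> i \<cdot> b i) ?F"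
        by (rule asum_Plus[OF x o(1)]) (use ty0 a b in auto)
      also have "\<dots> = ?\<Theta> a \<boxplus> ?\<Theta> b" using ext[OF a F(1) _ F(2)] ext[OF b F(1) _ F(2)] by auto
      finally show "?\<Theta> (a \<otimes>\<^bsub>?G\<^esub> b) = ?\<Theta> a \<otimes>\<^bsub>?H\<^esub> ?\<Theta> b" by simp
    qed
    moreover have "inj_on ?\<Theta> (carrier ?G)"
    proof (rule inj_onI)
      fix a b assume a: "a \<in> carrier ?G" and b: "b \<in> carrier ?G" and e: "?\<Theta> a = ?\<Theta> b"
      have "a i = b i" if "i \<in> I" for i using coord[OF a that] coord[OF b that] e by simp
      then show "a = b" using a b car by (intro PiE_ext[of a I _ b]) auto
    qed
    moreover have "h \<in> ?\<Theta> ` carrier ?G" if h: "h \<in> homset C x c" for h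
    proof -
      obtain F a where F: "finite F" "F \<subseteq> I" "\<And>i. i \<in> F \<Longrightarrow> a i \<in> homset C x (t i)" "h = asum x c (\<lambda>i. \<iota> i \<cdot> a i) F"
        using bspec[OF R h] that by (rule fin_mapE)
      \<comment> \<open>The coefficients are padded with zeros off F, and restricted to I because
        elements of the sum group are extensional functions.\<close>
      define a' where "a' = (\<lambda>i\<in>I. if i \<in> F then a i else Zero C x (t i))"
      have s: "?s a' \<subseteq> F" by (auto simp: a'_def)
      have a': "a' \<in> carrier ?G"
        using F s finite_subset[OF s F(1)] Zero_in[OF x o(3)] unfolding car by (auto simp: a'_def)
      have "h = asum x c (\<lambda>i. \<iota> i \<cdot> a' i) F"
        unfolding F(4)
      proof (rule asum_cong[OF x o(1)])
        fix i assume i: "i \<in> F"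
        then have iI: "i \<in> I" using F(2) by blast
        show "\<iota> i \<cdot> a' i \<in> homset C x c" by (rule ty0[OF a' iI])
        show "\<iota> i \<cdot> a i = \<iota> i \<cdot> a' i" using i iI by (simp add: a'_def)
      qed
      then have "h = ?\<Theta> a'" using ext[OF a' F(1) s F(2)] by simp
      then show ?thesis using a' by (rule image_eqI)
    qed
    moreover have "?\<Theta> a \<in> homset C x c" if "a \<in> carrier ?G" for a
      by (rule asum_in[OF x o(1)]) (use ty0[OF that] in auto)
    ultimately show "?\<Theta> \<in> iso ?G ?H"
      unfolding iso_def bij_betw_def hom_group_simps by blast
  qed
qed

lemma compact_objects_iff:
  fixes \<kappa> :: "'u rel"
  shows "x \<in> compact_objects \<kappa> C \<longleftrightarrow> x \<in> Obj C \<and>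
    (\<forall>(I :: 'u set) t c \<iota>. small \<kappa> I \<longrightarrow> is_coproduct C I t c \<iota> \<longrightarrow> (\<forall>h \<in> homset C x c. fin_map I t \<iota> x c h))"
  unfolding compact_objects_def mem_Collect_eq
  by (intro conj_cong refl all_cong1 imp_cong compact_hom_iso_iff)

lemma compactD:
  fixes \<kappa> :: "'u rel" and I :: "'u set"
  shows "\<lbrakk>x \<in> compact_objects \<kappa> C; small \<kappa> I; is_coproduct C I t c \<iota>; h \<in> homset C x c\<rbrakk> \<Longrightarrow> fin_map I t \<iota> x c h"
  unfolding compact_objects_iff by simp

lemma compactI:
  fixes \<kappa> :: "'u rel"
  assumes "x \<in> Obj C"
    "\<And>(I :: 'u set) t c \<iota> h. \<lbrakk>small \<kappa> I; is_coproduct C I t c \<iota>; h \<in> homset C x c\<rbrakk> \<Longrightarrow> fin_map I t \<iota> x c h"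
  shows "x \<in> compact_objects \<kappa> C"
  unfolding compact_objects_iff using assms by simp

lemma fin_map_reindex:
  assumes \<phi>: "bij_betw \<phi> I A" and c: "is_coproduct C A t c \<iota>" and x: "x \<in> Obj C"
    and h: "fin_map I (\<lambda>i. t (\<phi> i)) (\<lambda>i. \<iota> (\<phi> i)) x c h"
  shows "fin_map A t \<iota> x c h"
proof -
  note o = coproduct_in[OF c]
  obtain F a where F: "finite F" "F \<subseteq> I" "\<And>i. i \<in> F \<Longrightarrow> a i \<in> homset C x (t (\<phi> i))"
    "h = asum x c (\<lambda>i. \<iota> (\<phi> i) \<cdot> a i) F"
    using h that by (rule fin_mapE)
  define a' where "a' = (\<lambda>j. a (inv_into I \<phi> j))"
  have inj: "inj_on \<phi> F" "\<phi> ` F \<subseteq> A" using \<phi> F(2) by (auto simp: bij_betw_def inj_on_def)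
  have inv: "inv_into I \<phi> (\<phi> i) = i" if "i \<in> F" for i using \<phi> F(2) that by (auto simp: bij_betw_def)
  have t: "\<iota> j \<cdot> a' j \<in> homset C x c" if "j \<in> \<phi> ` F" for j
    using that F(2,3) inv inj(2) Comp_in[OF _ o(2)] by (auto simp: a'_def)
  have "asum x c (\<lambda>j. \<iota> j \<cdot> a' j) (\<phi> ` F) = asum x c (\<lambda>i. \<iota> (\<phi> i) \<cdot> a' (\<phi> i)) F"
    using comm_monoid.finprod_reindex[OF hom_comm_monoid[OF x o(1)] _ inj(1), of "\<lambda>j. \<iota> j \<cdot> a' j"] t by auto
  also have "\<dots> = h"
    unfolding F(4) by (rule asum_cong[OF x o(1)]) (use F(2,3) inv inj(2) Comp_in[OF _ o(2)] in \<open>auto simp: a'_def\<close>)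
  finally show ?thesis using F inj inv by (intro fin_mapI[of "\<phi> ` F" A a']) (auto simp: a'_def)
qed

lemma compact_fin_map:
  fixes \<kappa> :: "'u rel"
  assumes "inaccessible \<kappa>" and x: "x \<in> compact_objects \<kappa> C" and A: "small \<kappa> A" and c: "is_coproduct C A t c \<iota>" and h: "h \<in> homset C x c"
  shows "fin_map A t \<iota> x c h"
proof -
  have "Card_order \<kappa>" using assms(1) by (simp add: inaccessible_def)
  then obtain \<phi> and I :: "'u set" where \<phi>: "bij_betw \<phi> I A" "small \<kappa> I" using small_transport[OF A] by metis
  have "fin_map I (\<lambda>i. t (\<phi> i)) (\<lambda>i. \<iota> (\<phi> i)) x c h"
    using x \<phi>(2) coproduct_reindex[OF \<phi>(1) c] h by (rule compactD)
  then show ?thesis using fin_map_reindex[OF \<phi>(1) c] hom_obj[OF h] by blast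
qed

lemma small_coproduct_ex:
  fixes \<kappa> :: "'u rel"
  assumes "inaccessible \<kappa>" "has_small_coproducts \<kappa> C" "small \<kappa> A" "\<And>a. a \<in> A \<Longrightarrow> t a \<in> Obj C"
  obtains c \<iota> where "is_coproduct C A t c \<iota>"
proof -
  have "Card_order \<kappa>" using assms(1) by (simp add: inaccessible_def)
  then obtain \<phi> and I :: "'u set" where \<phi>: "bij_betw \<phi> I A" "small \<kappa> I" using small_transport[OF assms(3)] by metis
  have "\<forall>i\<in>I. t (\<phi> i) \<in> Obj C" using \<phi>(1) assms(4) by (auto simp: bij_betw_def)
  then obtain c \<iota> where c: "is_coproduct C I (\<lambda>i. t (\<phi> i)) c \<iota>"
    using assms(2)[unfolded has_small_coproducts_def, rule_format, OF \<phi>(2), of "\<lambda>i. t (\<phi> i)"] by blast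
  let ?\<psi> = "inv_into I \<phi>"
  have \<psi>: "bij_betw ?\<psi> A I" using \<phi>(1) by (rule bij_betw_inv_into)
  have "\<phi> (?\<psi> a) = a" if "a \<in> A" for a using \<phi>(1) that by (auto simp: bij_betw_def f_inv_into_f)
  then have "is_coproduct C A t c (\<lambda>a. \<iota> (?\<psi> a))"
    using coproduct_cong[OF coproduct_reindex[OF \<psi> c]] by simp
  then show thesis using that by blast
qed

end

section \<open>Compact objects and localizing subcategories\<close>

context triangulated_category
begin

lemma localizing_triangulated: "localizing_subcategory \<kappa> T L \<Longrightarrow> triangulated_subcategory T L"
  by (simp add: localizing_subcategory_def)

lemma localizing_coproduct:
  fixes \<kappa> :: "'u rel"
  assumes "inaccessible \<kappa>" "localizing_subcategory \<kappa> T L" "small \<kappa> A" "is_coproduct T A t c \<iota>" "\<And>a. a \<in> A \<Longrightarrow> t a \<in> L"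
  shows "c \<in> L"
proof -
  have "Card_order \<kappa>" using assms(1) by (simp add: inaccessible_def)
  then obtain \<phi> and I :: "'u set" where \<phi>: "bij_betw \<phi> I A" "small \<kappa> I" using small_transport[OF assms(3)] by metis
  have "\<forall>i\<in>I. t (\<phi> i) \<in> L" using \<phi>(1) assms(5) by (auto simp: bij_betw_def)
  then show ?thesis
    using assms(2) \<phi>(2) coproduct_reindex[OF \<phi>(1) assms(4)] unfolding localizing_subcategory_def by blast
qed

lemma localizing_Obj: "localizing_subcategory \<kappa> T (Obj T)"
  unfolding localizing_subcategory_def
  by (intro conjI triangulated_subcategoryI) (auto simp: is_coproduct_def zero_obj_obj dest: triD(7) isomorphic_obj)

lemma localizing_Inter:
  fixes \<kappa> :: "'u rel"
  assumes "\<And>L. L \<in> \<L> \<Longrightarrow> localizing_subcategory \<kappa> T L" "\<L> \<noteq> {}"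
  shows "localizing_subcategory \<kappa> T (\<Inter>\<L>)"
proof -
  note t = localizing_triangulated[OF assms(1)]
  obtain L0 where L0: "L0 \<in> \<L>" using assms(2) by blast
  have "triangulated_subcategory T (\<Inter>\<L>)"
  proof (rule triangulated_subcategoryI)
    show "\<Inter>\<L> \<subseteq> Obj T" using triangulated_subcategoryD(1)[OF t[OF L0]] L0 by blast
    show "z \<in> \<Inter>\<L>" if "is_zero_obj T z" for z using triangulated_subcategoryD(2)[OF t] that by blast
    show "y \<in> \<Inter>\<L>" if "x \<in> \<Inter>\<L>" "isomorphic T x y" for x y
      using triangulated_subcategoryD(3)[OF t] that by blast
    show "\<Sigma>\<^sub>o x \<in> \<Inter>\<L>" if "x \<in> \<Inter>\<L>" for x
      using triangulated_subcategoryD(1,4)[OF t] that by blast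
    show "x \<in> \<Inter>\<L>" if "x \<in> Obj T" "\<Sigma>\<^sub>o x \<in> \<Inter>\<L>" for x
      using triangulated_subcategoryD(4)[OF t] that by blast
    show "z \<in> \<Inter>\<L>" if "tri f g h x y z" "x \<in> \<Inter>\<L>" "y \<in> \<Inter>\<L>" for f g h x y z
      using triangulated_subcategoryD(5)[OF t that(1)] that(2,3) by blast
  qed
  moreover have "c \<in> L" if "small \<kappa> I" "is_coproduct T I t c \<iota>" "\<forall>i\<in>I. t i \<in> \<Inter>\<L>" "L \<in> \<L>"
    for I :: "'u set" and t c \<iota> L
    using assms(1)[OF that(4)] that unfolding localizing_subcategory_def by blast
  ultimately show ?thesis unfolding localizing_subcategory_def by blast
qed

lemma Loc_localizing: "E \<subseteq> Obj T \<Longrightarrow> localizing_subcategory \<kappa> T (Loc \<kappa> T E)"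
  unfolding Loc_def by (rule localizing_Inter) (use localizing_Obj in auto)

lemma Loc_superset: "E \<subseteq> Loc \<kappa> T E"
  by (auto simp: Loc_def)

lemma Loc_least: "\<lbrakk>localizing_subcategory \<kappa> T L; E \<subseteq> L\<rbrakk> \<Longrightarrow> Loc \<kappa> T E \<subseteq> L"
  by (auto simp: Loc_def)

lemma Sh_asum:
  assumes "x \<in> Obj T" "y \<in> Obj T" "finite F" "\<And>i. i \<in> F \<Longrightarrow> \<phi> i \<in> homset T x y"
  shows "\<Sigma>\<^sub>a (asum x y \<phi> F) = asum (\<Sigma>\<^sub>o x) (\<Sigma>\<^sub>o y) (\<lambda>i. \<Sigma>\<^sub>a (\<phi> i)) F"
  using assms(3,4)
proof (induction F)
  case empty
  then show ?case using assms by simp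
next
  case (insert j F)
  have "\<Sigma>\<^sub>a (asum x y \<phi> (insert j F)) = \<Sigma>\<^sub>a (\<phi> j \<boxplus> asum x y \<phi> F)"
    using asum_insert[OF assms(1,2) insert(1,2)] insert.prems by simp
  also have "\<dots> = \<Sigma>\<^sub>a (\<phi> j) \<boxplus> \<Sigma>\<^sub>a (asum x y \<phi> F)"
    by (rule ShA_Plus[of _ x y]) (use insert.prems asum_in[OF assms(1,2), of F \<phi>] in auto)
  also have "\<dots> = asum (\<Sigma>\<^sub>o x) (\<Sigma>\<^sub>o y) (\<lambda>i. \<Sigma>\<^sub>a (\<phi> i)) (insert j F)"
    using asum_insert[of "\<Sigma>\<^sub>o x" "\<Sigma>\<^sub>o y" F j "\<lambda>i. \<Sigma>\<^sub>a (\<phi> i)"] insert assms(1,2) ShA_in by simp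
  finally show ?case .
qed

section \<open>Closure properties of the compact objects\<close>

lemma compact_retract:
  fixes \<kappa> :: "'u rel"
  assumes "s \<in> compact_objects \<kappa> T" "retract x s"
  shows "x \<in> compact_objects \<kappa> T"
proof (rule compactI)
  obtain i r where i: "i \<in> homset T x s" "r \<in> homset T s x" "r \<cdot> i = Id T x"
    using assms(2) by (auto simp: retract_def)
  show "x \<in> Obj T" using i hom_obj by blast
  fix I :: "'u set" and t c \<iota> h assume I: "small \<kappa> I" and c: "is_coproduct T I t c \<iota>" and h: "h \<in> homset T x c"
  have "fin_map I t \<iota> s c (h \<cdot> r)"
    using assms(1) I c Comp_in[OF i(2) h] by (rule compactD)
  then have "fin_map I t \<iota> x c ((h \<cdot> r) \<cdot> i)" by (rule fin_map_Comp[OF c _ i(1)])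
  then show "fin_map I t \<iota> x c h" using homsetD[OF i(1)] homsetD[OF i(2)] homsetD[OF h] i(3) by simp
qed

lemma compact_zero:
  fixes \<kappa> :: "'u rel"
  assumes "is_zero_obj T z"
  shows "z \<in> compact_objects \<kappa> T"
proof (rule compactI)
  show "z \<in> Obj T" using assms zero_obj_obj by blast
  fix I :: "'u set" and t c \<iota> h assume "small \<kappa> I" and c: "is_coproduct T I t c \<iota>" and h: "h \<in> homset T z c"
  have "h = Zero T z c" by (rule zero_obj_hom(1)[OF assms h])
  then have "h = asum z c (\<lambda>i. \<iota> i \<cdot> undefined i) {}" using hom_obj[OF h] by simp
  then show "fin_map I t \<iota> z c h" by (intro fin_mapI[of "{}"]) auto
qed

lemma compact_obj: "x \<in> compact_objects \<kappa> T \<Longrightarrow> x \<in> Obj T"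
  by (simp add: compact_objects_def)

lemma compact_Sh:
  fixes \<kappa> :: "'u rel"
  assumes "x \<in> compact_objects \<kappa> T"
  shows "\<Sigma>\<^sub>o x \<in> compact_objects \<kappa> T"
proof (rule compactI)
  have x: "x \<in> Obj T" using compact_obj assms by blast
  then show "\<Sigma>\<^sub>o x \<in> Obj T" by simp
  fix I :: "'u set" and t c \<iota> k assume I: "small \<kappa> I" and c: "is_coproduct T I t c \<iota>" and k: "k \<in> homset T (\<Sigma>\<^sub>o x) c"
  note o = coproduct_in[OF c]
  obtain t' c' \<iota>' \<theta> \<alpha> where d: "is_coproduct T I t' c' \<iota>'" "\<alpha> \<in> homset T (\<Sigma>\<^sub>o c') c" "is_iso_arr T \<alpha>"
    "\<And>i. i \<in> I \<Longrightarrow> \<theta> i \<in> homset T (\<Sigma>\<^sub>o (t' i)) (t i) \<and> \<alpha> \<cdot> \<Sigma>\<^sub>a (\<iota>' i) = \<iota> i \<cdot> \<theta> i"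
    using that by (rule desuspend_coproduct[OF c])
  note o' = coproduct_in[OF d(1)]
  obtain \<beta> where \<beta>: "\<beta> \<in> homset T c (\<Sigma>\<^sub>o c')" "\<alpha> \<cdot> \<beta> = Id T c" using iso_arrE[OF d(3,2)] by metis
  obtain k' where k': "k' \<in> homset T x c'" "\<Sigma>\<^sub>a k' = \<beta> \<cdot> k" by (rule Sh_full[OF x o'(1) Comp_in[OF k \<beta>(1)]])
  have "fin_map I t' \<iota>' x c' k'" using assms I d(1) k'(1) by (rule compactD)
  then obtain F a where F: "finite F" "F \<subseteq> I" "\<And>i. i \<in> F \<Longrightarrow> a i \<in> homset T x (t' i)" "k' = asum x c' (\<lambda>i. \<iota>' i \<cdot> a i) F"
    using that by (rule fin_mapE)
  have ty: "\<iota>' i \<cdot> a i \<in> homset T x c'" if "i \<in> F" for i using Comp_in[OF F(3) o'(2)] that F(2) by blast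
  have "k = \<alpha> \<cdot> \<Sigma>\<^sub>a k'"
    using comp_eq_assoc[OF \<beta>(2), of k] k'(2) homsetD[OF d(2)] homsetD[OF \<beta>(1)] homsetD[OF k] by simp
  also have "\<dots> = \<alpha> \<cdot> asum (\<Sigma>\<^sub>o x) (\<Sigma>\<^sub>o c') (\<lambda>i. \<Sigma>\<^sub>a (\<iota>' i \<cdot> a i)) F"
    unfolding F(4) using Sh_asum[OF x o'(1) F(1) ty] by simp
  also have "\<dots> = asum (\<Sigma>\<^sub>o x) c (\<lambda>i. \<alpha> \<cdot> \<Sigma>\<^sub>a (\<iota>' i \<cdot> a i)) F"
    by (rule Comp_asum[OF d(2) Sh_obj[OF x] F(1)]) (use ty ShA_in in blast)
  also have "\<dots> = asum (\<Sigma>\<^sub>o x) c (\<lambda>i. \<iota> i \<cdot> (\<theta> i \<cdot> \<Sigma>\<^sub>a (a i))) F"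
  proof (rule asum_cong[OF Sh_obj[OF x] o(1)])
    fix i assume i: "i \<in> F"
    then have iI: "i \<in> I" using F(2) by blast
    have th: "\<theta> i \<in> homset T (\<Sigma>\<^sub>o (t' i)) (t i)" "\<alpha> \<cdot> \<Sigma>\<^sub>a (\<iota>' i) = \<iota> i \<cdot> \<theta> i" using d(4)[OF iI] by auto
    note A = homsetD[OF th(1)] homsetD[OF F(3)[OF i]] homsetD[OF o(2)[OF iI]] homsetD[OF o'(2)[OF iI]] homsetD[OF d(2)]
    show "\<iota> i \<cdot> (\<theta> i \<cdot> \<Sigma>\<^sub>a (a i)) \<in> homset T (\<Sigma>\<^sub>o x) c" using A by (simp add: homset_iff)
    show "\<alpha> \<cdot> \<Sigma>\<^sub>a (\<iota>' i \<cdot> a i) = \<iota> i \<cdot> (\<theta> i \<cdot> \<Sigma>\<^sub>a (a i))"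
      using comp_eq_extend[OF th(2), of "\<Sigma>\<^sub>a (a i)"] A by (simp add: Sh_Comp)
  qed
  finally show "fin_map I t \<iota> (\<Sigma>\<^sub>o x) c k"
    using F(1-3) d(4) Comp_in[OF ShA_in] by (intro fin_mapI[of F I "\<lambda>i. \<theta> i \<cdot> \<Sigma>\<^sub>a (a i)"]) blast+
qed

lemma compact_Sh_reflects:
  fixes \<kappa> :: "'u rel"
  assumes "\<Sigma>\<^sub>o x \<in> compact_objects \<kappa> T" and x: "x \<in> Obj T"
  shows "x \<in> compact_objects \<kappa> T"
proof (rule compactI)
  fix I :: "'u set" and t c \<iota> k assume I: "small \<kappa> I" and c: "is_coproduct T I t c \<iota>" and k: "k \<in> homset T x c"
  note o = coproduct_in[OF c]
  have "fin_map I (\<lambda>i. \<Sigma>\<^sub>o (t i)) (\<lambda>i. \<Sigma>\<^sub>a (\<iota> i)) (\<Sigma>\<^sub>o x) (\<Sigma>\<^sub>o c) (\<Sigma>\<^sub>a k)"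
    using assms(1) I Sh_coproduct[OF c] ShA_in[OF k] by (rule compactD)
  then obtain F a where F: "finite F" "F \<subseteq> I" "\<And>i. i \<in> F \<Longrightarrow> a i \<in> homset T (\<Sigma>\<^sub>o x) (\<Sigma>\<^sub>o (t i))"
    "\<Sigma>\<^sub>a k = asum (\<Sigma>\<^sub>o x) (\<Sigma>\<^sub>o c) (\<lambda>i. \<Sigma>\<^sub>a (\<iota> i) \<cdot> a i) F"
    using that by (rule fin_mapE)
  have "\<exists>b. b \<in> homset T x (t i) \<and> \<Sigma>\<^sub>a b = a i" if "i \<in> F" for i
    using Sh_full[OF x o(3) F(3)[OF that]] that F(2) by blast
  then obtain b where b: "\<And>i. i \<in> F \<Longrightarrow> b i \<in> homset T x (t i)" "\<And>i. i \<in> F \<Longrightarrow> \<Sigma>\<^sub>a (b i) = a i" by metis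
  have ty: "\<iota> i \<cdot> b i \<in> homset T x c" if "i \<in> F" for i using Comp_in[OF b(1) o(2)] that F(2) by blast
  have "\<Sigma>\<^sub>a (asum x c (\<lambda>i. \<iota> i \<cdot> b i) F) = asum (\<Sigma>\<^sub>o x) (\<Sigma>\<^sub>o c) (\<lambda>i. \<Sigma>\<^sub>a (\<iota> i \<cdot> b i)) F"
    by (rule Sh_asum[OF x o(1) F(1) ty])
  also have "\<dots> = \<Sigma>\<^sub>a k" unfolding F(4)
  proof (rule asum_cong)
    fix i assume i: "i \<in> F"
    then have iI: "i \<in> I" using F(2) by blast
    show "\<Sigma>\<^sub>a (\<iota> i) \<cdot> a i \<in> homset T (\<Sigma>\<^sub>o x) (\<Sigma>\<^sub>o c)" by (rule Comp_in[OF F(3)[OF i] ShA_in[OF o(2)[OF iI]]])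
    show "\<Sigma>\<^sub>a (\<iota> i \<cdot> b i) = \<Sigma>\<^sub>a (\<iota> i) \<cdot> a i" using ShA_Comp[OF b(1)[OF i] o(2)[OF iI]] b(2)[OF i] by simp
  qed (use x o in auto)
  finally have e: "\<Sigma>\<^sub>a (asum x c (\<lambda>i. \<iota> i \<cdot> b i) F) = \<Sigma>\<^sub>a k" .
  have "asum x c (\<lambda>i. \<iota> i \<cdot> b i) F \<in> homset T x c" by (rule asum_in[OF x o(1) ty])
  then have "asum x c (\<lambda>i. \<iota> i \<cdot> b i) F = k" by (rule Sh_faithful[OF _ k e])
  then show "fin_map I t \<iota> x c k" using F(1,2) b(1) by (intro fin_mapI[of F I b]) auto
qed (rule x)

text \<open>Restricted to y, a map k from the cone is a finite sum. The projections show that each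
  component vanishes on f and so extends over g, which gives a finite map ?k' from z. The difference
  of k and ?k' factors through \<Sigma>x, which is compact.\<close>

lemma compact_cone:
  fixes \<kappa> :: "'u rel"
  assumes t: "tri f g h x y z" and x: "x \<in> compact_objects \<kappa> T" and y: "y \<in> compact_objects \<kappa> T"
  shows "z \<in> compact_objects \<kappa> T"
proof (rule compactI)
  note A = tri_arr[OF t]
  show "z \<in> Obj T" by (rule A(12))
  fix I :: "'u set" and s c \<iota> k assume I: "small \<kappa> I" and c: "is_coproduct T I s c \<iota>" and k: "k \<in> homset T z c"
  note o = coproduct_in[OF c]
  have kg: "k \<cdot> g \<in> homset T y c" by (rule Comp_in[OF triD(3)[OF t] k])
  have "fin_map I s \<iota> y c (k \<cdot> g)" using y I c kg by (rule compactD)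
  then obtain F b where F: "finite F" "F \<subseteq> I" "\<And>i. i \<in> F \<Longrightarrow> b i \<in> homset T y (s i)" "k \<cdot> g = asum y c (\<lambda>i. \<iota> i \<cdot> b i) F"
    using that by (rule fin_mapE)
  obtain \<pi> where \<pi>: "\<And>i. i \<in> I \<Longrightarrow> \<pi> i \<in> homset T c (s i)" "\<And>i. i \<in> I \<Longrightarrow> \<pi> i \<cdot> \<iota> i = Id T (s i)"
    "\<And>i j. \<lbrakk>i \<in> I; j \<in> I; j \<noteq> i\<rbrakk> \<Longrightarrow> \<pi> i \<cdot> \<iota> j = Zero T (s j) (s i)"
    using that by (rule coproduct_projections[OF c])
  have "\<exists>b'. b' \<in> homset T z (s i) \<and> b' \<cdot> g = b i" if i: "i \<in> F" for i
  proof -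
    have iI: "i \<in> I" using i F by blast
    note B = homsetD[OF \<pi>(1)[OF iI]] homsetD[OF k] A
    have "b i = \<pi> i \<cdot> (k \<cdot> g)"
      using proj_asum[OF c A(11) F(1,2,3) \<pi> iI] i unfolding F(4) by simp
    then have "b i \<cdot> f = Zero T x (s i)" using B tri_comp1[OF t] by simp
    from tri_weak1[OF t F(3)[OF i] this] show ?thesis by blast
  qed
  then obtain b' where b': "\<And>i. i \<in> F \<Longrightarrow> b' i \<in> homset T z (s i)" "\<And>i. i \<in> F \<Longrightarrow> b' i \<cdot> g = b i" by metis
  let ?k' = "asum z c (\<lambda>i. \<iota> i \<cdot> b' i) F"
  have ty: "\<iota> i \<cdot> b' i \<in> homset T z c" if "i \<in> F" for i using Comp_in[OF b'(1) o(2)] that F(2) by blast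
  have k': "?k' \<in> homset T z c" by (rule asum_in[OF A(12) o(1) ty])
  have "?k' \<cdot> g = asum y c (\<lambda>i. (\<iota> i \<cdot> b' i) \<cdot> g) F" by (rule asum_Comp[OF triD(3)[OF t] o(1) F(1) ty])
  also have "\<dots> = k \<cdot> g" unfolding F(4)
  proof (rule asum_cong[OF A(11) o(1)])
    fix i assume i: "i \<in> F"
    then have iI: "i \<in> I" using F(2) by blast
    show "\<iota> i \<cdot> b i \<in> homset T y c" by (rule Comp_in[OF F(3)[OF i] o(2)[OF iI]])
    show "(\<iota> i \<cdot> b' i) \<cdot> g = \<iota> i \<cdot> b i" using Comp_assoc[OF triD(3)[OF t] b'(1)[OF i] o(2)[OF iI]] b'(2)[OF i] by simp
  qed
  finally obtain w where w: "w \<in> homset T (\<Sigma>\<^sub>o x) c" "k = w \<cdot> h \<boxplus> ?k'"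
    using tri_weak1_diff[OF t k k'] by metis
  have "fin_map I s \<iota> (\<Sigma>\<^sub>o x) c w" using compact_Sh[OF x] I c w(1) by (rule compactD)
  then have "fin_map I s \<iota> z c (w \<cdot> h)" by (rule fin_map_Comp[OF c _ triD(4)[OF t]])
  moreover have "fin_map I s \<iota> z c ?k'" using F(1,2) b'(1) by (intro fin_mapI[of F I b']) auto
  ultimately show "fin_map I s \<iota> z c k" unfolding w(2) by (rule fin_map_Plus[OF c A(12)])
qed

lemma compact_triangulated: "triangulated_subcategory T (compact_objects \<kappa> T)"
proof (rule triangulated_subcategoryI)
  show "compact_objects \<kappa> T \<subseteq> Obj T" using compact_obj by blast
  show "y \<in> compact_objects \<kappa> T" if "x \<in> compact_objects \<kappa> T" "isomorphic T x y" for x y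
    by (rule compact_retract[OF that(1) isomorphic_retract[OF isomorphic_sym[OF that(2)]]])
qed (erule compact_zero compact_Sh compact_Sh_reflects compact_cone; assumption)+

section \<open>Neeman's theorem on compact objects of a localizing subcategory\<close>

definition factors_via where
  "factors_via J c w k \<longleftrightarrow> (\<exists>j \<in> J. \<exists>a \<in> homset T c j. \<exists>b \<in> homset T j w. k = b \<cdot> a)"

text \<open>The two middle objects are combined into their biproduct, which is why J has to be
  triangulated.\<close>

lemma factors_via_Plus:
  assumes J: "triangulated_subcategory T J" and k: "factors_via J c w k" and k': "factors_via J c w k'"
  shows "factors_via J c w (k \<boxplus> k')"
proof -
  obtain j a b where 1: "j \<in> J" "a \<in> homset T c j" "b \<in> homset T j w" "k = b \<cdot> a"
    using k by (auto simp: factors_via_def)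
  obtain j' a' b' where 2: "j' \<in> J" "a' \<in> homset T c j'" "b' \<in> homset T j' w" "k' = b' \<cdot> a'"
    using k' by (auto simp: factors_via_def)
  obtain s where s: "s \<in> J" "is_biproduct T j j' s" using triangulated_biproduct[OF J 1(1) 2(1)] by blast
  obtain i i' p p' where b: "i \<in> homset T j s" "i' \<in> homset T j' s" "p \<in> homset T s j" "p' \<in> homset T s j'"
    "p \<cdot> i = Id T j" "p' \<cdot> i' = Id T j'" "p' \<cdot> i = Zero T j j'" "p \<cdot> i' = Zero T j' j"
    using s(2) unfolding is_biproduct_def by blast
  note A = homsetD[OF b(1)] homsetD[OF b(2)] homsetD[OF b(3)] homsetD[OF b(4)] homsetD[OF 1(2)] homsetD[OF 1(3)]
    homsetD[OF 2(2)] homsetD[OF 2(3)] hom_obj[OF 1(3)] hom_obj[OF 2(2)]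
  let ?a = "i \<cdot> a \<boxplus> i' \<cdot> a'" and ?b = "b \<cdot> p \<boxplus> b' \<cdot> p'"
  have 3: "p \<cdot> (i \<cdot> a) = a" "p' \<cdot> (i' \<cdot> a') = a'" "p' \<cdot> (i \<cdot> a) = Zero T c j'" "p \<cdot> (i' \<cdot> a') = Zero T c j"
    using comp_eq_assoc[OF b(5), of a] comp_eq_assoc[OF b(6), of a'] comp_eq_assoc[OF b(7), of a] comp_eq_assoc[OF b(8), of a'] A
    by simp_all
  have "?b \<cdot> ?a = k \<boxplus> k'" using 3 1(4) 2(4) A by simp
  moreover have "?a \<in> homset T c s" "?b \<in> homset T s w" using A by (simp_all add: homset_iff)
  ultimately show ?thesis using s(1) unfolding factors_via_def by metis
qed

lemma factors_via_left:
  assumes "factors_via J c w k" "u \<in> homset T w w'"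
  shows "factors_via J c w' (u \<cdot> k)"
proof -
  obtain j a b where 1: "j \<in> J" "a \<in> homset T c j" "b \<in> homset T j w" "k = b \<cdot> a"
    using assms(1) by (auto simp: factors_via_def)
  then have "u \<cdot> k = (u \<cdot> b) \<cdot> a" using Comp_assoc[OF 1(2,3) assms(2)] by simp
  then show ?thesis using 1 Comp_in[OF 1(3) assms(2)] unfolding factors_via_def by blast
qed

lemma factors_via_right:
  assumes "factors_via J c w k" "u \<in> homset T c' c"
  shows "factors_via J c' w (k \<cdot> u)"
proof -
  obtain j a b where 1: "j \<in> J" "a \<in> homset T c j" "b \<in> homset T j w" "k = b \<cdot> a"
    using assms(1) by (auto simp: factors_via_def)
  then have "k \<cdot> u = b \<cdot> (a \<cdot> u)" using Comp_assoc[OF assms(2) 1(2,3)] by simp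
  then show ?thesis using 1 Comp_in[OF assms(2) 1(2)] unfolding factors_via_def by blast
qed

text \<open>Describes the objects that maps from compact objects cannot distinguish from filtered
  colimits of objects of J, without forming any colimit. A compact object with this property is a
  retract of an object of J.\<close>

definition ind_closure where
  "ind_closure \<kappa> J = {w \<in> Obj T. \<forall>c \<in> compact_objects \<kappa> T. \<forall>k \<in> homset T c w. factors_via J c w k}"

lemma ind_closure_superset: "J \<subseteq> Obj T \<Longrightarrow> J \<subseteq> ind_closure \<kappa> J"
proof
  fix j assume "J \<subseteq> Obj T" "j \<in> J"
  then have "j \<in> Obj T" by blast
  moreover have "factors_via J c j k" if k: "k \<in> homset T c j" for c k
    unfolding factors_via_def using \<open>j \<in> J\<close> k Id_in[OF calculation] Id_left[OF k] by metis
  ultimately show "j \<in> ind_closure \<kappa> J" by (simp add: ind_closure_def)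
qed

text \<open>Closure under cones is the core of Neeman's theorem on compact objects of a localizing
  subcategory. A map \<open>k\<close> from a compact object to the cone is corrected, up to a map through
  \<open>J\<close>, so that it lifts: the component in the suspension of the source is first factored through
  an object \<open>j1\<close> of \<open>J\<close>, and then the obstruction is killed by a map from \<open>j1\<close> to another object
  \<open>j2\<close> of \<open>J\<close>.\<close>

lemma ind_closure_cone:
  assumes J: "triangulated_subcategory T J" "J \<subseteq> compact_objects \<kappa> T"
    and t: "tri f g h x y z" and x: "x \<in> ind_closure \<kappa> J" and y: "y \<in> ind_closure \<kappa> J"
  shows "z \<in> ind_closure \<kappa> J"
  unfolding ind_closure_def
proof (intro CollectI conjI ballI)
  note A = tri_arr[OF t]
  show "z \<in> Obj T" by (rule A(12))
  fix c k assume c: "c \<in> compact_objects \<kappa> T" and k: "k \<in> homset T c z"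
  have co: "c \<in> Obj T" using compact_obj c by blast
  \<comment> \<open>The composite h k ends in \<Sigma>x. Replacing c by an isomorphic \<Sigma>d
    allows it to be desuspended to a map d -> x.\<close>
  obtain d \<theta> \<theta>' where d: "d \<in> Obj T" "\<theta> \<in> homset T (\<Sigma>\<^sub>o d) c" "\<theta>' \<in> homset T c (\<Sigma>\<^sub>o d)" "\<theta> \<cdot> \<theta>' = Id T c" "isomorphic T (\<Sigma>\<^sub>o d) c"
    using Sh_ess_surj[OF co] isomorphicE by metis
  have Sdc: "\<Sigma>\<^sub>o d \<in> compact_objects \<kappa> T" using compact_retract[OF c isomorphic_retract[OF d(5)]] .
  then have dc: "d \<in> compact_objects \<kappa> T" using compact_Sh_reflects d(1) by blast
  note B = homsetD[OF d(2)] homsetD[OF d(3)] homsetD[OF k] d(1) co A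
  obtain k1 where k1: "k1 \<in> homset T d x" "\<Sigma>\<^sub>a k1 = h \<cdot> (k \<cdot> \<theta>)"
    by (rule Sh_full[of d x "h \<cdot> (k \<cdot> \<theta>)"]) (use B in \<open>auto simp: homset_iff\<close>)
  obtain j1 a1 b1 where 1: "j1 \<in> J" "a1 \<in> homset T d j1" "b1 \<in> homset T j1 x" "k1 = b1 \<cdot> a1"
    using x dc k1(1) unfolding ind_closure_def factors_via_def by blast
  note B1 = homsetD[OF k1(1)] homsetD[OF 1(2)] homsetD[OF 1(3)] hom_obj[OF 1(3)]
  have "f \<cdot> k1 = Zero T d y"
  proof (rule Sh_eq_Zero[OF Comp_in[OF k1(1) triD(2)[OF t]]])
    show "\<Sigma>\<^sub>a (f \<cdot> k1) = Zero T (\<Sigma>\<^sub>o d) (\<Sigma>\<^sub>o y)"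
      using Sh_Comp[of k1 f] k1(2) comp_eq_assoc[OF tri_comp3[OF t], of "k \<cdot> \<theta>"] B B1 by simp
  qed
  then have fb: "(f \<cdot> b1) \<cdot> a1 = Zero T d y" using 1(4) B B1 by simp
  \<comment> \<open>Since f b1 vanishes on a1, it extends over the cone m1 of a1. This cone is again
    compact, so the extension factors through an object j2 of J.\<close>
  obtain d1 e1 m1 where t1: "tri a1 d1 e1 d j1 m1" by (rule tri_ex[OF 1(2)])
  have m1: "m1 \<in> compact_objects \<kappa> T" using compact_cone[OF t1 dc] 1(1) J(2) by blast
  obtain v where v: "v \<in> homset T m1 y" "v \<cdot> d1 = f \<cdot> b1"
    by (rule tri_weak1[OF t1 Comp_in[OF 1(3) triD(2)[OF t]] fb])
  obtain j2 a2 b2 where 2: "j2 \<in> J" "a2 \<in> homset T m1 j2" "b2 \<in> homset T j2 y" "v = b2 \<cdot> a2"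
    using y m1 v(1) unfolding ind_closure_def factors_via_def by blast
  note B2 = tri_arr[OF t1] homsetD[OF v(1)] homsetD[OF 2(2)] homsetD[OF 2(3)] hom_obj[OF 2(3)]
  let ?m = "a2 \<cdot> d1"
  have m: "?m \<in> homset T j1 j2" "?m \<cdot> a1 = Zero T d j2" "b2 \<cdot> ?m = f \<cdot> b1"
    using B B1 B2 tri_comp1[OF t1] 2(4) v(2) by (auto simp: homset_iff)
  obtain p q e where t2: "tri ?m p q j1 j2 e" by (rule tri_ex[OF m(1)])
  have eJ: "e \<in> J" by (rule triangulated_subcategoryD(5)[OF J(1) t2 1(1) 2(1)])
  \<comment> \<open>The cone e of j1 -> j2 lies in J, and b1, b2 induce \<gamma> from e to z. The
    lift a3 of \<Sigma>a1 to e makes \<gamma> a3 agree with k \<theta> after h, so the two differ by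
    a map through y.\<close>
  obtain \<gamma> where \<gamma>: "\<gamma> \<in> homset T e z" "\<gamma> \<cdot> p = g \<cdot> b2" "\<Sigma>\<^sub>a b1 \<cdot> q = h \<cdot> \<gamma>"
    by (rule tri_fill[OF t2 t 1(3) 2(3) m(3)])
  have "\<Sigma>\<^sub>a ?m \<cdot> \<Sigma>\<^sub>a a1 = Zero T (\<Sigma>\<^sub>o d) (\<Sigma>\<^sub>o j2)" using ShA_Comp[OF 1(2) m(1)] m(2) B B2 by simp
  then obtain a3 where a3: "a3 \<in> homset T (\<Sigma>\<^sub>o d) e" "q \<cdot> a3 = \<Sigma>\<^sub>a a1"
    by (rule tri_exact3[OF t2 ShA_in[OF 1(2)]])
  note B3 = tri_arr[OF t2] homsetD[OF \<gamma>(1)] homsetD[OF a3(1)]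
  have "h \<cdot> (\<gamma> \<cdot> a3) = \<Sigma>\<^sub>a b1 \<cdot> (q \<cdot> a3)" using comp_eq_extend[OF \<gamma>(3), of a3] B B1 B3 by simp
  also have "\<dots> = h \<cdot> (k \<cdot> \<theta>)" using a3(2) Sh_Comp[of a1 b1] k1(2) 1(4) B1 by simp
  finally have hh: "h \<cdot> (k \<cdot> \<theta>) = h \<cdot> (\<gamma> \<cdot> a3)" by simp
  obtain l where l: "l \<in> homset T (\<Sigma>\<^sub>o d) y" "k \<cdot> \<theta> = g \<cdot> l \<boxplus> \<gamma> \<cdot> a3"
    by (rule tri_exact2_diff[OF t Comp_in[OF d(2) k] Comp_in[OF a3(1) \<gamma>(1)] hh])
  have "factors_via J (\<Sigma>\<^sub>o d) y l" using y Sdc l(1) unfolding ind_closure_def by blast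
  then have "factors_via J (\<Sigma>\<^sub>o d) z (g \<cdot> l)" by (rule factors_via_left[OF _ triD(3)[OF t]])
  moreover have "factors_via J (\<Sigma>\<^sub>o d) z (\<gamma> \<cdot> a3)" using eJ a3(1) \<gamma>(1) unfolding factors_via_def by blast
  ultimately have "factors_via J (\<Sigma>\<^sub>o d) z (k \<cdot> \<theta>)" unfolding l(2) by (rule factors_via_Plus[OF J(1)])
  then have "factors_via J c z ((k \<cdot> \<theta>) \<cdot> \<theta>')" by (rule factors_via_right[OF _ d(3)])
  then show "factors_via J c z k" using B d(4) by simp
qed

lemma ind_closure_localizing:
  fixes \<kappa> :: "'u rel"
  assumes J: "triangulated_subcategory T J" "J \<subseteq> compact_objects \<kappa> T"
  shows "localizing_subcategory \<kappa> T (ind_closure \<kappa> J)"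
  unfolding localizing_subcategory_def
proof (intro conjI allI impI)
  note JO = triangulated_subcategoryD[OF J(1)]
  show "triangulated_subcategory T (ind_closure \<kappa> J)"
  proof (rule triangulated_subcategoryI)
    show "ind_closure \<kappa> J \<subseteq> Obj T" by (auto simp: ind_closure_def)
    show "z \<in> ind_closure \<kappa> J" if "is_zero_obj T z" for z
      using JO(1,2) that ind_closure_superset[of J] by blast
    show "z \<in> ind_closure \<kappa> J" if "tri f g h x y z" "x \<in> ind_closure \<kappa> J" "y \<in> ind_closure \<kappa> J" for f g h x y z
      by (rule ind_closure_cone[OF J that])
    show "y \<in> ind_closure \<kappa> J" if x: "x \<in> ind_closure \<kappa> J" and i: "isomorphic T x y" for x y
      unfolding ind_closure_def
    proof (intro CollectI conjI ballI)
      show "y \<in> Obj T" using isomorphic_obj[OF i] by blast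
      fix c k assume c: "c \<in> compact_objects \<kappa> T" and k: "k \<in> homset T c y"
      obtain f g where fg: "f \<in> homset T x y" "g \<in> homset T y x" "f \<cdot> g = Id T y" using i by (rule isomorphicE)
      have "factors_via J c x (g \<cdot> k)" using x c Comp_in[OF k fg(2)] unfolding ind_closure_def by blast
      then have "factors_via J c y (f \<cdot> (g \<cdot> k))" by (rule factors_via_left[OF _ fg(1)])
      then show "factors_via J c y k"
        using comp_eq_assoc[OF fg(3), of k] homsetD[OF fg(1)] homsetD[OF fg(2)] homsetD[OF k] by simp
    qed
    show "\<Sigma>\<^sub>o x \<in> ind_closure \<kappa> J" if x: "x \<in> ind_closure \<kappa> J" for x
      unfolding ind_closure_def
    proof (intro CollectI conjI ballI)
      have xo: "x \<in> Obj T" using x by (simp add: ind_closure_def)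
      then show "\<Sigma>\<^sub>o x \<in> Obj T" by simp
      fix c k assume c: "c \<in> compact_objects \<kappa> T" and k: "k \<in> homset T c (\<Sigma>\<^sub>o x)"
      have co: "c \<in> Obj T" using compact_obj c by blast
      obtain d \<theta> \<theta>' where d: "d \<in> Obj T" "\<theta> \<in> homset T (\<Sigma>\<^sub>o d) c" "\<theta>' \<in> homset T c (\<Sigma>\<^sub>o d)" "\<theta> \<cdot> \<theta>' = Id T c" "isomorphic T (\<Sigma>\<^sub>o d) c"
        using Sh_ess_surj[OF co] isomorphicE by metis
      have dc: "d \<in> compact_objects \<kappa> T"
        using compact_retract[OF c isomorphic_retract[OF d(5)]] compact_Sh_reflects d(1) by blast
      obtain k1 where k1: "k1 \<in> homset T d x" "\<Sigma>\<^sub>a k1 = k \<cdot> \<theta>" by (rule Sh_full[OF d(1) xo Comp_in[OF d(2) k]])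
      obtain j a b where j: "j \<in> J" "a \<in> homset T d j" "b \<in> homset T j x" "k1 = b \<cdot> a"
        using x dc k1(1) unfolding ind_closure_def factors_via_def by blast
      have "\<Sigma>\<^sub>o j \<in> J" using JO(1,4) j(1) by blast
      moreover have "k \<cdot> \<theta> = \<Sigma>\<^sub>a b \<cdot> \<Sigma>\<^sub>a a" using k1(2) j(4) ShA_Comp[OF j(2,3)] by simp
      ultimately have "factors_via J (\<Sigma>\<^sub>o d) (\<Sigma>\<^sub>o x) (k \<cdot> \<theta>)"
        using ShA_in j(2,3) unfolding factors_via_def by blast
      then have "factors_via J c (\<Sigma>\<^sub>o x) ((k \<cdot> \<theta>) \<cdot> \<theta>')" by (rule factors_via_right[OF _ d(3)])
      then show "factors_via J c (\<Sigma>\<^sub>o x) k" using homsetD[OF d(2)] homsetD[OF d(3)] homsetD[OF k] d(4) by simp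
    qed
    show "x \<in> ind_closure \<kappa> J" if xo: "x \<in> Obj T" and x: "\<Sigma>\<^sub>o x \<in> ind_closure \<kappa> J" for x
      unfolding ind_closure_def
    proof (intro CollectI conjI ballI)
      fix c k assume c: "c \<in> compact_objects \<kappa> T" and k: "k \<in> homset T c x"
      have co: "c \<in> Obj T" using compact_obj c by blast
      obtain j a b where j: "j \<in> J" "a \<in> homset T (\<Sigma>\<^sub>o c) j" "b \<in> homset T j (\<Sigma>\<^sub>o x)" "\<Sigma>\<^sub>a k = b \<cdot> a"
        using x compact_Sh[OF c] ShA_in[OF k] unfolding ind_closure_def factors_via_def by blast
      \<comment> \<open>The factorization of \<Sigma>k is brought down by one suspension. The
        desuspension j' belongs to J because \<Sigma>j' is isomorphic to j.\<close>
      obtain j' \<theta> \<theta>' where d: "j' \<in> Obj T" "\<theta> \<in> homset T (\<Sigma>\<^sub>o j') j" "\<theta>' \<in> homset T j (\<Sigma>\<^sub>o j')" "\<theta> \<cdot> \<theta>' = Id T j" "isomorphic T (\<Sigma>\<^sub>o j') j"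
        using Sh_ess_surj[OF JO(1)[OF j(1)]] isomorphicE by metis
      have j': "j' \<in> J" using JO(3)[OF j(1) isomorphic_sym[OF d(5)]] JO(4)[OF d(1)] by blast
      obtain a' where a': "a' \<in> homset T c j'" "\<Sigma>\<^sub>a a' = \<theta>' \<cdot> a" by (rule Sh_full[OF co d(1) Comp_in[OF j(2) d(3)]])
      obtain b' where b': "b' \<in> homset T j' x" "\<Sigma>\<^sub>a b' = b \<cdot> \<theta>" by (rule Sh_full[OF d(1) xo Comp_in[OF d(2) j(3)]])
      have "\<Sigma>\<^sub>a (b' \<cdot> a') = (b \<cdot> \<theta>) \<cdot> (\<theta>' \<cdot> a)" using ShA_Comp[OF a'(1) b'(1)] a' b' by simp
      also have "\<dots> = \<Sigma>\<^sub>a k"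
        using comp_eq_assoc[OF d(4), of a] j(4) homsetD[OF d(2)] homsetD[OF d(3)] homsetD[OF j(2)] homsetD[OF j(3)] by simp
      finally have "k = b' \<cdot> a'" using Sh_faithful[OF Comp_in[OF a'(1) b'(1)] k] by simp
      then show "factors_via J c x k" using j' a'(1) b'(1) unfolding factors_via_def by blast
    qed (rule xo)
  qed
  fix I :: "'u set" and t w \<iota> assume I: "small \<kappa> I" and w: "is_coproduct T I t w \<iota>" and t: "\<forall>i\<in>I. t i \<in> ind_closure \<kappa> J"
  note o = coproduct_in[OF w]
  show "w \<in> ind_closure \<kappa> J" unfolding ind_closure_def
  proof (intro CollectI conjI ballI)
    show "w \<in> Obj T" by (rule o(1))
    fix c k assume c: "c \<in> compact_objects \<kappa> T" and k: "k \<in> homset T c w"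
    have co: "c \<in> Obj T" using compact_obj c by blast
    have "fin_map I t \<iota> c w k" using c I w k by (rule compactD)
    then obtain F a where F: "finite F" "F \<subseteq> I" "\<And>i. i \<in> F \<Longrightarrow> a i \<in> homset T c (t i)" "k = asum c w (\<lambda>i. \<iota> i \<cdot> a i) F"
      using that by (rule fin_mapE)
    have "factors_via J c w (asum c w (\<lambda>i. \<iota> i \<cdot> a i) F)" using F(1-3)
    proof (induction F)
      case empty
      obtain z where z: "is_zero_obj T z" "z \<in> Obj T" by (rule zero_obj_obtain)
      have "Zero T c w = Zero T z w \<cdot> Zero T c z" using z(2) co o(1) by simp
      then have "factors_via J c w (Zero T c w)"
        unfolding factors_via_def using JO(2)[OF z(1)] Zero_in[OF co z(2)] Zero_in[OF z(2) o(1)] by blast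
      then show ?case using co o(1) by simp
    next
      case (insert i F)
      have iI: "i \<in> I" and ai: "a i \<in> homset T c (t i)" using insert.prems by auto
      have "factors_via J c (t i) (a i)" using t iI c ai unfolding ind_closure_def by blast
      then have "factors_via J c w (\<iota> i \<cdot> a i)" by (rule factors_via_left[OF _ o(2)[OF iI]])
      moreover have "factors_via J c w (asum c w (\<lambda>i. \<iota> i \<cdot> a i) F)" using insert by auto
      moreover have "asum c w (\<lambda>i. \<iota> i \<cdot> a i) (insert i F) = \<iota> i \<cdot> a i \<boxplus> asum c w (\<lambda>i. \<iota> i \<cdot> a i) F"
        by (rule asum_insert[OF co o(1) insert(1,2)])
           (use Comp_in[OF insert.prems(2) o(2)] insert.prems(1) in auto)
      ultimately show ?case using factors_via_Plus[OF J(1)] by simp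
    qed
    then show "factors_via J c w k" using F(4) by simp
  qed
qed

text \<open>For compact x the identity of x is one of the maps that must factor through J.\<close>

lemma compact_ind_closure_retract:
  assumes "x \<in> compact_objects \<kappa> T" "x \<in> ind_closure \<kappa> J"
  obtains j where "j \<in> J" "retract x j"
proof -
  have "Id T x \<in> homset T x x" using compact_obj[OF assms(1)] Id_in by blast
  then have "factors_via J x x (Id T x)" using assms unfolding ind_closure_def by blast
  then obtain j a b where "j \<in> J" "a \<in> homset T x j" "b \<in> homset T j x" "Id T x = b \<cdot> a" by (auto simp: factors_via_def)
  then show thesis using that retractI[of a x j b] by simp
qed

end

section \<open>Tensor products\<close>

context symmetric_monoidal_category
begin

lemma Unit_obj [simp]: "\<one>\<^sub>T \<in> Obj T"
  by (rule Unit_in)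

lemma TenO_obj [simp]: "\<lbrakk>x \<in> Obj T; y \<in> Obj T\<rbrakk> \<Longrightarrow> x \<boxtimes> y \<in> Obj T"
  by (rule TenO_in)

lemma TenA_arr [simp]:
  assumes "f \<in> Arr T" "g \<in> Arr T"
  shows "f \<boxdot> g \<in> Arr T" "Dom T (f \<boxdot> g) = Dom T f \<boxtimes> Dom T g" "Cod T (f \<boxdot> g) = Cod T f \<boxtimes> Cod T g"
  using TenA_in[of f "Dom T f" "Cod T f" g "Dom T g" "Cod T g"] assms by (auto simp: homset_iff)

lemma structure_arr [simp]:
  assumes "x \<in> Obj T"
  shows "LUnit T x \<in> Arr T" "Dom T (LUnit T x) = \<one>\<^sub>T \<boxtimes> x" "Cod T (LUnit T x) = x"
    "RUnit T x \<in> Arr T" "Dom T (RUnit T x) = x \<boxtimes> \<one>\<^sub>T" "Cod T (RUnit T x) = x"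
  using LUnit_in[OF assms] RUnit_in[OF assms] by (auto simp: homset_iff)

lemma Assoc_arr [simp]:
  assumes "x \<in> Obj T" "y \<in> Obj T" "z \<in> Obj T"
  shows "Assoc T x y z \<in> Arr T" "Dom T (Assoc T x y z) = (x \<boxtimes> y) \<boxtimes> z" "Cod T (Assoc T x y z) = x \<boxtimes> (y \<boxtimes> z)"
  using Assoc_in[OF assms] by (auto simp: homset_iff)

lemma Braid_arr [simp]:
  assumes "x \<in> Obj T" "y \<in> Obj T"
  shows "Braid T x y \<in> Arr T" "Dom T (Braid T x y) = x \<boxtimes> y" "Cod T (Braid T x y) = y \<boxtimes> x"
  using Braid_in[OF assms] by (auto simp: homset_iff)

lemma ten_merge:
  "\<lbrakk>f \<in> Arr T; f' \<in> Arr T; g \<in> Arr T; g' \<in> Arr T; Cod T f = Dom T f'; Cod T g = Dom T g'\<rbrakk>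
    \<Longrightarrow> (f' \<boxdot> g') \<cdot> (f \<boxdot> g) = (f' \<cdot> f) \<boxdot> (g' \<cdot> g)"
  by (rule TenA_Comp[symmetric]) (auto simp: homset_iff)

lemma ten_merge_left:
  "\<lbrakk>f \<in> Arr T; f' \<in> Arr T; Cod T f = Dom T f'; w \<in> Obj T\<rbrakk> \<Longrightarrow> (f' \<boxdot> Id T w) \<cdot> (f \<boxdot> Id T w) = (f' \<cdot> f) \<boxdot> Id T w"
  using ten_merge[of f f' "Id T w" "Id T w"] by simp

lemma ten_merge_right:
  "\<lbrakk>f \<in> Arr T; f' \<in> Arr T; Cod T f = Dom T f'; w \<in> Obj T\<rbrakk> \<Longrightarrow> (Id T w \<boxdot> f') \<cdot> (Id T w \<boxdot> f) = Id T w \<boxdot> (f' \<cdot> f)"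
  using ten_merge[of "Id T w" "Id T w" f f'] by simp

lemma ten_iso:
  assumes "is_iso_arr T f" "f \<in> homset T x y" "is_iso_arr T g" "g \<in> homset T v w"
  shows "is_iso_arr T (f \<boxdot> g)"
proof -
  obtain f' where f': "f' \<in> homset T y x" "f' \<cdot> f = Id T x" "f \<cdot> f' = Id T y" using iso_arrE[OF assms(1,2)] by metis
  obtain g' where g': "g' \<in> homset T w v" "g' \<cdot> g = Id T v" "g \<cdot> g' = Id T w" using iso_arrE[OF assms(3,4)] by metis
  note A = homsetD[OF assms(2)] homsetD[OF assms(4)] homsetD[OF f'(1)] homsetD[OF g'(1)]
    hom_obj[OF assms(2)] hom_obj[OF assms(4)]
  show ?thesis
    by (rule iso_arrI[OF TenA_in[OF assms(2,4)] TenA_in[OF f'(1) g'(1)]])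
       (use A f' g' ten_merge[of f f' g g'] ten_merge[of f' f g' g] TenA_Id in simp_all)
qed

lemma ten_isomorphic:
  assumes "isomorphic T x x'" "isomorphic T y y'"
  shows "isomorphic T (x \<boxtimes> y) (x' \<boxtimes> y')"
  using assms ten_iso TenA_in unfolding isomorphic_def by metis

lemma Braid_iso: "\<lbrakk>x \<in> Obj T; y \<in> Obj T\<rbrakk> \<Longrightarrow> is_iso_arr T (Braid T x y)"
  by (rule iso_arrI[OF Braid_in Braid_in]) (auto simp: Braid_symmetric)

lemma Braid_isomorphic: "\<lbrakk>x \<in> Obj T; y \<in> Obj T\<rbrakk> \<Longrightarrow> isomorphic T (x \<boxtimes> y) (y \<boxtimes> x)"
  by (rule isomorphicI[OF Braid_in Braid_iso])

lemma Assoc_isomorphic: "\<lbrakk>x \<in> Obj T; y \<in> Obj T; z \<in> Obj T\<rbrakk> \<Longrightarrow> isomorphic T ((x \<boxtimes> y) \<boxtimes> z) (x \<boxtimes> (y \<boxtimes> z))"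
  by (rule isomorphicI[OF Assoc_in Assoc_iso])

lemma LUnit_isomorphic: "x \<in> Obj T \<Longrightarrow> isomorphic T (\<one>\<^sub>T \<boxtimes> x) x"
  by (rule isomorphicI[OF LUnit_in LUnit_iso])

lemma RUnit_isomorphic: "x \<in> Obj T \<Longrightarrow> isomorphic T (x \<boxtimes> \<one>\<^sub>T) x"
  by (rule isomorphicI[OF RUnit_in RUnit_iso])

lemma LUnit_nat: "\<lbrakk>f \<in> Arr T; Dom T f = x; Cod T f = y\<rbrakk> \<Longrightarrow> LUnit T y \<cdot> (Id T \<one>\<^sub>T \<boxdot> f) = f \<cdot> LUnit T x"
  by (rule LUnit_natural) (auto simp: homset_iff)

lemma Assoc_nat1:
  "\<lbrakk>f \<in> homset T x x'; y \<in> Obj T; z \<in> Obj T\<rbrakk>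
    \<Longrightarrow> Assoc T x' y z \<cdot> ((f \<boxdot> Id T y) \<boxdot> Id T z) = (f \<boxdot> Id T (y \<boxtimes> z)) \<cdot> Assoc T x y z"
  using Assoc_natural[of f x x' "Id T y" y y "Id T z" z z] Id_in TenA_Id[of y z] by simp

lemma Assoc_nat2:
  "\<lbrakk>f \<in> homset T y y'; x \<in> Obj T; z \<in> Obj T\<rbrakk>
    \<Longrightarrow> Assoc T x y' z \<cdot> ((Id T x \<boxdot> f) \<boxdot> Id T z) = (Id T x \<boxdot> (f \<boxdot> Id T z)) \<cdot> Assoc T x y z"
  using Assoc_natural[of "Id T x" x x f y y' "Id T z" z z] Id_in by simp

lemma Assoc_nat3:
  "\<lbrakk>f \<in> homset T z z'; x \<in> Obj T; y \<in> Obj T\<rbrakk>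
    \<Longrightarrow> Assoc T x y z' \<cdot> (Id T (x \<boxtimes> y) \<boxdot> f) = (Id T x \<boxdot> (Id T y \<boxdot> f)) \<cdot> Assoc T x y z"
  using Assoc_natural[of "Id T x" x x "Id T y" y y f z z'] Id_in TenA_Id[of x y] by simp

lemma unit_tensor_faithful:
  assumes f: "f \<in> homset T x y" and g: "g \<in> homset T x y" and e: "Id T \<one>\<^sub>T \<boxdot> f = Id T \<one>\<^sub>T \<boxdot> g"
  shows "f = g"
proof -
  note o = hom_obj[OF f]
  have "f \<cdot> LUnit T x = g \<cdot> LUnit T x" using LUnit_natural[OF f] LUnit_natural[OF g] e by simp
  then show ?thesis by (rule iso_cancel_right[OF LUnit_iso[OF o(1)] LUnit_in[OF o(1)] f g])
qed

lemma tensor_unit_faithful: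
  assumes f: "f \<in> homset T x y" and g: "g \<in> homset T x y" and e: "f \<boxdot> Id T \<one>\<^sub>T = g \<boxdot> Id T \<one>\<^sub>T"
  shows "f = g"
proof -
  note o = hom_obj[OF f]
  have "f \<cdot> RUnit T x = g \<cdot> RUnit T x" using RUnit_natural[OF f] RUnit_natural[OF g] e by simp
  then show ?thesis by (rule iso_cancel_right[OF RUnit_iso[OF o(1)] RUnit_in[OF o(1)] f g])
qed

text \<open>Kelly's argument: the pentagon for \<open>1, 1, x, y\<close>, with the outer unit cancelled.\<close>

lemma LUnit_tensor:
  assumes x: "x \<in> Obj T" and y: "y \<in> Obj T"
  shows "LUnit T (x \<boxtimes> y) \<cdot> Assoc T \<one>\<^sub>T x y = LUnit T x \<boxdot> Id T y"
proof (rule unit_tensor_faithful)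
  let ?I = "Id T \<one>\<^sub>T" and ?l = "LUnit T" and ?a = "Assoc T" and ?u = "\<one>\<^sub>T"
  \<comment> \<open>The part of the pentagon that is common to both sides. Being invertible, it can
    be cancelled once the two composites with it agree.\<close>
  let ?P = "?a ?u (?u \<boxtimes> x) y \<cdot> (?a ?u ?u x \<boxdot> Id T y)"
  have P: "?P \<in> homset T (((?u \<boxtimes> ?u) \<boxtimes> x) \<boxtimes> y) (?u \<boxtimes> ((?u \<boxtimes> x) \<boxtimes> y))"
    using x y by (simp add: homset_iff)
  have Piso: "is_iso_arr T ?P"
    by (rule iso_comp[OF ten_iso[OF Assoc_iso Assoc_in iso_Id Id_in] Assoc_iso TenA_in[OF Assoc_in Id_in] Assoc_in])
       (use x y in auto)
  have t: "(?I \<boxdot> ?l z) \<cdot> ?a ?u ?u z = RUnit T ?u \<boxdot> Id T z" if "z \<in> Obj T" for z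
    using unit_triangle[of ?u z] that by simp
  have "(?I \<boxdot> (?l (x \<boxtimes> y) \<cdot> ?a ?u x y)) \<cdot> ?P = (?I \<boxdot> ?l (x \<boxtimes> y)) \<cdot> ((?I \<boxdot> ?a ?u x y) \<cdot> ?P)"
    using x y ten_merge_right[of "?a ?u x y" "?l (x \<boxtimes> y)" ?u, symmetric] by simp
  also have "(?I \<boxdot> ?a ?u x y) \<cdot> ?P = ?a ?u ?u (x \<boxtimes> y) \<cdot> ?a (?u \<boxtimes> ?u) x y"
    using pentagon[of ?u ?u x y] x y by simp
  also have "(?I \<boxdot> ?l (x \<boxtimes> y)) \<cdot> (?a ?u ?u (x \<boxtimes> y) \<cdot> ?a (?u \<boxtimes> ?u) x y) = (RUnit T ?u \<boxdot> Id T (x \<boxtimes> y)) \<cdot> ?a (?u \<boxtimes> ?u) x y"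
    using comp_eq_assoc[OF t[of "x \<boxtimes> y"], of "?a (?u \<boxtimes> ?u) x y"] x y by simp
  also have "\<dots> = ?a ?u x y \<cdot> ((RUnit T ?u \<boxdot> Id T x) \<boxdot> Id T y)"
    using Assoc_nat1[OF RUnit_in[OF Unit_in] x y] by simp
  also have "(RUnit T ?u \<boxdot> Id T x) \<boxdot> Id T y = ((?I \<boxdot> ?l x) \<boxdot> Id T y) \<cdot> (?a ?u ?u x \<boxdot> Id T y)"
    using ten_merge_left[of "?a ?u ?u x" "?I \<boxdot> ?l x" y] t[OF x] x y by simp
  also have "?a ?u x y \<cdot> \<dots> = (?I \<boxdot> (?l x \<boxdot> Id T y)) \<cdot> ?P"
    using comp_eq_extend[OF Assoc_nat2[OF LUnit_in[OF x] Unit_in y], of "?a ?u ?u x \<boxdot> Id T y"] x y by simp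
  finally have e: "(?I \<boxdot> (?l (x \<boxtimes> y) \<cdot> ?a ?u x y)) \<cdot> ?P = (?I \<boxdot> (?l x \<boxdot> Id T y)) \<cdot> ?P" .
  show "?I \<boxdot> (?l (x \<boxtimes> y) \<cdot> ?a ?u x y) = ?I \<boxdot> (?l x \<boxdot> Id T y)"
    by (rule iso_cancel_right[OF Piso P _ _ e]) (use x y in \<open>auto simp: homset_iff\<close>)
  show "?l (x \<boxtimes> y) \<cdot> ?a ?u x y \<in> homset T ((?u \<boxtimes> x) \<boxtimes> y) (x \<boxtimes> y)" using x y by (simp add: homset_iff)
  show "?l x \<boxdot> Id T y \<in> homset T ((?u \<boxtimes> x) \<boxtimes> y) (x \<boxtimes> y)" using x y by (simp add: homset_iff)
qed

text \<open>Naturality of the left unit constraint at itself identifies its value on 1 \<otimes> 1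
  with 1 \<otimes> l. Then \<open>LUnit_tensor\<close> and the unit triangle have equal left sides,
  and tensoring with the unit is faithful.\<close>

lemma LUnit_Unit_eq: "LUnit T \<one>\<^sub>T = RUnit T \<one>\<^sub>T"
proof (rule tensor_unit_faithful[OF LUnit_in[OF Unit_in] RUnit_in[OF Unit_in]])
  let ?I = "Id T \<one>\<^sub>T" and ?l = "LUnit T \<one>\<^sub>T" and ?u = "\<one>\<^sub>T"
  have "LUnit T (?u \<boxtimes> ?u) = ?I \<boxdot> ?l"
    by (rule iso_cancel_left[OF LUnit_iso[OF Unit_in] LUnit_in[OF Unit_in], symmetric])
       (use LUnit_nat[of ?l "?u \<boxtimes> ?u" ?u] in \<open>auto simp: homset_iff\<close>)
  then show "?l \<boxdot> ?I = RUnit T ?u \<boxdot> ?I" using LUnit_tensor[of ?u ?u] unit_triangle[of ?u ?u] by simp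
qed

section \<open>Dual pairs and the adjunctions they induce\<close>

definition dual_pair where
  "dual_pair x y \<eta> \<epsilon> \<longleftrightarrow> x \<in> Obj T \<and> y \<in> Obj T \<and> \<eta> \<in> homset T \<one>\<^sub>T (x \<boxtimes> y) \<and> \<epsilon> \<in> homset T (y \<boxtimes> x) \<one>\<^sub>T \<and>
    RUnit T x \<cdot> (Id T x \<boxdot> \<epsilon>) \<cdot> Assoc T x y x \<cdot> (\<eta> \<boxdot> Id T x) = LUnit T x \<and>
    LUnit T y \<cdot> (\<epsilon> \<boxdot> Id T y) \<cdot> inverse_arr T (Assoc T y x y) \<cdot> (Id T y \<boxdot> \<eta>) = RUnit T y"

lemma dualizable_iff: "x \<in> dualizable_objects T \<longleftrightarrow> (\<exists>y \<eta> \<epsilon>. dual_pair x y \<eta> \<epsilon>)"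
  unfolding dualizable_objects_def dual_pair_def by blast

lemma dual_pairD:
  assumes "dual_pair x y \<eta> \<epsilon>"
  shows "x \<in> Obj T" "y \<in> Obj T" "\<eta> \<in> homset T \<one>\<^sub>T (x \<boxtimes> y)" "\<epsilon> \<in> homset T (y \<boxtimes> x) \<one>\<^sub>T"
    "RUnit T x \<cdot> (Id T x \<boxdot> \<epsilon>) \<cdot> Assoc T x y x \<cdot> (\<eta> \<boxdot> Id T x) = LUnit T x"
    "LUnit T y \<cdot> (\<epsilon> \<boxdot> Id T y) \<cdot> inverse_arr T (Assoc T y x y) \<cdot> (Id T y \<boxdot> \<eta>) = RUnit T y"
  using assms unfolding dual_pair_def by auto

text \<open>The unit is its own dual, with \<open>LUnit\<close> as evaluation and its inverse as
  coevaluation. Under rigidity this makes the unit compact.\<close>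

lemma Unit_dualizable: "\<one>\<^sub>T \<in> dualizable_objects T"
proof -
  let ?I = "Id T \<one>\<^sub>T" and ?l = "LUnit T \<one>\<^sub>T" and ?u = "\<one>\<^sub>T"
  obtain l' where l': "l' \<in> homset T ?u (?u \<boxtimes> ?u)" "l' \<cdot> ?l = Id T (?u \<boxtimes> ?u)" "?l \<cdot> l' = ?I"
    using iso_arrE[OF LUnit_iso[OF Unit_in] LUnit_in[OF Unit_in]] by metis
  obtain a' where a': "a' \<in> homset T (?u \<boxtimes> (?u \<boxtimes> ?u)) ((?u \<boxtimes> ?u) \<boxtimes> ?u)" "Assoc T ?u ?u ?u \<cdot> a' = Id T (?u \<boxtimes> (?u \<boxtimes> ?u))"
    "inverse_arr T (Assoc T ?u ?u ?u) = a'"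
    using iso_arrE[OF Assoc_iso Assoc_in, of ?u ?u ?u] by (metis Unit_in)
  note A = homsetD[OF l'(1)] homsetD[OF a'(1)]
  have t: "(?I \<boxdot> ?l) \<cdot> Assoc T ?u ?u ?u = ?l \<boxdot> ?I" using unit_triangle[of ?u ?u] LUnit_Unit_eq by simp
  have I: "?I \<boxdot> ?I = Id T (?u \<boxtimes> ?u)" using TenA_Id by simp
  have "(?I \<boxdot> ?l) \<cdot> Assoc T ?u ?u ?u \<cdot> (l' \<boxdot> ?I) = (?l \<boxdot> ?I) \<cdot> (l' \<boxdot> ?I)"
    using comp_eq_assoc[OF t, of "l' \<boxdot> ?I"] A by simp
  also have "\<dots> = Id T (?u \<boxtimes> ?u)" using ten_merge_left[of l' ?l ?u] l'(3) I A by simp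
  finally have 1: "RUnit T ?u \<cdot> (?I \<boxdot> ?l) \<cdot> Assoc T ?u ?u ?u \<cdot> (l' \<boxdot> ?I) = ?l" using LUnit_Unit_eq by simp
  have "(?l \<boxdot> ?I) \<cdot> a' = ((?I \<boxdot> ?l) \<cdot> Assoc T ?u ?u ?u) \<cdot> a'" using t by simp
  also have "\<dots> = ?I \<boxdot> ?l" using a'(2) A by simp
  finally have "(?l \<boxdot> ?I) \<cdot> a' \<cdot> (?I \<boxdot> l') = (?I \<boxdot> ?l) \<cdot> (?I \<boxdot> l')"
    using comp_eq_assoc[of "?l \<boxdot> ?I" a' "?I \<boxdot> ?l" "?I \<boxdot> l'"] A by simp
  also have "\<dots> = Id T (?u \<boxtimes> ?u)" using ten_merge_right[of l' ?l ?u] l'(3) I A by simp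
  finally have 2: "?l \<cdot> (?l \<boxdot> ?I) \<cdot> inverse_arr T (Assoc T ?u ?u ?u) \<cdot> (?I \<boxdot> l') = RUnit T ?u"
    using a'(3) LUnit_Unit_eq by simp
  show ?thesis unfolding dualizable_iff dual_pair_def
    using 1 2 l'(1) LUnit_in[OF Unit_in] Unit_in by blast
qed

text \<open>The counit \<open>y \<otimes> (x \<otimes> s) \<rightarrow> s\<close> of the adjunction between \<open>y \<otimes> -\<close> and \<open>x \<otimes> -\<close>.\<close>

definition adj_counit where
  "adj_counit x y \<epsilon> s = LUnit T s \<cdot> (\<epsilon> \<boxdot> Id T s) \<cdot> inverse_arr T (Assoc T y x s)"

lemma inverse_Assoc:
  assumes "x \<in> Obj T" "y \<in> Obj T" "z \<in> Obj T"
  shows "inverse_arr T (Assoc T x y z) \<in> homset T (x \<boxtimes> (y \<boxtimes> z)) ((x \<boxtimes> y) \<boxtimes> z)"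
    "inverse_arr T (Assoc T x y z) \<cdot> Assoc T x y z = Id T ((x \<boxtimes> y) \<boxtimes> z)"
    "Assoc T x y z \<cdot> inverse_arr T (Assoc T x y z) = Id T (x \<boxtimes> (y \<boxtimes> z))"
    "is_iso_arr T (inverse_arr T (Assoc T x y z))"
  using iso_arrE[OF Assoc_iso[OF assms] Assoc_in[OF assms]] by metis+

lemma inverse_Assoc_arr [simp]:
  assumes "x \<in> Obj T" "y \<in> Obj T" "z \<in> Obj T"
  shows "inverse_arr T (Assoc T x y z) \<in> Arr T" "Dom T (inverse_arr T (Assoc T x y z)) = x \<boxtimes> (y \<boxtimes> z)"
    "Cod T (inverse_arr T (Assoc T x y z)) = (x \<boxtimes> y) \<boxtimes> z"
  using inverse_Assoc(1)[OF assms] by (auto simp: homset_iff)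

lemma inverse_Assoc_nat3:
  assumes f: "f \<in> homset T z z'" and x: "x \<in> Obj T" and y: "y \<in> Obj T"
  shows "inverse_arr T (Assoc T x y z') \<cdot> (Id T x \<boxdot> (Id T y \<boxdot> f)) = (Id T (x \<boxtimes> y) \<boxdot> f) \<cdot> inverse_arr T (Assoc T x y z)"
proof (rule iso_cancel_left[OF Assoc_iso Assoc_in])
  note o = hom_obj[OF f] homsetD[OF f]
  let ?a = "Assoc T x y" and ?a' = "\<lambda>z. inverse_arr T (Assoc T x y z)"
  have "?a z' \<cdot> ((Id T (x \<boxtimes> y) \<boxdot> f) \<cdot> ?a' z) = ((Id T x \<boxdot> (Id T y \<boxdot> f)) \<cdot> ?a z) \<cdot> ?a' z"
    using Assoc_nat3[OF f x y] o x y comp_eq_extend[OF Assoc_nat3[OF f x y], of "?a' z"] by simp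
  also have "\<dots> = Id T x \<boxdot> (Id T y \<boxdot> f)" using inverse_Assoc(3)[OF x y o(1)] o x y by simp
  finally show "?a z' \<cdot> (?a' z' \<cdot> (Id T x \<boxdot> (Id T y \<boxdot> f))) = ?a z' \<cdot> ((Id T (x \<boxtimes> y) \<boxdot> f) \<cdot> ?a' z)"
    using comp_eq_assoc[OF inverse_Assoc(3)[OF x y o(2)], of "Id T x \<boxdot> (Id T y \<boxdot> f)"] o x y by simp
qed (use assms hom_obj[OF f] homsetD[OF f] in \<open>auto simp: homset_iff\<close>)

lemma adj_counit_in: "\<lbrakk>dual_pair x y \<eta> \<epsilon>; s \<in> Obj T\<rbrakk> \<Longrightarrow> adj_counit x y \<epsilon> s \<in> homset T (y \<boxtimes> (x \<boxtimes> s)) s"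
  using dual_pairD(1,2)[of x y \<eta> \<epsilon>] homsetD[OF dual_pairD(4)[of x y \<eta> \<epsilon>]] unfolding adj_counit_def by (simp add: homset_iff)

lemma adj_counit_natural:
  assumes d: "dual_pair x y \<eta> \<epsilon>" and f: "f \<in> homset T s s'"
  shows "adj_counit x y \<epsilon> s' \<cdot> (Id T y \<boxdot> (Id T x \<boxdot> f)) = f \<cdot> adj_counit x y \<epsilon> s"
proof -
  note A = dual_pairD(1,2)[OF d] homsetD[OF dual_pairD(4)[OF d]] homsetD[OF f] hom_obj[OF f]
  let ?a' = "\<lambda>z. inverse_arr T (Assoc T y x z)"
  have "adj_counit x y \<epsilon> s' \<cdot> (Id T y \<boxdot> (Id T x \<boxdot> f)) = LUnit T s' \<cdot> ((\<epsilon> \<boxdot> Id T s') \<cdot> (?a' s' \<cdot> (Id T y \<boxdot> (Id T x \<boxdot> f))))"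
    unfolding adj_counit_def using A by simp
  also have "?a' s' \<cdot> (Id T y \<boxdot> (Id T x \<boxdot> f)) = (Id T (y \<boxtimes> x) \<boxdot> f) \<cdot> ?a' s"
    by (rule inverse_Assoc_nat3[OF f A(2,1)])
  also have "(\<epsilon> \<boxdot> Id T s') \<cdot> \<dots> = (Id T \<one>\<^sub>T \<boxdot> f) \<cdot> ((\<epsilon> \<boxdot> Id T s) \<cdot> ?a' s)"
    by (rule comp_eq_extend)
       (use A ten_merge[of "Id T (y \<boxtimes> x)" \<epsilon> f "Id T s'"] ten_merge[of \<epsilon> "Id T \<one>\<^sub>T" "Id T s" f] in simp_all)
  also have "LUnit T s' \<cdot> \<dots> = f \<cdot> (LUnit T s \<cdot> ((\<epsilon> \<boxdot> Id T s) \<cdot> ?a' s))"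
    by (rule comp_eq_extend[OF LUnit_natural[OF f]]) (use A in simp_all)
  finally show ?thesis unfolding adj_counit_def by simp
qed

text \<open>The unit \<open>c \<rightarrow> x \<otimes> (y \<otimes> c)\<close> of the same adjunction. Only one triangle identity is needed,
  and only up to the isomorphism below.\<close>

definition adj_unit where
  "adj_unit x y \<eta> c = Assoc T x y c \<cdot> (\<eta> \<boxdot> Id T c) \<cdot> inverse_arr T (LUnit T c)"

lemma inverse_LUnit:
  assumes "x \<in> Obj T"
  shows "inverse_arr T (LUnit T x) \<in> homset T x (\<one>\<^sub>T \<boxtimes> x)"
    "inverse_arr T (LUnit T x) \<cdot> LUnit T x = Id T (\<one>\<^sub>T \<boxtimes> x)"
    "LUnit T x \<cdot> inverse_arr T (LUnit T x) = Id T x"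
  using iso_arrE[OF LUnit_iso[OF assms] LUnit_in[OF assms]] by metis+

lemma inverse_RUnit:
  assumes "x \<in> Obj T"
  shows "inverse_arr T (RUnit T x) \<in> homset T x (x \<boxtimes> \<one>\<^sub>T)"
    "inverse_arr T (RUnit T x) \<cdot> RUnit T x = Id T (x \<boxtimes> \<one>\<^sub>T)"
    "RUnit T x \<cdot> inverse_arr T (RUnit T x) = Id T x"
  using iso_arrE[OF RUnit_iso[OF assms] RUnit_in[OF assms]] by metis+

lemma adj_unit_in: "\<lbrakk>dual_pair x y \<eta> \<epsilon>; c \<in> Obj T\<rbrakk> \<Longrightarrow> adj_unit x y \<eta> c \<in> homset T c (x \<boxtimes> (y \<boxtimes> c))"
  using dual_pairD(1,2)[of x y \<eta> \<epsilon>] homsetD[OF dual_pairD(3)[of x y \<eta> \<epsilon>]] homsetD[OF inverse_LUnit(1)[of c]]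
  unfolding adj_unit_def by (simp add: homset_iff)

lemma adj_unit_natural:
  assumes d: "dual_pair x y \<eta> \<epsilon>" and k: "k \<in> homset T c w"
  shows "adj_unit x y \<eta> w \<cdot> k = (Id T x \<boxdot> (Id T y \<boxdot> k)) \<cdot> adj_unit x y \<eta> c"
proof -
  note A = dual_pairD(1,2)[OF d] homsetD[OF dual_pairD(3)[OF d]] homsetD[OF k] hom_obj[OF k]
    homsetD[OF inverse_LUnit(1)[OF hom_obj(1)[OF k]]] homsetD[OF inverse_LUnit(1)[OF hom_obj(2)[OF k]]]
  let ?l' = "\<lambda>c. inverse_arr T (LUnit T c)"
  have l: "?l' w \<cdot> k = (Id T \<one>\<^sub>T \<boxdot> k) \<cdot> ?l' c"
  proof (rule iso_cancel_left[OF LUnit_iso LUnit_in])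
    have "LUnit T w \<cdot> ((Id T \<one>\<^sub>T \<boxdot> k) \<cdot> ?l' c) = k \<cdot> (LUnit T c \<cdot> ?l' c)"
      by (rule comp_eq_extend[OF LUnit_natural[OF k]]) (use A in simp_all)
    also have "\<dots> = k" using inverse_LUnit(3) A by simp
    finally show "LUnit T w \<cdot> (?l' w \<cdot> k) = LUnit T w \<cdot> ((Id T \<one>\<^sub>T \<boxdot> k) \<cdot> ?l' c)"
      using comp_eq_assoc[OF inverse_LUnit(3)[OF A(10)], of k] A by simp
  qed (use A in \<open>auto simp: homset_iff\<close>)
  have "adj_unit x y \<eta> w \<cdot> k = Assoc T x y w \<cdot> ((\<eta> \<boxdot> Id T w) \<cdot> (?l' w \<cdot> k))"
    unfolding adj_unit_def using A by simp
  also have "\<dots> = Assoc T x y w \<cdot> ((\<eta> \<boxdot> Id T w) \<cdot> ((Id T \<one>\<^sub>T \<boxdot> k) \<cdot> ?l' c))" unfolding l ..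
  also have "(\<eta> \<boxdot> Id T w) \<cdot> ((Id T \<one>\<^sub>T \<boxdot> k) \<cdot> ?l' c) = (Id T (x \<boxtimes> y) \<boxdot> k) \<cdot> ((\<eta> \<boxdot> Id T c) \<cdot> ?l' c)"
    by (rule comp_eq_extend)
       (use A ten_merge[of "Id T \<one>\<^sub>T" \<eta> k "Id T w"] ten_merge[of \<eta> "Id T (x \<boxtimes> y)" "Id T c" k] in simp_all)
  also have "Assoc T x y w \<cdot> \<dots> = (Id T x \<boxdot> (Id T y \<boxdot> k)) \<cdot> (Assoc T x y c \<cdot> ((\<eta> \<boxdot> Id T c) \<cdot> ?l' c))"
    by (rule comp_eq_extend[OF Assoc_nat3[OF k A(1,2)]]) (use A in simp_all)
  finally show ?thesis unfolding adj_unit_def by simp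
qed

lemma iso_comp_iff_right:
  assumes "is_iso_arr T f" "f \<in> homset T x y" "g \<in> homset T y z" "is_iso_arr T (g \<cdot> f)"
  shows "is_iso_arr T g"
proof -
  obtain f' where f': "f' \<in> homset T y x" "f \<cdot> f' = Id T y" "is_iso_arr T f'" using iso_arrE[OF assms(1,2)] by metis
  have "is_iso_arr T ((g \<cdot> f) \<cdot> f')" by (rule iso_comp[OF f'(3) assms(4) f'(1) Comp_in[OF assms(2,3)]])
  then show ?thesis using f'(2) homsetD[OF f'(1)] homsetD[OF assms(2)] homsetD[OF assms(3)] by simp
qed

text \<open>Precomposed with the isomorphism ?Q, which absorbs the inverse unit constraint and
  rebrackets, the composite becomes the first duality identity tensored with s, hence an
  isomorphism.\<close>

lemma triangle_iso:
  assumes d: "dual_pair x y \<eta> \<epsilon>" and s: "s \<in> Obj T"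
  shows "is_iso_arr T ((Id T x \<boxdot> adj_counit x y \<epsilon> s) \<cdot> adj_unit x y \<eta> (x \<boxtimes> s))"
proof -
  note o = dual_pairD(1,2)[OF d] s
  note A = o homsetD[OF dual_pairD(3)[OF d]] homsetD[OF dual_pairD(4)[OF d]]
    homsetD[OF adj_counit_in[OF d s]] homsetD[OF adj_unit_in[OF d, of "x \<boxtimes> s"]]
    homsetD[OF inverse_LUnit(1)[of "x \<boxtimes> s"]]
  let ?u = "\<one>\<^sub>T" and ?a = "Assoc T"
  let ?Q = "LUnit T (x \<boxtimes> s) \<cdot> ?a ?u x s"
  let ?P = "(Id T x \<boxdot> adj_counit x y \<epsilon> s) \<cdot> adj_unit x y \<eta> (x \<boxtimes> s)"
  have "adj_unit x y \<eta> (x \<boxtimes> s) \<cdot> ?Q = ?a x y (x \<boxtimes> s) \<cdot> ((\<eta> \<boxdot> Id T (x \<boxtimes> s)) \<cdot> ((inverse_arr T (LUnit T (x \<boxtimes> s)) \<cdot> LUnit T (x \<boxtimes> s)) \<cdot> ?a ?u x s))"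
    unfolding adj_unit_def using A by simp
  also have "\<dots> = ?a x y (x \<boxtimes> s) \<cdot> ((\<eta> \<boxdot> Id T (x \<boxtimes> s)) \<cdot> ?a ?u x s)"
    using inverse_LUnit(2)[of "x \<boxtimes> s"] A by simp
  also have "(\<eta> \<boxdot> Id T (x \<boxtimes> s)) \<cdot> ?a ?u x s = ?a (x \<boxtimes> y) x s \<cdot> ((\<eta> \<boxdot> Id T x) \<boxdot> Id T s)"
    using Assoc_nat1[OF dual_pairD(3)[OF d] o(1,3)] by simp
  also have "?a x y (x \<boxtimes> s) \<cdot> \<dots> = (?a x y (x \<boxtimes> s) \<cdot> ?a (x \<boxtimes> y) x s) \<cdot> ((\<eta> \<boxdot> Id T x) \<boxdot> Id T s)"
    using A by simp
  also have "?a x y (x \<boxtimes> s) \<cdot> ?a (x \<boxtimes> y) x s = (Id T x \<boxdot> ?a y x s) \<cdot> ?a x (y \<boxtimes> x) s \<cdot> (?a x y x \<boxdot> Id T s)"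
    by (rule pentagon) (use A in auto)
  finally have 1: "adj_unit x y \<eta> (x \<boxtimes> s) \<cdot> ?Q = (Id T x \<boxdot> ?a y x s) \<cdot> (?a x (y \<boxtimes> x) s \<cdot> ((?a x y x \<boxdot> Id T s) \<cdot> ((\<eta> \<boxdot> Id T x) \<boxdot> Id T s)))"
    using A by simp
  have c: "adj_counit x y \<epsilon> s \<cdot> ?a y x s = LUnit T s \<cdot> (\<epsilon> \<boxdot> Id T s)"
    unfolding adj_counit_def using inverse_Assoc(2)[OF o(2,1,3)] A by simp
  have 2: "(Id T x \<boxdot> adj_counit x y \<epsilon> s) \<cdot> (Id T x \<boxdot> ?a y x s) = (Id T x \<boxdot> LUnit T s) \<cdot> (Id T x \<boxdot> (\<epsilon> \<boxdot> Id T s))"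
    using ten_merge_right[of "?a y x s" "adj_counit x y \<epsilon> s" x] ten_merge_right[of "\<epsilon> \<boxdot> Id T s" "LUnit T s" x] c A by simp
  have "?P \<cdot> ?Q = (Id T x \<boxdot> adj_counit x y \<epsilon> s) \<cdot> (adj_unit x y \<eta> (x \<boxtimes> s) \<cdot> ?Q)" using A by simp
  also have "\<dots> = (Id T x \<boxdot> adj_counit x y \<epsilon> s) \<cdot> ((Id T x \<boxdot> ?a y x s) \<cdot> (?a x (y \<boxtimes> x) s \<cdot> ((?a x y x \<boxdot> Id T s) \<cdot> ((\<eta> \<boxdot> Id T x) \<boxdot> Id T s))))"
    unfolding 1 ..
  also have "\<dots> = (Id T x \<boxdot> LUnit T s) \<cdot> ((Id T x \<boxdot> (\<epsilon> \<boxdot> Id T s)) \<cdot> (?a x (y \<boxtimes> x) s \<cdot> ((?a x y x \<boxdot> Id T s) \<cdot> ((\<eta> \<boxdot> Id T x) \<boxdot> Id T s))))"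
    by (rule comp_eq_extend[OF 2]) (use A in simp_all)
  also have "(Id T x \<boxdot> (\<epsilon> \<boxdot> Id T s)) \<cdot> (?a x (y \<boxtimes> x) s \<cdot> ((?a x y x \<boxdot> Id T s) \<cdot> ((\<eta> \<boxdot> Id T x) \<boxdot> Id T s)))
     = ?a x ?u s \<cdot> (((Id T x \<boxdot> \<epsilon>) \<boxdot> Id T s) \<cdot> ((?a x y x \<boxdot> Id T s) \<cdot> ((\<eta> \<boxdot> Id T x) \<boxdot> Id T s)))"
    by (rule comp_eq_extend[OF Assoc_nat2[OF dual_pairD(4)[OF d] o(1,3), symmetric]]) (use A in simp_all)
  also have "(Id T x \<boxdot> LUnit T s) \<cdot> \<dots> = (RUnit T x \<boxdot> Id T s) \<cdot> (((Id T x \<boxdot> \<epsilon>) \<boxdot> Id T s) \<cdot> ((?a x y x \<boxdot> Id T s) \<cdot> ((\<eta> \<boxdot> Id T x) \<boxdot> Id T s)))"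
    by (rule comp_eq_assoc[OF unit_triangle[OF o(1,3)]]) (use A in simp_all)
  also have "\<dots> = (RUnit T x \<cdot> (Id T x \<boxdot> \<epsilon>) \<cdot> ?a x y x \<cdot> (\<eta> \<boxdot> Id T x)) \<boxdot> Id T s"
    using A by (simp add: ten_merge_left)
  also have "\<dots> = LUnit T x \<boxdot> Id T s" unfolding dual_pairD(5)[OF d] ..
  finally have e: "?P \<cdot> ?Q = LUnit T x \<boxdot> Id T s" .
  show ?thesis
  proof (rule iso_comp_iff_right)
    show "is_iso_arr T ?Q" by (rule iso_comp[OF Assoc_iso LUnit_iso Assoc_in LUnit_in]) (use A in auto)
    show "?Q \<in> homset T ((?u \<boxtimes> x) \<boxtimes> s) (x \<boxtimes> s)" using A by (simp add: homset_iff)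
    show "?P \<in> homset T (x \<boxtimes> s) (x \<boxtimes> s)" using A by (simp add: homset_iff)
    show "is_iso_arr T (?P \<cdot> ?Q)" unfolding e using ten_iso[OF LUnit_iso LUnit_in iso_Id Id_in] A by simp
  qed
qed

text \<open>The adjoint k' of k recovers k up to the invertible triangle composite, whose inverse is
  p. The gain is that every map c -> x \<otimes> s passes through x \<otimes> (y \<otimes> c), an
  object independent of s.\<close>

lemma dual_factorization:
  assumes d: "dual_pair x y \<eta> \<epsilon>" and s: "s \<in> Obj T" and k: "k \<in> homset T c (x \<boxtimes> s)"
  obtains k' p where "k' \<in> homset T (y \<boxtimes> c) s" "p \<in> homset T (x \<boxtimes> s) (x \<boxtimes> s)"
    "k = p \<cdot> (Id T x \<boxdot> k') \<cdot> adj_unit x y \<eta> c"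
proof -
  note o = dual_pairD(1,2)[OF d] s hom_obj(1)[OF k]
  let ?P = "(Id T x \<boxdot> adj_counit x y \<epsilon> s) \<cdot> adj_unit x y \<eta> (x \<boxtimes> s)"
  have P: "?P \<in> homset T (x \<boxtimes> s) (x \<boxtimes> s)"
    by (rule Comp_in[OF adj_unit_in[OF d] TenA_in[OF Id_in adj_counit_in[OF d s]]]) (use o in auto)
  obtain p where p: "p \<in> homset T (x \<boxtimes> s) (x \<boxtimes> s)" "p \<cdot> ?P = Id T (x \<boxtimes> s)"
    using iso_arrE[OF triangle_iso[OF d s] P] by metis
  let ?k' = "adj_counit x y \<epsilon> s \<cdot> (Id T y \<boxdot> k)"
  have k': "?k' \<in> homset T (y \<boxtimes> c) s" by (rule Comp_in[OF TenA_in[OF Id_in[OF o(2)] k] adj_counit_in[OF d s]])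
  note A = o homsetD[OF k] homsetD[OF p(1)] homsetD[OF adj_counit_in[OF d s]] homsetD[OF adj_unit_in[OF d o(4)]]
    homsetD[OF adj_unit_in[OF d, of "x \<boxtimes> s"]]
  have "(Id T x \<boxdot> ?k') \<cdot> adj_unit x y \<eta> c = (Id T x \<boxdot> adj_counit x y \<epsilon> s) \<cdot> ((Id T x \<boxdot> (Id T y \<boxdot> k)) \<cdot> adj_unit x y \<eta> c)"
    using ten_merge_right[of "Id T y \<boxdot> k" "adj_counit x y \<epsilon> s" x, symmetric] A by simp
  also have "\<dots> = ?P \<cdot> k" using adj_unit_natural[OF d k, symmetric] A by simp
  finally have e: "(Id T x \<boxdot> ?k') \<cdot> adj_unit x y \<eta> c = ?P \<cdot> k" .
  have "p \<cdot> (?P \<cdot> k) = k" using comp_eq_assoc[OF p(2), of k] A homsetD[OF P] by (simp del: assoc)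
  then show thesis using that[OF k' p(1)] e by simp
qed

text \<open>Recovers h from its mate 1 -> x \<otimes> s, by naturality of the counit and the second
  duality identity. It reduces maps out of y to maps out of the unit.\<close>

lemma dual_map_expansion:
  assumes d: "dual_pair x y \<eta> \<epsilon>" and h: "h \<in> homset T y s"
  shows "h = adj_counit x y \<epsilon> s \<cdot> (Id T y \<boxdot> ((Id T x \<boxdot> h) \<cdot> \<eta>)) \<cdot> inverse_arr T (RUnit T y)"
proof -
  note o = dual_pairD(1,2)[OF d] hom_obj[OF h]
  note A = o homsetD[OF h] homsetD[OF dual_pairD(3)[OF d]] homsetD[OF dual_pairD(4)[OF d]] homsetD[OF adj_counit_in[OF d o(4)]]
    homsetD[OF adj_counit_in[OF d o(2)]] homsetD[OF inverse_RUnit(1)[OF o(2)]]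
  have z: "adj_counit x y \<epsilon> y \<cdot> (Id T y \<boxdot> \<eta>) = RUnit T y"
    using dual_pairD(6)[OF d] A unfolding adj_counit_def by simp
  have "adj_counit x y \<epsilon> s \<cdot> (Id T y \<boxdot> ((Id T x \<boxdot> h) \<cdot> \<eta>)) \<cdot> inverse_arr T (RUnit T y)
    = adj_counit x y \<epsilon> s \<cdot> ((Id T y \<boxdot> (Id T x \<boxdot> h)) \<cdot> ((Id T y \<boxdot> \<eta>) \<cdot> inverse_arr T (RUnit T y)))"
    using ten_merge_right[of \<eta> "Id T x \<boxdot> h" y, symmetric] A by simp
  also have "\<dots> = h \<cdot> (adj_counit x y \<epsilon> y \<cdot> ((Id T y \<boxdot> \<eta>) \<cdot> inverse_arr T (RUnit T y)))"
    by (rule comp_eq_extend[OF adj_counit_natural[OF d h]]) (use A in simp_all)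
  also have "adj_counit x y \<epsilon> y \<cdot> ((Id T y \<boxdot> \<eta>) \<cdot> inverse_arr T (RUnit T y)) = RUnit T y \<cdot> inverse_arr T (RUnit T y)"
    by (rule comp_eq_assoc[OF z]) (use A in simp_all)
  also have "\<dots> = Id T y" by (rule inverse_RUnit(3)[OF o(2)])
  finally show ?thesis using A by simp
qed

text \<open>The counit \<open>(s \<otimes> y) \<otimes> x \<rightarrow> s\<close> of the adjunction between \<open>- \<otimes> x\<close> and \<open>- \<otimes> y\<close>.\<close>

definition rcounit where
  "rcounit x y \<epsilon> s = RUnit T s \<cdot> (Id T s \<boxdot> \<epsilon>) \<cdot> Assoc T s y x"

lemma rcounit_in: "\<lbrakk>dual_pair x y \<eta> \<epsilon>; s \<in> Obj T\<rbrakk> \<Longrightarrow> rcounit x y \<epsilon> s \<in> homset T ((s \<boxtimes> y) \<boxtimes> x) s"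
  using dual_pairD(1,2)[of x y \<eta> \<epsilon>] homsetD[OF dual_pairD(4)[of x y \<eta> \<epsilon>]] unfolding rcounit_def by (simp add: homset_iff)

lemma rcounit_natural:
  assumes d: "dual_pair x y \<eta> \<epsilon>" and f: "f \<in> homset T s s'"
  shows "rcounit x y \<epsilon> s' \<cdot> ((f \<boxdot> Id T y) \<boxdot> Id T x) = f \<cdot> rcounit x y \<epsilon> s"
proof -
  note A = dual_pairD(1,2)[OF d] homsetD[OF dual_pairD(4)[OF d]] homsetD[OF f] hom_obj[OF f]
  have "rcounit x y \<epsilon> s' \<cdot> ((f \<boxdot> Id T y) \<boxdot> Id T x) = RUnit T s' \<cdot> ((Id T s' \<boxdot> \<epsilon>) \<cdot> (Assoc T s' y x \<cdot> ((f \<boxdot> Id T y) \<boxdot> Id T x)))"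
    unfolding rcounit_def using A by simp
  also have "Assoc T s' y x \<cdot> ((f \<boxdot> Id T y) \<boxdot> Id T x) = (f \<boxdot> Id T (y \<boxtimes> x)) \<cdot> Assoc T s y x"
    by (rule Assoc_nat1[OF f A(2,1)])
  also have "(Id T s' \<boxdot> \<epsilon>) \<cdot> \<dots> = (f \<boxdot> Id T \<one>\<^sub>T) \<cdot> ((Id T s \<boxdot> \<epsilon>) \<cdot> Assoc T s y x)"
    by (rule comp_eq_extend)
       (use A ten_merge[of f "Id T s'" "Id T (y \<boxtimes> x)" \<epsilon>] ten_merge[of "Id T s" f \<epsilon> "Id T \<one>\<^sub>T"] in simp_all)
  also have "RUnit T s' \<cdot> \<dots> = f \<cdot> (RUnit T s \<cdot> ((Id T s \<boxdot> \<epsilon>) \<cdot> Assoc T s y x))"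
    by (rule comp_eq_extend[OF RUnit_natural[OF f]]) (use A in simp_all)
  finally show ?thesis unfolding rcounit_def by simp
qed

text \<open>The surjectivity half of the adjunction between - \<otimes> x and - \<otimes> y. As in
  \<open>triangle_iso\<close>, the triangle composite ?N is only shown to be invertible, and its
  inverse is absorbed into the map being transposed.\<close>

lemma dual_right_adjoint:
  assumes d: "dual_pair x y \<eta> \<epsilon>" and h: "h \<in> homset T (t \<boxtimes> x) c" and t: "t \<in> Obj T"
  obtains k where "k \<in> homset T t (c \<boxtimes> y)" "h = rcounit x y \<epsilon> c \<cdot> (k \<boxdot> Id T x)"
proof -
  note o = dual_pairD(1,2)[OF d] t hom_obj(2)[OF h]
  let ?u = "\<one>\<^sub>T" and ?a = "Assoc T"
  define r where "r = inverse_arr T (RUnit T t)"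
  define a' where "a' = inverse_arr T (?a t x y)"
  have r: "r \<in> homset T t (t \<boxtimes> ?u)" "RUnit T t \<cdot> r = Id T t" using inverse_RUnit[OF t] by (auto simp: r_def)
  have a': "a' \<in> homset T (t \<boxtimes> (x \<boxtimes> y)) ((t \<boxtimes> x) \<boxtimes> y)" "?a t x y \<cdot> a' = Id T (t \<boxtimes> (x \<boxtimes> y))"
    using inverse_Assoc[OF t o(1,2)] by (auto simp: a'_def)
  define u where "u = a' \<cdot> (Id T t \<boxdot> \<eta>) \<cdot> r"
  note B = o homsetD[OF dual_pairD(3)[OF d]] homsetD[OF dual_pairD(4)[OF d]] homsetD[OF r(1)] homsetD[OF a'(1)] homsetD[OF h]
  have u: "u \<in> homset T t ((t \<boxtimes> x) \<boxtimes> y)" unfolding u_def using B by (simp add: homset_iff)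
  note A = B homsetD[OF u]
  let ?M = "(Id T (t \<boxtimes> x) \<boxdot> \<epsilon>) \<cdot> ?a (t \<boxtimes> x) y x \<cdot> (u \<boxdot> Id T x)"
  let ?Q = "(Id T t \<boxdot> RUnit T x) \<cdot> ?a t x ?u"
  have "?a t x y \<cdot> u = (Id T t \<boxdot> \<eta>) \<cdot> r"
    unfolding u_def using comp_eq_assoc[OF a'(2), of "(Id T t \<boxdot> \<eta>) \<cdot> r"] B by simp
  then have au: "(?a t x y \<boxdot> Id T x) \<cdot> (u \<boxdot> Id T x) = ((Id T t \<boxdot> \<eta>) \<boxdot> Id T x) \<cdot> (r \<boxdot> Id T x)"
    using A by (simp add: ten_merge_left)
  have "?a t x (y \<boxtimes> x) \<cdot> (?a (t \<boxtimes> x) y x \<cdot> (u \<boxdot> Id T x))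
      = (?a t x (y \<boxtimes> x) \<cdot> ?a (t \<boxtimes> x) y x) \<cdot> (u \<boxdot> Id T x)" using A by simp
  also have "?a t x (y \<boxtimes> x) \<cdot> ?a (t \<boxtimes> x) y x = (Id T t \<boxdot> ?a x y x) \<cdot> ?a t (x \<boxtimes> y) x \<cdot> (?a t x y \<boxdot> Id T x)"
    by (rule pentagon) (use A in auto)
  also have "\<dots> \<cdot> (u \<boxdot> Id T x) = (Id T t \<boxdot> ?a x y x) \<cdot> (?a t (x \<boxtimes> y) x \<cdot> ((?a t x y \<boxdot> Id T x) \<cdot> (u \<boxdot> Id T x)))"
    using A by simp
  also have "(?a t x y \<boxdot> Id T x) \<cdot> (u \<boxdot> Id T x) = ((Id T t \<boxdot> \<eta>) \<boxdot> Id T x) \<cdot> (r \<boxdot> Id T x)" by (rule au)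
  also have "?a t (x \<boxtimes> y) x \<cdot> \<dots> = (Id T t \<boxdot> (\<eta> \<boxdot> Id T x)) \<cdot> (?a t ?u x \<cdot> (r \<boxdot> Id T x))"
    by (rule comp_eq_extend[OF Assoc_nat2[OF dual_pairD(3)[OF d] t o(1)]]) (use A in simp_all)
  finally have 1: "?a t x (y \<boxtimes> x) \<cdot> (?a (t \<boxtimes> x) y x \<cdot> (u \<boxdot> Id T x))
     = (Id T t \<boxdot> ?a x y x) \<cdot> ((Id T t \<boxdot> (\<eta> \<boxdot> Id T x)) \<cdot> (?a t ?u x \<cdot> (r \<boxdot> Id T x)))" .
  have "?Q \<cdot> ?M = (Id T t \<boxdot> RUnit T x) \<cdot> (?a t x ?u \<cdot> ((Id T (t \<boxtimes> x) \<boxdot> \<epsilon>) \<cdot> (?a (t \<boxtimes> x) y x \<cdot> (u \<boxdot> Id T x))))"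
    using A by simp
  also have "?a t x ?u \<cdot> ((Id T (t \<boxtimes> x) \<boxdot> \<epsilon>) \<cdot> (?a (t \<boxtimes> x) y x \<cdot> (u \<boxdot> Id T x)))
     = (Id T t \<boxdot> (Id T x \<boxdot> \<epsilon>)) \<cdot> (?a t x (y \<boxtimes> x) \<cdot> (?a (t \<boxtimes> x) y x \<cdot> (u \<boxdot> Id T x)))"
    by (rule comp_eq_extend[OF Assoc_nat3[OF dual_pairD(4)[OF d] t o(1)]]) (use A in simp_all)
  also have "\<dots> = (Id T t \<boxdot> (Id T x \<boxdot> \<epsilon>)) \<cdot> ((Id T t \<boxdot> ?a x y x) \<cdot> ((Id T t \<boxdot> (\<eta> \<boxdot> Id T x)) \<cdot> (?a t ?u x \<cdot> (r \<boxdot> Id T x))))"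
    unfolding 1 ..
  also have "(Id T t \<boxdot> RUnit T x) \<cdot> \<dots>
     = ((Id T t \<boxdot> RUnit T x) \<cdot> ((Id T t \<boxdot> (Id T x \<boxdot> \<epsilon>)) \<cdot> ((Id T t \<boxdot> ?a x y x) \<cdot> (Id T t \<boxdot> (\<eta> \<boxdot> Id T x))))) \<cdot> (?a t ?u x \<cdot> (r \<boxdot> Id T x))"
    using A by simp
  also have "(Id T t \<boxdot> RUnit T x) \<cdot> ((Id T t \<boxdot> (Id T x \<boxdot> \<epsilon>)) \<cdot> ((Id T t \<boxdot> ?a x y x) \<cdot> (Id T t \<boxdot> (\<eta> \<boxdot> Id T x))))
     = Id T t \<boxdot> (RUnit T x \<cdot> (Id T x \<boxdot> \<epsilon>) \<cdot> ?a x y x \<cdot> (\<eta> \<boxdot> Id T x))"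
    using A by (simp add: ten_merge_right)
  also have "\<dots> = Id T t \<boxdot> LUnit T x" unfolding dual_pairD(5)[OF d] ..
  also have "(Id T t \<boxdot> LUnit T x) \<cdot> (?a t ?u x \<cdot> (r \<boxdot> Id T x)) = (RUnit T t \<boxdot> Id T x) \<cdot> (r \<boxdot> Id T x)"
    by (rule comp_eq_assoc[OF unit_triangle[OF t o(1)]]) (use A in simp_all)
  also have "\<dots> = Id T (t \<boxtimes> x)" using A r(2) TenA_Id[OF t o(1)] by (simp add: ten_merge_left)
  finally have QM: "?Q \<cdot> ?M = Id T (t \<boxtimes> x)" .
  have Qi: "?Q \<in> homset T ((t \<boxtimes> x) \<boxtimes> ?u) (t \<boxtimes> x)" using A by (simp add: homset_iff)
  have Q: "is_iso_arr T ?Q"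
    by (rule iso_comp[OF Assoc_iso ten_iso[OF iso_Id Id_in RUnit_iso RUnit_in] Assoc_in TenA_in[OF Id_in RUnit_in]]) (use A in auto)
  have M: "?M \<in> homset T (t \<boxtimes> x) ((t \<boxtimes> x) \<boxtimes> ?u)" using A by (simp add: homset_iff)
  \<comment> \<open>A right inverse of the isomorphism ?Q is its inverse, so ?M is invertible
    too.\<close>
  obtain Q' where Q': "Q' \<in> homset T (t \<boxtimes> x) ((t \<boxtimes> x) \<boxtimes> ?u)" "Q' \<cdot> ?Q = Id T ((t \<boxtimes> x) \<boxtimes> ?u)" "is_iso_arr T Q'"
    using iso_arrE[OF Q Qi] by metis
  have "Q' = Q' \<cdot> (?Q \<cdot> ?M)" using QM homsetD[OF Q'(1)] by simp
  also have "\<dots> = (Q' \<cdot> ?Q) \<cdot> ?M" by (rule Comp_assoc[OF M Qi Q'(1), symmetric])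
  also have "\<dots> = ?M" unfolding Q'(2) by (rule Id_left[OF M])
  finally have Miso: "is_iso_arr T ?M" using Q'(3) by simp
  let ?N = "RUnit T (t \<boxtimes> x) \<cdot> ?M"
  have Ni: "?N \<in> homset T (t \<boxtimes> x) (t \<boxtimes> x)" by (rule Comp_in[OF M RUnit_in]) (use A in auto)
  have N: "is_iso_arr T ?N" by (rule iso_comp[OF Miso RUnit_iso M RUnit_in]) (use A in auto)
  have Nr: "?N = rcounit x y \<epsilon> (t \<boxtimes> x) \<cdot> (u \<boxdot> Id T x)" unfolding rcounit_def using A by simp
  obtain N' where N': "N' \<in> homset T (t \<boxtimes> x) (t \<boxtimes> x)" "N' \<cdot> ?N = Id T (t \<boxtimes> x)" using iso_arrE[OF N Ni] by metis
  \<comment> \<open>The naive adjoint of h would return h only up to ?N, so h is corrected by the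
    inverse of ?N beforehand.\<close>
  define h' where "h' = h \<cdot> N'"
  have h': "h' \<in> homset T (t \<boxtimes> x) c" unfolding h'_def by (rule Comp_in[OF N'(1) h])
  let ?k = "(h' \<boxdot> Id T y) \<cdot> u"
  have k: "?k \<in> homset T t (c \<boxtimes> y)" by (rule Comp_in[OF u TenA_in[OF h' Id_in[OF o(2)]]])
  note C = A homsetD[OF h'] homsetD[OF rcounit_in[OF d o(4)]] homsetD[OF rcounit_in[OF d, of "t \<boxtimes> x"]]
  have "rcounit x y \<epsilon> c \<cdot> (?k \<boxdot> Id T x) = rcounit x y \<epsilon> c \<cdot> (((h' \<boxdot> Id T y) \<boxdot> Id T x) \<cdot> (u \<boxdot> Id T x))"
    using C by (simp add: ten_merge_left)
  also have "\<dots> = h' \<cdot> (rcounit x y \<epsilon> (t \<boxtimes> x) \<cdot> (u \<boxdot> Id T x))"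
    by (rule comp_eq_extend[OF rcounit_natural[OF d h']]) (use C in simp_all)
  also have "\<dots> = (h \<cdot> N') \<cdot> ?N" unfolding Nr h'_def ..
  also have "\<dots> = h \<cdot> (N' \<cdot> ?N)" by (rule Comp_assoc[OF Ni N'(1) h])
  also have "\<dots> = h" unfolding N'(2) by (rule Id_right[OF h])
  finally have "h = rcounit x y \<epsilon> c \<cdot> (?k \<boxdot> Id T x)" by simp
  then show thesis using that k by blast
qed

end

context closed_symmetric_monoidal_category
begin

text \<open>Tensoring with w is left adjoint to the internal hom. Cocones are curried, glued on the
  coproduct and uncurried; uniqueness is transported in the same way.\<close>

lemma coproduct_tensor_right:
  assumes c: "is_coproduct T I t c \<iota>" and w: "w \<in> Obj T"
  shows "is_coproduct T I (\<lambda>i. t i \<boxtimes> w) (c \<boxtimes> w) (\<lambda>i. \<iota> i \<boxdot> Id T w)"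
proof (rule coproductI)
  note o = coproduct_in[OF c]
  show "c \<boxtimes> w \<in> Obj T" using o w by simp
  show "\<iota> i \<boxdot> Id T w \<in> homset T (t i \<boxtimes> w) (c \<boxtimes> w)" if "i \<in> I" for i
    by (rule TenA_in[OF o(2)[OF that] Id_in[OF w]])
  have merge: "(Ev T w y \<cdot> (k \<boxdot> Id T w)) \<cdot> (\<iota> i \<boxdot> Id T w) = Ev T w y \<cdot> ((k \<cdot> \<iota> i) \<boxdot> Id T w)"
    if "k \<in> homset T c (IHom T w y)" "i \<in> I" "y \<in> Obj T" for k i y
    using homsetD[OF that(1)] homsetD[OF o(2)[OF that(2)]] homsetD[OF Ev_in[OF w that(3)]] w
    by (simp add: ten_merge_left)
  fix y
  { fix g assume y: "y \<in> Obj T" and g: "\<And>i. i \<in> I \<Longrightarrow> g i \<in> homset T (t i \<boxtimes> w) y"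
    have "\<exists>k. k \<in> homset T (t i) (IHom T w y) \<and> Ev T w y \<cdot> (k \<boxdot> Id T w) = g i" if "i \<in> I" for i
      using Ev_universal[OF o(3)[OF that] w y g[OF that]] by blast
    then obtain g' where g': "\<And>i. i \<in> I \<Longrightarrow> g' i \<in> homset T (t i) (IHom T w y)"
      "\<And>i. i \<in> I \<Longrightarrow> Ev T w y \<cdot> (g' i \<boxdot> Id T w) = g i" by metis
    have "\<exists>k \<in> homset T c (IHom T w y). \<forall>i \<in> I. k \<cdot> \<iota> i = g' i"
      by (rule coproduct_ex[OF c IHom_in[OF w y] g'(1)])
    then obtain k where k: "k \<in> homset T c (IHom T w y)" "\<And>i. i \<in> I \<Longrightarrow> k \<cdot> \<iota> i = g' i" by auto
    have "(Ev T w y \<cdot> (k \<boxdot> Id T w)) \<cdot> (\<iota> i \<boxdot> Id T w) = g i" if "i \<in> I" for i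
      using merge[OF k(1) that y] k(2)[OF that] g'(2)[OF that] by simp
    then show "\<exists>h. h \<in> homset T (c \<boxtimes> w) y \<and> (\<forall>i\<in>I. h \<cdot> (\<iota> i \<boxdot> Id T w) = g i)"
      using Comp_in[OF TenA_in[OF k(1) Id_in[OF w]] Ev_in[OF w y]] by blast }
  fix h h' assume h: "h \<in> homset T (c \<boxtimes> w) y" "h' \<in> homset T (c \<boxtimes> w) y"
    and e: "\<And>i. i \<in> I \<Longrightarrow> h \<cdot> (\<iota> i \<boxdot> Id T w) = h' \<cdot> (\<iota> i \<boxdot> Id T w)"
  have y: "y \<in> Obj T" by (rule hom_obj(2)[OF h(1)])
  obtain k where k: "k \<in> homset T c (IHom T w y)" "Ev T w y \<cdot> (k \<boxdot> Id T w) = h"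
    using Ev_universal[OF o(1) w y h(1)] by blast
  obtain k' where k': "k' \<in> homset T c (IHom T w y)" "Ev T w y \<cdot> (k' \<boxdot> Id T w) = h'"
    using Ev_universal[OF o(1) w y h(2)] by blast
  have "k = k'"
  proof (rule coproduct_eq[OF c k(1) k'(1)])
    fix i assume i: "i \<in> I"
    have "h \<cdot> (\<iota> i \<boxdot> Id T w) \<in> homset T (t i \<boxtimes> w) y"
      by (rule Comp_in[OF TenA_in[OF o(2)[OF i] Id_in[OF w]] h(1)])
    from Ev_universal[OF o(3)[OF i] w y this]
    show "k \<cdot> \<iota> i = k' \<cdot> \<iota> i"
      using merge[OF k(1) i y] merge[OF k'(1) i y] k(2) k'(2) e[OF i]
        Comp_in[OF o(2)[OF i] k(1)] Comp_in[OF o(2)[OF i] k'(1)] by metis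
  qed
  then show "h = h'" using k(2) k'(2) by simp
qed

lemma coproduct_tensor_left:
  assumes c: "is_coproduct T I t c \<iota>" and w: "w \<in> Obj T"
  shows "is_coproduct T I (\<lambda>i. w \<boxtimes> t i) (w \<boxtimes> c) (\<lambda>i. Id T w \<boxdot> \<iota> i)"
proof -
  note o = coproduct_in[OF c]
  have "is_coproduct T I (\<lambda>i. w \<boxtimes> t i) (w \<boxtimes> c) (\<lambda>i. Braid T c w \<cdot> (\<iota> i \<boxdot> Id T w) \<cdot> Braid T w (t i))"
    by (rule coproduct_iso[OF coproduct_tensor_right[OF c w]]) (use o w Braid_in Braid_iso in auto)
  moreover have "Braid T c w \<cdot> (\<iota> i \<boxdot> Id T w) \<cdot> Braid T w (t i) = Id T w \<boxdot> \<iota> i" if i: "i \<in> I" for i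
  proof -
    note A = homsetD[OF o(2)[OF i]] o(1) o(3)[OF i] w
    have "Braid T c w \<cdot> (\<iota> i \<boxdot> Id T w) \<cdot> Braid T w (t i) = (Id T w \<boxdot> \<iota> i) \<cdot> (Braid T (t i) w \<cdot> Braid T w (t i))"
      by (rule comp_eq_extend[OF Braid_natural[OF o(2)[OF i] Id_in[OF w]]]) (use A in simp_all)
    also have "\<dots> = Id T w \<boxdot> \<iota> i" using Braid_symmetric[OF w o(3)[OF i]] A by simp
    finally show ?thesis .
  qed
  ultimately show ?thesis by (auto intro: coproduct_cong)
qed

end

section \<open>Tensor ideals\<close>

context tt_category
begin

lemma Zero_TenA:
  assumes "x \<in> Obj T" "y \<in> Obj T" "g \<in> homset T v w"
  shows "Zero T x y \<boxdot> g = Zero T (x \<boxtimes> v) (y \<boxtimes> w)"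
  by (rule Plus_idem_zero)
     (use TenA_Plus_left[OF Zero_in Zero_in assms(3), of x y] assms homsetD[OF assms(3)] in \<open>auto simp: homset_iff\<close>)

lemma TenA_Zero:
  assumes "x \<in> Obj T" "y \<in> Obj T" "g \<in> homset T v w"
  shows "g \<boxdot> Zero T x y = Zero T (v \<boxtimes> x) (w \<boxtimes> y)"
  by (rule Plus_idem_zero)
     (use TenA_Plus_right[OF assms(3) Zero_in Zero_in, of x y] assms homsetD[OF assms(3)] in \<open>auto simp: homset_iff\<close>)

lemma zero_tensor:
  assumes z: "is_zero_obj T z" and w: "w \<in> Obj T"
  shows "is_zero_obj T (z \<boxtimes> w)" "is_zero_obj T (w \<boxtimes> z)"
proof -
  have zo: "z \<in> Obj T" "Id T z = Zero T z z" using z by (auto simp: zero_obj_iff)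
  show "is_zero_obj T (z \<boxtimes> w)"
    using zo w TenA_Id[OF zo(1) w] Zero_TenA[OF zo(1,1) Id_in[OF w]] by (simp add: zero_obj_iff)
  show "is_zero_obj T (w \<boxtimes> z)"
    using zo w TenA_Id[OF w zo(1)] TenA_Zero[OF zo(1,1) Id_in[OF w]] by (simp add: zero_obj_iff)
qed

lemma tri_tensor:
  assumes t: "tri f g h x y z" and w: "w \<in> Obj T"
  shows "tri (f \<boxdot> Id T w) (g \<boxdot> Id T w) (TSh T x w \<cdot> (h \<boxdot> Id T w)) (x \<boxtimes> w) (y \<boxtimes> w) (z \<boxtimes> w)"
  using Ten_exact[OF triD(1)[OF t] w] TenA_in[OF triD(2)[OF t] Id_in[OF w]] TenA_in[OF triD(3)[OF t] Id_in[OF w]]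
    Comp_in[OF TenA_in[OF triD(4)[OF t] Id_in[OF w]] TSh_in[OF triD(5)[OF t] w]] tri_arr[OF t]
  unfolding tri_def by simp

lemma Sh_tensor_isomorphic: "\<lbrakk>x \<in> Obj T; y \<in> Obj T\<rbrakk> \<Longrightarrow> isomorphic T (\<Sigma>\<^sub>o x \<boxtimes> y) (\<Sigma>\<^sub>o (x \<boxtimes> y))"
  by (rule isomorphicI[OF TSh_in TSh_iso])

lemma asum_tensor:
  assumes x: "x \<in> Obj T" and y: "y \<in> Obj T" and w: "w \<in> Obj T" and "finite F" "\<And>i. i \<in> F \<Longrightarrow> \<phi> i \<in> homset T x y"
  shows "asum x y \<phi> F \<boxdot> Id T w = asum (x \<boxtimes> w) (y \<boxtimes> w) (\<lambda>i. \<phi> i \<boxdot> Id T w) F"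
  using assms(4,5)
proof (induction F)
  case empty
  then show ?case using Zero_TenA[OF x y Id_in[OF w]] x y w by simp
next
  case (insert j F)
  have \<phi>: "\<phi> j \<in> homset T x y" "\<And>i. i \<in> F \<Longrightarrow> \<phi> i \<in> homset T x y" using insert.prems by auto
  have "asum x y \<phi> (insert j F) \<boxdot> Id T w = (\<phi> j \<boxplus> asum x y \<phi> F) \<boxdot> Id T w"
    using asum_insert[OF x y insert(1,2) insert.prems] by simp
  also have "\<dots> = (\<phi> j \<boxdot> Id T w) \<boxplus> (asum x y \<phi> F \<boxdot> Id T w)"
    by (rule TenA_Plus_left[OF \<phi>(1) asum_in[OF x y \<phi>(2)] Id_in[OF w]])
  also have "asum x y \<phi> F \<boxdot> Id T w = asum (x \<boxtimes> w) (y \<boxtimes> w) (\<lambda>i. \<phi> i \<boxdot> Id T w) F" by (rule insert.IH[OF \<phi>(2)])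
  also have "(\<phi> j \<boxdot> Id T w) \<boxplus> \<dots> = asum (x \<boxtimes> w) (y \<boxtimes> w) (\<lambda>i. \<phi> i \<boxdot> Id T w) (insert j F)"
    by (rule asum_insert[symmetric]) (use x y w insert(1,2) TenA_in[OF insert.prems Id_in[OF w]] in auto)
  finally show ?case .
qed

lemma tensor_asum:
  assumes x: "x \<in> Obj T" and y: "y \<in> Obj T" and w: "w \<in> Obj T" and "finite F" "\<And>i. i \<in> F \<Longrightarrow> \<phi> i \<in> homset T x y"
  shows "Id T w \<boxdot> asum x y \<phi> F = asum (w \<boxtimes> x) (w \<boxtimes> y) (\<lambda>i. Id T w \<boxdot> \<phi> i) F"
  using assms(4,5)
proof (induction F)
  case empty
  then show ?case using TenA_Zero[OF x y Id_in[OF w]] x y w by simp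
next
  case (insert j F)
  have \<phi>: "\<phi> j \<in> homset T x y" "\<And>i. i \<in> F \<Longrightarrow> \<phi> i \<in> homset T x y" using insert.prems by auto
  have "Id T w \<boxdot> asum x y \<phi> (insert j F) = Id T w \<boxdot> (\<phi> j \<boxplus> asum x y \<phi> F)"
    using asum_insert[OF x y insert(1,2) insert.prems] by simp
  also have "\<dots> = (Id T w \<boxdot> \<phi> j) \<boxplus> (Id T w \<boxdot> asum x y \<phi> F)"
    by (rule TenA_Plus_right[OF Id_in[OF w] \<phi>(1) asum_in[OF x y \<phi>(2)]])
  also have "Id T w \<boxdot> asum x y \<phi> F = asum (w \<boxtimes> x) (w \<boxtimes> y) (\<lambda>i. Id T w \<boxdot> \<phi> i) F" by (rule insert.IH[OF \<phi>(2)])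
  also have "(Id T w \<boxdot> \<phi> j) \<boxplus> \<dots> = asum (w \<boxtimes> x) (w \<boxtimes> y) (\<lambda>i. Id T w \<boxdot> \<phi> i) (insert j F)"
    by (rule asum_insert[symmetric]) (use x y w insert(1,2) TenA_in[OF Id_in[OF w] insert.prems] in auto)
  finally show ?case .
qed

text \<open>A map from c \<otimes> x to a coproduct transposes to a map from c to the coproduct of
  the s i \<otimes> y. Compactness of c makes this a finite sum, and naturality of the counit
  carries the sum back.\<close>

lemma compact_tensor_dualizable:
  fixes \<kappa> :: "'u rel"
  assumes c: "c \<in> compact_objects \<kappa> T" and d: "dual_pair x y \<eta> \<epsilon>"
  shows "c \<boxtimes> x \<in> compact_objects \<kappa> T"
proof (rule compactI)
  note o = dual_pairD(1,2)[OF d] compact_obj[OF c]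
  show "c \<boxtimes> x \<in> Obj T" using o by simp
  fix I :: "'u set" and s C \<iota> h
  assume I: "small \<kappa> I" and C: "is_coproduct T I s C \<iota>" and h: "h \<in> homset T (c \<boxtimes> x) C"
  note q = coproduct_in[OF C]
  obtain k where k: "k \<in> homset T c (C \<boxtimes> y)" "h = rcounit x y \<epsilon> C \<cdot> (k \<boxdot> Id T x)"
    by (rule dual_right_adjoint[OF d h o(3)])
  have "fin_map I (\<lambda>i. s i \<boxtimes> y) (\<lambda>i. \<iota> i \<boxdot> Id T y) c (C \<boxtimes> y) k"
    using c I coproduct_tensor_right[OF C o(2)] k(1) by (rule compactD)
  then obtain F a where F: "finite F" "F \<subseteq> I" "\<And>i. i \<in> F \<Longrightarrow> a i \<in> homset T c (s i \<boxtimes> y)"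
    "k = asum c (C \<boxtimes> y) (\<lambda>i. (\<iota> i \<boxdot> Id T y) \<cdot> a i) F"
    using that by (rule fin_mapE)
  have I': "i \<in> I" if "i \<in> F" for i using that F(2) by blast
  have ty: "(\<iota> i \<boxdot> Id T y) \<cdot> a i \<in> homset T c (C \<boxtimes> y)" if "i \<in> F" for i
    by (rule Comp_in[OF F(3)[OF that] TenA_in[OF q(2)[OF I'[OF that]] Id_in[OF o(2)]]])
  have ty2: "rcounit x y \<epsilon> (s i) \<cdot> (a i \<boxdot> Id T x) \<in> homset T (c \<boxtimes> x) (s i)" if "i \<in> F" for i
    by (rule Comp_in[OF TenA_in[OF F(3)[OF that] Id_in[OF o(1)]] rcounit_in[OF d q(3)[OF I'[OF that]]]])
  have "h = rcounit x y \<epsilon> C \<cdot> (asum c (C \<boxtimes> y) (\<lambda>i. (\<iota> i \<boxdot> Id T y) \<cdot> a i) F \<boxdot> Id T x)"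
    using k(2) F(4) by simp
  also have "asum c (C \<boxtimes> y) (\<lambda>i. (\<iota> i \<boxdot> Id T y) \<cdot> a i) F \<boxdot> Id T x
    = asum (c \<boxtimes> x) ((C \<boxtimes> y) \<boxtimes> x) (\<lambda>i. ((\<iota> i \<boxdot> Id T y) \<cdot> a i) \<boxdot> Id T x) F"
    by (rule asum_tensor) (use o q(1) F(1) ty in auto)
  also have "rcounit x y \<epsilon> C \<cdot> \<dots> = asum (c \<boxtimes> x) C (\<lambda>i. rcounit x y \<epsilon> C \<cdot> (((\<iota> i \<boxdot> Id T y) \<cdot> a i) \<boxdot> Id T x)) F"
    by (rule Comp_asum[OF rcounit_in[OF d q(1)]]) (use o F(1) TenA_in[OF ty Id_in[OF o(1)]] in auto)
  also have "\<dots> = asum (c \<boxtimes> x) C (\<lambda>i. \<iota> i \<cdot> (rcounit x y \<epsilon> (s i) \<cdot> (a i \<boxdot> Id T x))) F"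
  proof (rule asum_cong)
    fix i assume i: "i \<in> F"
    note A = homsetD[OF F(3)[OF i]] homsetD[OF q(2)[OF I'[OF i]]] o q(1) q(3)[OF I'[OF i]] homsetD[OF rcounit_in[OF d q(1)]]
      homsetD[OF rcounit_in[OF d q(3)[OF I'[OF i]]]]
    show "\<iota> i \<cdot> (rcounit x y \<epsilon> (s i) \<cdot> (a i \<boxdot> Id T x)) \<in> homset T (c \<boxtimes> x) C"
      by (rule Comp_in[OF ty2[OF i] q(2)[OF I'[OF i]]])
    have "((\<iota> i \<boxdot> Id T y) \<cdot> a i) \<boxdot> Id T x = ((\<iota> i \<boxdot> Id T y) \<boxdot> Id T x) \<cdot> (a i \<boxdot> Id T x)"
      using ten_merge_left[of "a i" "\<iota> i \<boxdot> Id T y" x] A by simp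
    then show "rcounit x y \<epsilon> C \<cdot> (((\<iota> i \<boxdot> Id T y) \<cdot> a i) \<boxdot> Id T x) = \<iota> i \<cdot> (rcounit x y \<epsilon> (s i) \<cdot> (a i \<boxdot> Id T x))"
      using comp_eq_extend[OF rcounit_natural[OF d q(2)[OF I'[OF i]]], of "a i \<boxdot> Id T x"] A by simp
  qed (use o q(1) in auto)
  finally have e: "h = asum (c \<boxtimes> x) C (\<lambda>i. \<iota> i \<cdot> (rcounit x y \<epsilon> (s i) \<cdot> (a i \<boxdot> Id T x))) F" .
  show "fin_map I s \<iota> (c \<boxtimes> x) C h" by (rule fin_mapI[OF F(1,2) _ e]) (rule ty2)
qed

text \<open>The mate of a map from y to a coproduct is a map from the unit to the coproduct of the x
  \<otimes> s i, hence a finite sum. This is a direct route to the compactness of the dual, without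
  first making y dualizable through the symmetry.\<close>

lemma compact_dual:
  fixes \<kappa> :: "'u rel"
  assumes u: "\<one>\<^sub>T \<in> compact_objects \<kappa> T" and d: "dual_pair x y \<eta> \<epsilon>"
  shows "y \<in> compact_objects \<kappa> T"
proof (rule compactI)
  note o = dual_pairD(1,2)[OF d]
  note \<eta> = dual_pairD(3)[OF d]
  show "y \<in> Obj T" by (rule o(2))
  fix I :: "'u set" and s C \<iota> h
  assume I: "small \<kappa> I" and C: "is_coproduct T I s C \<iota>" and h: "h \<in> homset T y C"
  note q = coproduct_in[OF C]
  let ?k = "(Id T x \<boxdot> h) \<cdot> \<eta>" and ?r = "inverse_arr T (RUnit T y)"
  note r = inverse_RUnit(1)[OF o(2)]
  have k: "?k \<in> homset T \<one>\<^sub>T (x \<boxtimes> C)" by (rule Comp_in[OF \<eta> TenA_in[OF Id_in[OF o(1)] h]])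
  have "fin_map I (\<lambda>i. x \<boxtimes> s i) (\<lambda>i. Id T x \<boxdot> \<iota> i) \<one>\<^sub>T (x \<boxtimes> C) ?k"
    using u I coproduct_tensor_left[OF C o(1)] k by (rule compactD)
  then obtain F a where F: "finite F" "F \<subseteq> I" "\<And>i. i \<in> F \<Longrightarrow> a i \<in> homset T \<one>\<^sub>T (x \<boxtimes> s i)"
    "?k = asum \<one>\<^sub>T (x \<boxtimes> C) (\<lambda>i. (Id T x \<boxdot> \<iota> i) \<cdot> a i) F"
    using that by (rule fin_mapE)
  have I': "i \<in> I" if "i \<in> F" for i using that F(2) by blast
  have ty: "(Id T x \<boxdot> \<iota> i) \<cdot> a i \<in> homset T \<one>\<^sub>T (x \<boxtimes> C)" if "i \<in> F" for i
    by (rule Comp_in[OF F(3)[OF that] TenA_in[OF Id_in[OF o(1)] q(2)[OF I'[OF that]]]])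
  let ?b = "\<lambda>i. adj_counit x y \<epsilon> (s i) \<cdot> (Id T y \<boxdot> a i) \<cdot> ?r"
  have ty2: "?b i \<in> homset T y (s i)" if "i \<in> F" for i
    by (rule Comp_in[OF Comp_in[OF r TenA_in[OF Id_in[OF o(2)] F(3)[OF that]]] adj_counit_in[OF d q(3)[OF I'[OF that]]]])
  have tyb: "(Id T y \<boxdot> ((Id T x \<boxdot> \<iota> i) \<cdot> a i)) \<cdot> ?r \<in> homset T y (y \<boxtimes> (x \<boxtimes> C))" if "i \<in> F" for i
    by (rule Comp_in[OF r TenA_in[OF Id_in[OF o(2)] ty[OF that]]])
  have "(Id T y \<boxdot> ?k) \<cdot> ?r = asum (y \<boxtimes> \<one>\<^sub>T) (y \<boxtimes> (x \<boxtimes> C)) (\<lambda>i. Id T y \<boxdot> ((Id T x \<boxdot> \<iota> i) \<cdot> a i)) F \<cdot> ?r"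
    unfolding F(4) using tensor_asum[OF Unit_in _ o(2) F(1) ty] o q(1) by simp
  also have "\<dots> = asum y (y \<boxtimes> (x \<boxtimes> C)) (\<lambda>i. (Id T y \<boxdot> ((Id T x \<boxdot> \<iota> i) \<cdot> a i)) \<cdot> ?r) F"
    by (rule asum_Comp[OF r]) (use o q(1) F(1) TenA_in[OF Id_in[OF o(2)] ty] in auto)
  finally have "h = adj_counit x y \<epsilon> C \<cdot> asum y (y \<boxtimes> (x \<boxtimes> C)) (\<lambda>i. (Id T y \<boxdot> ((Id T x \<boxdot> \<iota> i) \<cdot> a i)) \<cdot> ?r) F"
    using dual_map_expansion[OF d h] by simp
  also have "\<dots> = asum y C (\<lambda>i. adj_counit x y \<epsilon> C \<cdot> ((Id T y \<boxdot> ((Id T x \<boxdot> \<iota> i) \<cdot> a i)) \<cdot> ?r)) F"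
    by (rule Comp_asum[OF adj_counit_in[OF d q(1)] o(2) F(1) tyb])
  also have "\<dots> = asum y C (\<lambda>i. \<iota> i \<cdot> ?b i) F"
  proof (rule asum_cong[OF o(2) q(1)])
    fix i assume i: "i \<in> F"
    note A = homsetD[OF F(3)[OF i]] homsetD[OF q(2)[OF I'[OF i]]] o q(1) q(3)[OF I'[OF i]] homsetD[OF adj_counit_in[OF d q(1)]]
      homsetD[OF adj_counit_in[OF d q(3)[OF I'[OF i]]]] homsetD[OF r]
    show "\<iota> i \<cdot> ?b i \<in> homset T y C" by (rule Comp_in[OF ty2[OF i] q(2)[OF I'[OF i]]])
    have "Id T y \<boxdot> ((Id T x \<boxdot> \<iota> i) \<cdot> a i) = (Id T y \<boxdot> (Id T x \<boxdot> \<iota> i)) \<cdot> (Id T y \<boxdot> a i)"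
      using ten_merge_right[of "a i" "Id T x \<boxdot> \<iota> i" y] A by simp
    then show "adj_counit x y \<epsilon> C \<cdot> ((Id T y \<boxdot> ((Id T x \<boxdot> \<iota> i) \<cdot> a i)) \<cdot> ?r) = \<iota> i \<cdot> ?b i"
      using comp_eq_extend[OF adj_counit_natural[OF d q(2)[OF I'[OF i]]], of "(Id T y \<boxdot> a i) \<cdot> ?r"] A by simp
  qed
  finally have e: "h = asum y C (\<lambda>i. \<iota> i \<cdot> ?b i) F" .
  show "fin_map I s \<iota> y C h" by (rule fin_mapI[OF F(1,2) _ e]) (rule ty2)
qed

text \<open>The second duality identity exhibits the retraction. It puts the dual of an object of a
  thick ideal into the ideal.\<close>

lemma dual_retract:
  assumes d: "dual_pair x y \<eta> \<epsilon>"
  shows "retract y ((y \<boxtimes> x) \<boxtimes> y)"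
proof (rule retractI)
  note o = dual_pairD(1,2)[OF d]
  let ?i = "inverse_arr T (Assoc T y x y) \<cdot> (Id T y \<boxdot> \<eta>) \<cdot> inverse_arr T (RUnit T y)"
  let ?r = "LUnit T y \<cdot> (\<epsilon> \<boxdot> Id T y)"
  note A = o homsetD[OF dual_pairD(3)[OF d]] homsetD[OF dual_pairD(4)[OF d]] homsetD[OF inverse_RUnit(1)[OF o(2)]]
  show "?i \<in> homset T y ((y \<boxtimes> x) \<boxtimes> y)" "?r \<in> homset T ((y \<boxtimes> x) \<boxtimes> y) y" using A by (simp_all add: homset_iff)
  have "?r \<cdot> ?i = (LUnit T y \<cdot> (\<epsilon> \<boxdot> Id T y) \<cdot> inverse_arr T (Assoc T y x y) \<cdot> (Id T y \<boxdot> \<eta>)) \<cdot> inverse_arr T (RUnit T y)"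
    using A by simp
  also have "\<dots> = Id T y" unfolding dual_pairD(6)[OF d] by (rule inverse_RUnit(3)[OF o(2)])
  finally show "?r \<cdot> ?i = Id T y" .
qed

text \<open>Turns a property of generators into one of everything generated: once w \<otimes> s lies
  in L for the generators w, it does so throughout the localizing subcategory.\<close>

lemma preimage_localizing:
  fixes \<kappa> :: "'u rel"
  assumes L: "localizing_subcategory \<kappa> T L" and s: "s \<in> Obj T"
  shows "localizing_subcategory \<kappa> T {w \<in> Obj T. w \<boxtimes> s \<in> L}" (is "localizing_subcategory \<kappa> T ?P")
  unfolding localizing_subcategory_def
proof (intro conjI allI impI)
  note LD = triangulated_subcategoryD[OF localizing_triangulated[OF L]]
  show "triangulated_subcategory T ?P"
  proof (rule triangulated_subcategoryI)
    show "?P \<subseteq> Obj T" by blast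
    show "z \<in> ?P" if "is_zero_obj T z" for z using zero_tensor(1)[OF that s] LD(2) zero_obj_obj[OF that] by blast
    show "y \<in> ?P" if "x \<in> ?P" "isomorphic T x y" for x y
      using LD(3)[OF _ ten_isomorphic[OF that(2) isomorphic_refl[OF s]]] that isomorphic_obj by blast
    have Sh: "\<Sigma>\<^sub>o x \<boxtimes> s \<in> L \<longleftrightarrow> x \<boxtimes> s \<in> L" if x: "x \<in> Obj T" for x
      using LD(3)[OF _ Sh_tensor_isomorphic[OF x s]] LD(3)[OF _ isomorphic_sym[OF Sh_tensor_isomorphic[OF x s]]]
        LD(4)[OF TenO_in[OF x s]] by blast
    show "\<Sigma>\<^sub>o x \<in> ?P" if "x \<in> ?P" for x using Sh that by simp
    show "x \<in> ?P" if "x \<in> Obj T" "\<Sigma>\<^sub>o x \<in> ?P" for x using Sh that by simp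
    show "z \<in> ?P" if "tri f g h x y z" "x \<in> ?P" "y \<in> ?P" for f g h x y z
      using LD(5)[OF tri_tensor[OF that(1) s]] that(2,3) tri_arr(12)[OF that(1)] by simp
  qed
  fix I :: "'u set" and t c \<iota> assume *: "small \<kappa> I" "is_coproduct T I t c \<iota>" "\<forall>i\<in>I. t i \<in> ?P"
  have "\<forall>i\<in>I. t i \<boxtimes> s \<in> L" using *(3) by simp
  then have "c \<boxtimes> s \<in> L" using L *(1) coproduct_tensor_right[OF *(2) s] unfolding localizing_subcategory_def by blast
  then show "c \<in> ?P" using coproduct_in(1)[OF *(2)] by simp
qed

lemma localizing_idealD:
  assumes "localizing_ideal \<kappa> T L"
  shows "localizing_subcategory \<kappa> T L" "triangulated_subcategory T L" "\<lbrakk>t \<in> L; s \<in> Obj T\<rbrakk> \<Longrightarrow> s \<boxtimes> t \<in> L"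
    "\<lbrakk>t \<in> L; s \<in> Obj T\<rbrakk> \<Longrightarrow> t \<boxtimes> s \<in> L"
proof -
  show 1: "localizing_subcategory \<kappa> T L" and 2: "\<lbrakk>t \<in> L; s \<in> Obj T\<rbrakk> \<Longrightarrow> s \<boxtimes> t \<in> L"
    using assms by (auto simp: localizing_ideal_def)
  show 3: "triangulated_subcategory T L" using 1 localizing_triangulated by blast
  show "t \<boxtimes> s \<in> L" if "t \<in> L" "s \<in> Obj T"
    using triangulated_subcategoryD(3)[OF 3 _ Braid_isomorphic[of s t]] assms that triangulated_subcategoryD(1)[OF 3]
    by (simp add: localizing_ideal_def)
qed

lemma preimage_ideal:
  assumes L: "localizing_ideal \<kappa> T L" and s: "s \<in> Obj T"
  shows "localizing_ideal \<kappa> T {w \<in> Obj T. w \<boxtimes> s \<in> L}"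
  unfolding localizing_ideal_def
proof (intro conjI ballI)
  show "localizing_subcategory \<kappa> T {w \<in> Obj T. w \<boxtimes> s \<in> L}" by (rule preimage_localizing[OF localizing_idealD(1)[OF L] s])
  fix t r assume t: "t \<in> {w \<in> Obj T. w \<boxtimes> s \<in> L}" and r: "r \<in> Obj T"
  have "r \<boxtimes> (t \<boxtimes> s) \<in> L" using localizing_idealD(3)[OF L] t r by simp
  moreover have "isomorphic T (r \<boxtimes> (t \<boxtimes> s)) ((r \<boxtimes> t) \<boxtimes> s)"
    using isomorphic_sym[OF Assoc_isomorphic[OF r _ s, of t]] t by simp
  ultimately have "(r \<boxtimes> t) \<boxtimes> s \<in> L" by (rule triangulated_subcategoryD(3)[OF localizing_idealD(2)[OF L]])
  then show "r \<boxtimes> t \<in> {w \<in> Obj T. w \<boxtimes> s \<in> L}" using t r by simp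
qed

lemma localizing_ideal_Inter:
  fixes \<kappa> :: "'u rel"
  assumes "\<And>L. L \<in> \<L> \<Longrightarrow> localizing_ideal \<kappa> T L" "\<L> \<noteq> {}"
  shows "localizing_ideal \<kappa> T (\<Inter>\<L>)"
  using localizing_Inter[of \<L> \<kappa>] assms unfolding localizing_ideal_def by blast

lemma localizing_ideal_Obj: "localizing_ideal \<kappa> T (Obj T)"
  unfolding localizing_ideal_def using localizing_Obj by simp

lemma Loc_ideal_ideal:
  fixes \<kappa> :: "'u rel"
  shows "E \<subseteq> Obj T \<Longrightarrow> localizing_ideal \<kappa> T (Loc_ideal \<kappa> T E)"
  unfolding Loc_ideal_def by (rule localizing_ideal_Inter) (use localizing_ideal_Obj in auto)

lemma Loc_ideal_superset: "E \<subseteq> Loc_ideal \<kappa> T E"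
  by (auto simp: Loc_ideal_def)

lemma Loc_ideal_least: "\<lbrakk>localizing_ideal \<kappa> T L; E \<subseteq> L\<rbrakk> \<Longrightarrow> Loc_ideal \<kappa> T E \<subseteq> L"
  by (auto simp: Loc_ideal_def)

end

section \<open>Rigidity and the compact objects of a localizing ideal\<close>

locale rigid_category = tt_category T for T (structure) +
  fixes \<kappa> :: "'u rel"
  assumes univ: "inaccessible \<kappa>"
    and generated: "compactly_generated \<kappa> T"
    and rigid: "compact_objects \<kappa> T = dualizable_objects T"
begin

abbreviation K where "K \<equiv> compact_objects \<kappa> T"

lemma K_dual:
  assumes "x \<in> K"
  obtains y \<eta> \<epsilon> where "dual_pair x y \<eta> \<epsilon>" "y \<in> K"
  using assms compact_dual[OF Unit_dualizable[folded rigid]] unfolding rigid dualizable_iff by metis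

lemma Unit_K: "\<one>\<^sub>T \<in> K"
  using Unit_dualizable rigid by simp

lemma K_tensor: "\<lbrakk>x \<in> K; y \<in> K\<rbrakk> \<Longrightarrow> x \<boxtimes> y \<in> K"
  using compact_tensor_dualizable[of x \<kappa>] K_dual[of y] by metis

lemma thick_idealD:
  assumes "thick_ideal_compacts \<kappa> T J"
  shows "triangulated_subcategory T J" "J \<subseteq> K" "\<lbrakk>x \<in> J; y \<in> K\<rbrakk> \<Longrightarrow> y \<boxtimes> x \<in> J" "\<lbrakk>x \<in> J; y \<in> K\<rbrakk> \<Longrightarrow> x \<boxtimes> y \<in> J"
    "\<lbrakk>x \<in> J; retract y x\<rbrakk> \<Longrightarrow> y \<in> J"
proof -
  show 1: "triangulated_subcategory T J" and 2: "J \<subseteq> K" and 3: "\<lbrakk>x \<in> J; y \<in> K\<rbrakk> \<Longrightarrow> y \<boxtimes> x \<in> J"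
    and "\<lbrakk>x \<in> J; retract y x\<rbrakk> \<Longrightarrow> y \<in> J"
    using assms thick_subcategory_iff[of J] unfolding thick_ideal_compacts_def by auto
  show "x \<boxtimes> y \<in> J" if "x \<in> J" "y \<in> K"
  proof (rule triangulated_subcategoryD(3)[OF 1])
    show "y \<boxtimes> x \<in> J" using assms that unfolding thick_ideal_compacts_def by blast
    show "isomorphic T (y \<boxtimes> x) (x \<boxtimes> y)" using Braid_isomorphic compact_obj that 2 by blast
  qed
qed

lemma thick_ideal_dual:
  assumes J: "thick_ideal_compacts \<kappa> T J" and d: "dual_pair x y \<eta> \<epsilon>" and "x \<in> J" "y \<in> K"
  shows "y \<in> J"
  by (rule thick_idealD(5)[OF J _ dual_retract[OF d]]) (use thick_idealD(3,4)[OF J] assms(3,4) in blast)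

text \<open>An object of a thick ideal \<open>J\<close> is dualizable, so a map from a compact object \<open>c\<close> to \<open>j \<otimes> s\<close>
  factors through \<open>j \<otimes> (j* \<otimes> c)\<close>, which lies in \<open>J\<close>.\<close>

lemma thick_ideal_tensor_ind_closure:
  assumes J: "thick_ideal_compacts \<kappa> T J" and j: "j \<in> J" and s: "s \<in> Obj T"
  shows "j \<boxtimes> s \<in> ind_closure \<kappa> J"
  unfolding ind_closure_def
proof (intro CollectI conjI ballI)
  have jK: "j \<in> K" using thick_idealD(2)[OF J] j by blast
  have jo: "j \<in> Obj T" by (rule compact_obj[OF jK])
  show "j \<boxtimes> s \<in> Obj T" using jo s by simp
  fix c k assume c: "c \<in> K" and k: "k \<in> homset T c (j \<boxtimes> s)"
  obtain y \<eta> \<epsilon> where d: "dual_pair j y \<eta> \<epsilon>" "y \<in> K" by (rule K_dual[OF jK])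
  obtain k' p where k': "k' \<in> homset T (y \<boxtimes> c) s" "p \<in> homset T (j \<boxtimes> s) (j \<boxtimes> s)"
    "k = p \<cdot> (Id T j \<boxdot> k') \<cdot> adj_unit j y \<eta> c"
    by (rule dual_factorization[OF d(1) s k])
  have co: "c \<in> Obj T" by (rule compact_obj[OF c])
  have u: "adj_unit j y \<eta> c \<in> homset T c (j \<boxtimes> (y \<boxtimes> c))" by (rule adj_unit_in[OF d(1) co])
  have b: "Id T j \<boxdot> k' \<in> homset T (j \<boxtimes> (y \<boxtimes> c)) (j \<boxtimes> s)" by (rule TenA_in[OF Id_in[OF jo] k'(1)])
  have "k = (p \<cdot> (Id T j \<boxdot> k')) \<cdot> adj_unit j y \<eta> c" unfolding k'(3) by (rule Comp_assoc[OF u b k'(2), symmetric])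
  moreover have "j \<boxtimes> (y \<boxtimes> c) \<in> J" by (rule thick_idealD(4)[OF J j K_tensor[OF d(2) c]])
  ultimately show "factors_via J c (j \<boxtimes> s) k"
    unfolding factors_via_def using u Comp_in[OF b k'(2)] by blast
qed

theorem compact_in_Loc_ideal:
  assumes J: "thick_ideal_compacts \<kappa> T J" and E: "E \<subseteq> J" and x: "x \<in> K" "x \<in> Loc_ideal \<kappa> T E"
  shows "x \<in> J"
proof -
  let ?F = "ind_closure \<kappa> J"
  \<comment> \<open>The ind-closure is localizing, and its largest part stable under tensoring is a
    localizing ideal. Tensoring with the unit returns from this part to the ind-closure.\<close>
  let ?G = "{w \<in> Obj T. \<forall>s \<in> Obj T. w \<boxtimes> s \<in> ?F}"
  have F: "localizing_subcategory \<kappa> T ?F" by (rule ind_closure_localizing[OF thick_idealD(1,2)[OF J]])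
  note FD = triangulated_subcategoryD[OF localizing_triangulated[OF F]]
  have "?G = \<Inter>((\<lambda>s. {w \<in> Obj T. w \<boxtimes> s \<in> ?F}) ` Obj T)" using Unit_in by blast
  moreover have "localizing_subcategory \<kappa> T (\<Inter>((\<lambda>s. {w \<in> Obj T. w \<boxtimes> s \<in> ?F}) ` Obj T))"
  proof (rule localizing_Inter)
    show "(\<lambda>s. {w \<in> Obj T. w \<boxtimes> s \<in> ?F}) ` Obj T \<noteq> {}" using Unit_in by blast
  qed (use preimage_localizing[OF F] in blast)
  ultimately have "localizing_subcategory \<kappa> T ?G" by simp
  moreover have "r \<boxtimes> t \<in> ?G" if t: "t \<in> ?G" and r: "r \<in> Obj T" for r t
  proof -
    have to: "t \<in> Obj T" using t by blast
    have "(r \<boxtimes> t) \<boxtimes> s \<in> ?F" if s: "s \<in> Obj T" for s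
    proof (rule FD(3))
      show "t \<boxtimes> (r \<boxtimes> s) \<in> ?F" using t TenO_in[OF r s] by blast
      show "isomorphic T (t \<boxtimes> (r \<boxtimes> s)) ((r \<boxtimes> t) \<boxtimes> s)"
        using isomorphic_trans[OF isomorphic_sym[OF Assoc_isomorphic[OF to r s]]
            ten_isomorphic[OF Braid_isomorphic[OF to r] isomorphic_refl[OF s]]] .
    qed
    then show ?thesis using to r by simp
  qed
  ultimately have "localizing_ideal \<kappa> T ?G" unfolding localizing_ideal_def by blast
  moreover have "E \<subseteq> ?G"
    using thick_ideal_tensor_ind_closure[OF J] E thick_idealD(2)[OF J] compact_obj by blast
  ultimately have "x \<in> ?G" using Loc_ideal_least x(2) by blast
  then have "x \<boxtimes> \<one>\<^sub>T \<in> ?F" using Unit_in by blast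
  then have "x \<in> ?F" using FD(3) RUnit_isomorphic[OF compact_obj[OF x(1)]] by blast
  then obtain j where "j \<in> J" "retract x j" using compact_ind_closure_retract[OF x(1)] by blast
  then show ?thesis using thick_idealD(5)[OF J] by blast
qed

end

section \<open>Spectral spaces\<close>

lemma spectralD:
  assumes "spectral_space X"
  shows "compactin X (topspace X)" "sober_space X" "\<lbrakk>qc_open X U; qc_open X V\<rbrakk> \<Longrightarrow> qc_open X (U \<inter> V)"
    "\<lbrakk>openin X W; p \<in> W\<rbrakk> \<Longrightarrow> \<exists>V. qc_open X V \<and> p \<in> V \<and> V \<subseteq> W"
  using assms unfolding spectral_space_def compact_space_def by blast+

lemma thomason_closed_qc: "thomason_closed X Z \<Longrightarrow> qc_open X (topspace X - Z)"
  by (auto simp: thomason_closed_def qc_open_def)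

lemma thomason_closed_subset: "thomason_closed X Z \<Longrightarrow> Z \<subseteq> topspace X"
  using closedin_subset by (auto simp: thomason_closed_def)

lemma qc_thomason_closed: "qc_open X V \<Longrightarrow> thomason_closed X (topspace X - V)"
  using openin_subset[of X V] by (auto simp: thomason_closed_def qc_open_def double_diff)

lemma thomason_closed_empty: "spectral_space X \<Longrightarrow> thomason_closed X {}"
  using spectralD(1) by (auto simp: thomason_closed_def)

lemma thomason_closed_Un:
  assumes "spectral_space X" "thomason_closed X Y" "thomason_closed X Z"
  shows "thomason_closed X (Y \<union> Z)"
proof -
  have "qc_open X ((topspace X - Y) \<inter> (topspace X - Z))"
    using spectralD(3)[OF assms(1)] thomason_closed_qc assms(2,3) by blast
  moreover have "(topspace X - Y) \<inter> (topspace X - Z) = topspace X - (Y \<union> Z)" by blast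
  ultimately show ?thesis using assms(2,3) by (auto simp: thomason_closed_def qc_open_def)
qed

lemma thomason_closed_Union:
  assumes "spectral_space X" "finite \<F>" "\<And>Z. Z \<in> \<F> \<Longrightarrow> thomason_closed X Z"
  shows "thomason_closed X (\<Union>\<F>)"
  using assms(2,3) by (induction \<F>) (auto simp: thomason_closed_empty[OF assms(1)] thomason_closed_Un[OF assms(1)])

text \<open>Compactness for the constructible topology: a closed set that is minimal among those meeting
  every member of \<open>\<V>\<close> is irreducible, and its generic point works.\<close>

lemma spectral_point:
  assumes X: "spectral_space X" and C: "closedin X C" and ne: "\<V> \<noteq> {}"
    and qc: "\<And>V. V \<in> \<V> \<Longrightarrow> qc_open X V" and dir: "\<And>V W. \<lbrakk>V \<in> \<V>; W \<in> \<V>\<rbrakk> \<Longrightarrow> \<exists>U \<in> \<V>. U \<subseteq> V \<inter> W"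
    and meet: "\<And>V. V \<in> \<V> \<Longrightarrow> C \<inter> V \<noteq> {}"
  obtains p where "p \<in> C" "\<And>V. V \<in> \<V> \<Longrightarrow> p \<in> V"
proof -
  \<comment> \<open>Zorn's lemma is applied to the complements: a maximal open set in \<A> is the
    complement of a minimal closed subset of C that meets every member of \<V>.\<close>
  define \<A> where "\<A> = {U. openin X U \<and> topspace X - C \<subseteq> U \<and> (\<forall>V \<in> \<V>. \<not> V \<subseteq> U)}"
  have Vsub: "V \<subseteq> topspace X" if "V \<in> \<V>" for V using qc[OF that] openin_subset by (auto simp: qc_open_def)
  have "topspace X - C \<in> \<A>" using C meet Vsub unfolding \<A>_def by blast
  moreover have "\<Union>\<C> \<in> \<A>" if \<C>: "\<C> \<noteq> {}" "subset.chain \<A> \<C>" for \<C>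
  proof -
    have sub: "\<C> \<subseteq> \<A>" using \<C>(2) by (auto simp: subset.chain_def)
    \<comment> \<open>Quasi-compactness of V is what makes chains have upper bounds: if V lay in the
      union of the chain, it would lie in a single member.\<close>
    have "\<not> V \<subseteq> \<Union>\<C>" if V: "V \<in> \<V>" for V
    proof
      assume "V \<subseteq> \<Union>\<C>"
      moreover have "compactin X V" "\<And>U. U \<in> \<C> \<Longrightarrow> openin X U" using qc[OF V] sub by (auto simp: qc_open_def \<A>_def)
      ultimately obtain \<F> where \<F>: "finite \<F>" "\<F> \<subseteq> \<C>" "V \<subseteq> \<Union>\<F>" unfolding compactin_def by meson
      show False
      proof (cases "\<F> = {}")
        case True
        then show False using \<F> meet[OF V] by blast
      next
        case False
        have "subset.chain \<A> \<F>" using \<C>(2) \<F>(2) unfolding subset_chain_def by blast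
        then have "\<Union>\<F> \<in> \<F>" by (rule Union_in_chain[OF \<F>(1) False])
        then show False using \<F>(2,3) sub V by (auto simp: \<A>_def)
      qed
    qed
    then show ?thesis using sub \<C>(1) unfolding \<A>_def by blast
  qed
  ultimately obtain M where M: "M \<in> \<A>" "\<And>U. \<lbrakk>U \<in> \<A>; M \<subseteq> U\<rbrakk> \<Longrightarrow> U = M"
    using subset_Zorn_nonempty[of \<A>] by (metis empty_iff)
  let ?D = "topspace X - M"
  have Mo: "openin X M" "topspace X - C \<subseteq> M" "\<And>V. V \<in> \<V> \<Longrightarrow> \<not> V \<subseteq> M" using M(1) by (auto simp: \<A>_def)
  have "irreducible_closed X ?D" unfolding irreducible_closed_def
  proof (intro conjI allI impI)
    show "closedin X ?D" using Mo(1) by blast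
    show "?D \<noteq> {}" using ne Mo(3) Vsub by blast
    fix A B assume A: "closedin X A" and B: "closedin X B" and D: "?D = A \<union> B"
    show "?D = A \<or> ?D = B"
    proof (rule ccontr)
      assume n: "\<not> (?D = A \<or> ?D = B)"
      \<comment> \<open>A closed set strictly inside ?D has an open complement strictly larger than
        M, which by maximality must contain some member of \<V>.\<close>
      have big: "\<exists>V \<in> \<V>. V \<subseteq> topspace X - S" if S: "closedin X S" "S \<subseteq> ?D" "?D \<noteq> S" for S
      proof (rule ccontr)
        assume "\<not> (\<exists>V \<in> \<V>. V \<subseteq> topspace X - S)"
        moreover have MS: "M \<subseteq> topspace X - S" using S(2) openin_subset[OF Mo(1)] by blast
        ultimately have "topspace X - S \<in> \<A>" using S(1) Mo(2) unfolding \<A>_def by blast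
        then have "topspace X - S = M" using M(2) MS by blast
        then show False using S closedin_subset[OF S(1)] by blast
      qed
      obtain V W where "V \<in> \<V>" "V \<subseteq> topspace X - A" "W \<in> \<V>" "W \<subseteq> topspace X - B"
        using big[OF A] big[OF B] D n by blast
      moreover from this obtain U where "U \<in> \<V>" "U \<subseteq> V \<inter> W" using dir by blast
      ultimately have "U \<subseteq> topspace X - ?D" using D by blast
      then show False using Mo(3)[OF \<open>U \<in> \<V>\<close>] by blast
    qed
  qed
  then obtain p where p: "p \<in> topspace X" "X closure_of {p} = ?D"
    using spectralD(2)[OF X] unfolding sober_space_def by blast
  have "p \<in> ?D" using p closure_of_subset[of "{p}" X] by blast
  \<comment> \<open>V meets ?D, the closure of p, and an open set meeting the closure of a point
    contains the point.\<close>
  moreover have "p \<in> V" if V: "V \<in> \<V>" for V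
  proof -
    obtain q where "q \<in> V" "q \<in> X closure_of {p}" using Mo(3)[OF V] Vsub[OF V] p(2) by blast
    then show ?thesis using qc[OF V] unfolding in_closure_of qc_open_def by blast
  qed
  ultimately show thesis using that Mo(2) by blast
qed

text \<open>If no finite subfamily covered Z, the complements of finite unions would be a directed
  family of quasi-compact open sets meeting Z, and \<open>spectral_point\<close> would give a point
  of Z that is not covered at all.\<close>

lemma thomason_closed_finite_cover:
  assumes X: "spectral_space X" and Z: "thomason_closed X Z" and \<F>: "\<And>Y. Y \<in> \<F> \<Longrightarrow> thomason_closed X Y"
    and cover: "Z \<subseteq> \<Union>\<F>"
  shows "\<exists>\<G>. finite \<G> \<and> \<G> \<subseteq> \<F> \<and> Z \<subseteq> \<Union>\<G>"
proof (rule ccontr)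
  assume n: "\<not> (\<exists>\<G>. finite \<G> \<and> \<G> \<subseteq> \<F> \<and> Z \<subseteq> \<Union>\<G>)"
  define \<V> where "\<V> = {topspace X - \<Union>\<G> |\<G>. finite \<G> \<and> \<G> \<subseteq> \<F>}"
  have ZX: "Z \<subseteq> topspace X" using thomason_closed_subset[OF Z] .
  obtain p where p: "p \<in> Z" "\<And>V. V \<in> \<V> \<Longrightarrow> p \<in> V"
  proof (rule spectral_point[OF X, of Z \<V>])
    show "closedin X Z" using Z by (simp add: thomason_closed_def)
    show "\<V> \<noteq> {}" unfolding \<V>_def by blast
    show "qc_open X V" if "V \<in> \<V>" for V
      using that thomason_closed_qc[OF thomason_closed_Union[OF X]] \<F> unfolding \<V>_def by blast
    show "\<exists>U \<in> \<V>. U \<subseteq> V \<inter> W" if VW: "V \<in> \<V>" "W \<in> \<V>" for V W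
    proof -
      obtain \<G> \<H> where "finite \<G>" "\<G> \<subseteq> \<F>" "V = topspace X - \<Union>\<G>" "finite \<H>" "\<H> \<subseteq> \<F>" "W = topspace X - \<Union>\<H>"
        using VW unfolding \<V>_def by blast
      then show ?thesis unfolding \<V>_def by (intro bexI[of _ "topspace X - \<Union>(\<G> \<union> \<H>)"] CollectI exI[of _ "\<G> \<union> \<H>"]) auto
    qed
    show "Z \<inter> V \<noteq> {}" if "V \<in> \<V>" for V using n that ZX unfolding \<V>_def by blast
  qed blast
  obtain Y where "Y \<in> \<F>" "p \<in> Y" using p(1) cover by blast
  moreover have "topspace X - \<Union>{Y} \<in> \<V>" unfolding \<V>_def using \<open>Y \<in> \<F>\<close> by blast
  ultimately show False using p(2) by blast
qed

text \<open>Points that no quasi-compact open set separates have the same closure. The closure of a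
  point is irreducible, so sobriety makes its generic point unique.\<close>

lemma T0_spectral:
  assumes X: "spectral_space X" and pq: "p \<in> topspace X" "q \<in> topspace X"
    and eq: "\<And>V. qc_open X V \<Longrightarrow> p \<in> V \<longleftrightarrow> q \<in> V"
  shows "p = q"
proof -
  have o: "p \<in> V \<longleftrightarrow> q \<in> V" if "openin X V" for V
    using spectralD(4)[OF X that] eq by blast
  have e: "X closure_of {p} = X closure_of {q}"
    using o pq by (auto simp: in_closure_of)
  have "irreducible_closed X (X closure_of {p})" unfolding irreducible_closed_def
  proof (intro conjI allI impI)
    have pc: "p \<in> X closure_of {p}" using pq closure_of_subset[of "{p}" X] by blast
    then show "X closure_of {p} \<noteq> {}" by blast
    fix A B assume AB: "closedin X A" "closedin X B" "X closure_of {p} = A \<union> B"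
    then have "p \<in> A \<or> p \<in> B" using pc by blast
    then show "X closure_of {p} = A \<or> X closure_of {p} = B"
      using AB closure_of_minimal[of "{p}" A X] closure_of_minimal[of "{p}" B X] by blast
  qed simp
  then show ?thesis using spectralD(2)[OF X] e pq unfolding sober_space_def by metis
qed

section \<open>Stratification\<close>

locale stratified = rigid_category T \<kappa> for T (structure) and \<kappa> :: "'u rel" +
  fixes X :: "'x topology" and \<sigma> :: "'a \<Rightarrow> 'x set"
  assumes spectral: "spectral_space X"
    and \<sigma>_subset: "t \<in> Obj T \<Longrightarrow> \<sigma> t \<subseteq> topspace X"
    and \<sigma>_zero: "is_zero_obj T z \<Longrightarrow> \<sigma> z = {}"
    and \<sigma>_unit: "\<sigma> \<one>\<^sub>T = topspace X"
    and \<sigma>_shift: "t \<in> Obj T \<Longrightarrow> \<sigma> (\<Sigma>\<^sub>o t) = \<sigma> t"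
    and \<sigma>_triangle: "\<lbrakk>(f, g, h) \<in> Tri T; f \<in> homset T a b; g \<in> homset T b c; h \<in> homset T c (\<Sigma>\<^sub>o a)\<rbrakk>
          \<Longrightarrow> \<sigma> c \<subseteq> \<sigma> a \<union> \<sigma> b"
    and \<sigma>_coproduct: "\<And>(I :: 'u set) t c \<iota>. \<lbrakk>small \<kappa> I; is_coproduct T I t c \<iota>\<rbrakk> \<Longrightarrow> \<sigma> c = (\<Union>i \<in> I. \<sigma> (t i))"
    and \<sigma>_tensor: "\<lbrakk>s \<in> Obj T; t \<in> Obj T\<rbrakk> \<Longrightarrow> \<sigma> (s \<boxtimes> t) \<subseteq> \<sigma> s \<inter> \<sigma> t"
    and stratifies: "bij_betw (\<lambda>L. \<Union>t \<in> L. \<sigma> t) {L. localizing_ideal \<kappa> T L} (Pow (topspace X))"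
begin

abbreviation supports where "supports E \<equiv> (\<Union>t \<in> E. \<sigma> t)"

lemma \<sigma>_biproduct:
  assumes "is_biproduct T x y s"
  shows "\<sigma> s = \<sigma> x \<union> \<sigma> y"
proof -
  obtain i j p q where b: "i \<in> homset T x s" "j \<in> homset T y s" "p \<in> homset T s x" "q \<in> homset T s y"
    "p \<cdot> i = Id T x" "q \<cdot> j = Id T y" "q \<cdot> i = Zero T x y" "p \<cdot> j = Zero T y x" "i \<cdot> p \<boxplus> j \<cdot> q = Id T s"
    using assms unfolding is_biproduct_def by blast
  note A = homsetD[OF b(1)] homsetD[OF b(2)] homsetD[OF b(3)] homsetD[OF b(4)] hom_obj[OF b(1)] hom_obj[OF b(2)]
  \<comment> \<open>A binary coproduct needs an index set with two elements inside the type of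
    \<kappa>. A copy of the natural numbers in that type provides them.\<close>
  have "small \<kappa> (UNIV :: nat set)" by (rule small_nat[OF univ])
  moreover have "Card_order \<kappa>" using univ by (simp add: inaccessible_def)
  ultimately obtain \<phi> and I :: "'u set" where \<phi>: "bij_betw \<phi> I (UNIV :: nat set)" by (rule small_transport)
  have "0 \<in> \<phi> ` I" "1 \<in> \<phi> ` I" using bij_betw_imp_surj_on[OF \<phi>] by auto
  then obtain u v where "\<phi> u = 0" "\<phi> v = 1" by (elim imageE) simp
  then have uv: "u \<noteq> v" by auto
  have "is_coproduct T {u, v} (\<lambda>k. if k = u then x else y) s (\<lambda>k. if k = u then i else j)"
  proof (rule coproductI)
    show "s \<in> Obj T" using A by simp
    show "(if k = u then i else j) \<in> homset T (if k = u then x else y) s" if "k \<in> {u, v}" for k using b by auto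
    fix z
    { fix g assume z: "z \<in> Obj T" and "\<And>k. k \<in> {u, v} \<Longrightarrow> g k \<in> homset T (if k = u then x else y) z"
      then have g: "g u \<in> homset T x z" "g v \<in> homset T y z" using uv by (metis insertCI)+
      note B = A homsetD[OF g(1)] homsetD[OF g(2)]
      let ?h = "g u \<cdot> p \<boxplus> g v \<cdot> q"
      have "?h \<cdot> i = g u" "?h \<cdot> j = g v" using B b z by simp_all
      moreover have "?h \<in> homset T s z" using B by (simp add: homset_iff)
      ultimately show "\<exists>h. h \<in> homset T s z \<and> (\<forall>k\<in>{u, v}. h \<cdot> (if k = u then i else j) = g k)"
        using uv by (intro exI[of _ ?h]) auto }
    fix h h' assume h: "h \<in> homset T s z" "h' \<in> homset T s z"
      and e: "\<And>k. k \<in> {u, v} \<Longrightarrow> h \<cdot> (if k = u then i else j) = h' \<cdot> (if k = u then i else j)"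
    have e': "h \<cdot> i = h' \<cdot> i" "h \<cdot> j = h' \<cdot> j" using e[of u] e[of v] uv by auto
    note B = A homsetD[OF h(1)] homsetD[OF h(2)]
    have "k = (k \<cdot> i) \<cdot> p \<boxplus> (k \<cdot> j) \<cdot> q" if k: "k \<in> homset T s z" for k
    proof -
      have "k = k \<cdot> (i \<cdot> p \<boxplus> j \<cdot> q)" unfolding b(9) using homsetD[OF k] by simp
      also have "\<dots> = (k \<cdot> i) \<cdot> p \<boxplus> (k \<cdot> j) \<cdot> q" using A homsetD[OF k] by simp
      finally show ?thesis .
    qed
    from this[OF h(1)] this[OF h(2)] show "h = h'" using e' by simp
  qed
  then have "\<sigma> s = (\<Union>k \<in> {u, v}. \<sigma> (if k = u then x else y))"
    by (rule \<sigma>_coproduct[OF small_finite[OF univ], rotated]) simp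
  then show ?thesis using uv by auto
qed

lemma \<sigma>_retract:
  assumes "retract x s"
  shows "\<sigma> x \<subseteq> \<sigma> s"
proof -
  obtain z where "is_biproduct T x z s" by (rule retract_biproduct[OF assms])
  then show ?thesis using \<sigma>_biproduct by blast
qed

lemma \<sigma>_isomorphic:
  assumes "isomorphic T x y"
  shows "\<sigma> x = \<sigma> y"
  using \<sigma>_retract[OF isomorphic_retract[OF assms]] \<sigma>_retract[OF isomorphic_retract[OF isomorphic_sym[OF assms]]]
  by (rule equalityI)

lemma \<sigma>_tri: "tri f g h x y z \<Longrightarrow> \<sigma> z \<subseteq> \<sigma> x \<union> \<sigma> y"
  using \<sigma>_triangle unfolding tri_def by blast

text \<open>On subsets of X this is the inverse of the stratifying bijection, as
  \<open>supports_supported\<close> and \<open>ideal_eq_supported\<close> show.\<close>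

definition supported where "supported Y = {t \<in> Obj T. \<sigma> t \<subseteq> Y}"

lemma supported_ideal: "localizing_ideal \<kappa> T (supported Y)"
  unfolding localizing_ideal_def localizing_subcategory_def
proof (intro conjI allI impI ballI)
  show "triangulated_subcategory T (supported Y)"
  proof (rule triangulated_subcategoryI)
    show "supported Y \<subseteq> Obj T" by (auto simp: supported_def)
    show "z \<in> supported Y" if "is_zero_obj T z" for z using \<sigma>_zero zero_obj_obj that by (simp add: supported_def)
    show "y \<in> supported Y" if "x \<in> supported Y" "isomorphic T x y" for x y
      using \<sigma>_isomorphic[OF that(2)] isomorphic_obj[OF that(2)] that(1) by (simp add: supported_def)
    show "z \<in> supported Y" if "tri f g h x y z" "x \<in> supported Y" "y \<in> supported Y" for f g h x y z
      using \<sigma>_tri[OF that(1)] that(2,3) tri_arr(12)[OF that(1)] by (auto simp: supported_def)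
  qed (auto simp: supported_def \<sigma>_shift)
  show "c \<in> supported Y" if "small \<kappa> I" "is_coproduct T I t c \<iota>" "\<forall>i\<in>I. t i \<in> supported Y" for I :: "'u set" and t c \<iota>
    using \<sigma>_coproduct[OF that(1,2)] coproduct_in(1)[OF that(2)] that(3) by (auto simp: supported_def)
  show "s \<boxtimes> t \<in> supported Y" if "t \<in> supported Y" "s \<in> Obj T" for t s
    using \<sigma>_tensor[OF that(2), of t] that by (auto simp: supported_def)
qed

lemma supports_supported: "Y \<subseteq> topspace X \<Longrightarrow> supports (supported Y) = Y"
proof -
  assume "Y \<subseteq> topspace X"
  then have "Y \<in> (\<lambda>L. \<Union>t \<in> L. \<sigma> t) ` {L. localizing_ideal \<kappa> T L}"
    using bij_betw_imp_surj_on[OF stratifies] by simp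
  then obtain L where L: "localizing_ideal \<kappa> T L" "Y = supports L" by blast
  have "L \<subseteq> supported Y"
    using triangulated_subcategoryD(1)[OF localizing_idealD(2)[OF L(1)]] L(2) by (auto simp: supported_def)
  then show ?thesis using L(2) by (auto simp: supported_def)
qed

text \<open>Two ideals with the same support are compared, so this is the injectivity of the
  stratifying map; surjectivity went into \<open>supports_supported\<close>.\<close>

lemma ideal_eq_supported:
  assumes L: "localizing_ideal \<kappa> T L"
  shows "L = supported (supports L)"
proof (rule inj_onD[OF bij_betw_imp_inj_on[OF stratifies]])
  have "L \<subseteq> Obj T" using triangulated_subcategoryD(1)[OF localizing_idealD(2)[OF L]] by blast
  then have "supports L \<subseteq> topspace X" using \<sigma>_subset by blast
  then show "supports L = supports (supported (supports L))" using supports_supported by simp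
qed (use L supported_ideal in auto)

lemma Loc_ideal_eq: "E \<subseteq> Obj T \<Longrightarrow> Loc_ideal \<kappa> T E = supported (supports E)"
proof -
  assume E: "E \<subseteq> Obj T"
  note L = Loc_ideal_ideal[OF E, where \<kappa> = \<kappa>]
  have 1: "Loc_ideal \<kappa> T E \<subseteq> supported (supports E)"
    by (rule Loc_ideal_least[OF supported_ideal]) (use E in \<open>auto simp: supported_def\<close>)
  then have "supports (Loc_ideal \<kappa> T E) = supports E"
    using Loc_ideal_superset[of E \<kappa>] by (auto simp: supported_def)
  then show ?thesis using ideal_eq_supported[OF L] by simp
qed

text \<open>Prepares \<open>\<sigma>_empty_iff\<close>: as an ideal with empty support it coincides
  with the ideal supported on the empty set, so \<sigma> detects zero objects.\<close>

lemma zero_objects_ideal: "localizing_ideal \<kappa> T {z. is_zero_obj T z}" (is "localizing_ideal \<kappa> T ?Z")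
  unfolding localizing_ideal_def localizing_subcategory_def
proof (intro conjI allI impI ballI)
  show "triangulated_subcategory T ?Z"
  proof (rule triangulated_subcategoryI)
    show "y \<in> ?Z" if "x \<in> ?Z" "isomorphic T x y" for x y
      using zero_obj_isomorphic isomorphic_sym that by blast
    show "z \<in> ?Z" if t: "tri f g h x y z" and xZ: "x \<in> ?Z" and yZ: "y \<in> ?Z" for f g h x y z
    proof -
      have x: "is_zero_obj T x" and y: "is_zero_obj T y" using xZ yZ by auto
      note A = tri_arr[OF t]
      have "h = Zero T z (\<Sigma>\<^sub>o x)" by (rule zero_obj_hom(2)[OF Sh_zero_obj[OF x] triD(4)[OF t]])
      then have "h \<cdot> Id T z = Zero T z (\<Sigma>\<^sub>o x)" using A by simp
      then obtain v where v: "v \<in> homset T z y" "g \<cdot> v = Id T z" by (rule tri_exact2[OF t Id_in[OF A(12)]])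
      show ?thesis using zero_obj_retract[OF y retractI[OF v(1) triD(3)[OF t] v(2)]] by blast
    qed
    show "\<Sigma>\<^sub>o x \<in> ?Z" if "x \<in> ?Z" for x using Sh_zero_obj that by blast
    show "x \<in> ?Z" if "x \<in> Obj T" "\<Sigma>\<^sub>o x \<in> ?Z" for x using Sh_reflects_zero_obj that by blast
  qed (use zero_obj_obj in blast)+
  show "c \<in> ?Z" if c: "is_coproduct T I t c \<iota>" and z: "\<forall>i\<in>I. t i \<in> ?Z" for I :: "'u set" and t c \<iota>
  proof -
    note o = coproduct_in[OF c]
    have "Id T c = Zero T c c"
    proof (rule coproduct_eq[OF c Id_in[OF o(1)] Zero_in[OF o(1,1)]])
      fix i assume i: "i \<in> I"
      have "\<iota> i = Zero T (t i) c" using zero_obj_hom(1)[OF _ o(2)[OF i]] z i by blast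
      then show "Id T c \<cdot> \<iota> i = Zero T c c \<cdot> \<iota> i" using o(1) o(3)[OF i] by simp
    qed
    then show ?thesis using o(1) by (simp add: zero_obj_iff)
  qed
  show "s \<boxtimes> t \<in> ?Z" if "t \<in> ?Z" "s \<in> Obj T" for t s using zero_tensor(2) that by blast
qed

lemma \<sigma>_empty_iff: "t \<in> Obj T \<Longrightarrow> \<sigma> t = {} \<longleftrightarrow> is_zero_obj T t"
proof -
  assume t: "t \<in> Obj T"
  have "{z. is_zero_obj T z} = supported {}"
    using ideal_eq_supported[OF zero_objects_ideal] \<sigma>_zero by simp
  then show ?thesis using t by (auto simp: supported_def)
qed

lemma exists_point_object:
  assumes "p \<in> topspace X"
  obtains t where "t \<in> Obj T" "\<sigma> t = {p}"
proof -
  have "supports (supported {p}) = {p}" using supports_supported assms by simp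
  then obtain t where "t \<in> supported {p}" "p \<in> \<sigma> t" by blast
  then show thesis using that[of t] by (auto simp: supported_def)
qed

text \<open>Otherwise the ideal N of objects whose product with t has empty support would contain t
  and all objects supported at a point other than p. Its support would be X, so it would contain the
  unit, and t itself would have empty support.\<close>

lemma \<sigma>_tensor_point:
  assumes t: "t \<in> Obj T" "\<sigma> t = {p}"
  shows "\<sigma> (t \<boxtimes> t) = {p}"
proof (rule ccontr)
  assume "\<sigma> (t \<boxtimes> t) \<noteq> {p}"
  moreover have "\<sigma> (t \<boxtimes> t) \<subseteq> {p}" using \<sigma>_tensor[OF t(1,1)] t(2) by simp
  ultimately have tt: "\<sigma> (t \<boxtimes> t) = {}" by (auto dest: subset_singletonD)
  define N where "N = {a \<in> Obj T. a \<boxtimes> t \<in> supported {}}"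
  have N: "localizing_ideal \<kappa> T N" unfolding N_def by (rule preimage_ideal[OF supported_ideal t(1)])
  have "q \<in> supports N" if q: "q \<in> topspace X" for q
  proof (cases "q = p")
    case True
    have "t \<in> N" using t tt by (simp add: N_def supported_def)
    then show ?thesis using t True by blast
  next
    case False
    obtain b where b: "b \<in> Obj T" "\<sigma> b = {q}" by (rule exists_point_object[OF q])
    have "b \<in> N" using b t False \<sigma>_tensor[OF b(1) t(1)] by (auto simp: N_def supported_def)
    then show ?thesis using b by blast
  qed
  then have "\<one>\<^sub>T \<in> supported (supports N)" using \<sigma>_unit Unit_in by (auto simp: supported_def)
  then have "\<one>\<^sub>T \<in> N" using ideal_eq_supported[OF N] by simp
  then have "\<sigma> (\<one>\<^sub>T \<boxtimes> t) = {}" by (auto simp: N_def supported_def)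
  then show False using \<sigma>_isomorphic[OF LUnit_isomorphic[OF t(1)]] t(2) by simp
qed

text \<open>For p in both supports take a with support {p}. It lies in the localizing ideals
  generated by s and by t, so s and then t can be replaced by a in s \<otimes> t without leaving the
  ideal supported on \<sigma>(s \<otimes> t). Finally, a \<otimes> a still has p in its
  support.\<close>

lemma \<sigma>_tensor_eq:
  assumes s: "s \<in> Obj T" and t: "t \<in> Obj T"
  shows "\<sigma> (s \<boxtimes> t) = \<sigma> s \<inter> \<sigma> t"
proof
  show "\<sigma> (s \<boxtimes> t) \<subseteq> \<sigma> s \<inter> \<sigma> t" by (rule \<sigma>_tensor[OF s t])
  show "\<sigma> s \<inter> \<sigma> t \<subseteq> \<sigma> (s \<boxtimes> t)"
  proof
    fix p assume p: "p \<in> \<sigma> s \<inter> \<sigma> t"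
    obtain a where a: "a \<in> Obj T" "\<sigma> a = {p}" using exists_point_object p \<sigma>_subset[OF s] by blast
    let ?M = "supported (\<sigma> (s \<boxtimes> t))"
    have aL: "a \<in> Loc_ideal \<kappa> T {s}" "a \<in> Loc_ideal \<kappa> T {t}"
      using a p Loc_ideal_eq[of "{s}"] Loc_ideal_eq[of "{t}"] s t by (auto simp: supported_def)
    have "Loc_ideal \<kappa> T {s} \<subseteq> {w \<in> Obj T. w \<boxtimes> t \<in> ?M}"
      by (rule Loc_ideal_least[OF preimage_ideal[OF supported_ideal t]]) (use s t in \<open>auto simp: supported_def\<close>)
    then have at: "\<sigma> (a \<boxtimes> t) \<subseteq> \<sigma> (s \<boxtimes> t)" using aL(1) by (auto simp: supported_def)
    have "Loc_ideal \<kappa> T {t} \<subseteq> {w \<in> Obj T. w \<boxtimes> a \<in> ?M}"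
      by (rule Loc_ideal_least[OF preimage_ideal[OF supported_ideal a(1)]])
         (use at \<sigma>_isomorphic[OF Braid_isomorphic[OF a(1) t]] a(1) t in \<open>auto simp: supported_def\<close>)
    then have "\<sigma> (a \<boxtimes> a) \<subseteq> \<sigma> (s \<boxtimes> t)" using aL(2) by (auto simp: supported_def)
    then show "p \<in> \<sigma> (s \<boxtimes> t)" using \<sigma>_tensor_point[OF a] by simp
  qed
qed

lemma K_obj: "x \<in> K \<Longrightarrow> x \<in> Obj T"
  by (rule compact_obj)

lemma K_Un:
  assumes "x \<in> K" "y \<in> K"
  obtains w where "w \<in> K" "\<sigma> w = \<sigma> x \<union> \<sigma> y"
  using triangulated_biproduct[OF compact_triangulated assms] \<sigma>_biproduct by metis

lemma K_empty: obtains z where "z \<in> K" "\<sigma> z = {}"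
  using zero_obj_obtain compact_zero \<sigma>_zero by metis

lemma K_finite_Un:
  assumes "finite F" "F \<subseteq> K"
  obtains w where "w \<in> K" "\<sigma> w = supports F"
proof -
  have "\<exists>w \<in> K. \<sigma> w = supports F" using assms
  proof (induction F)
    case empty
    then show ?case using K_empty by (metis UN_empty)
  next
    case (insert x F)
    then obtain w where "w \<in> K" "\<sigma> w = supports F" by blast
    moreover obtain v where "v \<in> K" "\<sigma> v = \<sigma> x \<union> \<sigma> w" using K_Un[of x w] insert.prems calculation(1) by blast
    ultimately show ?case by auto
  qed
  then show thesis using that by blast
qed

text \<open>Thick ideals of compact objects correspond to ideals of the lattice of supports of compact
  objects.\<close>

lemma thick_idealI:
  assumes JK: "J \<subseteq> K" and ne: "J \<noteq> {}" and clo: "\<And>x y z. \<lbrakk>x \<in> K; y \<in> J; z \<in> J; \<sigma> x \<subseteq> \<sigma> y \<union> \<sigma> z\<rbrakk> \<Longrightarrow> x \<in> J"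
  shows "thick_ideal_compacts \<kappa> T J"
  unfolding thick_ideal_compacts_def thick_subcategory_iff
proof (intro conjI ballI allI impI)
  obtain j where j: "j \<in> J" using ne by blast
  have down: "x \<in> J" if "x \<in> K" "y \<in> J" "\<sigma> x \<subseteq> \<sigma> y" for x y using clo[OF that(1,2,2)] that(3) by blast
  note KD = triangulated_subcategoryD[OF compact_triangulated[of \<kappa>]]
  show "J \<subseteq> K" by fact
  show "triangulated_subcategory T J"
  proof (rule triangulated_subcategoryI)
    show "J \<subseteq> Obj T" using JK K_obj by blast
    show "z \<in> J" if "is_zero_obj T z" for z using down[OF compact_zero[OF that] j] \<sigma>_zero[OF that] by blast
    show "y \<in> J" if "x \<in> J" "isomorphic T x y" for x y
      using down[OF KD(3)[OF _ that(2)] that(1)] JK that(1) \<sigma>_isomorphic[OF that(2)] by blast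
    show "\<Sigma>\<^sub>o x \<in> J" if "x \<in> J" for x
      using down[OF compact_Sh that] \<sigma>_shift JK K_obj that by blast
    show "x \<in> J" if "x \<in> Obj T" "\<Sigma>\<^sub>o x \<in> J" for x
      using down[OF compact_Sh_reflects[OF _ that(1)] that(2)] \<sigma>_shift JK that by blast
    show "z \<in> J" if "tri f g h x y z" "x \<in> J" "y \<in> J" for f g h x y z
      using clo[OF compact_cone[OF that(1)] that(2,3) \<sigma>_tri[OF that(1)]] JK that(2,3) by blast
  qed
  show "x \<in> J" if "s \<in> J" "retract x s" for s x
    using down[OF compact_retract[OF _ that(2)] that(1) \<sigma>_retract[OF that(2)]] JK that(1) by blast
  show "y \<boxtimes> x \<in> J" if "x \<in> J" "y \<in> K" for x y
    using down[OF K_tensor[OF that(2)] that(1)] \<sigma>_tensor[of y x] JK K_obj that by blast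
qed

text \<open>By stratification, y and z generate the localizing ideal of all objects supported on the
  union of their supports. The compact object x belongs to it, hence to J by
  \<open>compact_in_Loc_ideal\<close>.\<close>

lemma thick_ideal_closed:
  assumes J: "thick_ideal_compacts \<kappa> T J" and x: "x \<in> K" and y: "y \<in> J" "z \<in> J" and s: "\<sigma> x \<subseteq> \<sigma> y \<union> \<sigma> z"
  shows "x \<in> J"
proof (rule compact_in_Loc_ideal[OF J _ x])
  show "{y, z} \<subseteq> J" using y by blast
  then have "{y, z} \<subseteq> Obj T" using thick_idealD(2)[OF J] K_obj by blast
  then show "x \<in> Loc_ideal \<kappa> T {y, z}" using Loc_ideal_eq s K_obj[OF x] by (auto simp: supported_def)
qed

text \<open>Compactness in the categorical sense does the work here. The compact objects whose
  support is covered by finitely many members of E form a thick ideal containing E, and x lies in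
  the localizing ideal generated by E.\<close>

lemma finite_subcover:
  assumes x: "x \<in> K" and E: "E \<subseteq> K" and s: "\<sigma> x \<subseteq> supports E"
  obtains F where "finite F" "F \<subseteq> E" "\<sigma> x \<subseteq> supports F"
proof -
  define J where "J = {x \<in> K. \<exists>F. finite F \<and> F \<subseteq> E \<and> \<sigma> x \<subseteq> supports F}"
  have "thick_ideal_compacts \<kappa> T J"
  proof (rule thick_idealI)
    show "J \<subseteq> K" by (auto simp: J_def)
    obtain z where "z \<in> K" "\<sigma> z = {}" by (rule K_empty)
    then have "z \<in> J" unfolding J_def by blast
    then show "J \<noteq> {}" by blast
    fix a b c assume a: "a \<in> K" "b \<in> J" "c \<in> J" "\<sigma> a \<subseteq> \<sigma> b \<union> \<sigma> c"
    then obtain F G where "finite F" "F \<subseteq> E" "\<sigma> b \<subseteq> supports F" "finite G" "G \<subseteq> E" "\<sigma> c \<subseteq> supports G"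
      by (auto simp: J_def)
    then have "finite (F \<union> G)" "F \<union> G \<subseteq> E" "\<sigma> a \<subseteq> supports (F \<union> G)" using a(4) by auto
    then show "a \<in> J" using a(1) unfolding J_def by blast
  qed
  moreover have "E \<subseteq> J"
  proof
    fix e assume "e \<in> E"
    then have "finite {e} \<and> {e} \<subseteq> E \<and> \<sigma> e \<subseteq> supports {e}" by blast
    then show "e \<in> J" using \<open>e \<in> E\<close> E unfolding J_def by blast
  qed
  moreover have "x \<in> Loc_ideal \<kappa> T E" using Loc_ideal_eq[of E] E K_obj s x by (auto simp: supported_def)
  ultimately have "x \<in> J" using compact_in_Loc_ideal x by blast
  then show thesis using that unfolding J_def by blast
qed

section \<open>Compactly generated ideals and Thomason subsets\<close>

lemma compactly_generated_supports:
  "(\<lambda>L. supports L) ` {L. compactly_generated_ideal \<kappa> T L} = {supports E |E. E \<subseteq> K}"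
proof -
  have e: "supports (Loc_ideal \<kappa> T E) = supports E" if "E \<subseteq> K" for E
  proof -
    have "E \<subseteq> Obj T" using that K_obj by blast
    then have "supports E \<subseteq> topspace X" using \<sigma>_subset by blast
    moreover have "Loc_ideal \<kappa> T E = supported (supports E)" by (rule Loc_ideal_eq) fact
    ultimately show ?thesis using supports_supported by simp
  qed
  have "{L. compactly_generated_ideal \<kappa> T L} = Loc_ideal \<kappa> T ` {E. E \<subseteq> K}"
    unfolding compactly_generated_ideal_def by auto
  then have "(\<lambda>L. supports L) ` {L. compactly_generated_ideal \<kappa> T L} = (\<lambda>E. supports (Loc_ideal \<kappa> T E)) ` {E. E \<subseteq> K}"
    by (simp add: image_image)
  also have "\<dots> = (\<lambda>E. supports E) ` {E. E \<subseteq> K}" by (rule image_cong) (use e in auto)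
  finally show ?thesis by (simp add: setcompr_eq_image)
qed

abbreviation closed_condition where
  "closed_condition \<equiv> (\<forall>x \<in> K. thomason_closed X (\<sigma> x)) \<and> (\<forall>Z. thomason_closed X Z \<longrightarrow> (\<exists>x \<in> K. Z = \<sigma> x))"

lemma closed_condition_iff_generated:
  "closed_condition \<longleftrightarrow> (\<lambda>L. supports L) ` {L. compactly_generated_ideal \<kappa> T L} = {Y. thomason X Y}"
  unfolding compactly_generated_supports
proof
  assume a: closed_condition
  have p1: "thomason X (supports E)" if "E \<subseteq> K" for E
    unfolding thomason_def by (rule exI[of _ "\<sigma> ` E"]) (use a that in blast)
  have p2: "\<exists>E \<subseteq> K. Y = supports E" if Y: "thomason X Y" for Y
  proof -
    obtain \<F> where \<F>: "\<forall>Z \<in> \<F>. thomason_closed X Z" "Y = \<Union>\<F>" using Y unfolding thomason_def by blast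
    have "Z \<subseteq> supports {x \<in> K. \<sigma> x \<in> \<F>}" if Z: "Z \<in> \<F>" for Z
    proof -
      obtain x where "x \<in> K" "Z = \<sigma> x" using a \<F>(1) Z by auto
      then show ?thesis using Z by auto
    qed
    then have "Y = supports {x \<in> K. \<sigma> x \<in> \<F>}" using \<F>(2) by auto
    then show ?thesis by (intro exI[of _ "{x \<in> K. \<sigma> x \<in> \<F>}"]) auto
  qed
  show "{supports E |E. E \<subseteq> K} = {Y. thomason X Y}"
  proof (intro equalityI subsetI)
    show "Y \<in> {Y. thomason X Y}" if "Y \<in> {supports E |E. E \<subseteq> K}" for Y using that p1 by auto
    fix Y assume "Y \<in> {Y. thomason X Y}"
    then obtain E where "E \<subseteq> K" "Y = supports E" using p2[of Y] by auto
    then show "Y \<in> {supports E |E. E \<subseteq> K}" by (intro CollectI exI[of _ E]) simp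
  qed
next
  assume b: "{supports E |E. E \<subseteq> K} = {Y. thomason X Y}"
  have th: "thomason X Z" if "thomason_closed X Z" for Z
    unfolding thomason_def using that by (intro exI[of _ "{Z}"]) auto
  have ex: "\<exists>E \<subseteq> K. Y = supports E" if "thomason X Y" for Y
  proof -
    have "Y \<in> {supports E |E. E \<subseteq> K}" unfolding b using that by simp
    then show ?thesis by auto
  qed
  have 1: "thomason_closed X (\<sigma> x)" if x: "x \<in> K" for x
  proof -
    have "supports {x} \<in> {supports E |E. E \<subseteq> K}" using x by (intro CollectI exI[of _ "{x}"]) simp
    then have "thomason X (\<sigma> x)" unfolding b by simp
    then obtain \<F> where \<F>: "\<forall>Z \<in> \<F>. thomason_closed X Z" "\<sigma> x = \<Union>\<F>" unfolding thomason_def by blast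
    \<comment> \<open>Each member of \<F> is Thomason and therefore, by (b), a union of supports of
      compact objects. So the compact objects supported inside a single member of \<F> still cover
      \<sigma> x.\<close>
    define E where "E = {y \<in> K. \<exists>Z \<in> \<F>. \<sigma> y \<subseteq> Z}"
    have "\<sigma> x \<subseteq> supports E"
    proof
      fix p assume "p \<in> \<sigma> x"
      then obtain Z where Z: "Z \<in> \<F>" "p \<in> Z" using \<F> by blast
      then obtain G where G: "G \<subseteq> K" "Z = supports G" using ex th \<F>(1) by blast
      then show "p \<in> supports E" using Z unfolding E_def by blast
    qed
    moreover have "E \<subseteq> K" by (auto simp: E_def)
    ultimately obtain F where F: "finite F" "F \<subseteq> E" "\<sigma> x \<subseteq> supports F"
      using finite_subcover[OF x] by metis
    have "\<forall>y \<in> F. \<exists>Z. Z \<in> \<F> \<and> \<sigma> y \<subseteq> Z" using F(2) by (auto simp: E_def)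
    then obtain Zf where Zf: "\<forall>y \<in> F. Zf y \<in> \<F> \<and> \<sigma> y \<subseteq> Zf y" by metis
    \<comment> \<open>The members chosen for the finitely many y cover \<sigma> x and are contained
      in it, so \<sigma> x is a finite union of Thomason closed sets.\<close>
    have "\<sigma> x = \<Union>(Zf ` F)" using F(3) Zf \<F>(2) by blast
    moreover have "thomason_closed X (\<Union>(Zf ` F))"
      by (rule thomason_closed_Union[OF spectral]) (use F(1) Zf \<F>(1) in auto)
    ultimately show ?thesis by simp
  qed
  moreover have "\<exists>x \<in> K. Z = \<sigma> x" if Z: "thomason_closed X Z" for Z
  proof -
    obtain E where E: "E \<subseteq> K" "Z = supports E" using ex th[OF Z] by blast
    \<comment> \<open>The supports of the objects in E are Thomason closed by the first half, so
      finitely many of them cover Z; a direct sum of the corresponding objects then has support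
      Z.\<close>
    have "\<exists>\<G>. finite \<G> \<and> \<G> \<subseteq> \<sigma> ` E \<and> Z \<subseteq> \<Union>\<G>"
      by (rule thomason_closed_finite_cover[OF spectral Z]) (use 1 E in auto)
    then obtain \<G> where \<G>: "finite \<G>" "\<G> \<subseteq> \<sigma> ` E" "Z \<subseteq> \<Union>\<G>" by blast
    then obtain F where F: "finite F" "F \<subseteq> E" "\<G> = \<sigma> ` F" using finite_subset_image by metis
    have "F \<subseteq> K" using F(2) E(1) by blast
    then obtain w where w: "w \<in> K" "\<sigma> w = supports F" by (rule K_finite_Un[OF F(1)])
    have "Z = supports F" using \<G>(3) F(2,3) E(2) by auto
    then show ?thesis using w by auto
  qed
  ultimately show closed_condition by simp
qed

end

context stratified
begin

section \<open>Comparison with the Balmer spectrum\<close>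

lemma primeD:
  assumes "P \<in> prime_ideals \<kappa> T"
  shows "thick_ideal_compacts \<kappa> T P" "P \<subseteq> K" "\<one>\<^sub>T \<notin> P" "\<lbrakk>x \<in> K; y \<in> K; x \<boxtimes> y \<in> P\<rbrakk> \<Longrightarrow> x \<in> P \<or> y \<in> P"
    "\<exists>z \<in> P. \<sigma> z = {}"
proof -
  show J: "thick_ideal_compacts \<kappa> T P" using assms by (simp add: prime_ideals_def)
  show PK: "P \<subseteq> K" by (rule thick_idealD(2)[OF J])
  show "\<lbrakk>x \<in> K; y \<in> K; x \<boxtimes> y \<in> P\<rbrakk> \<Longrightarrow> x \<in> P \<or> y \<in> P" using assms by (simp add: prime_ideals_def)
  show "\<one>\<^sub>T \<notin> P"
  proof
    assume u: "\<one>\<^sub>T \<in> P"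
    have "x \<in> P" if "x \<in> K" for x
      by (rule thick_ideal_closed[OF J that u u]) (use \<sigma>_unit \<sigma>_subset[OF K_obj[OF that]] in blast)
    then show False using assms PK by (auto simp: prime_ideals_def)
  qed
  obtain z where "is_zero_obj T z" by (rule zero_obj_obtain)
  then show "\<exists>z \<in> P. \<sigma> z = {}" using triangulated_subcategoryD(2)[OF thick_idealD(1)[OF J]] \<sigma>_zero by blast
qed

text \<open>The space of a generated topology is the union of the generating sets. A zero object
  lies in every prime, so its generating set is the whole spectrum.\<close>

lemma topspace_Spc: "topspace (Spc \<kappa> T) = prime_ideals \<kappa> T"
proof -
  obtain z where z: "is_zero_obj T z" by (rule zero_obj_obtain)
  have "z \<in> P" if "P \<in> prime_ideals \<kappa> T" for P
    using triangulated_subcategoryD(2)[OF thick_idealD(1)[OF primeD(1)[OF that]]] z by blast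
  then have "prime_ideals \<kappa> T \<subseteq> (\<Union>x \<in> K. prime_ideals \<kappa> T - supp \<kappa> T x)"
    using compact_zero[OF z, of \<kappa>] by (auto simp: supp_def)
  then show ?thesis unfolding Spc_def topology_generated_by_topspace by auto
qed

lemma openin_Spc_basic: "x \<in> K \<Longrightarrow> openin (Spc \<kappa> T) {P \<in> prime_ideals \<kappa> T. x \<in> P}"
proof -
  assume x: "x \<in> K"
  have "openin (Spc \<kappa> T) (prime_ideals \<kappa> T - supp \<kappa> T x)"
    unfolding Spc_def by (rule topology_generated_by_Basis) (use x in simp)
  moreover have "prime_ideals \<kappa> T - supp \<kappa> T x = {P \<in> prime_ideals \<kappa> T. x \<in> P}" by (auto simp: supp_def)
  ultimately show ?thesis by simp
qed

text \<open>In the induction over the generated topology only intersections have content: a direct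
  sum w of x and y lies in exactly the primes that contain both.\<close>

lemma openin_Spc_basis:
  assumes "openin (Spc \<kappa> T) U" "P \<in> U"
  obtains x where "x \<in> K" "x \<in> P" "{Q \<in> prime_ideals \<kappa> T. x \<in> Q} \<subseteq> U"
proof -
  have "generate_topology_on ((\<lambda>x. prime_ideals \<kappa> T - supp \<kappa> T x) ` K) U"
    using assms(1) unfolding Spc_def openin_topology_generated_by_iff .
  then have "\<forall>P \<in> U. \<exists>x \<in> K. x \<in> P \<and> {Q \<in> prime_ideals \<kappa> T. x \<in> Q} \<subseteq> U"
  proof (induction rule: generate_topology_on.induct)
    case (Int a b)
    show ?case
    proof
      fix P assume P: "P \<in> a \<inter> b"
      obtain x where x: "x \<in> K" "x \<in> P" "{Q \<in> prime_ideals \<kappa> T. x \<in> Q} \<subseteq> a" using Int.IH(1) P by blast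
      obtain y where y: "y \<in> K" "y \<in> P" "{Q \<in> prime_ideals \<kappa> T. y \<in> Q} \<subseteq> b" using Int.IH(2) P by blast
      obtain w where w: "w \<in> K" "\<sigma> w = \<sigma> x \<union> \<sigma> y" by (rule K_Un[OF x(1) y(1)])
      have wx: "w \<in> Q \<longleftrightarrow> x \<in> Q \<and> y \<in> Q" if "Q \<in> prime_ideals \<kappa> T" for Q
      proof -
        note J = primeD(1)[OF that]
        show ?thesis
          using thick_ideal_closed[OF J w(1), of x y] thick_ideal_closed[OF J x(1), of w w] thick_ideal_closed[OF J y(1), of w w] w(2)
          by blast
      qed
      have "openin (Spc \<kappa> T) a" using Int.hyps(1) unfolding Spc_def openin_topology_generated_by_iff .
      then have "P \<in> prime_ideals \<kappa> T" using P openin_subset topspace_Spc by blast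
      then show "\<exists>x \<in> K. x \<in> P \<and> {Q \<in> prime_ideals \<kappa> T. x \<in> Q} \<subseteq> a \<inter> b"
        using wx w(1) x y by (intro bexI[of _ w]) auto
    qed
  next
    case (UN \<U>)
    then show ?case by (meson UnionE Union_upper subset_trans)
  next
    case (Basis s)
    then obtain x where x: "x \<in> K" "s = prime_ideals \<kappa> T - supp \<kappa> T x" by blast
    then have "s = {Q \<in> prime_ideals \<kappa> T. x \<in> Q}" by (auto simp: supp_def)
    then show ?case using x(1) by blast
  qed simp
  then show thesis using assms(2) that by blast
qed

text \<open>The prime ideal theorem for the distributive lattice of compact supports: a thick ideal
  containing x is taken maximal among those that avoid a multiplicative class around S. The
  hypothesis on finite subsets says that the ideal of x avoids this class.\<close>

lemma prime_exists:
  assumes x: "x \<in> K" and S: "S \<subseteq> K"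
    and fin: "\<And>F. \<lbrakk>finite F; F \<subseteq> S\<rbrakk> \<Longrightarrow> \<not> topspace X \<inter> (\<Inter>y \<in> F. \<sigma> y) \<subseteq> \<sigma> x"
  obtains P where "P \<in> prime_ideals \<kappa> T" "x \<in> P" "S \<inter> P = {}"
proof -
  \<comment> \<open>The filter generated by the supports of S. It contains S and the unit, is closed
    under tensor products by \<open>\<sigma>_tensor_eq\<close>, and is the class that the ideals
    must avoid.\<close>
  define W where "W = {w \<in> K. \<exists>F. finite F \<and> F \<subseteq> S \<and> topspace X \<inter> (\<Inter>y \<in> F. \<sigma> y) \<subseteq> \<sigma> w}"
  define \<A> where "\<A> = {J. thick_ideal_compacts \<kappa> T J \<and> x \<in> J \<and> J \<inter> W = {}}"
  have Wup: "v \<in> W" if ww: "w \<in> W" "w' \<in> W" and v: "v \<in> K" "\<sigma> w \<inter> \<sigma> w' \<subseteq> \<sigma> v" for v w w'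
  proof -
    obtain F where F: "finite F" "F \<subseteq> S" "topspace X \<inter> (\<Inter>y \<in> F. \<sigma> y) \<subseteq> \<sigma> w" using ww(1) by (auto simp: W_def)
    obtain G where G: "finite G" "G \<subseteq> S" "topspace X \<inter> (\<Inter>y \<in> G. \<sigma> y) \<subseteq> \<sigma> w'" using ww(2) by (auto simp: W_def)
    have "topspace X \<inter> (\<Inter>y \<in> F \<union> G. \<sigma> y) \<subseteq> (topspace X \<inter> (\<Inter>y \<in> F. \<sigma> y)) \<inter> (topspace X \<inter> (\<Inter>y \<in> G. \<sigma> y))" by auto
    also have "\<dots> \<subseteq> \<sigma> w \<inter> \<sigma> w'" by (rule Int_mono[OF F(3) G(3)])
    finally have "topspace X \<inter> (\<Inter>y \<in> F \<union> G. \<sigma> y) \<subseteq> \<sigma> v" using v(2) by (rule subset_trans)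
    then show ?thesis using v(1) F(1,2) G(1,2) unfolding W_def by (intro CollectI conjI exI[of _ "F \<union> G"]) auto
  qed
  have SW: "S \<subseteq> W"
  proof
    fix s assume s: "s \<in> S"
    then have "finite {s} \<and> {s} \<subseteq> S \<and> topspace X \<inter> (\<Inter>y \<in> {s}. \<sigma> y) \<subseteq> \<sigma> s" by blast
    then show "s \<in> W" using s S unfolding W_def by blast
  qed
  have uW: "\<one>\<^sub>T \<in> W"
  proof -
    have "finite {} \<and> {} \<subseteq> S \<and> topspace X \<inter> (\<Inter>y \<in> {}. \<sigma> y) \<subseteq> \<sigma> \<one>\<^sub>T" using \<sigma>_unit by simp
    then show ?thesis using Unit_K unfolding W_def by blast
  qed
  define J0 where "J0 = {y \<in> K. \<sigma> y \<subseteq> \<sigma> x}"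
  have "J0 \<in> \<A>"
  proof -
    have "thick_ideal_compacts \<kappa> T J0" by (rule thick_idealI) (use x in \<open>auto simp: J0_def\<close>)
    moreover have "J0 \<inter> W = {}"
    proof (rule ccontr)
      assume "J0 \<inter> W \<noteq> {}"
      then obtain w F where "\<sigma> w \<subseteq> \<sigma> x" "finite F" "F \<subseteq> S" "topspace X \<inter> (\<Inter>y \<in> F. \<sigma> y) \<subseteq> \<sigma> w"
        by (auto simp: J0_def W_def)
      then show False using fin[of F] by blast
    qed
    ultimately show ?thesis using x by (auto simp: \<A>_def J0_def)
  qed
  moreover have "\<Union>\<C> \<in> \<A>" if \<C>: "\<C> \<noteq> {}" "subset.chain \<A> \<C>" for \<C>
  proof -
    have sub: "\<C> \<subseteq> \<A>" and ch: "\<And>I J. \<lbrakk>I \<in> \<C>; J \<in> \<C>\<rbrakk> \<Longrightarrow> I \<subseteq> J \<or> J \<subseteq> I" using \<C>(2) by (auto simp: subset.chain_def)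
    have th: "thick_ideal_compacts \<kappa> T J" if "J \<in> \<C>" for J using sub that by (auto simp: \<A>_def)
    have "thick_ideal_compacts \<kappa> T (\<Union>\<C>)"
    proof (rule thick_idealI)
      show "\<Union>\<C> \<subseteq> K" using thick_idealD(2)[OF th] by blast
      show "\<Union>\<C> \<noteq> {}" using \<C>(1) sub by (auto simp: \<A>_def)
      fix a b c assume a: "a \<in> K" "b \<in> \<Union>\<C>" "c \<in> \<Union>\<C>" "\<sigma> a \<subseteq> \<sigma> b \<union> \<sigma> c"
      then obtain J where "J \<in> \<C>" "b \<in> J" "c \<in> J" using ch by blast
      then show "a \<in> \<Union>\<C>" using thick_ideal_closed[OF th a(1) _ _ a(4)] by blast
    qed
    then show ?thesis using sub \<C>(1) unfolding \<A>_def by blast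
  qed
  ultimately obtain P where P: "P \<in> \<A>" "\<And>J. \<lbrakk>J \<in> \<A>; P \<subseteq> J\<rbrakk> \<Longrightarrow> J = P"
    using subset_Zorn_nonempty[of \<A>] by (metis empty_iff)
  have PJ: "thick_ideal_compacts \<kappa> T P" "x \<in> P" "P \<inter> W = {}" using P(1) by (auto simp: \<A>_def)
  note PK = thick_idealD(2)[OF PJ(1)]
  have ext: "\<exists>w \<in> W. \<exists>p \<in> P. \<sigma> w \<subseteq> \<sigma> p \<union> \<sigma> a" if a: "a \<in> K" "a \<notin> P" for a
  proof -
    \<comment> \<open>The thick ideal generated by P and a. It properly contains P, so by maximality
      it meets W.\<close>
    define Q where "Q = {y \<in> K. \<exists>p \<in> P. \<sigma> y \<subseteq> \<sigma> p \<union> \<sigma> a}"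
    have PQ: "P \<subseteq> Q" using PK by (auto simp: Q_def)
    have aQ: "a \<in> Q" using a PJ(2) by (auto simp: Q_def)
    have "thick_ideal_compacts \<kappa> T Q"
    proof (rule thick_idealI)
      fix u v w assume u: "u \<in> K" "v \<in> Q" "w \<in> Q" "\<sigma> u \<subseteq> \<sigma> v \<union> \<sigma> w"
      then obtain p q where p: "p \<in> P" "\<sigma> v \<subseteq> \<sigma> p \<union> \<sigma> a" and q: "q \<in> P" "\<sigma> w \<subseteq> \<sigma> q \<union> \<sigma> a"
        by (auto simp: Q_def)
      obtain m where m: "m \<in> K" "\<sigma> m = \<sigma> p \<union> \<sigma> q" using K_Un p(1) q(1) PK by blast
      have "m \<in> P" using thick_ideal_closed[OF PJ(1) m(1) p(1) q(1)] m(2) by blast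
      moreover have "\<sigma> u \<subseteq> \<sigma> m \<union> \<sigma> a" using u(4) p(2) q(2) m(2) by blast
      ultimately show "u \<in> Q" using u(1) by (auto simp: Q_def)
    qed (use aQ in \<open>auto simp: Q_def\<close>)
    then have "Q \<inter> W \<noteq> {}" using P(2)[of Q] PQ aQ a(2) PJ(2) unfolding \<A>_def by blast
    then show ?thesis by (auto simp: Q_def)
  qed
  have "P \<in> prime_ideals \<kappa> T" unfolding prime_ideals_def
  proof (intro CollectI conjI ballI impI)
    show "thick_ideal_compacts \<kappa> T P" by (rule PJ(1))
    show "P \<noteq> K" using uW PJ(3) Unit_K by blast
    fix a b assume a: "a \<in> K" and b: "b \<in> K" and ab: "a \<boxtimes> b \<in> P"
    show "a \<in> P \<or> b \<in> P"
    proof (rule ccontr)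
      assume n: "\<not> (a \<in> P \<or> b \<in> P)"
      obtain w p where w: "w \<in> W" "p \<in> P" "\<sigma> w \<subseteq> \<sigma> p \<union> \<sigma> a" using ext[OF a] n by blast
      obtain w' p' where w': "w' \<in> W" "p' \<in> P" "\<sigma> w' \<subseteq> \<sigma> p' \<union> \<sigma> b" using ext[OF b] n by blast
      have wK: "w \<in> K" "w' \<in> K" using w(1) w'(1) by (auto simp: W_def)
      have "w \<boxtimes> w' \<in> W"
        by (rule Wup[OF w(1) w'(1) K_tensor[OF wK]]) (use \<sigma>_tensor_eq K_obj wK in simp)
      moreover obtain m where m: "m \<in> K" "\<sigma> m = \<sigma> p \<union> \<sigma> p'" using K_Un w(2) w'(2) PK by blast
      have "m \<in> P" using thick_ideal_closed[OF PJ(1) m(1) w(2) w'(2)] m(2) by blast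
      \<comment> \<open>Distributivity: the intersection of \<sigma>(p) \<union> \<sigma>(a) and
        \<sigma>(p') \<union> \<sigma>(b) is contained in \<sigma>(m) \<union> \<sigma>(a \<otimes>
        b).\<close>
      then have "w \<boxtimes> w' \<in> P"
        using thick_ideal_closed[OF PJ(1) K_tensor[OF wK] _ ab, of m] w(3) w'(3) m(2)
          \<sigma>_tensor_eq[OF K_obj[OF wK(1)] K_obj[OF wK(2)]] \<sigma>_tensor_eq[OF K_obj[OF a] K_obj[OF b]] by blast
      ultimately show False using PJ(3) by blast
    qed
  qed
  then show thesis using that PJ(2,3) SW by blast
qed

section \<open>The comparison homeomorphism\<close>

lemma comparison_homeoD:
  assumes "comparison_homeo \<kappa> T X \<sigma> f"
  shows "bij_betw f (topspace X) (prime_ideals \<kappa> T)" "continuous_map X (Spc \<kappa> T) f" "open_map X (Spc \<kappa> T) f"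
    "\<lbrakk>p \<in> topspace X; x \<in> K\<rbrakk> \<Longrightarrow> x \<in> f p \<longleftrightarrow> p \<notin> \<sigma> x"
    "p \<in> topspace X \<Longrightarrow> f p = {x \<in> K. p \<notin> \<sigma> x}"
proof -
  have h: "homeomorphic_map X (Spc \<kappa> T) f" and s: "\<And>x. x \<in> K \<Longrightarrow> \<sigma> x = {p \<in> topspace X. f p \<in> supp \<kappa> T x}"
    using assms by (auto simp: comparison_homeo_def)
  show b: "bij_betw f (topspace X) (prime_ideals \<kappa> T)"
    using h homeomorphic_imp_injective_map homeomorphic_imp_surjective_map topspace_Spc unfolding bij_betw_def by metis
  show "continuous_map X (Spc \<kappa> T) f" "open_map X (Spc \<kappa> T) f"
    using h homeomorphic_imp_continuous_map homeomorphic_imp_open_map by auto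
  show 1: "x \<in> f p \<longleftrightarrow> p \<notin> \<sigma> x" if p: "p \<in> topspace X" and x: "x \<in> K" for p x
    using s[OF x] p bij_betwE[OF b] by (auto simp: supp_def)
  show "f p = {x \<in> K. p \<notin> \<sigma> x}" if p: "p \<in> topspace X" for p
    using 1[OF p] primeD(2)[of "f p"] bij_betwE[OF b] p by blast
qed

text \<open>Compatibility with supports already determines the prime f p; the topology plays no
  part.\<close>

lemma comparison_homeo_unique:
  assumes "comparison_homeo \<kappa> T X \<sigma> f" "comparison_homeo \<kappa> T X \<sigma> f'"
  shows "f = f'"
proof (rule extensionalityI[of _ "topspace X"])
  show "f \<in> extensional (topspace X)" "f' \<in> extensional (topspace X)" using assms by (auto simp: comparison_homeo_def)
  show "f p = f' p" if "p \<in> topspace X" for p using comparison_homeoD(5)[OF assms(1) that] comparison_homeoD(5)[OF assms(2) that] by simp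
qed

lemma closed_condition_imp_comparison:
  assumes a: closed_condition
  shows "\<exists>f. comparison_homeo \<kappa> T X \<sigma> f"
proof -
  define f where "f = restrict (\<lambda>p. {x \<in> K. p \<notin> \<sigma> x}) (topspace X)"
  have fp: "f p = {x \<in> K. p \<notin> \<sigma> x}" if "p \<in> topspace X" for p using that by (simp add: f_def)
  have tc: "thomason_closed X (\<sigma> x)" if "x \<in> K" for x using a that by blast
  have prime: "f p \<in> prime_ideals \<kappa> T" if p: "p \<in> topspace X" for p
    unfolding prime_ideals_def fp[OF p]
  proof (intro CollectI conjI ballI impI)
    obtain z where "z \<in> K" "\<sigma> z = {}" by (rule K_empty)
    then show "thick_ideal_compacts \<kappa> T {x \<in> K. p \<notin> \<sigma> x}" by (intro thick_idealI) auto
    show "{x \<in> K. p \<notin> \<sigma> x} \<noteq> K" using Unit_K \<sigma>_unit p by blast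
    show "x \<in> {x \<in> K. p \<notin> \<sigma> x} \<or> y \<in> {x \<in> K. p \<notin> \<sigma> x}" if "x \<in> K" "y \<in> K" "x \<boxtimes> y \<in> {x \<in> K. p \<notin> \<sigma> x}" for x y
      using that \<sigma>_tensor_eq[OF K_obj[OF that(1)] K_obj[OF that(2)]] by blast
  qed
  have inj: "inj_on f (topspace X)"
  proof (rule inj_onI)
    fix p q assume pq: "p \<in> topspace X" "q \<in> topspace X" "f p = f q"
    show "p = q"
    proof (rule T0_spectral[OF spectral pq(1,2)])
      fix V assume V: "qc_open X V"
      obtain x where x: "x \<in> K" "topspace X - V = \<sigma> x" using a qc_thomason_closed[OF V] by blast
      have "p \<in> \<sigma> x \<longleftrightarrow> q \<in> \<sigma> x" using pq(3) fp[OF pq(1)] fp[OF pq(2)] x(1) by blast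
      then show "p \<in> V \<longleftrightarrow> q \<in> V" using x(2) pq(1,2) by blast
    qed
  qed
  have surj: "\<exists>p \<in> topspace X. f p = P" if P: "P \<in> prime_ideals \<kappa> T" for P
  proof -
    note PD = primeD[OF P]
    \<comment> \<open>By primality the complement of P is closed under tensor products, so finitely
      many supports of objects outside P contain the support of a single such object.\<close>
    have fin: "\<exists>z \<in> K - P. \<sigma> z \<subseteq> (\<Inter>y \<in> F. \<sigma> y)" if "finite F" "F \<subseteq> K - P" for F
      using that
    proof (induction F)
      case empty
      then show ?case using Unit_K PD(3) by blast
    next
      case (insert y F)
      then obtain z where z: "z \<in> K - P" "\<sigma> z \<subseteq> (\<Inter>y \<in> F. \<sigma> y)" by blast
      have y: "y \<in> K - P" using insert.prems by blast
      have "y \<boxtimes> z \<in> K - P" using PD(4)[of y z] K_tensor y z(1) by blast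
      moreover have "\<sigma> (y \<boxtimes> z) \<subseteq> (\<Inter>y \<in> insert y F. \<sigma> y)" using \<sigma>_tensor[of y z] K_obj y z by blast
      ultimately show ?case by blast
    qed
    \<comment> \<open>A point p has prime P when it lies in \<sigma>(z) for all compact z outside P
      and in no \<sigma>(y) with y in P. The former is the closed set ?C; the latter asks for
      membership in the quasi-compact open sets ?\<V>, directed because P has direct sums.\<close>
    let ?C = "\<Inter>z \<in> K - P. \<sigma> z" and ?\<V> = "(\<lambda>y. topspace X - \<sigma> y) ` P"
    have uKP: "\<one>\<^sub>T \<in> K - P" using Unit_K PD(3) by blast
    obtain p where p: "p \<in> ?C" "\<And>V. V \<in> ?\<V> \<Longrightarrow> p \<in> V"
    proof (rule spectral_point[OF spectral, of ?C ?\<V>])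
      show "closedin X ?C" by (rule closedin_Inter) (use uKP tc in \<open>auto simp: thomason_closed_def\<close>)
      show "?\<V> \<noteq> {}" using PD(5) by blast
      show "qc_open X V" if "V \<in> ?\<V>" for V using that tc PD(2) thomason_closed_qc by blast
      show "\<exists>U \<in> ?\<V>. U \<subseteq> V \<inter> W" if "V \<in> ?\<V>" "W \<in> ?\<V>" for V W
      proof -
        obtain y w where yw: "y \<in> P" "V = topspace X - \<sigma> y" "w \<in> P" "W = topspace X - \<sigma> w" using \<open>V \<in> ?\<V>\<close> \<open>W \<in> ?\<V>\<close> by blast
        obtain m where m: "m \<in> K" "\<sigma> m = \<sigma> y \<union> \<sigma> w" using K_Un yw(1,3) PD(2) by blast
        have "m \<in> P" using thick_ideal_closed[OF PD(1) m(1) yw(1,3)] m(2) by blast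
        then show ?thesis using yw m(2) by blast
      qed
      show "?C \<inter> V \<noteq> {}" if V: "V \<in> ?\<V>" for V
      proof
        assume e: "?C \<inter> V = {}"
        obtain y where y: "y \<in> P" "V = topspace X - \<sigma> y" using V by blast
        \<comment> \<open>If ?C missed V, finitely many complements of \<sigma>(z) would cover V.
          Their objects can be merged into one z outside P with \<sigma>(z) inside \<sigma>(y),
          which forces z into P.\<close>
        have "compactin X V" using y tc PD(2) by (auto simp: thomason_closed_def)
        moreover have "V \<subseteq> \<Union>((\<lambda>z. topspace X - \<sigma> z) ` (K - P))" using e y(2) by blast
        moreover have "openin X U" if "U \<in> (\<lambda>z. topspace X - \<sigma> z) ` (K - P)" for U
          using that tc by (auto simp: thomason_closed_def)
        ultimately obtain \<G> where \<G>: "finite \<G>" "\<G> \<subseteq> (\<lambda>z. topspace X - \<sigma> z) ` (K - P)" "V \<subseteq> \<Union>\<G>"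
          unfolding compactin_def by meson
        then obtain F where F: "finite F" "F \<subseteq> K - P" "\<G> = (\<lambda>z. topspace X - \<sigma> z) ` F" using finite_subset_image by metis
        obtain z where z: "z \<in> K - P" "\<sigma> z \<subseteq> (\<Inter>y \<in> F. \<sigma> y)" using fin[OF F(1,2)] by blast
        have "\<sigma> z \<subseteq> \<sigma> y" using z(2) \<G>(3) F(3) y(2) \<sigma>_subset[OF K_obj, of z] z(1) by blast
        then have "z \<in> P" using thick_ideal_closed[OF PD(1) _ y(1,1)] z(1) by blast
        then show False using z(1) by blast
      qed
    qed blast
    have pX: "p \<in> topspace X" using p(1) uKP \<sigma>_unit by blast
    have "x \<in> P \<longleftrightarrow> p \<notin> \<sigma> x" if "x \<in> K" for x using p that by blast
    then have "f p = P" using fp[OF pX] PD(2) by blast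
    then show ?thesis using pX by blast
  qed
  have im: "f ` topspace X = prime_ideals \<kappa> T" using prime surj by blast
  have "homeomorphic_map X (Spc \<kappa> T) f"
  proof (rule bijective_open_imp_homeomorphic_map)
    show "continuous_map X (Spc \<kappa> T) f" unfolding continuous_map_def
    proof (intro conjI allI impI)
      show "f \<in> topspace X \<rightarrow> topspace (Spc \<kappa> T)" using prime topspace_Spc by auto
      fix U assume U: "openin (Spc \<kappa> T) U"
      show "openin X {p \<in> topspace X. f p \<in> U}"
      proof (subst openin_subopen, intro ballI)
        fix p assume p: "p \<in> {p \<in> topspace X. f p \<in> U}"
        then obtain x where x: "x \<in> K" "x \<in> f p" "{Q \<in> prime_ideals \<kappa> T. x \<in> Q} \<subseteq> U" using openin_Spc_basis[OF U, of "f p"] by blast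
        have "openin X (topspace X - \<sigma> x)" using tc[OF x(1)] by (auto simp: thomason_closed_def)
        moreover have "p \<in> topspace X - \<sigma> x" using p x(2) fp by auto
        moreover have "topspace X - \<sigma> x \<subseteq> {p \<in> topspace X. f p \<in> U}" using x(1,3) prime fp by auto
        ultimately show "\<exists>V. openin X V \<and> p \<in> V \<and> V \<subseteq> {p \<in> topspace X. f p \<in> U}" by blast
      qed
    qed
    show "open_map X (Spc \<kappa> T) f" unfolding open_map_def
    proof (intro allI impI)
      fix V assume V: "openin X V"
      show "openin (Spc \<kappa> T) (f ` V)"
      proof (subst openin_subopen, intro ballI)
        fix P assume "P \<in> f ` V"
        then obtain p where p: "p \<in> V" "P = f p" by blast
        obtain U where U: "qc_open X U" "p \<in> U" "U \<subseteq> V" using spectralD(4)[OF spectral V p(1)] by blast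
        obtain x where x: "x \<in> K" "topspace X - U = \<sigma> x" using a qc_thomason_closed[OF U(1)] by blast
        have pX: "p \<in> topspace X" using p(1) openin_subset[OF V] by blast
        have "{Q \<in> prime_ideals \<kappa> T. x \<in> Q} \<subseteq> f ` V"
        proof
          fix Q assume Q: "Q \<in> {Q \<in> prime_ideals \<kappa> T. x \<in> Q}"
          then obtain q where q: "q \<in> topspace X" "Q = f q" using surj by blast
          then have "q \<notin> \<sigma> x" using Q fp by auto
          then show "Q \<in> f ` V" using q x(2) U(3) by blast
        qed
        moreover have "P \<in> {Q \<in> prime_ideals \<kappa> T. x \<in> Q}" using p(2) prime[OF pX] fp[OF pX] x U(2) by blast
        ultimately show "\<exists>W. openin (Spc \<kappa> T) W \<and> P \<in> W \<and> W \<subseteq> f ` V" using openin_Spc_basic[OF x(1)] by blast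
      qed
    qed
    show "f ` topspace X = topspace (Spc \<kappa> T)" using im topspace_Spc by simp
    show "inj_on f (topspace X)" by (rule inj)
  qed
  moreover have "\<sigma> x = {p \<in> topspace X. f p \<in> supp \<kappa> T x}" if "x \<in> K" for x
    using \<sigma>_subset[OF K_obj[OF that]] that prime fp by (auto simp: supp_def)
  moreover have "f \<in> extensional (topspace X)" by (simp add: f_def)
  ultimately show ?thesis unfolding comparison_homeo_def by blast
qed

text \<open>Closedness of \<sigma>(x) is read off the basic open sets of the spectrum.
  Quasi-compactness of its complement comes from \<open>prime_exists\<close>: without a finite
  subcover there would be a prime, hence a point, that the cover misses.\<close>

lemma comparison_imp_closed_condition:
  assumes f: "comparison_homeo \<kappa> T X \<sigma> f"
  shows closed_condition
proof -
  note fD = comparison_homeoD[OF f]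
  have fP: "f p \<in> prime_ideals \<kappa> T" if "p \<in> topspace X" for p using bij_betwE[OF fD(1)] that by blast
  have closed: "closedin X (\<sigma> x)" if x: "x \<in> K" for x
  proof -
    have "openin X {p \<in> topspace X. f p \<in> {P \<in> prime_ideals \<kappa> T. x \<in> P}}"
      by (rule openin_continuous_map_preimage[OF fD(2) openin_Spc_basic[OF x]])
    moreover have "{p \<in> topspace X. f p \<in> {P \<in> prime_ideals \<kappa> T. x \<in> P}} = topspace X - \<sigma> x"
      using fP fD(4)[OF _ x] by auto
    ultimately show ?thesis using \<sigma>_subset[OF K_obj[OF x]] by (simp add: closedin_def)
  qed
  have basis: "\<exists>x \<in> K. p \<in> topspace X - \<sigma> x \<and> topspace X - \<sigma> x \<subseteq> V" if V: "openin X V" and p: "p \<in> V" for V p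
  proof -
    have "openin (Spc \<kappa> T) (f ` V)" using fD(3) V unfolding open_map_def by blast
    then obtain x where x: "x \<in> K" "x \<in> f p" "{Q \<in> prime_ideals \<kappa> T. x \<in> Q} \<subseteq> f ` V"
      by (rule openin_Spc_basis[OF _ imageI[OF p]])
    have pX: "p \<in> topspace X" using openin_subset[OF V] p by blast
    have "topspace X - \<sigma> x \<subseteq> V"
    proof
      fix q assume q: "q \<in> topspace X - \<sigma> x"
      then have "f q \<in> f ` V" using x(1,3) fP fD(4) by blast
      then show "q \<in> V" using bij_betw_imp_inj_on[OF fD(1)] q openin_subset[OF V] by (auto dest: inj_onD)
    qed
    then show ?thesis using x(1,2) fD(4)[OF pX x(1)] pX by blast
  qed
  \<comment> \<open>Tensor products realize finite intersections of supports. The factor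
    \<open>topspace X\<close> covers the empty family, which the unit realizes.\<close>
  have meet: "\<exists>w \<in> K. \<sigma> w = topspace X \<inter> (\<Inter>y \<in> F. \<sigma> y)" if "finite F" "F \<subseteq> K" for F using that
  proof (induction F)
    case empty
    then show ?case using Unit_K \<sigma>_unit by auto
  next
    case (insert y F)
    then obtain w where w: "w \<in> K" "\<sigma> w = topspace X \<inter> (\<Inter>y \<in> F. \<sigma> y)" by blast
    have y: "y \<in> K" using insert.prems by blast
    have "\<sigma> (y \<boxtimes> w) = topspace X \<inter> (\<Inter>y \<in> insert y F. \<sigma> y)"
      using \<sigma>_tensor_eq[OF K_obj[OF y] K_obj[OF w(1)]] w(2) by auto
    then show ?case using K_tensor[OF y w(1)] by blast
  qed
  have "compactin X (topspace X - \<sigma> x)" if x: "x \<in> K" for x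
    unfolding compactin_def
  proof (intro conjI allI impI)
    fix \<U> assume U: "(\<forall>U\<in>\<U>. openin X U) \<and> topspace X - \<sigma> x \<subseteq> \<Union>\<U>"
    \<comment> \<open>The objects whose basic open set lies in one member of the cover. A prime
      containing x and avoiding S would be a point outside \<sigma>(x) that no member of the cover
      contains.\<close>
    define S where "S = {y \<in> K. \<exists>U \<in> \<U>. topspace X - \<sigma> y \<subseteq> U}"
    have "\<exists>F. finite F \<and> F \<subseteq> S \<and> topspace X \<inter> (\<Inter>y \<in> F. \<sigma> y) \<subseteq> \<sigma> x"
    proof (rule ccontr)
      assume "\<not> (\<exists>F. finite F \<and> F \<subseteq> S \<and> topspace X \<inter> (\<Inter>y \<in> F. \<sigma> y) \<subseteq> \<sigma> x)"
      then have fin: "\<not> topspace X \<inter> (\<Inter>y \<in> F. \<sigma> y) \<subseteq> \<sigma> x" if "finite F" "F \<subseteq> S" for F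
        using that by simp
      have "S \<subseteq> K" by (auto simp: S_def)
      then obtain P where P: "P \<in> prime_ideals \<kappa> T" "x \<in> P" "S \<inter> P = {}"
        using prime_exists[OF x _ fin] by metis
      then obtain p where p: "p \<in> topspace X" "P = f p" using bij_betw_imp_surj_on[OF fD(1)] by blast
      have "p \<in> topspace X - \<sigma> x" using fD(4)[OF p(1) x] P(2) p by blast
      then obtain U where U': "U \<in> \<U>" "p \<in> U" using U by blast
      have "openin X U" using U U'(1) by auto
      then obtain y where y: "y \<in> K" "p \<in> topspace X - \<sigma> y" "topspace X - \<sigma> y \<subseteq> U" using basis[OF _ U'(2)] by auto
      then have "y \<in> S" using U'(1) unfolding S_def by blast
      moreover have "y \<in> P" using fD(4)[OF p(1) y(1)] y(2) p(2) by blast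
      ultimately show False using P(3) by blast
    qed
    then obtain F where F: "finite F" "F \<subseteq> S" "topspace X \<inter> (\<Inter>y \<in> F. \<sigma> y) \<subseteq> \<sigma> x" by blast
    have "\<forall>y \<in> F. \<exists>U. U \<in> \<U> \<and> topspace X - \<sigma> y \<subseteq> U" using F(2) unfolding S_def by blast
    then obtain u where u: "\<forall>y \<in> F. u y \<in> \<U> \<and> topspace X - \<sigma> y \<subseteq> u y" by metis
    have "topspace X - \<sigma> x \<subseteq> \<Union>(u ` F)" using F(3) u by blast
    then show "\<exists>\<F>. finite \<F> \<and> \<F> \<subseteq> \<U> \<and> topspace X - \<sigma> x \<subseteq> \<Union>\<F>"
      using F(1) u by (intro exI[of _ "u ` F"]) auto
  qed blast
  then have 1: "thomason_closed X (\<sigma> x)" if "x \<in> K" for x using closed that by (simp add: thomason_closed_def)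
  have "\<exists>x \<in> K. Z = \<sigma> x" if Z: "thomason_closed X Z" for Z
  proof -
    let ?V = "topspace X - Z"
    \<comment> \<open>The quasi-compact complement of Z is a finite union of basic open sets; the
      tensor product of the corresponding objects has support Z.\<close>
    define S where "S = {y \<in> K. topspace X - \<sigma> y \<subseteq> ?V}"
    have V: "openin X ?V" "compactin X ?V" using Z by (auto simp: thomason_closed_def)
    have "?V \<subseteq> \<Union>((\<lambda>y. topspace X - \<sigma> y) ` S)" using basis[OF V(1)] unfolding S_def by blast
    moreover have "openin X U" if "U \<in> (\<lambda>y. topspace X - \<sigma> y) ` S" for U using that closed unfolding S_def by auto
    ultimately obtain \<G> where \<G>: "finite \<G>" "\<G> \<subseteq> (\<lambda>y. topspace X - \<sigma> y) ` S" "?V \<subseteq> \<Union>\<G>"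
      using V(2) unfolding compactin_def by meson
    then obtain F where F: "finite F" "F \<subseteq> S" "\<G> = (\<lambda>y. topspace X - \<sigma> y) ` F" using finite_subset_image by metis
    obtain w where w: "w \<in> K" "\<sigma> w = topspace X \<inter> (\<Inter>y \<in> F. \<sigma> y)" using meet[OF F(1)] F(2) unfolding S_def by blast
    have "Z \<subseteq> topspace X" by (rule thomason_closed_subset[OF Z])
    then have "Z = \<sigma> w" using w(2) \<G>(3) F(2,3) unfolding S_def by blast
    then show ?thesis using w(1) by blast
  qed
  then show ?thesis using 1 by blast
qed

lemma closed_condition_iff_comparison: "closed_condition \<longleftrightarrow> (\<exists>!f. comparison_homeo \<kappa> T X \<sigma> f)"
proof
  assume closed_condition
  then obtain f where f: "comparison_homeo \<kappa> T X \<sigma> f" using closed_condition_imp_comparison by blast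
  show "\<exists>!f. comparison_homeo \<kappa> T X \<sigma> f" by (rule ex1I[of "comparison_homeo \<kappa> T X \<sigma>", OF f]) (rule comparison_homeo_unique[OF _ f])
next
  assume "\<exists>!f. comparison_homeo \<kappa> T X \<sigma> f"
  then have "\<exists>f. comparison_homeo \<kappa> T X \<sigma> f" by (rule ex1_implies_ex)
  then obtain f where "comparison_homeo \<kappa> T X \<sigma> f" by (rule exE)
  then show closed_condition by (rule comparison_imp_closed_condition)
qed

end

section \<open>Cellular approximation\<close>

context rigid_category
begin
lemma coproducts: "has_small_coproducts \<kappa> T"
  using generated by (simp add: compactly_generated_def)

lemma small_homset: "\<lbrakk>x \<in> Obj T; y \<in> Obj T\<rbrakk> \<Longrightarrow> small \<kappa> (homset T x y)"
  using generated by (simp add: compactly_generated_def locally_small_def)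

text \<open>The coproduct of the domains of all arrows in A, with its tautological map e to w,
  handles all of A at once: each arrow of A factors through e, and a map that kills A kills
  e.\<close>

lemma cells_ex:
  assumes S: "small \<kappa> S" "S \<subseteq> Obj T" and w: "w \<in> Obj T"
    and A: "\<And>b. b \<in> A \<Longrightarrow> b \<in> Arr T \<and> Dom T b \<in> S \<and> Cod T b = w"
  obtains c e where "c \<in> Loc \<kappa> T S" "e \<in> homset T c w"
    "\<forall>b \<in> A. \<exists>b' \<in> homset T (Dom T b) c. e \<cdot> b' = b"
    "\<forall>t. \<forall>p \<in> homset T w t. (\<forall>b \<in> A. p \<cdot> b = Zero T (Dom T b) t) \<longrightarrow> p \<cdot> e = Zero T c t"
proof -
  have "A \<subseteq> (\<Union>s \<in> S. homset T s w)" using A by (auto simp: homset_iff)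
  moreover have "small \<kappa> (\<Union>s \<in> S. homset T s w)"
    by (rule small_UN[OF univ S(1)]) (use small_homset S(2) w in blast)
  ultimately have sA: "small \<kappa> A" using small_subset by blast
  have dom: "Dom T b \<in> Obj T" if "b \<in> A" for b using A[OF that] S(2) by blast
  obtain c \<iota> where c: "is_coproduct T A (Dom T) c \<iota>" \<comment> \<open>the arrows in \<open>A\<close> index their own domains\<close>
    by (rule small_coproduct_ex[where t = "Dom T", OF univ coproducts sA dom])
  note o = coproduct_in[OF c]
  have "\<exists>e \<in> homset T c w. \<forall>b \<in> A. e \<cdot> \<iota> b = b"
    by (rule coproduct_ex[OF c w]) (use A in \<open>auto simp: homset_iff\<close>)
  then obtain e where e: "e \<in> homset T c w" "\<And>b. b \<in> A \<Longrightarrow> e \<cdot> \<iota> b = b" by auto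
  have "Dom T b \<in> Loc \<kappa> T S" if "b \<in> A" for b using A[OF that] Loc_superset by blast
  then have cL: "c \<in> Loc \<kappa> T S" by (rule localizing_coproduct[OF univ Loc_localizing[OF S(2)] sA c])
  have lift: "\<exists>b' \<in> homset T (Dom T b) c. e \<cdot> b' = b" if "b \<in> A" for b
    using o(2)[OF that] e(2)[OF that] by blast
  have kill: "p \<cdot> e = Zero T c t" if p: "p \<in> homset T w t" and z: "\<forall>b \<in> A. p \<cdot> b = Zero T (Dom T b) t" for t p
  proof (rule coproduct_eq[OF c Comp_in[OF e(1) p] Zero_in[OF o(1) hom_obj(2)[OF p]]])
    fix b assume b: "b \<in> A"
    note H = homsetD[OF p] homsetD[OF e(1)] homsetD[OF o(2)[OF b]] o(1) hom_obj(2)[OF p]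
    show "(p \<cdot> e) \<cdot> \<iota> b = Zero T c t \<cdot> \<iota> b" using H e(2)[OF b] z b by simp
  qed
  show thesis by (rule that[of c e]) (use cL e(1) lift kill in blast)+
qed

text \<open>The cone of the cells on all arrows from S that p kills. These arrows become zero in w',
  and p still extends because it kills the cells.\<close>

lemma attach_cells:
  assumes S: "small \<kappa> S" "S \<subseteq> Obj T" and w: "w \<in> Loc \<kappa> T S" and p: "p \<in> homset T w t"
  obtains w' p' u where "w' \<in> Loc \<kappa> T S" "p' \<in> homset T w' t" "u \<in> homset T w w'" "p' \<cdot> u = p"
    "\<forall>s \<in> S. \<forall>b \<in> homset T s w. p \<cdot> b = Zero T s t \<longrightarrow> u \<cdot> b = Zero T s w'"
proof -
  define A where "A = {b \<in> Arr T. Dom T b \<in> S \<and> Cod T b = w \<and> p \<cdot> b = Zero T (Dom T b) t}"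
  note L = triangulated_subcategoryD[OF localizing_triangulated[OF Loc_localizing[OF S(2), of \<kappa>]]]
  have A: "b \<in> Arr T \<and> Dom T b \<in> S \<and> Cod T b = w" if "b \<in> A" for b using that by (simp add: A_def)
  obtain c e where c: "c \<in> Loc \<kappa> T S" "e \<in> homset T c w" "\<forall>b \<in> A. \<exists>b' \<in> homset T (Dom T b) c. e \<cdot> b' = b"
    "\<forall>t. \<forall>p \<in> homset T w t. (\<forall>b \<in> A. p \<cdot> b = Zero T (Dom T b) t) \<longrightarrow> p \<cdot> e = Zero T c t"
    by (rule cells_ex[where A = A, OF S hom_obj(1)[OF p] A])
  obtain u h w' where t: "tri e u h c w w'" by (rule tri_ex[OF c(2)])
  have "p \<cdot> e = Zero T c t" using c(4) p by (simp add: A_def)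
  then obtain p' where p': "p' \<in> homset T w' t" "p' \<cdot> u = p" by (rule tri_weak1[OF t p])
  have "u \<cdot> b = Zero T s w'" if s: "s \<in> S" and b: "b \<in> homset T s w" and "p \<cdot> b = Zero T s t" for s b
  proof -
    have "b \<in> A" using that by (simp add: A_def homset_iff)
    then obtain b' where b': "b' \<in> homset T s c" "e \<cdot> b' = b" using bspec[OF c(3)] homsetD(2)[OF b] by metis
    note H = tri_arr[OF t] homsetD[OF b'(1)]
    have "u \<cdot> (e \<cdot> b') = Zero T c w' \<cdot> b'" by (rule comp_eq_assoc[OF tri_comp1[OF t]]) (use H in simp_all)
    then show ?thesis using b'(2) H by simp
  qed
  moreover have "w' \<in> Loc \<kappa> T S" by (rule L(5)[OF t c(1) w])
  ultimately show thesis using p' triD(3)[OF t] by (intro that[of w' p' u] ballI impI) auto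
qed

lemma approximation_sequence:
  assumes S: "small \<kappa> S" "S \<subseteq> Obj T" and t: "t \<in> Obj T"
  obtains w p u where "\<forall>n :: nat. w n \<in> Loc \<kappa> T S" "\<forall>n. p n \<in> homset T (w n) t" "\<forall>n. u n \<in> homset T (w n) (w (Suc n))"
    "\<forall>n. p (Suc n) \<cdot> u n = p n"
    "\<forall>n. \<forall>s \<in> S. \<forall>b \<in> homset T s (w n). p n \<cdot> b = Zero T s t \<longrightarrow> u n \<cdot> b = Zero T s (w (Suc n))"
    "\<forall>s \<in> S. \<forall>b \<in> homset T s t. \<exists>b' \<in> homset T s (w 0). p 0 \<cdot> b' = b"
proof -
  \<comment> \<open>P describes one stage and Q two consecutive stages, in the shape required by
    dependent choice. Surjectivity on maps out of S is imposed at stage 0 only, from where it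
    reaches the homotopy colimit.\<close>
  define P where "P = (\<lambda>(n :: nat) x. fst x \<in> Loc \<kappa> T S \<and> snd x \<in> homset T (fst x) t \<and>
    (n = 0 \<longrightarrow> (\<forall>s \<in> S. \<forall>b \<in> homset T s t. \<exists>b' \<in> homset T s (fst x). snd x \<cdot> b' = b)))"
  define Q where "Q = (\<lambda>(n :: nat) x y. \<exists>u \<in> homset T (fst x) (fst y). snd y \<cdot> u = snd x \<and>
    (\<forall>s \<in> S. \<forall>b \<in> homset T s (fst x). snd x \<cdot> b = Zero T s t \<longrightarrow> u \<cdot> b = Zero T s (fst y)))"
  have "\<exists>x. P 0 x"
  proof -
    let ?A = "{b \<in> Arr T. Dom T b \<in> S \<and> Cod T b = t}"
    have A: "b \<in> Arr T \<and> Dom T b \<in> S \<and> Cod T b = t" if "b \<in> ?A" for b using that by simp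
    obtain c e where c: "c \<in> Loc \<kappa> T S" "e \<in> homset T c t" "\<forall>b \<in> ?A. \<exists>b' \<in> homset T (Dom T b) c. e \<cdot> b' = b"
      by (rule cells_ex[where A = ?A, OF S t A])
    have "\<exists>b' \<in> homset T s c. e \<cdot> b' = b" if "s \<in> S" "b \<in> homset T s t" for s b
      using bspec[OF c(3), of b] that by (simp add: homset_iff)
    then have "P 0 (c, e)" using c(1,2) by (simp add: P_def)
    then show ?thesis by blast
  qed
  moreover have "\<exists>y. P (Suc n) y \<and> Q n x y" if "P n x" for n x
  proof -
    have x: "fst x \<in> Loc \<kappa> T S" "snd x \<in> homset T (fst x) t" using that by (auto simp: P_def)
    obtain w' p' u where "w' \<in> Loc \<kappa> T S" "p' \<in> homset T w' t" "u \<in> homset T (fst x) w'" "p' \<cdot> u = snd x"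
      "\<forall>s \<in> S. \<forall>b \<in> homset T s (fst x). snd x \<cdot> b = Zero T s t \<longrightarrow> u \<cdot> b = Zero T s w'"
      by (rule attach_cells[OF S x])
    then have "P (Suc n) (w', p') \<and> Q n x (w', p')" unfolding P_def Q_def by auto
    then show ?thesis by blast
  qed
  ultimately have "\<exists>f. \<forall>n. P n (f n) \<and> Q n (f n) (f (Suc n))" by (rule dependent_nat_choice)
  then obtain f where f: "\<And>n. P n (f n)" "\<And>n. Q n (f n) (f (Suc n))" by auto
  have "\<forall>n. \<exists>u. u \<in> homset T (fst (f n)) (fst (f (Suc n))) \<and> snd (f (Suc n)) \<cdot> u = snd (f n) \<and>
    (\<forall>s \<in> S. \<forall>b \<in> homset T s (fst (f n)). snd (f n) \<cdot> b = Zero T s t \<longrightarrow> u \<cdot> b = Zero T s (fst (f (Suc n))))"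
    by (rule allI) (rule f(2)[unfolded Q_def Bex_def])
  then have "\<exists>u. \<forall>n. u n \<in> homset T (fst (f n)) (fst (f (Suc n))) \<and> snd (f (Suc n)) \<cdot> u n = snd (f n) \<and>
    (\<forall>s \<in> S. \<forall>b \<in> homset T s (fst (f n)). snd (f n) \<cdot> b = Zero T s t \<longrightarrow> u n \<cdot> b = Zero T s (fst (f (Suc n))))"
    by (rule choice)
  then obtain u where u: "\<forall>n. u n \<in> homset T (fst (f n)) (fst (f (Suc n))) \<and> snd (f (Suc n)) \<cdot> u n = snd (f n) \<and>
    (\<forall>s \<in> S. \<forall>b \<in> homset T s (fst (f n)). snd (f n) \<cdot> b = Zero T s t \<longrightarrow> u n \<cdot> b = Zero T s (fst (f (Suc n))))"
    by (rule exE)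
  show thesis
    by (rule that[of "\<lambda>n. fst (f n)" "\<lambda>n. snd (f n)" u]) (use f(1) u in \<open>auto simp: P_def\<close>)
qed

text \<open>\<open>D\<close> is the map 1 - shift, whose cone is the homotopy colimit of the sequence \<open>u\<close>.\<close>

definition telescope where
  "telescope w u C \<iota> D \<longleftrightarrow> is_coproduct T (UNIV :: nat set) w C \<iota> \<and> (\<forall>n. u n \<in> homset T (w n) (w (Suc n))) \<and>
    D \<in> homset T C C \<and> (\<forall>n. D \<cdot> \<iota> n = \<iota> n \<boxplus> neg_arr T (\<iota> (Suc n) \<cdot> u n))"

lemma telescopeD:
  assumes "telescope w u C \<iota> D"
  shows "is_coproduct T UNIV w C \<iota>" "u n \<in> homset T (w n) (w (Suc n))" "D \<in> homset T C C"
    "D \<cdot> \<iota> n = \<iota> n \<boxplus> neg_arr T (\<iota> (Suc n) \<cdot> u n)" "\<iota> n \<in> homset T (w n) C" "w n \<in> Obj T" "C \<in> Obj T"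
  using assms coproduct_in[of UNIV w C \<iota>] unfolding telescope_def by auto

lemma telescope_arr:
  assumes "telescope w u C \<iota> D"
  shows "u n \<in> Arr T" "Dom T (u n) = w n" "Cod T (u n) = w (Suc n)" "D \<in> Arr T" "Dom T D = C" "Cod T D = C"
    "\<iota> n \<in> Arr T" "Dom T (\<iota> n) = w n" "Cod T (\<iota> n) = C" "w n \<in> Obj T" "C \<in> Obj T"
  using telescopeD(2,3,5,6,7)[OF assms] by (auto simp: homset_iff)

lemma telescope_ex:
  assumes "\<And>n. u n \<in> homset T (w n) (w (Suc n))"
  obtains C \<iota> D where "telescope w u C \<iota> D"
proof -
  have w: "w n \<in> Obj T" for n using hom_obj(1)[OF assms] .
  obtain C \<iota> where C: "is_coproduct T (UNIV :: nat set) w C \<iota>"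
    using small_coproduct_ex[OF univ coproducts small_nat[OF univ], of UNIV w] w by blast
  note o = coproduct_in[OF C]
  have ty: "\<iota> n \<boxplus> neg_arr T (\<iota> (Suc n) \<cdot> u n) \<in> homset T (w n) C" for n
    by (rule Plus_in[OF o(2)[OF UNIV_I] neg_in[OF Comp_in[OF assms o(2)[OF UNIV_I]]]])
  have "\<exists>D \<in> homset T C C. \<forall>n \<in> UNIV. D \<cdot> \<iota> n = \<iota> n \<boxplus> neg_arr T (\<iota> (Suc n) \<cdot> u n)"
    by (rule coproduct_ex[OF C o(1) ty])
  then obtain D where "D \<in> homset T C C" "\<forall>n \<in> UNIV. D \<cdot> \<iota> n = \<iota> n \<boxplus> neg_arr T (\<iota> (Suc n) \<cdot> u n)" by (rule bexE)
  then show thesis using that C assms unfolding telescope_def by auto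
qed

text \<open>Component by component, D a = 0 says that a has zeroth component 0 and that its
  component k+1 is u k applied to component k. So all components vanish, and as s is compact, a is
  the finite sum of its components.\<close>

lemma telescope_injective:
  assumes t: "telescope w u C \<iota> D" and s: "s \<in> K" and a: "a \<in> homset T s C" and z: "D \<cdot> a = Zero T s C"
  shows "a = Zero T s C"
proof -
  note C = telescopeD(1)[OF t] and tt = telescope_arr[OF t] and D\<iota> = telescopeD(4)[OF t]
  note so = compact_obj[OF s]
  note aa = homsetD[OF a]
  obtain \<pi> where \<pi>: "\<And>i. i \<in> UNIV \<Longrightarrow> \<pi> i \<in> homset T C (w i)" "\<And>i. i \<in> UNIV \<Longrightarrow> \<pi> i \<cdot> \<iota> i = Id T (w i)"
    "\<And>i j. \<lbrakk>i \<in> UNIV; j \<in> UNIV; j \<noteq> i\<rbrakk> \<Longrightarrow> \<pi> i \<cdot> \<iota> j = Zero T (w j) (w i)"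
    using that by (rule coproduct_projections[OF C])
  note \<pi>' = \<pi>[simplified]
  have pp: "\<pi> n \<in> Arr T" "Dom T (\<pi> n) = C" "Cod T (\<pi> n) = w n" for n using \<pi>'(1)[of n] by (auto simp: homset_iff)
  have \<pi>\<iota>u: "\<pi> k \<cdot> (\<iota> (Suc m) \<cdot> u m) = (if Suc m = k then u m else Zero T (w m) (w k))" for k m
    using comp_eq_assoc[OF \<pi>'(2)[of "Suc m"], of "u m"] comp_eq_assoc[OF \<pi>'(3)[of "Suc m" k], of "u m"] tt pp
    by (cases "Suc m = k") auto
  have p0: "\<pi> 0 \<cdot> D = \<pi> 0"
  proof (rule coproduct_eq[OF C])
    fix m
    show "(\<pi> 0 \<cdot> D) \<cdot> \<iota> m = \<pi> 0 \<cdot> \<iota> m" using tt pp D\<iota>[of m] \<pi>\<iota>u[of 0 m] by simp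
  qed (use tt pp in \<open>auto simp: homset_iff\<close>)
  have pS: "\<pi> (Suc k) \<cdot> D = \<pi> (Suc k) \<boxplus> neg_arr T (u k \<cdot> \<pi> k)" for k
  proof (rule coproduct_eq[OF C])
    fix m
    have "u k \<cdot> (\<pi> k \<cdot> \<iota> m) = (if m = k then u m else Zero T (w m) (w (Suc k)))"
      using \<pi>'(2)[of k] \<pi>'(3)[of m k] tt by auto
    then show "(\<pi> (Suc k) \<cdot> D) \<cdot> \<iota> m = (\<pi> (Suc k) \<boxplus> neg_arr T (u k \<cdot> \<pi> k)) \<cdot> \<iota> m"
      using tt pp D\<iota>[of m] \<pi>\<iota>u[of "Suc k" m] by simp
  qed (use tt pp in \<open>auto simp: homset_iff\<close>)
  have \<pi>a: "\<pi> n \<cdot> a = Zero T s (w n)" for n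
  proof (induction n)
    case 0
    have "\<pi> 0 \<cdot> (D \<cdot> a) = \<pi> 0 \<cdot> a" by (rule comp_eq_assoc[OF p0]) (use tt pp aa in simp_all)
    then show ?case using z tt pp so by simp
  next
    case (Suc k)
    have "\<pi> (Suc k) \<cdot> (D \<cdot> a) = (\<pi> (Suc k) \<boxplus> neg_arr T (u k \<cdot> \<pi> k)) \<cdot> a"
      by (rule comp_eq_assoc[OF pS]) (use tt pp aa in simp_all)
    then have "Zero T s (w (Suc k)) = \<pi> (Suc k) \<cdot> a \<boxplus> neg_arr T (u k \<cdot> (\<pi> k \<cdot> a))" using z tt pp aa so by simp
    then show ?case using Suc tt pp aa so by simp
  qed
  have "fin_map UNIV w \<iota> s C a" by (rule compact_fin_map[OF univ s small_nat[OF univ] C a])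
  then obtain F b where F: "finite F" "F \<subseteq> UNIV" "\<And>i. i \<in> F \<Longrightarrow> b i \<in> homset T s (w i)" "a = asum s C (\<lambda>i. \<iota> i \<cdot> b i) F"
    using that by (rule fin_mapE)
  have "b i = Zero T s (w i)" if "i \<in> F" for i
    using proj_asum[OF C so F(1,2,3) \<pi> UNIV_I, of i] \<pi>a[of i] that unfolding F(4)[symmetric] by simp
  then have "\<iota> i \<cdot> b i = Zero T s C" if "i \<in> F" for i using that tt so by simp
  then show ?thesis unfolding F(4) by (rule asum_zero[OF so tt(11)])
qed

text \<open>A map q with q D = 0 identifies stage n with its image in stage n+1. The finitely many
  components of a can therefore be pushed to a common stage and added there.\<close>

lemma telescope_factor:
  assumes t: "telescope w u C \<iota> D" and q: "q \<in> homset T C W" "q \<cdot> D = Zero T C W" and s: "s \<in> K" and a: "a \<in> homset T s C"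
  obtains n b where "b \<in> homset T s (w n)" "q \<cdot> a = q \<cdot> (\<iota> n \<cdot> b)"
proof -
  note C = telescopeD(1)[OF t] and tt = telescope_arr[OF t] and D\<iota> = telescopeD(4)[OF t]
  note so = compact_obj[OF s]
  note qq = homsetD[OF q(1)] hom_obj[OF q(1)]
  have q\<iota>: "q \<cdot> \<iota> n = q \<cdot> (\<iota> (Suc n) \<cdot> u n)" for n
  proof (rule minus_eq_zero)
    have "q \<cdot> (D \<cdot> \<iota> n) = Zero T C W \<cdot> \<iota> n" by (rule comp_eq_assoc[OF q(2)]) (use tt qq in simp_all)
    then show "q \<cdot> \<iota> n \<boxplus> neg_arr T (q \<cdot> (\<iota> (Suc n) \<cdot> u n)) = Zero T (w n) W" using D\<iota>[of n] tt qq by simp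
  qed (use tt qq in \<open>auto simp: homset_iff\<close>)
  have single: "\<exists>b' \<in> homset T s (w M). q \<cdot> (\<iota> n \<cdot> b) = q \<cdot> (\<iota> M \<cdot> b')" if "n \<le> M" "b \<in> homset T s (w n)" for n M b
    using that(1)
  proof (induction M rule: dec_induct)
    case base
    then show ?case using that(2) by blast
  next
    case (step M)
    then obtain b' where b': "b' \<in> homset T s (w M)" "q \<cdot> (\<iota> n \<cdot> b) = q \<cdot> (\<iota> M \<cdot> b')" by blast
    note bb = homsetD[OF b'(1)]
    have "q \<cdot> (\<iota> M \<cdot> b') = (q \<cdot> (\<iota> (Suc M) \<cdot> u M)) \<cdot> b'" by (rule comp_eq_assoc[OF q\<iota>]) (use tt qq bb in simp_all)
    then have "q \<cdot> (\<iota> n \<cdot> b) = q \<cdot> (\<iota> (Suc M) \<cdot> (u M \<cdot> b'))" using b'(2) tt qq bb by simp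
    moreover have "u M \<cdot> b' \<in> homset T s (w (Suc M))" by (rule Comp_in[OF b'(1) telescopeD(2)[OF t]])
    ultimately show ?case by blast
  qed
  have "fin_map UNIV w \<iota> s C a" by (rule compact_fin_map[OF univ s small_nat[OF univ] C a])
  then obtain F b where F: "finite F" "F \<subseteq> UNIV" "\<And>i. i \<in> F \<Longrightarrow> b i \<in> homset T s (w i)" "a = asum s C (\<lambda>i. \<iota> i \<cdot> b i) F"
    using that by (rule fin_mapE)
  \<comment> \<open>Asserting this for all stages from N on, rather than for one stage, lets the
    induction step combine two bounds by their maximum.\<close>
  have "\<exists>N. \<forall>M \<ge> N. \<exists>b' \<in> homset T s (w M). q \<cdot> asum s C (\<lambda>i. \<iota> i \<cdot> b i) F = q \<cdot> (\<iota> M \<cdot> b')"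
    using F(1,3)
  proof (induction F)
    case empty
    have "q \<cdot> asum s C (\<lambda>i. \<iota> i \<cdot> b i) {} = q \<cdot> (\<iota> M \<cdot> Zero T s (w M))" for M using tt so qq by simp
    then show ?case using Zero_in[OF so tt(10)] by blast
  next
    case (insert j F)
    have bj: "b j \<in> homset T s (w j)" and bF: "\<And>i. i \<in> F \<Longrightarrow> b i \<in> homset T s (w i)" using insert.prems by auto
    have ty: "\<iota> i \<cdot> b i \<in> homset T s C" if "i \<in> insert j F" for i by (rule Comp_in[OF insert.prems[OF that] telescopeD(5)[OF t]])
    have sF: "asum s C (\<lambda>i. \<iota> i \<cdot> b i) F \<in> homset T s C" by (rule asum_in[OF so tt(11)]) (rule ty[OF insertI2])
    obtain N where N: "\<And>M. M \<ge> N \<Longrightarrow> \<exists>b' \<in> homset T s (w M). q \<cdot> asum s C (\<lambda>i. \<iota> i \<cdot> b i) F = q \<cdot> (\<iota> M \<cdot> b')"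
      using insert.IH[OF bF] by blast
    have "\<exists>b' \<in> homset T s (w M). q \<cdot> asum s C (\<lambda>i. \<iota> i \<cdot> b i) (insert j F) = q \<cdot> (\<iota> M \<cdot> b')" if M: "M \<ge> max N j" for M
    proof -
      obtain c where c: "c \<in> homset T s (w M)" "q \<cdot> asum s C (\<lambda>i. \<iota> i \<cdot> b i) F = q \<cdot> (\<iota> M \<cdot> c)" using N[of M] M by auto
      obtain d where d: "d \<in> homset T s (w M)" "q \<cdot> (\<iota> j \<cdot> b j) = q \<cdot> (\<iota> M \<cdot> d)" using single[of j M, OF _ bj] M by auto
      have "q \<cdot> asum s C (\<lambda>i. \<iota> i \<cdot> b i) (insert j F) = q \<cdot> (\<iota> j \<cdot> b j \<boxplus> asum s C (\<lambda>i. \<iota> i \<cdot> b i) F)"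
        using asum_insert[OF so tt(11) insert(1,2) ty] by simp
      also have "\<dots> = q \<cdot> (\<iota> j \<cdot> b j) \<boxplus> q \<cdot> asum s C (\<lambda>i. \<iota> i \<cdot> b i) F"
        by (rule Comp_Plus_right[OF ty[OF insertI1] sF q(1)])
      also have "\<dots> = q \<cdot> (\<iota> M \<cdot> (d \<boxplus> c))" using c(2) d(2) tt qq homsetD[OF c(1)] homsetD[OF d(1)] by simp
      finally show ?thesis using Plus_in[OF d(1) c(1)] by blast
    qed
    then show ?case by blast
  qed
  then show thesis using that F(4) by blast
qed

text \<open>Attaching cells to kill the kernels of \<open>Hom(s, w n) \<rightarrow> Hom(s, t)\<close> at each stage makes the
  map from the homotopy colimit to \<open>t\<close> bijective on \<open>Hom(s, -)\<close>.\<close>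

lemma approximation:
  assumes S: "small \<kappa> S" "S \<subseteq> K" and desusp: "\<And>s. s \<in> S \<Longrightarrow> \<exists>s' \<in> S. isomorphic T (\<Sigma>\<^sub>o s') s" and t: "t \<in> Obj T"
  obtains W \<psi> g h F where "tri \<psi> g h W t F" "W \<in> Loc \<kappa> T S" "\<forall>s \<in> S. \<forall>k \<in> homset T s F. k = Zero T s F"
proof -
  have SO: "S \<subseteq> Obj T" using S(2) compact_obj by blast
  note LL = Loc_localizing[OF SO, of \<kappa>]
  note L = triangulated_subcategoryD[OF localizing_triangulated[OF LL]]
  obtain w p u where wp': "\<forall>n :: nat. w n \<in> Loc \<kappa> T S" "\<forall>n. p n \<in> homset T (w n) t" "\<forall>n. u n \<in> homset T (w n) (w (Suc n))"
    "\<forall>n. p (Suc n) \<cdot> u n = p n"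
    "\<forall>n. \<forall>s \<in> S. \<forall>b \<in> homset T s (w n). p n \<cdot> b = Zero T s t \<longrightarrow> u n \<cdot> b = Zero T s (w (Suc n))"
    "\<forall>s \<in> S. \<forall>b \<in> homset T s t. \<exists>b' \<in> homset T s (w 0). p 0 \<cdot> b' = b"
    by (rule approximation_sequence[OF S(1) SO t])
  note wp = wp'(1)[rule_format] wp'(2)[rule_format] wp'(3)[rule_format] wp'(4)[rule_format] wp'(5)[rule_format] wp'(6)[rule_format]
  obtain C \<iota> D where te: "telescope w u C \<iota> D" by (rule telescope_ex[where w = w and u = u, OF wp(3)])
  note C = telescopeD(1)[OF te] and tt = telescope_arr[OF te] and D\<iota> = telescopeD(4)[OF te]
  have CL: "C \<in> Loc \<kappa> T S" by (rule localizing_coproduct[OF univ LL small_nat[OF univ] C wp(1)])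
  have "\<exists>P \<in> homset T C t. \<forall>n \<in> UNIV. P \<cdot> \<iota> n = p n" by (rule coproduct_ex[OF C t wp(2)])
  then obtain P where P: "P \<in> homset T C t" "\<And>n. P \<cdot> \<iota> n = p n" by auto
  have pa: "p n \<in> Arr T" "Dom T (p n) = w n" "Cod T (p n) = t" for n using wp(2)[of n] by (auto simp: homset_iff)
  note PP = homsetD[OF P(1)]
  have PD: "P \<cdot> D = Zero T C t"
  proof (rule coproduct_eq[OF C Comp_in[OF telescopeD(3)[OF te] P(1)] Zero_in[OF tt(11) t]])
    fix n
    have "P \<cdot> (\<iota> (Suc n) \<cdot> u n) = p (Suc n) \<cdot> u n" by (rule comp_eq_assoc[OF P(2)]) (use tt PP in simp_all)
    then show "(P \<cdot> D) \<cdot> \<iota> n = Zero T C t \<cdot> \<iota> n" using D\<iota>[of n] P(2)[of n] wp(4)[of n] tt PP t pa by simp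
  qed
  obtain q \<delta> W where tr: "tri D q \<delta> C C W" by (rule tri_ex[OF telescopeD(3)[OF te]])
  note trr = tri_arr[OF tr]
  have WL: "W \<in> Loc \<kappa> T S" by (rule L(5)[OF tr CL CL])
  obtain \<psi> where \<psi>: "\<psi> \<in> homset T W t" "\<psi> \<cdot> q = P" by (rule tri_weak1[OF tr P(1) PD])
  note \<psi>a = homsetD[OF \<psi>(1)]
  \<comment> \<open>The boundary of \<phi>, desuspended along s', is killed by D and hence zero, so
    \<phi> comes from C and then from a map b into one stage n. There p n kills b, thus u n does
    too, and then D (\<iota> n b) = \<iota> n b shows that q sends it to zero.\<close>
  have inj: "\<phi> = Zero T s W" if s: "s \<in> S" and \<phi>: "\<phi> \<in> homset T s W" "\<psi> \<cdot> \<phi> = Zero T s t" for s \<phi>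
  proof -
    have sK: "s \<in> K" using S(2) s by blast
    note so = compact_obj[OF sK]
    obtain s' where s': "s' \<in> S" "isomorphic T (\<Sigma>\<^sub>o s') s" using desusp[OF s] by blast
    have s'K: "s' \<in> K" using S(2) s' by blast
    note s'o = compact_obj[OF s'K]
    obtain \<theta> where \<theta>: "\<theta> \<in> homset T (\<Sigma>\<^sub>o s') s" "is_iso_arr T \<theta>" using s'(2) by (auto simp: isomorphic_def)
    note H = homsetD[OF \<phi>(1)] homsetD[OF \<theta>(1)] so s'o
    obtain a where a: "a \<in> homset T s' C" "\<Sigma>\<^sub>a a = \<delta> \<cdot> (\<phi> \<cdot> \<theta>)"
      by (rule Sh_full[OF s'o tt(11), of "\<delta> \<cdot> (\<phi> \<cdot> \<theta>)"]) (use H trr in \<open>auto simp: homset_iff\<close>)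
    note aa = homsetD[OF a(1)]
    have "D \<cdot> a = Zero T s' C"
    proof (rule Sh_eq_Zero[OF Comp_in[OF a(1) telescopeD(3)[OF te]]])
      have "\<Sigma>\<^sub>a D \<cdot> (\<delta> \<cdot> (\<phi> \<cdot> \<theta>)) = Zero T W (\<Sigma>\<^sub>o C) \<cdot> (\<phi> \<cdot> \<theta>)"
        by (rule comp_eq_assoc[OF tri_comp3[OF tr]]) (use H trr in simp_all)
      then show "\<Sigma>\<^sub>a (D \<cdot> a) = Zero T (\<Sigma>\<^sub>o s') (\<Sigma>\<^sub>o C)" using Sh_Comp[of a D] a(2) aa tt H trr by simp
    qed
    then have "a = Zero T s' C" by (rule telescope_injective[OF te s'K a(1)])
    then have "(\<delta> \<cdot> \<phi>) \<cdot> \<theta> = Zero T s (\<Sigma>\<^sub>o C) \<cdot> \<theta>" using a(2) H trr tt s'o by simp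
    then have "\<delta> \<cdot> \<phi> = Zero T s (\<Sigma>\<^sub>o C)"
      by (rule iso_cancel_right[OF \<theta>(2,1), rotated 2]) (use H trr in \<open>auto simp: homset_iff\<close>)
    then obtain v where v: "v \<in> homset T s C" "q \<cdot> v = \<phi>" by (rule tri_exact2[OF tr \<phi>(1)])
    obtain n b where b: "b \<in> homset T s (w n)" "q \<cdot> v = q \<cdot> (\<iota> n \<cdot> b)"
      by (rule telescope_factor[OF te triD(3)[OF tr] tri_comp1[OF tr] sK v(1)])
    note bb = homsetD[OF b(1)]
    have "p n \<cdot> b = P \<cdot> (\<iota> n \<cdot> b)" using comp_eq_assoc[OF P(2), of n b] tt PP bb by simp
    also have "\<dots> = \<psi> \<cdot> (q \<cdot> (\<iota> n \<cdot> b))" using comp_eq_assoc[OF \<psi>(2), of "\<iota> n \<cdot> b"] tt PP bb trr \<psi>a by simp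
    also have "\<dots> = Zero T s t" using b(2) v(2) \<phi>(2) by simp
    finally have ub: "u n \<cdot> b = Zero T s (w (Suc n))" by (rule wp(5)[OF s b(1)])
    have "q \<cdot> (D \<cdot> (\<iota> n \<cdot> b)) = Zero T C W \<cdot> (\<iota> n \<cdot> b)" by (rule comp_eq_assoc[OF tri_comp1[OF tr]]) (use tt bb trr in simp_all)
    moreover have "D \<cdot> (\<iota> n \<cdot> b) = \<iota> n \<cdot> b"
      using comp_eq_assoc[OF D\<iota>[of n], of b] tt bb ub so by simp
    ultimately have "q \<cdot> (\<iota> n \<cdot> b) = Zero T s W" using tt bb trr by simp
    then show ?thesis using b(2) v(2) by simp
  qed
  obtain g h F where tF: "tri \<psi> g h W t F" by (rule tri_ex[OF \<psi>(1)])
  note tFa = tri_arr[OF tF]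
  \<comment> \<open>Injectivity, applied to the desuspension s', removes the boundary of k, so k
    comes from a map s -> t. That map lifts to stage 0, hence to W, and dies in F.\<close>
  have "k = Zero T s F" if s: "s \<in> S" and k: "k \<in> homset T s F" for s k
  proof -
    have so: "s \<in> Obj T" using SO s by blast
    obtain s' where s': "s' \<in> S" "isomorphic T (\<Sigma>\<^sub>o s') s" using desusp[OF s] by blast
    have s'o: "s' \<in> Obj T" using SO s'(1) by blast
    obtain \<theta> where \<theta>: "\<theta> \<in> homset T (\<Sigma>\<^sub>o s') s" "is_iso_arr T \<theta>" using s'(2) by (auto simp: isomorphic_def)
    note H = homsetD[OF k] homsetD[OF \<theta>(1)] so s'o
    obtain \<phi> where \<phi>: "\<phi> \<in> homset T s' W" "\<Sigma>\<^sub>a \<phi> = h \<cdot> (k \<cdot> \<theta>)"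
      by (rule Sh_full[OF s'o tFa(10), of "h \<cdot> (k \<cdot> \<theta>)"]) (use H tFa in \<open>auto simp: homset_iff\<close>)
    have "\<psi> \<cdot> \<phi> = Zero T s' t"
    proof (rule Sh_eq_Zero[OF Comp_in[OF \<phi>(1) \<psi>(1)]])
      have "\<Sigma>\<^sub>a \<psi> \<cdot> (h \<cdot> (k \<cdot> \<theta>)) = Zero T F (\<Sigma>\<^sub>o t) \<cdot> (k \<cdot> \<theta>)"
        by (rule comp_eq_assoc[OF tri_comp3[OF tF]]) (use H tFa in simp_all)
      then show "\<Sigma>\<^sub>a (\<psi> \<cdot> \<phi>) = Zero T (\<Sigma>\<^sub>o s') (\<Sigma>\<^sub>o t)" using Sh_Comp[of \<phi> \<psi>] \<phi>(2) homsetD[OF \<phi>(1)] H tFa by simp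
    qed
    then have "\<phi> = Zero T s' W" by (rule inj[OF s'(1) \<phi>(1)])
    then have "(h \<cdot> k) \<cdot> \<theta> = Zero T s (\<Sigma>\<^sub>o W) \<cdot> \<theta>" using \<phi>(2) H tFa by simp
    then have "h \<cdot> k = Zero T s (\<Sigma>\<^sub>o W)"
      by (rule iso_cancel_right[OF \<theta>(2,1), rotated 2]) (use H tFa in \<open>auto simp: homset_iff\<close>)
    then obtain l where l: "l \<in> homset T s t" "g \<cdot> l = k" by (rule tri_exact2[OF tF k])
    obtain b where b: "b \<in> homset T s (w 0)" "p 0 \<cdot> b = l" using wp(6)[OF s l(1)] by blast
    note bb = homsetD[OF b(1)]
    have "l = \<psi> \<cdot> (q \<cdot> (\<iota> 0 \<cdot> b))"
      using b(2) comp_eq_assoc[OF P(2), of 0 b] comp_eq_assoc[OF \<psi>(2), of "\<iota> 0 \<cdot> b"] tt PP bb trr \<psi>a by simp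
    then have "k = g \<cdot> (\<psi> \<cdot> (q \<cdot> (\<iota> 0 \<cdot> b)))" using l(2) by simp
    also have "\<dots> = Zero T W F \<cdot> (q \<cdot> (\<iota> 0 \<cdot> b))" by (rule comp_eq_assoc[OF tri_comp1[OF tF]]) (use tt bb trr tFa in simp_all)
    also have "\<dots> = Zero T s F" using tt bb trr tFa by simp
    finally show ?thesis .
  qed
  then show thesis using that tF WL by blast
qed

definition detects_zero where
  "detects_zero G \<longleftrightarrow> (\<forall>t \<in> Obj T. (\<forall>g \<in> G. \<forall>n. homset T g ((ShO T ^^ n) t) = {Zero T g ((ShO T ^^ n) t)} \<and>
     homset T ((ShO T ^^ n) g) t = {Zero T ((ShO T ^^ n) g) t}) \<longrightarrow> is_zero_obj T t)"

text \<open>The generation condition tests maps from suspensions of generators and maps to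
  suspensions of t. As S is closed under suspension and, up to isomorphism, desuspension, both
  reduce to maps from S to t.\<close>

lemma zero_by_generators:
  assumes G: "detects_zero G"
    and S: "S \<subseteq> Obj T" "G \<subseteq> S" "\<And>s. s \<in> S \<Longrightarrow> \<Sigma>\<^sub>o s \<in> S" "\<And>s. s \<in> S \<Longrightarrow> \<exists>s' \<in> S. isomorphic T (\<Sigma>\<^sub>o s') s"
    and t: "t \<in> Obj T" and z: "\<And>s k. \<lbrakk>s \<in> S; k \<in> homset T s t\<rbrakk> \<Longrightarrow> k = Zero T s t"
  shows "is_zero_obj T t"
proof (rule G[unfolded detects_zero_def, rule_format, OF t])
  have tn: "(ShO T ^^ n) t \<in> Obj T" for n by (induction n) (use t in auto)
  have zn: "k = Zero T s ((ShO T ^^ n) t)" if "s \<in> S" "k \<in> homset T s ((ShO T ^^ n) t)" for s k n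
    using that
  proof (induction n arbitrary: s k)
    case 0
    then show ?case using z by simp
  next
    case (Suc n)
    obtain s' where s': "s' \<in> S" "isomorphic T (\<Sigma>\<^sub>o s') s" using S(4)[OF Suc.prems(1)] by blast
    obtain \<theta> where \<theta>: "\<theta> \<in> homset T (\<Sigma>\<^sub>o s') s" "is_iso_arr T \<theta>" using s'(2) by (auto simp: isomorphic_def)
    have s'o: "s' \<in> Obj T" using S(1) s'(1) by blast
    have k: "k \<in> homset T s (\<Sigma>\<^sub>o ((ShO T ^^ n) t))" using Suc.prems(2) by simp
    obtain a where a: "a \<in> homset T s' ((ShO T ^^ n) t)" "\<Sigma>\<^sub>a a = k \<cdot> \<theta>" by (rule Sh_full[OF s'o tn Comp_in[OF \<theta>(1) k]])
    have "a = Zero T s' ((ShO T ^^ n) t)" by (rule Suc.IH[OF s'(1) a(1)])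
    then have "k \<cdot> \<theta> = Zero T s (\<Sigma>\<^sub>o ((ShO T ^^ n) t)) \<cdot> \<theta>"
      using a(2) s'o tn homsetD[OF \<theta>(1)] hom_obj[OF \<theta>(1)] by simp
    then have "k = Zero T s (\<Sigma>\<^sub>o ((ShO T ^^ n) t))"
      by (rule iso_cancel_right[OF \<theta>(2,1) k Zero_in[OF hom_obj(2)[OF \<theta>(1)] Sh_obj[OF tn]]])
    then show ?case by simp
  qed
  fix g n assume g: "g \<in> G"
  have gn: "(ShO T ^^ n) g \<in> S" by (induction n) (use g S(2,3) in auto)
  have "homset T s ((ShO T ^^ m) t) = {Zero T s ((ShO T ^^ m) t)}" if "s \<in> S" for s m
    using zn[OF that] Zero_in[OF _ tn] S(1) that by blast
  from this[of g n] this[of "(ShO T ^^ n) g" 0]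
  show "homset T g ((ShO T ^^ n) t) = {Zero T g ((ShO T ^^ n) t)} \<and> homset T ((ShO T ^^ n) g) t = {Zero T ((ShO T ^^ n) g) t}"
    using g S(2) gn by auto
qed

lemma generating_set:
  obtains G where "G \<subseteq> K" "small \<kappa> G" "detects_zero G"
proof -
  have "\<exists>G. G \<subseteq> K \<and> small \<kappa> G \<and> detects_zero G"
    using generated unfolding compactly_generated_def detects_zero_def by (elim conjE)
  then show thesis using that by blast
qed

lemma K_desuspend:
  assumes "c \<in> K"
  obtains d where "d \<in> K" "isomorphic T (\<Sigma>\<^sub>o d) c"
proof -
  obtain d where d: "d \<in> Obj T" "isomorphic T (\<Sigma>\<^sub>o d) c" using Sh_ess_surj[OF compact_obj[OF assms]] by blast
  have "\<Sigma>\<^sub>o d \<in> K" by (rule compact_retract[OF assms isomorphic_retract[OF d(2)]])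
  then show thesis using that d compact_Sh_reflects by blast
qed

lemma zero_by_compacts:
  assumes t: "t \<in> Obj T" and z: "\<And>c k. \<lbrakk>c \<in> K; k \<in> homset T c t\<rbrakk> \<Longrightarrow> k = Zero T c t"
  shows "is_zero_obj T t"
proof -
  obtain G where G: "G \<subseteq> K" "small \<kappa> G" "detects_zero G" by (rule generating_set)
  show ?thesis
  proof (rule zero_by_generators[OF G(3), of K])
    show "K \<subseteq> Obj T" using compact_obj by blast
    show "\<exists>s' \<in> K. isomorphic T (\<Sigma>\<^sub>o s') s" if "s \<in> K" for s using K_desuspend[OF that] by blast
  qed (use G(1) compact_Sh t z in auto)
qed

section \<open>Essential smallness of the compact objects\<close>

definition desuspension where "desuspension x = (SOME y. y \<in> Obj T \<and> isomorphic T (\<Sigma>\<^sub>o y) x)"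

definition cone where "cone f = (SOME z. \<exists>g h. tri f g h (Dom T f) (Cod T f) z)"

definition splits where
  "splits e x \<longleftrightarrow> (\<exists>i \<in> homset T x (Dom T e). \<exists>r \<in> homset T (Dom T e) x. r \<cdot> i = Id T x \<and> i \<cdot> r = e)"

definition splitting where "splitting e = (SOME x. splits e x)"

text \<open>One chosen cone, desuspension and splitting per datum keeps the result small while
  representing all of them up to isomorphism. Intersecting with \<open>Obj T\<close> discards the
  junk values of the choices, for instance splittings of arrows that are not split
  idempotents.\<close>

definition enlarge where
  "enlarge S = Obj T \<inter> (S \<union> ShO T ` S \<union> desuspension ` S \<union> (cone ` (\<Union>x \<in> S. \<Union>y \<in> S. homset T x y)) \<union>
     (splitting ` (\<Union>x \<in> S. \<Union>y \<in> S. homset T x y)))"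

lemma small_enlarge:
  assumes "small \<kappa> S" "S \<subseteq> Obj T"
  shows "small \<kappa> (enlarge S)"
proof -
  have "small \<kappa> (\<Union>x \<in> S. \<Union>y \<in> S. homset T x y)"
    by (intro small_UN[OF univ] assms(1) small_homset) (use assms(2) in auto)
  then have "small \<kappa> (S \<union> ShO T ` S \<union> desuspension ` S \<union> (cone ` (\<Union>x \<in> S. \<Union>y \<in> S. homset T x y)) \<union>
     (splitting ` (\<Union>x \<in> S. \<Union>y \<in> S. homset T x y)))"
    by (intro small_Un[OF univ] small_image assms(1))
  then show ?thesis unfolding enlarge_def by (rule small_subset) blast
qed

lemma split_isomorphic:
  assumes "splits e x" "splits e y"
  shows "isomorphic T x y"
proof -
  let ?s = "Dom T e"
  obtain i r where 1: "i \<in> homset T x ?s" "r \<in> homset T ?s x" "r \<cdot> i = Id T x" "i \<cdot> r = e" using assms(1) by (auto simp: splits_def)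
  obtain j q where 2: "j \<in> homset T y ?s" "q \<in> homset T ?s y" "q \<cdot> j = Id T y" "j \<cdot> q = e" using assms(2) by (auto simp: splits_def)
  note A = homsetD[OF 1(1)] homsetD[OF 1(2)] homsetD[OF 2(1)] homsetD[OF 2(2)] hom_obj[OF 1(1)] hom_obj[OF 2(1)]
  have e: "j \<cdot> q = i \<cdot> r" using 1(4) 2(4) by simp
  have "(r \<cdot> j) \<cdot> (q \<cdot> i) = r \<cdot> (j \<cdot> (q \<cdot> i))" using A by simp
  also have "j \<cdot> (q \<cdot> i) = i \<cdot> (r \<cdot> i)" by (rule comp_eq_extend[OF e]) (use A in simp_all)
  also have "r \<cdot> (i \<cdot> (r \<cdot> i)) = Id T x" using 1(3) A by simp
  finally have I: "(r \<cdot> j) \<cdot> (q \<cdot> i) = Id T x" .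
  have "(q \<cdot> i) \<cdot> (r \<cdot> j) = q \<cdot> (i \<cdot> (r \<cdot> j))" using A by simp
  also have "i \<cdot> (r \<cdot> j) = j \<cdot> (q \<cdot> j)" by (rule comp_eq_extend[OF e[symmetric]]) (use A in simp_all)
  also have "q \<cdot> (j \<cdot> (q \<cdot> j)) = Id T y" using 2(3) A by simp
  finally have J: "(q \<cdot> i) \<cdot> (r \<cdot> j) = Id T y" .
  have ty: "q \<cdot> i \<in> homset T x y" "r \<cdot> j \<in> homset T y x" using A by (simp_all add: homset_iff)
  show ?thesis using isomorphicI[OF ty(1) iso_arrI[OF ty I J]] .
qed

text \<open>Countably many rounds of \<open>enlarge\<close>, starting from a generating set, give a
  small U. Each compact c is the target of an approximation built from the compact members of U
  whose cone vanishes; Neeman's argument makes c a retract of such a member, and the splittings put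
  a copy of c into U.\<close>

lemma compacts_essentially_small:
  obtains R where "R \<subseteq> K" "small \<kappa> R" "\<And>c. c \<in> K \<Longrightarrow> \<exists>r \<in> R. isomorphic T c r"
proof -
  obtain G where G: "G \<subseteq> K" "small \<kappa> G" "detects_zero G" by (rule generating_set)
  obtain z0 where z0: "is_zero_obj T z0" "z0 \<in> Obj T" by (rule zero_obj_obtain)
  \<comment> \<open>The object z0 is inserted so that zero objects are represented.\<close>
  define V where "V n = (enlarge ^^ n) (insert z0 G)" for n
  have VO: "V n \<subseteq> Obj T" for n by (cases n) (use G(1) compact_obj z0 in \<open>auto simp: V_def enlarge_def\<close>)
  have VS: "V (Suc n) = enlarge (V n)" for n by (simp add: V_def)
  have mono: "V n \<subseteq> V (Suc n)" for n using VO[of n] unfolding VS enlarge_def by blast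
  have mono': "V m \<subseteq> V n" if "m \<le> n" for m n using lift_Suc_mono_le[of V, OF mono that] .
  have sV: "small \<kappa> (V n)" for n
  proof (induction n)
    case 0
    have "V 0 = {z0} \<union> G" by (simp add: V_def)
    then show ?case using small_Un[OF univ small_finite[OF univ, of "{z0}"] G(2)] by simp
  next
    case (Suc n)
    then show ?case unfolding VS using small_enlarge VO by blast
  qed
  define U where "U = (\<Union>n. V n)"
  have sU: "small \<kappa> U" unfolding U_def by (rule small_UN[OF univ small_nat[OF univ] sV])
  have UO: "U \<subseteq> Obj T" using VO unfolding U_def by blast
  have Usub: "insert z0 G \<subseteq> U" unfolding U_def V_def by (rule UN_upper[of 0 UNIV, simplified, THEN subset_trans[rotated]]) simp
  \<comment> \<open>The stages increase, so an arrow between two members of U lives at a single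
    stage, and its chosen cone appears at the next one.\<close>
  have common: "\<exists>n. x \<in> V n \<and> y \<in> V n" if xy: "x \<in> U" "y \<in> U" for x y
  proof -
    obtain m n where "x \<in> V m" "y \<in> V n" using xy unfolding U_def by blast
    then have "x \<in> V (max m n) \<and> y \<in> V (max m n)" using mono'[of m "max m n"] mono'[of n "max m n"] by auto
    then show ?thesis by blast
  qed
  have inU: "x \<in> U" if "x \<in> enlarge (V n)" for x n using that VS unfolding U_def by blast
  have USh: "\<Sigma>\<^sub>o x \<in> U" if x: "x \<in> U" for x
  proof -
    obtain n where "x \<in> V n" using x unfolding U_def by blast
    then have "\<Sigma>\<^sub>o x \<in> enlarge (V n)" using x UO by (auto simp: enlarge_def)
    then show ?thesis by (rule inU)
  qed
  have Udes: "\<exists>y \<in> U. isomorphic T (\<Sigma>\<^sub>o y) x" if x: "x \<in> U" for x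
  proof -
    obtain n where n: "x \<in> V n" using x unfolding U_def by blast
    have "\<exists>y. y \<in> Obj T \<and> isomorphic T (\<Sigma>\<^sub>o y) x" using Sh_ess_surj x UO by blast
    then have d: "desuspension x \<in> Obj T \<and> isomorphic T (\<Sigma>\<^sub>o (desuspension x)) x"
      unfolding desuspension_def by (rule someI_ex)
    then have "desuspension x \<in> enlarge (V n)" using n by (auto simp: enlarge_def)
    then show ?thesis using inU d by blast
  qed
  have Ucone: "\<exists>z g h. z \<in> U \<and> tri f g h x y z" if xy: "x \<in> U" "y \<in> U" and f: "f \<in> homset T x y" for f x y
  proof -
    obtain n where n: "x \<in> V n" "y \<in> V n" using common[OF xy] by blast
    have "\<exists>z. \<exists>g h. tri f g h x y z" using tri_ex[OF f] by metis
    then have "\<exists>g h. tri f g h x y (cone f)" unfolding cone_def homsetD(2,3)[OF f] by (rule someI_ex)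
    then obtain g h where t: "tri f g h x y (cone f)" by blast
    have "cone f \<in> enlarge (V n)" using n f triD(7)[OF t] by (auto simp: enlarge_def)
    then show ?thesis using inU t by blast
  qed
  have Usplit: "\<exists>x' \<in> U. isomorphic T x x'" if s: "s \<in> U" and x: "retract x s" for x s
  proof -
    obtain n where n: "s \<in> V n" using s unfolding U_def by blast
    obtain i r where i: "i \<in> homset T x s" "r \<in> homset T s x" "r \<cdot> i = Id T x" using x by (auto simp: retract_def)
    let ?e = "i \<cdot> r"
    have e: "?e \<in> homset T s s" by (rule Comp_in[OF i(2,1)])
    have sx: "splits ?e x" unfolding splits_def homsetD(2)[OF e] using i by blast
    then have sp: "splits ?e (splitting ?e)" unfolding splitting_def by (rule someI)
    have xs: "isomorphic T x (splitting ?e)" by (rule split_isomorphic[OF sx sp])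
    have "splitting ?e \<in> enlarge (V n)" proof -
      have "splitting ?e \<in> splitting ` (\<Union>x \<in> V n. \<Union>y \<in> V n. homset T x y)" by (rule imageI) (use n e in blast)
      then show ?thesis unfolding enlarge_def using isomorphic_obj[OF xs] by blast
    qed
    then show ?thesis using inU xs by blast
  qed
  let ?R = "U \<inter> K"
  \<comment> \<open>Closed under isomorphism, as a triangulated subcategory must be, and therefore
    in general not small; the small set used for the approximation is ?R.\<close>
  define J where "J = {x \<in> K. \<exists>s \<in> U. isomorphic T x s}"
  have RJ: "?R \<subseteq> J" using isomorphic_refl UO unfolding J_def by blast
  note KD = triangulated_subcategoryD[OF compact_triangulated[of \<kappa>]]
  have J: "triangulated_subcategory T J"
  proof (rule triangulated_subcategoryI)
    show "J \<subseteq> Obj T" using compact_obj unfolding J_def by blast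
    show "z \<in> J" if "is_zero_obj T z" for z
      using compact_zero[OF that, of \<kappa>] zero_obj_iso[OF that z0(1)] Usub unfolding J_def by blast
    show "y \<in> J" if "x \<in> J" "isomorphic T x y" for x y
      using KD(3)[OF _ that(2)] isomorphic_trans[OF isomorphic_sym[OF that(2)]] that(1) unfolding J_def by blast
    show "\<Sigma>\<^sub>o x \<in> J" if "x \<in> J" for x
      using compact_Sh USh Sh_isomorphic that unfolding J_def by blast
    show "x \<in> J" if xo: "x \<in> Obj T" and Sx: "\<Sigma>\<^sub>o x \<in> J" for x
    proof -
      obtain s where s: "s \<in> U" "isomorphic T (\<Sigma>\<^sub>o x) s" using Sx unfolding J_def by blast
      obtain y where y: "y \<in> U" "isomorphic T (\<Sigma>\<^sub>o y) s" using Udes[OF s(1)] by blast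
      have "isomorphic T (\<Sigma>\<^sub>o x) (\<Sigma>\<^sub>o y)" by (rule isomorphic_trans[OF s(2) isomorphic_sym[OF y(2)]])
      then have "isomorphic T x y" using Sh_reflects_isomorphic xo y(1) UO by blast
      then show ?thesis using y(1) Sx compact_Sh_reflects[OF _ xo] unfolding J_def by blast
    qed
    show "z \<in> J" if t: "tri f g h x y z" and x: "x \<in> J" and y: "y \<in> J" for f g h x y z
    proof -
      obtain s s' where s: "s \<in> U" "isomorphic T x s" "s' \<in> U" "isomorphic T y s'" using x y unfolding J_def by blast
      obtain a a' where a: "a \<in> homset T x s" "a' \<in> homset T s x" "a' \<cdot> a = Id T x" "is_iso_arr T a"
        using s(2) isomorphicE by metis
      obtain b where b: "b \<in> homset T y s'" "is_iso_arr T b" using s(4) by (auto simp: isomorphic_def)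
      let ?f = "b \<cdot> (f \<cdot> a')"
      note A = tri_arr[OF t] homsetD[OF a(1)] homsetD[OF a(2)] homsetD[OF b(1)]
      have f': "?f \<in> homset T s s'" by (rule Comp_in[OF Comp_in[OF a(2) triD(2)[OF t]] b(1)])
      obtain z' g' h' where z': "z' \<in> U" "tri ?f g' h' s s' z'" using Ucone[OF s(1,3) f'] by blast
      have "b \<cdot> f = ?f \<cdot> a" using A a(3) by simp
      then have "isomorphic T z z'" by (rule tri_iso_of_iso[OF t z'(2) a(1,4) b])
      then show ?thesis using z'(1) compact_cone[OF t] x y unfolding J_def by blast
    qed
  qed
  have JK: "J \<subseteq> K" by (auto simp: J_def)
  have sR: "small \<kappa> ?R" by (rule small_subset[OF sU]) blast
  have Rdes: "\<exists>s' \<in> ?R. isomorphic T (\<Sigma>\<^sub>o s') s" if s: "s \<in> ?R" for s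
  proof -
    obtain y where y: "y \<in> U" "isomorphic T (\<Sigma>\<^sub>o y) s" using Udes s by blast
    have "\<Sigma>\<^sub>o y \<in> K" using KD(3)[OF _ isomorphic_sym[OF y(2)]] s by blast
    then have "y \<in> K" using compact_Sh_reflects y(1) UO by blast
    then show ?thesis using y by blast
  qed
  have rep: "\<exists>r \<in> ?R. isomorphic T c r" if c: "c \<in> K" for c
  proof -
    \<comment> \<open>As ?R contains the generators and is stable under shifts, the cone F vanishes
      and c itself lies in the localizing subcategory generated by ?R.\<close>
    obtain W \<psi> g h F where W: "tri \<psi> g h W c F" "W \<in> Loc \<kappa> T ?R" "\<forall>s \<in> ?R. \<forall>k \<in> homset T s F. k = Zero T s F"
      by (rule approximation[OF sR _ Rdes compact_obj[OF c]]) auto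
    have "is_zero_obj T F"
    proof (rule zero_by_generators[OF G(3), of ?R])
      show "?R \<subseteq> Obj T" using UO by blast
      show "G \<subseteq> ?R" using Usub G(1) by blast
      show "\<Sigma>\<^sub>o s \<in> ?R" if "s \<in> ?R" for s using USh compact_Sh that by blast
      show "F \<in> Obj T" by (rule tri_arr(12)[OF W(1)])
    qed (use Rdes W(3) in auto)
    then have "isomorphic T W c" by (rule tri_zero_cone_iso[OF W(1)])
    moreover have "Loc \<kappa> T ?R \<subseteq> ind_closure \<kappa> J"
      by (rule Loc_least[OF ind_closure_localizing[OF J JK]]) (use RJ ind_closure_superset[of J \<kappa>] compact_obj JK in blast)
    ultimately have "c \<in> ind_closure \<kappa> J"
      using triangulated_subcategoryD(3)[OF localizing_triangulated[OF ind_closure_localizing[OF J JK]]] W(2) by blast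
    then obtain j where j: "j \<in> J" "retract c j" by (rule compact_ind_closure_retract[OF c])
    obtain s where s: "s \<in> U" "isomorphic T j s" using j(1) unfolding J_def by blast
    have "retract c s" by (rule retract_trans[OF j(2) isomorphic_retract[OF s(2)]])
    then obtain r where r: "r \<in> U" "isomorphic T c r" using Usplit[OF s(1)] by blast
    then show ?thesis using KD(3)[OF c r(2)] by blast
  qed
  show thesis by (rule that[OF _ sR rep]) auto
qed

end

section \<open>Idempotent triangles and the Balmer--Favi support\<close>

context stratified
begin

lemma \<sigma>_tri_middle:
  assumes t: "tri f g h x y z"
  shows "\<sigma> y \<subseteq> \<sigma> x \<union> \<sigma> z"
  using \<sigma>_tri[OF tri_rotate[OF tri_rotate[OF t]]] \<sigma>_shift tri_arr[OF t] by auto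

text \<open>The approximation is made with a small set of representatives of J. Its cone F receives
  no nonzero map from J, and duality strengthens this to j \<otimes> F = 0 for all j in J, which is
  a statement about supports.\<close>

lemma ideal_approximation:
  assumes J: "thick_ideal_compacts \<kappa> T J" and t: "t \<in> Obj T"
  obtains W \<psi> g h F where "tri \<psi> g h W t F" "W \<in> Loc \<kappa> T J" "\<sigma> W \<subseteq> supports J" "\<sigma> F \<inter> supports J = {}"
proof -
  note JD = thick_idealD[OF J]
  note J3 = triangulated_subcategoryD[OF JD(1)]
  have JO: "J \<subseteq> Obj T" using J3(1) by blast
  obtain R where R: "R \<subseteq> K" "small \<kappa> R" "\<And>c. c \<in> K \<Longrightarrow> \<exists>r \<in> R. isomorphic T c r"
    using compacts_essentially_small by blast
  let ?S = "R \<inter> J"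
  have rep: "\<exists>r \<in> ?S. isomorphic T j r" if j: "j \<in> J" for j
  proof -
    obtain r where "r \<in> R" "isomorphic T j r" using R(3) j JD(2) by blast
    then show ?thesis using J3(3)[OF j] by blast
  qed
  have des: "\<exists>s' \<in> ?S. isomorphic T (\<Sigma>\<^sub>o s') s" if s: "s \<in> ?S" for s
  proof -
    obtain d where d: "d \<in> Obj T" "isomorphic T (\<Sigma>\<^sub>o d) s" using Sh_ess_surj s JO by blast
    have "\<Sigma>\<^sub>o d \<in> J" using J3(3)[OF _ isomorphic_sym[OF d(2)]] s by blast
    then obtain r where r: "r \<in> ?S" "isomorphic T d r" using rep J3(4)[OF d(1)] by blast
    then have "isomorphic T (\<Sigma>\<^sub>o r) s" using isomorphic_trans[OF Sh_isomorphic[OF isomorphic_sym[OF r(2)]] d(2)] by blast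
    then show ?thesis using r(1) by blast
  qed
  have RK: "?S \<subseteq> K" using R(1) by blast
  have sS: "small \<kappa> ?S" by (rule small_subset[OF R(2)]) blast
  obtain W \<psi> g h F where W: "tri \<psi> g h W t F" "W \<in> Loc \<kappa> T ?S" "\<forall>s \<in> ?S. \<forall>k \<in> homset T s F. k = Zero T s F"
    by (rule approximation[OF sS RK des t])
  have Fo: "F \<in> Obj T" by (rule tri_arr(12)[OF W(1)])
  have WJ: "W \<in> Loc \<kappa> T J"
    using Loc_least[OF Loc_localizing[OF JO], of ?S] Loc_superset[of J \<kappa>] W(2) by blast
  have "Loc \<kappa> T J \<subseteq> supported (supports J)"
    by (rule Loc_least[OF localizing_idealD(1)[OF supported_ideal]]) (use JO in \<open>auto simp: supported_def\<close>)
  then have \<sigma>W: "\<sigma> W \<subseteq> supports J" using WJ by (auto simp: supported_def)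
  have homJ: "k = Zero T j F" if j: "j \<in> J" and k: "k \<in> homset T j F" for j k
  proof -
    obtain r where r: "r \<in> ?S" "isomorphic T j r" using rep[OF j] by blast
    obtain a where a: "a \<in> homset T r j" "is_iso_arr T a" using isomorphic_sym[OF r(2)] by (auto simp: isomorphic_def)
    have "k \<cdot> a = Zero T r F" by (rule W(3)[rule_format, OF r(1) Comp_in[OF a(1) k]])
    then have "k \<cdot> a = Zero T j F \<cdot> a" using homsetD[OF a(1)] Fo by simp
    then show ?thesis by (rule iso_cancel_right[OF a(2,1) k Zero_in[OF hom_obj(2)[OF a(1)] Fo]])
  qed
  have "\<sigma> j \<inter> \<sigma> F = {}" if j: "j \<in> J" for j
  proof -
    have jK: "j \<in> K" using j JD(2) by blast
    have jo: "j \<in> Obj T" using j JO by blast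
    obtain y \<eta> \<epsilon> where d: "dual_pair j y \<eta> \<epsilon>" "y \<in> K" by (rule K_dual[OF jK])
    have yJ: "y \<in> J" by (rule thick_ideal_dual[OF J d(1) j d(2)])
    \<comment> \<open>A map from a compact c to j \<otimes> F is governed by a map y \<otimes> c ->
      F, where y is the dual of j. Since y and hence y \<otimes> c lie in J, that map is zero, and
      compact objects detect zero objects.\<close>
    have "is_zero_obj T (j \<boxtimes> F)"
    proof (rule zero_by_compacts)
      show "j \<boxtimes> F \<in> Obj T" using jo Fo by simp
      fix c k assume c: "c \<in> K" and k: "k \<in> homset T c (j \<boxtimes> F)"
      obtain k' p where k': "k' \<in> homset T (y \<boxtimes> c) F" "p \<in> homset T (j \<boxtimes> F) (j \<boxtimes> F)"
        "k = p \<cdot> (Id T j \<boxdot> k') \<cdot> adj_unit j y \<eta> c"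
        by (rule dual_factorization[OF d(1) Fo k])
      have co: "c \<in> Obj T" by (rule compact_obj[OF c])
      have yco: "y \<boxtimes> c \<in> Obj T" using hom_obj[OF k'(1)] by blast
      have "k' = Zero T (y \<boxtimes> c) F" by (rule homJ[OF JD(4)[OF yJ c] k'(1)])
      then have "Id T j \<boxdot> k' = Zero T (j \<boxtimes> (y \<boxtimes> c)) (j \<boxtimes> F)" using TenA_Zero[OF yco Fo Id_in[OF jo]] by simp
      then show "k = Zero T c (j \<boxtimes> F)"
        using k'(3) homsetD[OF k'(2)] homsetD[OF adj_unit_in[OF d(1) co]] jo yco Fo co by simp
    qed
    then have "\<sigma> (j \<boxtimes> F) = {}" by (rule \<sigma>_zero)
    then show ?thesis using \<sigma>_tensor_eq[OF jo Fo] by simp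
  qed
  then show thesis using that W(1) WJ \<sigma>W by blast
qed

text \<open>Approximating the unit splits X into the disjoint sets \<sigma>(e) = ?Y and \<sigma>(f).
  By the tensor formula, all conditions on e and f then become statements about supports and
  identify the classes in question with \<open>supported ?Y\<close>.\<close>

lemma idempotent_triangle_ex:
  assumes J: "thick_ideal_compacts \<kappa> T (compacts_on \<kappa> T Y)"
  shows "\<exists>e f. idempotent_triangle \<kappa> T Y e f"
proof -
  let ?J = "compacts_on \<kappa> T Y"
  let ?Y = "supports ?J"
  have JO: "?J \<subseteq> Obj T" using thick_idealD(2)[OF J] compact_obj by blast
  obtain e i q d f where t: "tri i q d e \<one>\<^sub>T f" and e: "e \<in> Loc \<kappa> T ?J" "\<sigma> e \<subseteq> ?Y" and f: "\<sigma> f \<inter> ?Y = {}"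
    by (rule ideal_approximation[OF J Unit_in])
  note A = tri_arr[OF t]
  have cover: "topspace X \<subseteq> \<sigma> e \<union> \<sigma> f" using \<sigma>_tri_middle[OF t] \<sigma>_unit by simp
  have YX: "?Y \<subseteq> topspace X" using JO \<sigma>_subset by blast
  have kill: "is_zero_obj T (f \<boxtimes> s) \<longleftrightarrow> \<sigma> s \<subseteq> ?Y" if s: "s \<in> Obj T" for s
    using \<sigma>_empty_iff[of "f \<boxtimes> s"] \<sigma>_tensor_eq[OF A(12) s] \<sigma>_subset[OF s] A(12) s cover e(2) f by auto
  have ten: "isomorphic T s (e \<boxtimes> s)" if s: "s \<in> Obj T" "\<sigma> s \<subseteq> ?Y" for s
  proof -
    have "is_zero_obj T (f \<boxtimes> s)" using kill[OF s(1)] s(2) by blast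
    then have "isomorphic T (e \<boxtimes> s) (\<one>\<^sub>T \<boxtimes> s)" by (rule tri_zero_cone_iso[OF tri_tensor[OF t s(1)]])
    then show ?thesis using isomorphic_trans[OF _ LUnit_isomorphic[OF s(1)]] isomorphic_sym by blast
  qed
  have 1: "{t \<in> Obj T. is_zero_obj T (f \<boxtimes> t)} = supported ?Y" using kill by (auto simp: supported_def)
  have 2: "{t \<in> Obj T. \<exists>s \<in> Obj T. isomorphic T t (e \<boxtimes> s)} = supported ?Y"
  proof (intro equalityI subsetI)
    fix s assume "s \<in> {t \<in> Obj T. \<exists>s \<in> Obj T. isomorphic T t (e \<boxtimes> s)}"
    then obtain s' where "s \<in> Obj T" "s' \<in> Obj T" "isomorphic T s (e \<boxtimes> s')" by blast
    then show "s \<in> supported ?Y" using \<sigma>_isomorphic[of s "e \<boxtimes> s'"] \<sigma>_tensor[of e s'] A(10) e(2) by (auto simp: supported_def)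
  next
    fix s assume "s \<in> supported ?Y"
    then show "s \<in> {t \<in> Obj T. \<exists>s \<in> Obj T. isomorphic T t (e \<boxtimes> s)}" using ten by (auto simp: supported_def)
  qed
  \<comment> \<open>Here \<open>Loc\<close> appears rather than \<open>Loc_ideal\<close>, so
    stratification does not apply directly. Instead s is approximated by an object of
    \<open>Loc\<close>; the cone has support both inside ?Y and disjoint from it, hence
    vanishes.\<close>
  have 3: "supported ?Y = Loc \<kappa> T ?J"
  proof
    show "Loc \<kappa> T ?J \<subseteq> supported ?Y"
      by (rule Loc_least[OF localizing_idealD(1)[OF supported_ideal]]) (use JO in \<open>auto simp: supported_def\<close>)
    show "supported ?Y \<subseteq> Loc \<kappa> T ?J"
    proof
      fix s assume "s \<in> supported ?Y"
      then have s: "s \<in> Obj T" "\<sigma> s \<subseteq> ?Y" by (auto simp: supported_def)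
      obtain W \<psi> g h F where W: "tri \<psi> g h W s F" "W \<in> Loc \<kappa> T ?J" "\<sigma> W \<subseteq> ?Y" "\<sigma> F \<inter> ?Y = {}"
        by (rule ideal_approximation[OF J s(1)])
      have FY: "\<sigma> F \<subseteq> ?Y" by (rule subset_trans[OF \<sigma>_tri[OF W(1)] Un_least[OF W(3) s(2)]])
      have "\<sigma> F = {}" using W(4) unfolding inf.absorb1[OF FY] .
      then have "is_zero_obj T F" using \<sigma>_empty_iff[OF tri_arr(12)[OF W(1)]] by simp
      then have "isomorphic T W s" by (rule tri_zero_cone_iso[OF W(1)])
      then show "s \<in> Loc \<kappa> T ?J"
        by (rule triangulated_subcategoryD(3)[OF localizing_triangulated[OF Loc_localizing[OF JO]] W(2)])
    qed
  qed
  have 4: "is_zero_obj T (e \<boxtimes> f)"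
    using \<sigma>_empty_iff[of "e \<boxtimes> f"] \<sigma>_tensor_eq[OF A(10,12)] A(10,12) e(2) f by auto
  have "idempotent_triangle \<kappa> T Y e f"
    unfolding idempotent_triangle_def 1 2 using 3 4 triD[OF t] by blast
  then show ?thesis by blast
qed

text \<open>Holds for every idempotent triangle and not just for the constructed one, as required by
  the choice in \<open>idempotent_pair\<close>.\<close>

lemma idempotent_triangle_supports:
  assumes i: "idempotent_triangle \<kappa> T Y e f" and J: "compacts_on \<kappa> T Y \<subseteq> K"
  shows "e \<in> Obj T" "f \<in> Obj T" "\<sigma> e = supports (compacts_on \<kappa> T Y)"
    "\<sigma> f = topspace X - supports (compacts_on \<kappa> T Y)"
proof -
  let ?J = "compacts_on \<kappa> T Y"
  obtain i' q d where t: "tri i' q d e \<one>\<^sub>T f"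
    using assms(1) unfolding idempotent_triangle_def tri_def by blast
  note A = tri_arr[OF t]
  show eo: "e \<in> Obj T" and fo: "f \<in> Obj T" by (fact A(10), fact A(12))
  have JO: "?J \<subseteq> Obj T" using J compact_obj by blast
  have z: "is_zero_obj T (e \<boxtimes> f)" and L: "{t \<in> Obj T. \<exists>s \<in> Obj T. isomorphic T t (e \<boxtimes> s)} = Loc \<kappa> T ?J"
    using i unfolding idempotent_triangle_def by auto
  have "Loc \<kappa> T ?J \<subseteq> supported (supports ?J)"
    by (rule Loc_least[OF localizing_idealD(1)[OF supported_ideal]]) (use JO in \<open>auto simp: supported_def\<close>)
  moreover have "e \<in> Loc \<kappa> T ?J"
    unfolding L[symmetric] using eo isomorphic_sym[OF RUnit_isomorphic[OF eo]] Unit_in by blast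
  ultimately have le: "\<sigma> e \<subseteq> supports ?J" by (auto simp: supported_def)
  have "\<sigma> j \<subseteq> \<sigma> e" if "j \<in> ?J" for j
  proof -
    have "j \<in> Loc \<kappa> T ?J" using Loc_superset that by blast
    then obtain s where "s \<in> Obj T" "isomorphic T j (e \<boxtimes> s)" unfolding L[symmetric] by blast
    then show ?thesis using \<sigma>_isomorphic[of j "e \<boxtimes> s"] \<sigma>_tensor[OF eo, of s] by blast
  qed
  then show \<sigma>e: "\<sigma> e = supports ?J" using le by blast
  have "\<sigma> e \<inter> \<sigma> f = {}" using \<sigma>_zero[OF z] \<sigma>_tensor_eq[OF eo fo] by simp
  moreover have "topspace X \<subseteq> \<sigma> e \<union> \<sigma> f" using \<sigma>_tri_middle[OF t] \<sigma>_unit by simp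
  ultimately show "\<sigma> f = topspace X - supports ?J" using \<sigma>_subset[OF fo] \<sigma>e by blast
qed

section \<open>Thomason subsets under the comparison, and the support of g(P)\<close>

lemma thomason_subset: "thomason Z U \<Longrightarrow> U \<subseteq> topspace Z"
  unfolding thomason_def using thomason_closed_subset by blast

lemma thomason_homeomorphic:
  assumes h: "homeomorphic_map X Z f" and U: "U \<subseteq> topspace X"
  shows "thomason Z (f ` U) \<longleftrightarrow> thomason X U"
proof -
  have inj: "inj_on f (topspace X)" by (rule homeomorphic_imp_injective_map[OF h])
  have surj: "f ` topspace X = topspace Z" by (rule homeomorphic_imp_surjective_map[OF h])
  have tc: "thomason_closed Z (f ` V) \<longleftrightarrow> thomason_closed X V" if V: "V \<subseteq> topspace X" for V
  proof -
    have "topspace Z - f ` V = f ` (topspace X - V)" using inj_on_image_set_diff[OF inj Diff_subset V] surj by simp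
    then show ?thesis
      unfolding thomason_closed_def
      using homeomorphic_map_closedness[OF h V] homeomorphic_map_compactness[OF h, of "topspace X - V"] by simp
  qed
  show ?thesis
  proof
    assume "thomason X U"
    then obtain \<F> where \<F>: "\<forall>V \<in> \<F>. thomason_closed X V" "U = \<Union>\<F>" unfolding thomason_def by blast
    have "thomason_closed Z (f ` V)" if "V \<in> \<F>" for V
      using tc[of V] \<F>(1) that thomason_closed_subset by blast
    then show "thomason Z (f ` U)" unfolding thomason_def \<F>(2) image_Union by (intro exI[of _ "(`) f ` \<F>"]) auto
  next
    assume "thomason Z (f ` U)"
    then obtain \<F> where \<F>: "\<forall>V \<in> \<F>. thomason_closed Z V" "f ` U = \<Union>\<F>" unfolding thomason_def by blast
    let ?g = "\<lambda>V. {p \<in> topspace X. f p \<in> V}"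
    have im: "f ` ?g V = V" if "V \<subseteq> topspace Z" for V using that unfolding surj[symmetric] by blast
    have "thomason_closed X (?g V)" if "V \<in> \<F>" for V
    proof -
      have "V \<subseteq> topspace Z" using \<F>(1) that thomason_closed_subset by blast
      then show ?thesis using tc[of "?g V"] im[of V] \<F>(1) that by auto
    qed
    moreover have "U = \<Union>(?g ` \<F>)"
    proof
      show "U \<subseteq> \<Union>(?g ` \<F>)" using U \<F>(2) by auto
      show "\<Union>(?g ` \<F>) \<subseteq> U"
      proof
        fix p assume "p \<in> \<Union>(?g ` \<F>)"
        then have "p \<in> topspace X" "f p \<in> f ` U" using \<F>(2) by auto
        then show "p \<in> U" using inj U by (auto dest: inj_onD)
      qed
    qed
    ultimately show "thomason X U" unfolding thomason_def by (intro exI[of _ "?g ` \<F>"]) auto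
  qed
qed

text \<open>Transported to X, a Thomason set is a union of Thomason closed sets, and by (a) each of
  these is the support of a compact object.\<close>

lemma comparison_compacts_on:
  assumes f: "comparison_homeo \<kappa> T X \<sigma> f" and Y: "thomason (Spc \<kappa> T) Y"
  shows "thick_ideal_compacts \<kappa> T (compacts_on \<kappa> T Y)" "supports (compacts_on \<kappa> T Y) = {p \<in> topspace X. f p \<in> Y}"
proof -
  note fD = comparison_homeoD[OF f]
  have h: "homeomorphic_map X (Spc \<kappa> T) f" using f by (simp add: comparison_homeo_def)
  let ?Y = "{p \<in> topspace X. f p \<in> Y}"
  have YS: "Y \<subseteq> topspace (Spc \<kappa> T)" by (rule thomason_subset[OF Y])
  have im: "f ` topspace X = topspace (Spc \<kappa> T)" by (rule homeomorphic_imp_surjective_map[OF h])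
  have im': "f ` {p \<in> topspace X. f p \<in> V} = V" if "V \<subseteq> topspace (Spc \<kappa> T)" for V
    using that unfolding im[symmetric] by blast
  have tY: "thomason X ?Y" using thomason_homeomorphic[OF h, of ?Y] Y unfolding im'[OF YS] by blast
  have supp: "supp \<kappa> T x = f ` \<sigma> x" if x: "x \<in> K" for x
  proof -
    have "\<sigma> x = {p \<in> topspace X. f p \<in> supp \<kappa> T x}" using f x by (simp add: comparison_homeo_def)
    moreover have "supp \<kappa> T x \<subseteq> topspace (Spc \<kappa> T)" unfolding topspace_Spc by (auto simp: supp_def)
    ultimately show ?thesis using im' by simp
  qed
  have iff: "supp \<kappa> T x \<subseteq> Y \<longleftrightarrow> \<sigma> x \<subseteq> ?Y" if x: "x \<in> K" for x
    unfolding supp[OF x] using \<sigma>_subset[OF K_obj[OF x]] by blast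
  have J: "compacts_on \<kappa> T Y = {x \<in> K. \<sigma> x \<subseteq> ?Y}"
    unfolding compacts_on_def using iff by blast
  obtain z where z: "z \<in> K" "\<sigma> z = {}" by (rule K_empty)
  show "thick_ideal_compacts \<kappa> T (compacts_on \<kappa> T Y)"
    unfolding J by (rule thick_idealI) (use z in auto)
  have "?Y \<subseteq> supports (compacts_on \<kappa> T Y)"
  proof
    fix p assume p: "p \<in> ?Y"
    obtain \<F> where \<F>: "\<forall>V \<in> \<F>. thomason_closed X V" "?Y = \<Union>\<F>" using tY unfolding thomason_def by blast
    then obtain V where V: "V \<in> \<F>" "p \<in> V" using p by blast
    then obtain x where x: "x \<in> K" "V = \<sigma> x" using comparison_imp_closed_condition[OF f] \<F>(1) by blast
    then have "x \<in> compacts_on \<kappa> T Y" unfolding J using V(1) \<F>(2) by blast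
    then show "p \<in> supports (compacts_on \<kappa> T Y)" using V(2) x(2) by blast
  qed
  then show "supports (compacts_on \<kappa> T Y) = ?Y" unfolding J by blast
qed

lemma idempotent_supports:
  assumes f: "comparison_homeo \<kappa> T X \<sigma> f" and Y: "thomason (Spc \<kappa> T) Y"
  shows "e_idem \<kappa> T Y \<in> Obj T" "f_idem \<kappa> T Y \<in> Obj T" "\<sigma> (e_idem \<kappa> T Y) = {p \<in> topspace X. f p \<in> Y}"
    "\<sigma> (f_idem \<kappa> T Y) = {p \<in> topspace X. f p \<notin> Y}"
proof -
  note J = comparison_compacts_on[OF f Y]
  have "\<exists>p. idempotent_triangle \<kappa> T Y (fst p) (snd p)" using idempotent_triangle_ex[OF J(1)] by auto
  then have "idempotent_triangle \<kappa> T Y (e_idem \<kappa> T Y) (f_idem \<kappa> T Y)"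
    unfolding e_idem_def f_idem_def idempotent_pair_def by (rule someI_ex)
  from idempotent_triangle_supports[OF this thick_idealD(2)[OF J(1)]]
  show "e_idem \<kappa> T Y \<in> Obj T" "f_idem \<kappa> T Y \<in> Obj T" "\<sigma> (e_idem \<kappa> T Y) = {p \<in> topspace X. f p \<in> Y}"
    "\<sigma> (f_idem \<kappa> T Y) = {p \<in> topspace X. f p \<notin> Y}"
    unfolding J(2) by auto
qed

text \<open>The support of g(f(p)) is {p}, so by the tensor formula g(f(p)) \<otimes> t has support
  {p} \<inter> \<sigma>(t), and \<sigma> detects zero objects.\<close>

lemma support_eq_BF_Supp:
  assumes f: "comparison_homeo \<kappa> T X \<sigma> f" and wn: "weakly_noetherian X" and t: "t \<in> Obj T"
  shows "\<sigma> t = {p \<in> topspace X. f p \<in> BF_Supp \<kappa> T t}"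
proof -
  note fD = comparison_homeoD[OF f]
  have inj: "inj_on f (topspace X)" and im: "f ` topspace X = prime_ideals \<kappa> T"
    using fD(1) by (auto simp: bij_betw_def)
  have h: "homeomorphic_map X (Spc \<kappa> T) f" using f by (simp add: comparison_homeo_def)
  have "f p \<in> BF_Supp \<kappa> T t \<longleftrightarrow> p \<in> \<sigma> t" if p: "p \<in> topspace X" for p
  proof -
    \<comment> \<open>The condition under the choice in \<open>g_obj\<close>. Weak noetherianity of
      X, transported along f, shows that it can be met; the argument then works with whichever
      presentation was chosen.\<close>
    let ?good = "\<lambda>g. \<exists>Y\<^sub>1 Y\<^sub>2. thomason (Spc \<kappa> T) Y\<^sub>1 \<and> thomason (Spc \<kappa> T) Y\<^sub>2 \<and>
        {f p} = Y\<^sub>1 \<inter> (topspace (Spc \<kappa> T) - Y\<^sub>2) \<and> g = e_idem \<kappa> T Y\<^sub>1 \<boxtimes> f_idem \<kappa> T Y\<^sub>2"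
    obtain U\<^sub>1 U\<^sub>2 where U: "thomason X U\<^sub>1" "thomason X U\<^sub>2" "{p} = U\<^sub>1 \<inter> (topspace X - U\<^sub>2)"
      using wn p unfolding weakly_noetherian_def by blast
    have UX: "U\<^sub>1 \<subseteq> topspace X" "U\<^sub>2 \<subseteq> topspace X"
      using U(1,2) by (auto dest: thomason_subset)
    have "thomason (Spc \<kappa> T) (f ` U\<^sub>1)" "thomason (Spc \<kappa> T) (f ` U\<^sub>2)"
      using thomason_homeomorphic[OF h UX(1)] thomason_homeomorphic[OF h UX(2)] U(1,2) by simp_all
    moreover have "{f p} = f ` U\<^sub>1 \<inter> (topspace (Spc \<kappa> T) - f ` U\<^sub>2)"
    proof -
      have "f ` (U\<^sub>1 \<inter> (topspace X - U\<^sub>2)) = f ` U\<^sub>1 \<inter> (f ` topspace X - f ` U\<^sub>2)"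
        using inj_on_image_Int[OF inj UX(1), of "topspace X - U\<^sub>2"] inj_on_image_set_diff[OF inj, of "topspace X" U\<^sub>2] UX(2) by simp
      then show ?thesis using U(3)[symmetric] im topspace_Spc by simp
    qed
    ultimately have "\<exists>g. ?good g" by blast
    then have "?good (g_obj \<kappa> T (f p))" unfolding g_obj_def by (rule someI_ex)
    then obtain Y\<^sub>1 Y\<^sub>2 where Y: "thomason (Spc \<kappa> T) Y\<^sub>1" "thomason (Spc \<kappa> T) Y\<^sub>2"
      "{f p} = Y\<^sub>1 \<inter> (topspace (Spc \<kappa> T) - Y\<^sub>2)" "g_obj \<kappa> T (f p) = e_idem \<kappa> T Y\<^sub>1 \<boxtimes> f_idem \<kappa> T Y\<^sub>2" by blast
    note e = idempotent_supports[OF f Y(1)] and g = idempotent_supports[OF f Y(2)]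
    have go: "g_obj \<kappa> T (f p) \<in> Obj T" unfolding Y(4) by (rule TenO_in[OF e(1) g(2)])
    have "\<sigma> (g_obj \<kappa> T (f p)) = {q \<in> topspace X. f q \<in> {f p}}"
      unfolding Y(4) \<sigma>_tensor_eq[OF e(1) g(2)] e(3) g(4) Y(3) using im topspace_Spc by auto
    also have "\<dots> = {p}" using inj p by (auto dest: inj_onD)
    finally have "\<sigma> (g_obj \<kappa> T (f p) \<boxtimes> t) = {p} \<inter> \<sigma> t" using \<sigma>_tensor_eq[OF go t] by simp
    then have "is_zero_obj T (g_obj \<kappa> T (f p) \<boxtimes> t) \<longleftrightarrow> p \<notin> \<sigma> t" using \<sigma>_empty_iff[of "g_obj \<kappa> T (f p) \<boxtimes> t"] go t by auto
    then show ?thesis unfolding BF_Supp_def using im p by blast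
  qed
  then show ?thesis using \<sigma>_subset[OF t] by blast
qed

end

theorem theorem7p6:
  fixes \<kappa> :: "'u rel"
    and T :: "('o, 'm) tt_cat"
    and X :: "'x topology"
    and \<sigma> :: "'o \<Rightarrow> 'x set"
  assumes univ: "inaccessible \<kappa>"
    and rcg: "rigidly_compactly_generated \<kappa> T"
    and spectral: "spectral_space X"
    and \<sigma>_subset: "\<And>t. t \<in> Obj T \<Longrightarrow> \<sigma> t \<subseteq> topspace X"
    and \<sigma>_zero: "\<And>z. is_zero_obj T z \<Longrightarrow> \<sigma> z = {}"
    and \<sigma>_unit: "\<sigma> (Unit T) = topspace X"
    and \<sigma>_shift: "\<And>t. t \<in> Obj T \<Longrightarrow> \<sigma> (ShO T t) = \<sigma> t"
    and \<sigma>_triangle: "\<And>a b c f g h. \<lbrakk>(f, g, h) \<in> Tri T;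
          f \<in> homset T a b; g \<in> homset T b c; h \<in> homset T c (ShO T a)\<rbrakk> \<Longrightarrow> \<sigma> c \<subseteq> \<sigma> a \<union> \<sigma> b"
    and \<sigma>_coproduct: "\<And>(I :: 'u set) t c \<iota>. \<lbrakk>small \<kappa> I; is_coproduct T I t c \<iota>\<rbrakk>
          \<Longrightarrow> \<sigma> c = (\<Union>i \<in> I. \<sigma> (t i))"
    and \<sigma>_tensor: "\<And>t\<^sub>1 t\<^sub>2. \<lbrakk>t\<^sub>1 \<in> Obj T; t\<^sub>2 \<in> Obj T\<rbrakk> \<Longrightarrow> \<sigma> (TenO T t\<^sub>1 t\<^sub>2) \<subseteq> \<sigma> t\<^sub>1 \<inter> \<sigma> t\<^sub>2"
    and stratifies: "bij_betw (\<lambda>L. \<Union>t \<in> L. \<sigma> t) {L. localizing_ideal \<kappa> T L} (Pow (topspace X))"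
  shows
    "(((\<forall>x \<in> compact_objects \<kappa> T. thomason_closed X (\<sigma> x)) \<and>
       (\<forall>Z. thomason_closed X Z \<longrightarrow> (\<exists>x \<in> compact_objects \<kappa> T. Z = \<sigma> x)))
      \<longleftrightarrow> (\<lambda>L. \<Union>t \<in> L. \<sigma> t) ` {L. compactly_generated_ideal \<kappa> T L} = {Y. thomason X Y}) \<and>
     ((\<lambda>L. \<Union>t \<in> L. \<sigma> t) ` {L. compactly_generated_ideal \<kappa> T L} = {Y. thomason X Y}
      \<longleftrightarrow> (\<exists>!f. comparison_homeo \<kappa> T X \<sigma> f)) \<and>
     ((\<exists>!f. comparison_homeo \<kappa> T X \<sigma> f) \<longrightarrow> weakly_noetherian X \<longrightarrow>
      (\<forall>f. comparison_homeo \<kappa> T X \<sigma> f \<longrightarrow>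
         (\<forall>t \<in> Obj T. \<sigma> t = {p \<in> topspace X. f p \<in> BF_Supp \<kappa> T t})))"
proof -
  have tt: "tt_category T" and "compactly_generated \<kappa> T" and "compact_objects \<kappa> T = dualizable_objects T"
    using rcg by (auto simp: rigidly_compactly_generated_def)
  then have "rigid_category T \<kappa>" using univ by (simp add: rigid_category_def rigid_category_axioms_def)
  then interpret stratified T \<kappa> X \<sigma>
    by (rule stratified.intro)
       (unfold_locales; fact spectral \<sigma>_subset \<sigma>_zero \<sigma>_unit \<sigma>_shift \<sigma>_triangle \<sigma>_coproduct \<sigma>_tensor stratifies)
  \<comment> \<open>Condition (a) is the hub: (b) and (c) are each equivalent to it, and are linked
    to each other through it.\<close>
  note 1 = closed_condition_iff_generated
    and 2 = closed_condition_iff_comparison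
  show ?thesis
    by (intro conjI 1 trans[OF 1[symmetric] 2] impI allI ballI) (rule support_eq_BF_Supp)
qed

end
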